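(* Let $(\underline{x}_n)_{n\ge 1}$ be an arbitrary sequence of points of the Bedford–McMullen carpet $\Lambda$ and let $f:\mathbb{N}\to\mathbb{N}$ be an arbitrary function such that $\lim_{n\to\infty}\frac{f(n)}{n}=\alpha>0$. Then $$\dim_H\{\underline{y}\in\Lambda: T^n\underline{y}\in\mathcal{P}_{f(n)}(\underline{x}_n)\text{ for infinitely many } n\}=\max_{\underline{p}_-,\underline{p}_1,\underline{p}_2,\underline{p}_+\in\Upsilon}\mathcal{D}_\alpha(\underline{p}_-,\underline{p}_1,\underline{p}_2,\underline{p}_+,0),$$ where $\dim_H$ denotes Hausdorff dimension.
   Context: Carpet. Let $M>N\ge 2$ be integers and $\tau=\frac{\log M}{\log N}$. Let $S$ be a non-empty subset of $\{1,\dots,N\}$ and for every $a\in S$ let $P_a$ be a non-empty subset of $\{1,\dots,M\}$. Let $Q=\{(a,b):a\in S,\ b\in P_a\}$. For $(a,b)\in Q$ let $F_{(a,b)}(x,y)=\left(\frac{x+a-1}{N},\frac{y+b-1}{M}\right)$. The Bedford–McMullen carpet $\Lambda\subset[0,1]^2$ is the unique non-empty compact set with $\Lambda=\bigcup_{(a,b)\in Q}F_{(a,b)}(\Lambda)$. Dynamics. $T(x,y)=(Nx \bmod 1, My\bmod 1)$, $\mathcal{P}(x,y)=\left[\frac{\lfloor Nx\rfloor}{N},\frac{\lfloor Nx\rfloor+1}{N}\right]\times\left[\frac{\lfloor My\rfloor}{M},\frac{\lfloor My\rfloor+1}{M}\right]$, and $\mathcal{P}_n(x,y)=\bigcap_{k=0}^{n-1}T^{-k}\mathcal{P}(T^k(x,y))$.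 Entropies. $\Upsilon=\{\underline{p}=(p_{a,b})_{(a,b)\in Q}: p_{a,b}\ge 0,\ \sum_{(a,b)\in Q}p_{a,b}=1\}$. For $\underline{p}\in\Upsilon$ (with $0\log 0=0$): $h(\underline{p})=-\sum_{(a,b)\in Q}p_{a,b}\log p_{a,b}$, $h_r(\underline{p})=-\sum_{a\in S}\big(\sum_{b\in P_a}p_{a,b}\big)\log\big(\sum_{b\in P_a}p_{a,b}\big)$, and $\dim(\underline{p})=\frac{h(\underline{p})+(\tau-1)h_r(\underline{p})}{\log M}$. Dimension functions. Let $m=m(\alpha,\tau)=\min\{1,(1+\alpha)/\tau\}$ and $\bar m=1-m$. For $\underline{p}_-,\underline{p}_1,\underline{p}_2,\underline{p}_+\in\Upsilon$ and $H\in\mathbb{R}$ put $d_1=\dim\underline{p}_-$; $d_2^\alpha=\frac{m\,h(\underline{p}_-)+\bar m\,h_r(\underline{p}_1)}{(1+\alpha)\log N}$; $d_3^\alpha=\frac{m\,h(\underline{p}_-)+\bar m\,h(\underline{p}_1)+(\tau-1)h_r(\underline{p}_2)}{(\tau+\alpha)\log N}$; $d_4^\alpha=\frac{m\,h(\underline{p}_-)+\bar m\,h(\underline{p}_1)+(\tau-1)h_r(\underline{p}_2)+\alpha(\tau-1)h_r(\underline{p}_+)+\alpha(1-1/\tau)H}{\tau(1+\alpha)\log N}$; $d_5^\alpha=\frac{m\,h(\underline{p}_-)+\bar m\,h(\underline{p}_1)+(\tau-1)h(\underline{p}_2)+(\tau+\alpha)(\tau-1)h_r(\underline{p}_+)+\alpha(1-1/\tau)H}{\tau(\tau+\alpha)\log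 N}$; $d_6=\dim\underline{p}_+$; and $\mathcal{D}_\alpha(\underline{p}_-,\underline{p}_1,\underline{p}_2,\underline{p}_+,H)=\min\{d_1,d_2^\alpha,d_3^\alpha,d_4^\alpha,d_5^\alpha,d_6\}$.
   Formalization: At points of Λ on grid lines where the floor rectangle is not a carpet rectangle or T leaves Λ, T and 𝒫 use a carpet rectangle F_q([0,1]²) with the point in F_q(Λ), and the inverse of F_q; the literal formulas fail, e.g. for S={N}, P_N={1,…,M}. *)

theory Defs
  imports "HOL-Analysis.Analysis"
begin

section \<open>Hausdorff dimension\<close>

text \<open>The conventions at exponent \<open>0\<close> make the \<open>0\<close>-dimensional measure the counting measure; they
  are needed because \<open>0 powr 0 = 0\<close>. Covers are restricted to bounded sets, since
  \<^const>\<open>diameter\<close> is unspecified on unbounded ones.\<close>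

definition hausdorff_gauge :: "real \<Rightarrow> 'a::metric_space set \<Rightarrow> ennreal" where
  "hausdorff_gauge s U =
     (if U = {} then 0 else if s = 0 then 1 else ennreal (diameter U powr s))"

definition hausdorff_premeasure :: "real \<Rightarrow> real \<Rightarrow> 'a::metric_space set \<Rightarrow> ennreal" where
  "hausdorff_premeasure s \<delta> A =
     Inf {(\<Sum>i. hausdorff_gauge s (U i)) | U :: nat \<Rightarrow> 'a set.
            A \<subseteq> (\<Union>i. U i) \<and> (\<forall>i. bounded (U i) \<and> diameter (U i) \<le> \<delta>)}"

definition hausdorff_measure :: "real \<Rightarrow> 'a::metric_space set \<Rightarrow> ennreal" where
  "hausdorff_measure s A = (SUP \<delta>\<in>{0<..}. hausdorff_premeasure s \<delta> A)"

definition hausdorff_dim :: "'a::metric_space set \<Rightarrow> ereal" where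
  "hausdorff_dim A = Inf {ereal s | s. 0 \<le> s \<and> hausdorff_measure s A = 0}"


section \<open>Bedford--McMullen carpets\<close>

text \<open>The product metric on \<^typ>\<open>real \<times> real\<close> is the Euclidean one.\<close>

locale bedford_mcmullen =
  fixes N M :: nat and S :: "nat set" and P :: "nat \<Rightarrow> nat set"
  assumes N_ge_2: "2 \<le> N" and N_less_M: "N < M"
    and S_nonempty: "S \<noteq> {}" and S_subset: "S \<subseteq> {1..N}"
    and P_nonempty: "\<And>a. a \<in> S \<Longrightarrow> P a \<noteq> {}" and P_subset: "\<And>a. a \<in> S \<Longrightarrow> P a \<subseteq> {1..M}"
begin

definition \<tau> :: real where "\<tau> = ln (real M) / ln (real N)"

definition Q :: "(nat \<times> nat) set" where "Q = {(a, b). a \<in> S \<and> b \<in> P a}"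

definition F :: "nat \<times> nat \<Rightarrow> real \<times> real \<Rightarrow> real \<times> real" where
  "F = (\<lambda>(a, b) (x, y). ((x + real a - 1) / real N, (y + real b - 1) / real M))"

definition carpet :: "(real \<times> real) set" where
  "carpet = (THE K. compact K \<and> K \<noteq> {} \<and> K = (\<Union>q\<in>Q. F q ` K))"


subsection \<open>Dynamics\<close>

definition T_floor :: "real \<times> real \<Rightarrow> real \<times> real" where
  "T_floor = (\<lambda>(x, y). (frac (real N * x), frac (real M * y)))"

definition cell_floor :: "real \<times> real \<Rightarrow> (real \<times> real) set" where
  "cell_floor = (\<lambda>(x, y).
     {of_int \<lfloor>real N * x\<rfloor> / real N .. (of_int \<lfloor>real N * x\<rfloor> + 1) / real N} \<times>
     {of_int \<lfloor>real M * y\<rfloor> / real M .. (of_int \<lfloor>real M * y\<rfloor> + 1) / real M})"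

text \<open>The formulas \<open>T_floor\<close> and \<open>cell_floor\<close> do not respect the carpet at some points of the grid
  lines \<open>N x \<in> \<int>\<close>, \<open>M y \<in> \<int>\<close>: the rectangle picked by the floor function need not be one of the
  rectangles of the carpet (it need not even meet the unit square, as for the point \<open>(1, 1)\<close>),
  and \<open>T_floor\<close> need not map the point back into the carpet. For example, if \<open>S = {N}\<close> then the
  carpet lies in the line \<open>x = 1\<close>, while \<open>T_floor\<close> maps it into \<open>x = 0\<close> and \<open>cell_floor\<close> gives
  rectangles inside \<open>1 \<le> x \<le> 1 + 1 / N\<close>, so that no orbit hits any target.
  At exactly these exceptional points of the carpet, a rectangle of the carpet containing the
  point is used instead, with the corresponding inverse branch; everywhere else \<open>T\<close> and \<open>cell\<close>
  are given by the formulas (see \<open>T_cell_off_grid\<close> below).\<close>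

definition exceptional :: "real \<times> real \<Rightarrow> bool" where
  "exceptional = (\<lambda>(x, y). (x, y) \<in> carpet \<and>
     \<not> ((nat \<lfloor>real N * x\<rfloor> + 1, nat \<lfloor>real M * y\<rfloor> + 1) \<in> Q \<and> T_floor (x, y) \<in> carpet))"

definition address :: "real \<times> real \<Rightarrow> nat \<times> nat" where
  "address z = (SOME q. q \<in> Q \<and> z \<in> F q ` carpet)"

definition T :: "real \<times> real \<Rightarrow> real \<times> real" where
  "T z = (if exceptional z then the_inv (F (address z)) z else T_floor z)"

definition cell :: "real \<times> real \<Rightarrow> (real \<times> real) set" where
  "cell z = (if exceptional z then F (address z) ` ({0..1} \<times> {0..1}) else cell_floor z)"

definition cyl :: "nat \<Rightarrow> real \<times> real \<Rightarrow> (real \<times> real) set" where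
  "cyl n z = (\<Inter>k<n. (T ^^ k) -` cell ((T ^^ k) z))"


subsection \<open>Entropies and dimension functions\<close>

definition \<Upsilon> :: "(nat \<times> nat \<Rightarrow> real) set" where
  "\<Upsilon> = {p \<in> Q \<rightarrow>\<^sub>E {0..}. (\<Sum>q\<in>Q. p q) = 1}"

text \<open>The convention \<open>0 log 0 = 0\<close> holds automatically.\<close>

definition h :: "(nat \<times> nat \<Rightarrow> real) \<Rightarrow> real" where
  "h p = - (\<Sum>q\<in>Q. p q * ln (p q))"

definition h\<^sub>r :: "(nat \<times> nat \<Rightarrow> real) \<Rightarrow> real" where
  "h\<^sub>r p = - (\<Sum>a\<in>S. (\<Sum>b\<in>P a. p (a, b)) * ln (\<Sum>b\<in>P a. p (a, b)))"

definition pdim :: "(nat \<times> nat \<Rightarrow> real) \<Rightarrow> real" where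
  "pdim p = (h p + (\<tau> - 1) * h\<^sub>r p) / ln (real M)"

definition D :: "real \<Rightarrow> (nat \<times> nat \<Rightarrow> real) \<Rightarrow> (nat \<times> nat \<Rightarrow> real) \<Rightarrow>
    (nat \<times> nat \<Rightarrow> real) \<Rightarrow> (nat \<times> nat \<Rightarrow> real) \<Rightarrow> real \<Rightarrow> real" where
  "D \<alpha> pm p1 p2 pp H =
    (let m = min 1 ((1 + \<alpha>) / \<tau>);
         m' = 1 - m;
         d1 = pdim pm;
         d2 = (m * h pm + m' * h\<^sub>r p1) / ((1 + \<alpha>) * ln (real N));
         d3 = (m * h pm + m' * h p1 + (\<tau> - 1) * h\<^sub>r p2) / ((\<tau> + \<alpha>) * ln (real N));
         d4 = (m * h pm + m' * h p1 + (\<tau> - 1) * h\<^sub>r p2 + \<alpha> * (\<tau> - 1) * h\<^sub>r pp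
                + \<alpha> * (1 - 1 / \<tau>) * H) / (\<tau> * (1 + \<alpha>) * ln (real N));
         d5 = (m * h pm + m' * h p1 + (\<tau> - 1) * h p2 + (\<tau> + \<alpha>) * (\<tau> - 1) * h\<^sub>r pp
                + \<alpha> * (1 - 1 / \<tau>) * H) / (\<tau> * (\<tau> + \<alpha>) * ln (real N));
         d6 = pdim pp
     in Min {d1, d2, d3, d4, d5, d6})"


subsection \<open>Well-definedness of the carpet\<close>

lemma N_pos: "0 < real N" and M_pos: "0 < real M"
  using N_ge_2 N_less_M by auto

lemma finite_Q: "finite Q"
proof -
  have "Q \<subseteq> {1..N} \<times> {1..M}"
    using S_subset P_subset by (auto simp: Q_def)
  then show ?thesis
    by (rule finite_subset) auto
qed

lemma Q_bounds: "(a, b) \<in> Q \<Longrightarrow> 1 \<le> a \<and> a \<le> N \<and> 1 \<le> b \<and> b \<le> M"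
  using S_subset P_subset[of a] by (auto simp: Q_def)

lemma Q_nonempty: "Q \<noteq> {}"
proof -
  obtain a where "a \<in> S" using S_nonempty by blast
  moreover obtain b where "b \<in> P a" using P_nonempty[OF \<open>a \<in> S\<close>] by blast
  ultimately show ?thesis by (auto simp: Q_def)
qed

lemma inj_F: "inj (F q)"
  using N_pos M_pos by (auto simp: inj_def F_def split: prod.splits)

lemma dist_F: "dist (F q z) (F q w) \<le> dist z w / 2"
proof -
  obtain a b where q: "q = (a, b)" by (cases q)
  obtain x y where z: "z = (x, y)" by (cases z)
  obtain x' y' where w: "w = (x', y')" by (cases w)
  have *: "\<bar>(u + c - 1) / real K - (u' + c - 1) / real K\<bar> \<le> \<bar>u - u'\<bar> / 2" if "2 \<le> K"
    for u u' c :: real and K :: nat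
  proof -
    have "(u + c - 1) / real K - (u' + c - 1) / real K = (u - u') / real K"
      by (simp add: diff_divide_distrib[symmetric])
    moreover have "\<bar>(u - u') / real K\<bar> \<le> \<bar>u - u'\<bar> / 2"
      unfolding abs_divide using that by (intro divide_left_mono) auto
    ultimately show ?thesis by simp
  qed
  have "dist (F q z) (F q w) =
      sqrt (\<bar>(x + real a - 1) / real N - (x' + real a - 1) / real N\<bar>\<^sup>2
          + \<bar>(y + real b - 1) / real M - (y' + real b - 1) / real M\<bar>\<^sup>2)"
    by (simp add: q z w F_def dist_Pair_Pair dist_real_def)
  also have "\<dots> \<le> sqrt ((\<bar>x - x'\<bar> / 2)\<^sup>2 + (\<bar>y - y'\<bar> / 2)\<^sup>2)"
    using N_ge_2 N_less_M by (intro real_sqrt_le_mono add_mono power_mono *) auto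
  also have "\<dots> = sqrt ((1/2)\<^sup>2 * ((x - x')\<^sup>2 + (y - y')\<^sup>2))"
    by (simp add: power_divide field_simps)
  also have "\<dots> = sqrt ((x - x')\<^sup>2 + (y - y')\<^sup>2) / 2"
    by (simp add: real_sqrt_mult)
  also have "\<dots> = dist z w / 2"
    by (simp add: z w dist_Pair_Pair dist_real_def)
  finally show ?thesis .
qed

lemma continuous_on_F: "continuous_on A (F q)"
proof -
  have "F q = (\<lambda>z. ((fst z + real (fst q) - 1) / real N, (snd z + real (snd q) - 1) / real M))"
    by (auto simp: F_def fun_eq_iff split: prod.splits)
  then show ?thesis
    using N_pos M_pos by (auto intro!: continuous_intros)
qed

lemma F_unit_square:
  assumes "q \<in> Q" shows "F q ` ({0..1} \<times> {0..1}) \<subseteq> {0..1} \<times> {0..1}"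
proof -
  obtain a b where q: "q = (a, b)" by (cases q)
  have "1 \<le> real a" "real a \<le> real N" "1 \<le> real b" "real b \<le> real M"
    using Q_bounds[of a b] assms q by auto
  then show ?thesis
    using N_pos M_pos by (auto simp: q F_def)
qed

abbreviation is_carpet :: "(real \<times> real) set \<Rightarrow> bool" where
  "is_carpet K \<equiv> compact K \<and> K \<noteq> {} \<and> K = (\<Union>q\<in>Q. F q ` K)"

lemma is_carpet_subset:
  assumes X: "is_carpet X" and Y: "is_carpet Y"
  shows "X \<subseteq> Y"
proof -
  have "\<exists>x\<in>X. \<forall>y\<in>X. infdist y Y \<le> infdist x Y"
    using X by (intro continuous_attains_sup continuous_intros) auto
  then obtain x where x: "x \<in> X" "\<And>y. y \<in> X \<Longrightarrow> infdist y Y \<le> infdist x Y"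
    by blast
  have "x \<in> (\<Union>q\<in>Q. F q ` X)" using X x(1) by blast
  then obtain q x' where q: "q \<in> Q" "x' \<in> X" "x = F q x'" by blast
  have "closed Y" "Y \<noteq> {}" using Y by (auto intro: compact_imp_closed)
  then obtain y where y: "y \<in> Y" "infdist x' Y = dist x' y"
    using infdist_attains_inf by blast
  have "F q y \<in> Y" using Y q(1) y(1) by blast
  then have "infdist x Y \<le> dist x (F q y)" by (rule infdist_le)
  also have "\<dots> \<le> dist x' y / 2" using dist_F q(3) by simp
  also have "\<dots> \<le> infdist x Y / 2" using x(2)[OF q(2)] y(2) by simp
  finally have le: "infdist x Y \<le> 0" by simp
  show ?thesis
  proof
    fix z assume "z \<in> X"
    then have "infdist z Y = 0"
      using x(2)[of z] le infdist_nonneg[of z Y] by linarith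
    then show "z \<in> Y"
      using \<open>closed Y\<close> \<open>Y \<noteq> {}\<close> by (simp add: in_closed_iff_infdist_zero)
  qed
qed

lemma is_carpet_exists: "\<exists>K. is_carpet K \<and> K \<subseteq> {0..1} \<times> {0..1}"
proof -
  define G where "G X = (\<Union>q\<in>Q. F q ` X)" for X
  define A where "A n = (G ^^ n) ({0..1} \<times> {0..1})" for n
  have A_Suc: "A (Suc n) = G (A n)" for n by (simp add: A_def)
  have mono: "G X \<subseteq> G Y" if "X \<subseteq> Y" for X Y using that by (auto simp: G_def)
  have dec: "A (Suc n) \<subseteq> A n" for n
  proof (induction n)
    case 0
    then show ?case using F_unit_square by (auto simp: A_def G_def)
  next
    case (Suc n)
    then show ?case using mono by (simp add: A_Suc)
  qed
  have antimono: "A n \<subseteq> A k" if "k \<le> n" for k n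
    using that dec by (rule lift_Suc_antimono_le[rotated])
  have comp: "compact (A n) \<and> A n \<noteq> {}" for n
  proof (induction n)
    case 0
    then show ?case by (simp add: A_def compact_Times)
  next
    case (Suc n)
    then show ?case using finite_Q Q_nonempty
      by (auto simp: A_Suc G_def intro!: compact_UN compact_continuous_image continuous_on_F)
  qed
  define K where "K = (\<Inter>n. A n)"
  have "K \<noteq> {}"
    unfolding K_def by (rule compact_nest) (use comp antimono in auto)
  moreover have "compact K"
    unfolding K_def using comp by (intro compact_Inter) auto
  moreover have "K = (\<Union>q\<in>Q. F q ` K)"
  proof
    show "(\<Union>q\<in>Q. F q ` K) \<subseteq> K"
    proof -
      have "G K \<subseteq> A n" for n
      proof -
        have "K \<subseteq> A n" by (auto simp: K_def)
        then have "G K \<subseteq> A (Suc n)" unfolding A_Suc by (rule mono)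
        then show ?thesis using dec by blast
      qed
      then show ?thesis by (auto simp: K_def G_def)
    qed
    show "K \<subseteq> (\<Union>q\<in>Q. F q ` K)"
    proof
      fix z assume z: "z \<in> K"
      have "\<exists>q\<in>Q. z \<in> F q ` A n" for n
      proof -
        have "z \<in> A (Suc n)" using z by (simp add: K_def)
        then show ?thesis unfolding A_Suc G_def by blast
      qed
      then obtain c where c: "\<And>n. c n \<in> Q" "\<And>n. z \<in> F (c n) ` A n" by metis
      have "finite (range c)" using c(1) finite_Q by (meson finite_subset image_subsetI)
      then have "\<exists>k. infinite {n \<in> UNIV. c n = c k}"
        using pigeonhole_infinite[OF infinite_UNIV_nat, of c] by simp
      then obtain k where "infinite {n. c n = c k}" by auto
      then obtain q where q: "infinite {n. c n = q}" by (rule that)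
      then have "q \<in> Q" using c(1) by (metis (mono_tags, lifting) Collect_empty_eq finite.emptyI)
      have inA: "z \<in> F q ` A n" for n
      proof -
        obtain k where "k \<ge> n" "c k = q"
          using q by (metis (mono_tags, lifting) infinite_nat_iff_unbounded_le mem_Collect_eq)
        then show ?thesis using c(2)[of k] antimono[of n k] by blast
      qed
      then obtain w where w: "z = F q w" by blast
      have "w \<in> A n" for n
        using inA[of n] inj_F[of q] by (auto simp: w inj_image_mem_iff)
      then show "z \<in> (\<Union>q\<in>Q. F q ` K)"
        using w \<open>q \<in> Q\<close> by (auto simp: K_def)
    qed
  qed
  moreover have "K \<subseteq> A 0" by (auto simp: K_def)
  ultimately show ?thesis by (auto simp: A_def)
qed

lemma is_carpet_unique: "\<exists>!K. is_carpet K"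
  using is_carpet_exists is_carpet_subset by (metis subset_antisym)

lemma is_carpet_carpet: "is_carpet carpet"
  unfolding carpet_def by (rule theI'[OF is_carpet_unique])

lemma carpet_subset: "carpet \<subseteq> {0..1} \<times> {0..1}"
  using is_carpet_exists is_carpet_unique is_carpet_carpet by metis


subsection \<open>The dynamics on the carpet\<close>

lemma T_carpet:
  assumes "z \<in> carpet" shows "T z \<in> carpet"
proof (cases "exceptional z")
  case True
  have "\<exists>q. q \<in> Q \<and> z \<in> F q ` carpet" using assms is_carpet_carpet by blast
  then have "z \<in> F (address z) ` carpet"
    unfolding address_def by (rule someI2_ex) auto
  then show ?thesis
    unfolding T_def if_P[OF True] by (metis imageE inj_F the_inv_f_f)
next
  case False
  then show ?thesis using assms by (cases z) (auto simp: T_def exceptional_def)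
qed

lemma mem_cell:
  assumes "z \<in> carpet" shows "z \<in> cell z"
proof (cases "exceptional z")
  case True
  have "\<exists>q. q \<in> Q \<and> z \<in> F q ` carpet" using assms is_carpet_carpet by blast
  then have "z \<in> F (address z) ` carpet"
    unfolding address_def by (rule someI2_ex) auto
  then show ?thesis
    using True carpet_subset by (auto simp: cell_def)
next
  case False
  obtain x y where z: "z = (x, y)" by (cases z)
  have "of_int \<lfloor>real N * x\<rfloor> \<le> real N * x" "real N * x \<le> of_int \<lfloor>real N * x\<rfloor> + 1"
    "of_int \<lfloor>real M * y\<rfloor> \<le> real M * y" "real M * y \<le> of_int \<lfloor>real M * y\<rfloor> + 1"
    by linarith+
  then have "x \<in> {of_int \<lfloor>real N * x\<rfloor> / real N .. (of_int \<lfloor>real N * x\<rfloor> + 1) / real N}"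
    "y \<in> {of_int \<lfloor>real M * y\<rfloor> / real M .. (of_int \<lfloor>real M * y\<rfloor> + 1) / real M}"
    unfolding atLeastAtMost_iff pos_divide_le_eq[OF N_pos] pos_le_divide_eq[OF N_pos]
      pos_divide_le_eq[OF M_pos] pos_le_divide_eq[OF M_pos]
    by (simp_all only: mult.commute simp_thms)
  then show ?thesis
    unfolding cell_def if_not_P[OF False] by (simp only: cell_floor_def z prod.case mem_Times_iff fst_conv snd_conv simp_thms)
qed

lemma T_cell_off_grid:
  assumes "real N * x \<notin> \<int>" and "real M * y \<notin> \<int>"
  shows "T (x, y) = (frac (real N * x), frac (real M * y))"
    and "cell (x, y) =
      {of_int \<lfloor>real N * x\<rfloor> / real N .. (of_int \<lfloor>real N * x\<rfloor> + 1) / real N} \<times>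
      {of_int \<lfloor>real M * y\<rfloor> / real M .. (of_int \<lfloor>real M * y\<rfloor> + 1) / real M}"
proof -
  have "\<not> exceptional (x, y)"
  proof
    assume ex: "exceptional (x, y)"
    then have "(x, y) \<in> carpet" by (simp add: exceptional_def)
    then have "(x, y) \<in> (\<Union>q\<in>Q. F q ` carpet)" using is_carpet_carpet by blast
    then obtain a b u v where q: "(a, b) \<in> Q" "(u, v) \<in> carpet" "(x, y) = F (a, b) (u, v)"
      by auto
    have ab: "1 \<le> a" "1 \<le> b" using Q_bounds[OF q(1)] by auto
    have uv: "0 \<le> u" "u \<le> 1" "0 \<le> v" "v \<le> 1" using q(2) carpet_subset by auto
    have Nx: "real N * x = u + of_int (int a - 1)" and My: "real M * y = v + of_int (int b - 1)"
      using q(3) N_pos M_pos by (auto simp: F_def)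
    have "u \<noteq> 1" "v \<noteq> 1" using assms unfolding Nx My by auto
    then have fl: "\<lfloor>real N * x\<rfloor> = int a - 1" "\<lfloor>real M * y\<rfloor> = int b - 1"
      unfolding Nx My using uv by linarith+
    then have "T_floor (x, y) = (u, v)"
      using Nx My by (simp add: T_floor_def frac_def)
    moreover have "nat \<lfloor>real N * x\<rfloor> + 1 = a" "nat \<lfloor>real M * y\<rfloor> + 1 = b"
      using ab fl by auto
    ultimately show False using ex q(1,2) by (simp add: exceptional_def)
  qed
  then show "T (x, y) = (frac (real N * x), frac (real M * y))"
    and "cell (x, y) =
      {of_int \<lfloor>real N * x\<rfloor> / real N .. (of_int \<lfloor>real N * x\<rfloor> + 1) / real N} \<times>
      {of_int \<lfloor>real M * y\<rfloor> / real M .. (of_int \<lfloor>real M * y\<rfloor> + 1) / real M}"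
    by (simp_all add: T_def cell_def T_floor_def cell_floor_def)
qed

end

end

theory Submission
  imports Defs "HOL-Probability.Probability"
begin

text \<open>A point of the carpet is identified with the itinerary of its \<open>T\<close>-orbit; up to points with an
  eventually constant digit sequence in one coordinate, which satisfy the same condition for a
  modified target, hitting the target at time \<open>n\<close> prescribes the digits at the positions
  \<open>n, \<dots>, n + f n - 1\<close>. Natural covers consist of approximate squares of level \<open>L\<close>, determined by the
  first \<open>L\<close> columns and the first \<open>L / \<tau>\<close> rows.

  Upper bound. The maximum of the minimum of the six concave functions is dual to a convex
  combination of them, whose maximisers are Gibbs measures with column weights
  \<open>card (P a) powr \<kappa>\<close>. Give the free positions below \<open>m n\<close>, in \<open>[m n, n]\<close>, in \<open>[(1 + \<alpha>) n, (\<tau> + \<alpha>) n]\<close>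
  and beyond the corresponding Gibbs weights. A suitable positive combination, over the scales
  \<open>m n / \<tau> ^ j\<close>, \<open>(1 + \<alpha>) n\<close>, \<open>(\<tau> + \<alpha>) n\<close>, \<open>\<tau> ^ j \<tau> (1 + \<alpha>) n\<close> and \<open>\<tau> ^ j \<tau> (\<tau> + \<alpha>) n\<close>, of the logarithms of the
  masses of the approximate squares around a point does not depend on the point, up to a small
  error. Hence at one of these finitely many scales the square around the point has mass at least
  its side to the power \<open>d + \<epsilon>\<close>, and there are few such squares. The dual weights of the last
  scales have to be redistributed along the geometric chains; they stay nonnegative because the
  Gibbs exponent of \<open>p2\<close> is at least that of \<open>pp\<close> when \<open>d\<^sub>4\<close> and \<open>d\<^sub>6\<close> are both minimal.

  Lower bound. Choose target times \<open>n0 K ^ k\<close> and independent digits with distribution \<open>pm\<close>, \<open>p1\<close>,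
  prescribed, \<open>p2\<close> on the above intervals, and then a slow interpolation from \<open>pp\<close> back to \<open>pm\<close>. The
  expected logarithm of the mass of an approximate square is a minimum of affine functions of the
  scale between the critical scales, where it is controlled by \<open>d\<^sub>1, \<dots>, d\<^sub>6\<close>; deviations from it are
  exponentially unlikely, and the mass distribution principle applies.\<close>

section \<open>Hausdorff measures\<close>

text \<open>Nothing is known about the column statistics of a point that hits the targets, so the
  upper bound has to work for all of them. The cost of a square at scale \<open>c\<close> contains
  the column sums up to \<open>c\<close> and, since rows are seen only up to
  \<open>c / \<tau>\<close>, also those up to \<open>c / \<tau>\<close>; a finite combination of
  scales therefore leaves an unknown sum at the end of each chain. It is controlled by the position
  of the Gibbs exponents relative to \<open>1 / \<tau>\<close>: below the target the exponent is
  strictly larger, so an excess would be amplified along the scales \<open>m n / \<tau> ^ j\<close>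
  beyond its trivial bound; beyond the target it is strictly smaller, so the last unknown is damped
  along the increasing scales. Hence finitely many scales, fixed before the point, suffice. In the
  lower bound the same lag between columns and rows forces the return from \<open>pp\<close> to
  \<open>pm\<close> to be slow: a square sees the columns of one measure together with the rows of
  an earlier one.\<close>

lemma suminf_prod_decode_ennreal:
  fixes f :: "nat \<Rightarrow> nat \<Rightarrow> ennreal"
  shows "(\<Sum>i. (case prod_decode i of (k, j) \<Rightarrow> f k j)) = (\<Sum>k. \<Sum>j. f k j)"
  using suminf_ennreal_2dimen[of "\<lambda>k. \<Sum>j. f k j" "case_prod f"] by simp

lemma hausdorff_measure_eq_0I:
  assumes "\<And>\<delta> e. \<delta> > 0 \<Longrightarrow> e > 0 \<Longrightarrow> hausdorff_premeasure s \<delta> A \<le> ennreal e"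
  shows "hausdorff_measure s A = 0"
proof -
  have "hausdorff_premeasure s \<delta> A \<le> 0" if "\<delta> > 0" for \<delta>
  proof (rule ennreal_le_epsilon)
    fix e :: real assume "0 < e"
    then show "hausdorff_premeasure s \<delta> A \<le> 0 + ennreal e"
      unfolding add_0 by (rule assms[OF that])
  qed
  then have "hausdorff_measure s A \<le> 0"
    unfolding hausdorff_measure_def by (intro SUP_least) auto
  then show ?thesis by simp
qed

text \<open>A Borel-Cantelli argument: a point of \<open>A\<close> lies in infinitely many families,
  so the families beyond any index \<open>k0\<close> cover \<open>A\<close>, and their total mass is
  a tail of a convergent series.\<close>

lemma hausdorff_measure_limsup_zero:
  fixes \<C> :: "nat \<Rightarrow> 'a::metric_space set set" and r a :: "nat \<Rightarrow> real"
  assumes s: "s > 0"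
    and fin: "\<And>k. finite (\<C> k)"
    and bdd: "\<And>k U. U \<in> \<C> k \<Longrightarrow> bounded U \<and> diameter U \<le> r k"
    and r: "r \<longlonglongrightarrow> 0"
    and mass: "\<And>k. real (card (\<C> k)) * r k powr s \<le> a k"
    and a: "summable a"
    and cover: "\<And>y. y \<in> A \<Longrightarrow> infinite {k. y \<in> \<Union>(\<C> k)}"
  shows "hausdorff_measure s A = 0"
proof -
  have "hausdorff_premeasure s \<delta> A \<le> ennreal e" if \<delta>: "\<delta> > 0" and e: "e > 0" for \<delta> e
  proof -
    have a0: "0 \<le> a k" for k
      using order_trans[OF _ mass[of k]] by simp
    obtain k1 where k1: "\<And>k. k \<ge> k1 \<Longrightarrow> r k < \<delta>"
      using order_tendstoD(2)[OF r \<delta>] unfolding eventually_sequentially by blast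
    obtain k2 where k2: "(\<Sum>k. a (k + k2)) < e"
    proof -
      obtain k2 where "norm (\<Sum>k. a (k + k2)) < e"
        using suminf_exist_split[OF e a] by blast
      then have "(\<Sum>k. a (k + k2)) < e" by simp
      then show ?thesis by (rule that)
    qed
    define k0 where "k0 = max k1 k2"
    \<comment> \<open>The finite families are listed as rows of a double sequence. Padding by the
      empty set is free because its gauge is 0.\<close>
    define V where "V k j = (if j < card (\<C> (k + k0)) then (SOME g. bij_betw g {..<card (\<C> (k+k0))} (\<C> (k+k0))) j else {})" for k j
    have Vbij: "bij_betw (\<lambda>j. V k j) {..<card (\<C> (k+k0))} (\<C> (k+k0))" for k
    proof -
      have "\<exists>g. bij_betw g {..<card (\<C> (k+k0))} (\<C> (k+k0))"
        using ex_bij_betw_nat_finite[OF fin] by (simp add: atLeast0LessThan)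
      from someI_ex[OF this] show ?thesis
        by (rule bij_betw_cong[THEN iffD1, rotated]) (simp add: V_def)
    qed
    have V: "V k j = {} \<or> V k j \<in> \<C> (k+k0)" for k j
      using Vbij[of k] by (cases "j < card (\<C> (k+k0))") (auto simp: bij_betw_def V_def)
    define U where "U i = (case prod_decode i of (k, j) \<Rightarrow> V k j)" for i
    have "A \<subseteq> (\<Union>i. U i)"
    proof
      fix y assume "y \<in> A"
      then obtain k where "k \<ge> k0" "y \<in> \<Union>(\<C> k)"
        using cover[of y] unfolding infinite_nat_iff_unbounded_le by blast
      then obtain C where C: "C \<in> \<C> (k - k0 + k0)" "y \<in> C" by auto
      then obtain j where "C = V (k - k0) j"
        using Vbij[of "k - k0"] unfolding bij_betw_def by blast
      then have "y \<in> U (prod_encode (k - k0, j))" using C by (simp add: U_def)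
      then show "y \<in> (\<Union>i. U i)" by blast
    qed
    moreover have "bounded (U i) \<and> diameter (U i) \<le> \<delta>" for i
    proof -
      obtain k j where kj: "prod_decode i = (k, j)" by (cases "prod_decode i")
      show ?thesis
      proof (cases "V k j = {}")
        case True
        then show ?thesis using \<delta> kj by (simp add: U_def)
      next
        case False
        then have "V k j \<in> \<C> (k+k0)" using V by blast
        moreover have "r (k+k0) < \<delta>" by (rule k1) (simp add: k0_def)
        ultimately show ?thesis using bdd[of "V k j" "k+k0"] kj by (simp add: U_def)
      qed
    qed
    ultimately have "hausdorff_premeasure s \<delta> A \<le> (\<Sum>i. hausdorff_gauge s (U i))"
      unfolding hausdorff_premeasure_def by (intro Inf_lower) blast
    also have "\<dots> = (\<Sum>i. (case prod_decode i of (k, j) \<Rightarrow> hausdorff_gauge s (V k j)))"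
      by (simp add: U_def case_prod_beta)
    also have "\<dots> = (\<Sum>k. \<Sum>j. hausdorff_gauge s (V k j))"
      by (rule suminf_prod_decode_ennreal)
    also have "\<dots> \<le> (\<Sum>k. ennreal (a (k + k0)))"
    proof (intro suminf_le)
      fix k
      have "(\<Sum>j. hausdorff_gauge s (V k j)) = (\<Sum>j<card (\<C> (k+k0)). hausdorff_gauge s (V k j))"
        by (intro suminf_finite) (auto simp: V_def hausdorff_gauge_def)
      also have "\<dots> \<le> (\<Sum>j<card (\<C> (k+k0)). ennreal (r (k+k0) powr s))"
      proof (intro sum_mono)
        fix j assume "j \<in> {..<card (\<C> (k+k0))}"
        then have "V k j \<in> \<C> (k+k0)" using Vbij[of k] by (auto simp: bij_betw_def)
        with bdd[OF this] show "hausdorff_gauge s (V k j) \<le> ennreal (r (k+k0) powr s)"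
          using s by (auto simp: hausdorff_gauge_def intro!: ennreal_leI powr_mono2 diameter_ge_0)
      qed
      also have "\<dots> = ennreal (real (card (\<C> (k+k0))) * r (k+k0) powr s)"
        by (simp add: ennreal_mult ennreal_of_nat_eq_real_of_nat)
      also have "\<dots> \<le> ennreal (a (k + k0))" using mass by (rule ennreal_leI)
      finally show "(\<Sum>j. hausdorff_gauge s (V k j)) \<le> ennreal (a (k + k0))" .
    qed auto
    also have "\<dots> = ennreal (\<Sum>k. a (k + k0))"
      using a0 a by (intro suminf_ennreal2) (auto simp: summable_iff_shift)
    also have "\<dots> \<le> ennreal e"
    proof (rule ennreal_leI)
      have "(\<Sum>k. a (k + k2)) = (\<Sum>k. a (k + (k0 - k2) + k2)) + (\<Sum>k<k0-k2. a (k + k2))"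
        using a by (intro suminf_split_initial_segment) (simp add: summable_iff_shift)
      moreover have "(\<Sum>k<k0-k2. a (k + k2)) \<ge> 0" using a0 by (intro sum_nonneg) auto
      moreover have "k + (k0 - k2) + k2 = k + k0" for k by (simp add: k0_def)
      ultimately show "(\<Sum>k. a (k + k0)) \<le> e" using k2 by simp
    qed
    finally show ?thesis .
  qed
  then show ?thesis by (rule hausdorff_measure_eq_0I)
qed

lemma hausdorff_measure_mono:
  assumes "A \<subseteq> B" shows "hausdorff_measure s A \<le> hausdorff_measure s B"
  unfolding hausdorff_measure_def hausdorff_premeasure_def
  using assms by (intro SUP_mono' Inf_superset_mono) blast

lemma hausdorff_measure_Un_zero:
  assumes "hausdorff_measure s A = 0" "hausdorff_measure s B = 0"
  shows "hausdorff_measure s (A \<union> B) = 0"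
proof -
  have "hausdorff_premeasure s \<delta> (A \<union> B) \<le> ennreal e" if \<delta>: "\<delta> > 0" and e: "e > 0" for \<delta> e
  proof -
    have *: "\<exists>U. A \<subseteq> (\<Union>i::nat. U i) \<and> (\<forall>i. bounded (U i) \<and> diameter (U i) \<le> \<delta>)
        \<and> (\<Sum>i. hausdorff_gauge s (U i)) < ennreal (e/2)" if "hausdorff_measure s A = 0" for A :: "'a set"
    proof -
      have "hausdorff_premeasure s \<delta> A \<le> hausdorff_measure s A"
        unfolding hausdorff_measure_def using \<delta> by (intro SUP_upper) auto
      then have "hausdorff_premeasure s \<delta> A < ennreal (e/2)" using that e by simp
      then show ?thesis unfolding hausdorff_premeasure_def Inf_less_iff by blast
    qed
    obtain U where U: "A \<subseteq> (\<Union>i::nat. U i)" "\<And>i. bounded (U i) \<and> diameter (U i) \<le> \<delta>"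
      "(\<Sum>i. hausdorff_gauge s (U i)) < ennreal (e/2)" using *[OF assms(1)] by blast
    obtain V where V: "B \<subseteq> (\<Union>i::nat. V i)" "\<And>i. bounded (V i) \<and> diameter (V i) \<le> \<delta>"
      "(\<Sum>i. hausdorff_gauge s (V i)) < ennreal (e/2)" using *[OF assms(2)] by blast
    define W where "W k j = (if k = 0 then U j else if k = 1 then V j else {})" for k j :: nat
    have "hausdorff_premeasure s \<delta> (A \<union> B) \<le> (\<Sum>i. hausdorff_gauge s (case prod_decode i of (k, j) \<Rightarrow> W k j))"
      unfolding hausdorff_premeasure_def
    proof (rule Inf_lower, rule CollectI, intro exI conjI allI)
      show "A \<union> B \<subseteq> (\<Union>i. case prod_decode i of (k, j) \<Rightarrow> W k j)"
      proof
        fix x assume "x \<in> A \<union> B"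
        then obtain k j where "x \<in> W k j"
          using U(1) V(1) unfolding W_def by (metis UN_E UnE one_neq_zero subsetD)
        then have "x \<in> (case prod_decode (prod_encode (k, j)) of (k, j) \<Rightarrow> W k j)" by simp
        then show "x \<in> (\<Union>i. case prod_decode i of (k, j) \<Rightarrow> W k j)" by (rule UN_I[OF UNIV_I])
      qed
      show "bounded (case prod_decode i of (k, j) \<Rightarrow> W k j)" for i
        using U(2) V(2) by (auto simp: W_def split: prod.splits)
      show "diameter (case prod_decode i of (k, j) \<Rightarrow> W k j) \<le> \<delta>" for i
        using U(2) V(2) \<delta> by (auto simp: W_def split: prod.splits)
    qed auto
    also have "\<dots> = (\<Sum>k. \<Sum>j. hausdorff_gauge s (W k j))"
      using suminf_prod_decode_ennreal[of "\<lambda>k j. hausdorff_gauge s (W k j)"]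
      by (simp add: case_prod_beta)
    also have "\<dots> = (\<Sum>k<2. \<Sum>j. hausdorff_gauge s (W k j))"
      by (intro suminf_finite) (auto simp: W_def hausdorff_gauge_def)
    also have "\<dots> = (\<Sum>j. hausdorff_gauge s (U j)) + (\<Sum>j. hausdorff_gauge s (V j))"
      by (simp add: W_def numeral_2_eq_2)
    also have "\<dots> \<le> ennreal (e/2) + ennreal (e/2)"
      using U(3) V(3) by (intro add_mono) auto
    also have "\<dots> = ennreal e" using e by (subst ennreal_plus[symmetric]) auto
    finally show ?thesis .
  qed
  then show ?thesis by (rule hausdorff_measure_eq_0I)
qed

lemma hausdorff_measure_Union_zero:
  assumes "finite \<A>" "\<And>A. A \<in> \<A> \<Longrightarrow> hausdorff_measure s A = 0"
  shows "hausdorff_measure s (\<Union>\<A>) = 0"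
  using assms
proof (induction rule: finite_induct)
  case empty
  have "hausdorff_premeasure s \<delta> ({}::'a set) \<le> ennreal e" if "\<delta> > 0" for \<delta> e
  proof -
    have "hausdorff_premeasure s \<delta> ({}::'a set) \<le> (\<Sum>i::nat. hausdorff_gauge s ({}::'a set))"
      unfolding hausdorff_premeasure_def using that by (intro Inf_lower) (auto intro!: exI[of _ "\<lambda>_. {}"])
    then show ?thesis by (simp add: hausdorff_gauge_def)
  qed
  then show ?case by (simp add: hausdorff_measure_eq_0I)
next
  case (insert A \<A>)
  then show ?case by (auto intro!: hausdorff_measure_Un_zero)
qed

section \<open>Mass distribution, and the passage from measures to the dimension\<close>

lemma mass_distribution_principle:
  fixes \<pi> :: "'b \<Rightarrow> 'a::metric_space"
  assumes s: "s > 0" and C: "C \<ge> 0" and \<delta>: "\<delta> > 0"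
    and G: "G \<in> sets \<mu>" "emeasure \<mu> G > 0" and GA: "\<pi> ` G \<subseteq> A"
    and mass: "\<And>U. bounded U \<Longrightarrow> U \<noteq> {} \<Longrightarrow> diameter U \<le> \<delta> \<Longrightarrow>
      \<exists>B\<in>sets \<mu>. G \<inter> \<pi> -` U \<subseteq> B \<and> emeasure \<mu> B \<le> ennreal (C * diameter U powr s)"
  shows "hausdorff_measure s A \<noteq> 0"
proof
  assume "hausdorff_measure s A = 0"
  moreover have "hausdorff_premeasure s \<delta> A \<le> hausdorff_measure s A"
    unfolding hausdorff_measure_def using \<delta> by (intro SUP_upper) auto
  ultimately have z: "hausdorff_premeasure s \<delta> A = 0" by simp
  have "emeasure \<mu> G \<le> 0 + ennreal e" if "e > 0" for e
  proof -
    \<comment> \<open>\<open>C + 1\<close> instead of \<open>C\<close> keeps the quotient meaningful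
      for \<open>C = 0\<close>.\<close>
    define e' where "e' = e / (C + 1)"
    have "e' > 0" using that C by (simp add: e'_def)
    then have "hausdorff_premeasure s \<delta> A < ennreal e'" using z by simp
    then obtain U where U: "A \<subseteq> (\<Union>i::nat. U i)" "\<And>i. bounded (U i) \<and> diameter (U i) \<le> \<delta>"
      "(\<Sum>i. hausdorff_gauge s (U i)) < ennreal e'"
      unfolding hausdorff_premeasure_def Inf_less_iff by blast
    have "\<exists>B\<in>sets \<mu>. G \<inter> \<pi> -` U i \<subseteq> B \<and> emeasure \<mu> B \<le> ennreal C * hausdorff_gauge s (U i)" for i
    proof (cases "U i = {}")
      case True then show ?thesis by (auto intro!: bexI[of _ "{}"])
    next
      case False
      then show ?thesis using mass[of "U i"] U(2)[of i] s C
        by (auto simp: hausdorff_gauge_def ennreal_mult)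
    qed
    then obtain B where B: "\<And>i. B i \<in> sets \<mu>" "\<And>i. G \<inter> \<pi> -` U i \<subseteq> B i"
      "\<And>i. emeasure \<mu> (B i) \<le> ennreal C * hausdorff_gauge s (U i)" by metis
    have "G \<subseteq> (\<Union>i. B i)"
    proof
      fix w assume w: "w \<in> G"
      then obtain i where "\<pi> w \<in> U i" using GA U(1) by blast
      then show "w \<in> (\<Union>i. B i)" using w B(2)[of i] by blast
    qed
    then have "emeasure \<mu> G \<le> emeasure \<mu> (\<Union>i. B i)"
      using B(1) by (intro emeasure_mono) auto
    also have "\<dots> \<le> (\<Sum>i. emeasure \<mu> (B i))"
      using B(1) by (intro emeasure_subadditive_countably) auto
    also have "\<dots> \<le> (\<Sum>i. ennreal C * hausdorff_gauge s (U i))"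
      using B(3) by (intro suminf_le) auto
    also have "\<dots> = ennreal C * (\<Sum>i. hausdorff_gauge s (U i))" by simp
    also have "\<dots> \<le> ennreal C * ennreal e'" using U(3) by (intro mult_left_mono) auto
    also have "\<dots> = ennreal (C * e')" using C \<open>e' > 0\<close> by (simp add: ennreal_mult)
    also have "\<dots> \<le> ennreal e"
    proof (rule ennreal_leI)
      have "C * e' \<le> (C + 1) * e'" using \<open>e' > 0\<close> by simp
      also have "\<dots> = e" using C by (simp add: e'_def)
      finally show "C * e' \<le> e" .
    qed
    finally show ?thesis by simp
  qed
  then have "emeasure \<mu> G \<le> 0" by (rule ennreal_le_epsilon)
  then show False using G(2) by simp
qed

text \<open>The exponent 0 needs its own treatment: every nonempty covering set then costs 1, so a
  cover of cost below 1 consists of empty sets, which is excluded by \<open>lower0\<close>.\<close>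

lemma hausdorff_dim_eqI:
  assumes d: "0 \<le> d"
    and upper: "\<And>s. s > d \<Longrightarrow> hausdorff_measure s A = 0"
    and lower: "\<And>s. 0 < s \<Longrightarrow> s < d \<Longrightarrow> hausdorff_measure s A \<noteq> 0"
    and lower0: "0 < d \<Longrightarrow> A \<noteq> {}"
  shows "hausdorff_dim A = ereal d"
proof (rule antisym)
  show "hausdorff_dim A \<le> ereal d"
  proof (rule ereal_le_epsilon2)
    fix e :: real assume "0 < e"
    then have "hausdorff_dim A \<le> ereal (d + e)"
      unfolding hausdorff_dim_def using d upper[of "d+e"] by (intro Inf_lower) auto
    then show "hausdorff_dim A \<le> ereal d + ereal e" by simp
  qed
  show "ereal d \<le> hausdorff_dim A"
    unfolding hausdorff_dim_def
  proof (rule Inf_greatest)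
    fix z assume "z \<in> {ereal s |s. 0 \<le> s \<and> hausdorff_measure s A = 0}"
    then obtain s where s: "z = ereal s" "0 \<le> s" "hausdorff_measure s A = 0" by blast
    have "d \<le> s"
    proof (rule ccontr)
      assume "\<not> d \<le> s"
      then have "s < d" by simp
      with s lower[of s] have s0: "s = 0" by force
      have "d > 0" using \<open>s < d\<close> s0 by simp
      have "hausdorff_premeasure 0 1 A \<le> hausdorff_measure 0 A"
        unfolding hausdorff_measure_def by (intro SUP_upper) auto
      then have "hausdorff_premeasure 0 1 A < 1" using s s0 by simp
      then obtain U where U: "A \<subseteq> (\<Union>i::nat. U i)" "(\<Sum>i. hausdorff_gauge 0 (U i)) < 1"
        unfolding hausdorff_premeasure_def Inf_less_iff by blast
      have "U i = {}" for i
      proof (rule ccontr)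
        assume "U i \<noteq> {}"
        then have "1 = (\<Sum>j\<in>{i}. hausdorff_gauge 0 (U j))" by (simp add: hausdorff_gauge_def)
        also have "\<dots> \<le> (\<Sum>j. hausdorff_gauge 0 (U j))" by (intro sum_le_suminf) auto
        finally show False using U(2) by simp
      qed
      then show False using U(1) lower0[OF \<open>d > 0\<close>] by auto
    qed
    then show "ereal d \<le> z" using s by simp
  qed
qed

section \<open>Entropies and Gibbs measures\<close>

text \<open>The convex function \<open>x * ln x\<close> lies above its tangent at
  \<open>m\<close>.\<close>

lemma x_ln_x_ge:
  fixes x m :: real
  assumes "0 \<le> x" "0 < m"
  shows "x * ln x \<ge> x * ln m + x - m"
proof (cases "x = 0")
  case True
  then show ?thesis using assms by simp
next
  case False
  then have x: "x > 0" using assms by simp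
  have "ln (m / x) \<le> m / x - 1" using x assms by (intro ln_le_minus_one) simp
  then have "x * ln (m / x) \<le> x * (m / x - 1)" using x by (intro mult_left_mono) auto
  then show ?thesis using x assms by (simp add: ln_div algebra_simps)
qed

text \<open>Gibbs' inequality for unnormalised weights. The tangents of \<open>x_ln_x_ge\<close> are
  taken at the multiples of \<open>w i\<close> that have the same total as \<open>p\<close>, so that
  their linear remainders add up to zero.\<close>

lemma log_sum_inequality:
  fixes p w :: "'a \<Rightarrow> real"
  assumes fin: "finite A" and ne: "A \<noteq> {}"
    and p: "\<And>i. i \<in> A \<Longrightarrow> 0 \<le> p i" and w: "\<And>i. i \<in> A \<Longrightarrow> 0 < w i"
  shows "(\<Sum>i\<in>A. p i * ln (w i)) - (\<Sum>i\<in>A. p i * ln (p i)) \<le> sum p A * ln (sum w A) - sum p A * ln (sum p A)"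
proof (cases "sum p A = 0")
  case True
  then have "p i = 0" if "i \<in> A" for i using that p fin by (simp add: sum_nonneg_eq_0_iff)
  then show ?thesis using True by simp
next
  case False
  have sp: "sum p A > 0" using False p by (simp add: order_less_le sum_nonneg)
  have W: "sum w A > 0" using fin ne w by (intro sum_pos) auto
  have "p i * ln (w i) - p i * ln (p i) \<le> p i * ln (sum w A) - p i * ln (sum p A) + (w i * sum p A / sum w A - p i)"
    if i: "i \<in> A" for i
  proof -
    have "p i * ln (p i) \<ge> p i * ln (w i * sum p A / sum w A) + p i - w i * sum p A / sum w A"
      using p[OF i] w[OF i] sp W by (intro x_ln_x_ge) auto
    moreover have "ln (w i * sum p A / sum w A) = ln (w i) + ln (sum p A) - ln (sum w A)"
      using w[OF i] sp W by (simp add: ln_div ln_mult)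
    ultimately show ?thesis by (simp add: algebra_simps)
  qed
  then have "(\<Sum>i\<in>A. p i * ln (w i) - p i * ln (p i)) \<le>
      (\<Sum>i\<in>A. p i * ln (sum w A) - p i * ln (sum p A) + (w i * sum p A / sum w A - p i))"
    by (rule sum_mono)
  also have "\<dots> = sum p A * ln (sum w A) - sum p A * ln (sum p A) + (sum w A * sum p A / sum w A - sum p A)"
    by (simp add: sum.distrib sum_subtractf sum_distrib_right sum_divide_distrib)
  also have "sum w A * sum p A / sum w A - sum p A = 0" using W by simp
  finally show ?thesis by (simp add: sum_subtractf)
qed

text \<open>Both tangent inequalities are taken at the mixture \<open>m\<close>, where their
  combination is exactly \<open>m * ln m\<close>.\<close>

lemma x_ln_x_convex:
  fixes x y t :: real
  assumes "0 \<le> x" "0 \<le> y" "0 \<le> t" "t \<le> 1"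
  shows "((1 - t) * x + t * y) * ln ((1 - t) * x + t * y) \<le> (1 - t) * (x * ln x) + t * (y * ln y)"
proof -
  define m where "m = (1 - t) * x + t * y"
  have "0 \<le> m" using assms by (simp add: m_def)
  show ?thesis
  proof (cases "m = 0")
    case True
    then have "(1 - t) * x = 0" "t * y = 0"
      using assms unfolding m_def by (simp_all add: add_nonneg_eq_0_iff)
    then show ?thesis by auto
  next
    case False
    then have m: "m > 0" using \<open>0 \<le> m\<close> by simp
    have "(1 - t) * (x * ln x) \<ge> (1 - t) * (x * ln m + x - m)"
      using assms m by (intro mult_left_mono x_ln_x_ge) auto
    moreover have "t * (y * ln y) \<ge> t * (y * ln m + y - m)"
      using assms m by (intro mult_left_mono x_ln_x_ge) auto
    moreover have "(1 - t) * (x * ln m + x - m) + t * (y * ln m + y - m) = m * ln m"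
      unfolding m_def by (simp add: algebra_simps)
    ultimately show ?thesis unfolding m_def by linarith
  qed
qed

lemma continuous_on_x_ln_x: "continuous_on {0..} (\<lambda>x::real. x * ln x)"
  unfolding continuous_on
proof (intro ballI)
  fix x :: real assume "x \<in> {0..}"
  show "((\<lambda>x. x * ln x) \<longlongrightarrow> x * ln x) (at x within {0..})"
  proof (cases "x = 0")
    case True
    have "((\<lambda>x::real. x * ln x) \<longlongrightarrow> 0) (at_right 0)" by real_asymp
    moreover have "at (0::real) within {0..} = at_right 0"
      by (rule at_within_nhd[of _ "UNIV"]) auto
    ultimately show ?thesis using True by simp
  next
    case False
    then have "x > 0" using \<open>x \<in> {0..}\<close> by simp
    then show ?thesis by (intro tendsto_mult tendsto_ln tendsto_ident_at) simp
  qed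
qed

context bedford_mcmullen
begin

lemma tau_gt_1: "1 < \<tau>"
  using N_ge_2 N_less_M by (simp add: \<tau>_def)

lemma ln_N_pos: "0 < ln (real N)" using N_ge_2 by simp

lemma ln_M: "ln (real M) = \<tau> * ln (real N)"
  using ln_N_pos by (simp add: \<tau>_def)

lemma finite_S: "finite S" using S_subset by (rule finite_subset) simp

lemma finite_P: "a \<in> S \<Longrightarrow> finite (P a)" using P_subset[of a] finite_subset[of "P a" "{1..M}"] by simp

lemma card_P_ge_1: "a \<in> S \<Longrightarrow> 1 \<le> card (P a)"
  using finite_P P_nonempty by (simp add: Suc_le_eq card_gt_0_iff)

lemma Q_Sigma: "Q = Sigma S P" by (auto simp: Q_def)

lemma sum_Q: "(\<Sum>q\<in>Q. g q) = (\<Sum>a\<in>S. \<Sum>b\<in>P a. g (a, b))"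
  unfolding Q_Sigma using finite_S finite_P by (subst sum.Sigma) auto

definition col :: "(nat \<times> nat \<Rightarrow> real) \<Rightarrow> nat \<Rightarrow> real" where
  "col p a = (\<Sum>b\<in>P a. p (a, b))"

text \<open>By the chain rule this is the conditional entropy of the row digit given the column
  digit.\<close>

definition hc :: "(nat \<times> nat \<Rightarrow> real) \<Rightarrow> real" where
  "hc p = h p - h\<^sub>r p"

lemma h_r_col: "h\<^sub>r p = - (\<Sum>a\<in>S. col p a * ln (col p a))"
  by (simp add: h\<^sub>r_def col_def)

lemma Upsilon_nonneg: "p \<in> \<Upsilon> \<Longrightarrow> q \<in> Q \<Longrightarrow> 0 \<le> p q"
  by (auto simp: \<Upsilon>_def PiE_iff)

lemma Upsilon_sum: "p \<in> \<Upsilon> \<Longrightarrow> (\<Sum>q\<in>Q. p q) = 1"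
  by (simp add: \<Upsilon>_def)

lemma Upsilon_le_1: "p \<in> \<Upsilon> \<Longrightarrow> q \<in> Q \<Longrightarrow> p q \<le> 1"
  using member_le_sum[of q Q p] Upsilon_nonneg[of p] Upsilon_sum[of p] finite_Q by auto

lemma col_nonneg: "p \<in> \<Upsilon> \<Longrightarrow> a \<in> S \<Longrightarrow> 0 \<le> col p a"
  unfolding col_def by (intro sum_nonneg Upsilon_nonneg) (auto simp: Q_def)

lemma col_sum: "p \<in> \<Upsilon> \<Longrightarrow> (\<Sum>a\<in>S. col p a) = 1"
  unfolding col_def using Upsilon_sum sum_Q by metis

lemma col_le_1: "p \<in> \<Upsilon> \<Longrightarrow> a \<in> S \<Longrightarrow> col p a \<le> 1"
  using member_le_sum[of a S "col p"] col_nonneg[of p] col_sum[of p] finite_S by auto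

lemma le_col: "p \<in> \<Upsilon> \<Longrightarrow> a \<in> S \<Longrightarrow> b \<in> P a \<Longrightarrow> p (a, b) \<le> col p a"
  unfolding col_def using finite_P by (intro member_le_sum) (auto intro!: Upsilon_nonneg simp: Q_def)

lemma x_ln_x_nonpos: "0 \<le> x \<Longrightarrow> x \<le> 1 \<Longrightarrow> x * ln (x::real) \<le> 0"
  by (cases "x = 0") (auto intro!: mult_nonneg_nonpos)

lemma h_r_nonneg: "p \<in> \<Upsilon> \<Longrightarrow> 0 \<le> h\<^sub>r p"
  unfolding h_r_col neg_0_le_iff_le by (intro sum_nonpos x_ln_x_nonpos col_nonneg col_le_1)

lemma hc_nonneg:
  assumes p: "p \<in> \<Upsilon>" shows "0 \<le> hc p"
proof -
  have "(\<Sum>b\<in>P a. p (a, b) * ln (p (a, b))) \<le> col p a * ln (col p a)" if a: "a \<in> S" for a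
  proof -
    have "(\<Sum>b\<in>P a. p (a, b) * ln (p (a, b))) \<le> (\<Sum>b\<in>P a. p (a, b) * ln (col p a))"
    proof (rule sum_mono)
      fix b assume b: "b \<in> P a"
      have "0 \<le> p (a, b)" "p (a, b) \<le> col p a"
        using a b p by (auto intro!: Upsilon_nonneg le_col simp: Q_def)
      then show "p (a, b) * ln (p (a, b)) \<le> p (a, b) * ln (col p a)"
        by (cases "p (a, b) = 0") (auto intro!: mult_left_mono)
    qed
    then show ?thesis by (simp add: col_def sum_distrib_right)
  qed
  then have "(\<Sum>a\<in>S. \<Sum>b\<in>P a. p (a, b) * ln (p (a, b))) \<le> (\<Sum>a\<in>S. col p a * ln (col p a))"
    by (rule sum_mono)
  then show ?thesis by (simp add: hc_def h_def h_r_col sum_Q)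
qed

section \<open>Pressure and its variational principle\<close>

definition pressure :: "real \<Rightarrow> real" where
  "pressure \<kappa> = ln (\<Sum>a\<in>S. real (card (P a)) powr \<kappa>)"

lemma pressure_sum_pos: "0 < (\<Sum>a\<in>S. real (card (P a)) powr \<kappa>)"
  using finite_S S_nonempty card_P_ge_1 by (intro sum_pos) (force simp: powr_gt_zero)+

text \<open>Gibbs' inequality is applied twice: with unit weights inside each column, which bounds
  the conditional entropy by the logarithm of the column size, and then over the columns with
  weights \<open>card (P a) powr \<kappa>\<close>.\<close>

lemma pressure_ge:
  assumes p: "p \<in> \<Upsilon>" and \<kappa>: "0 \<le> \<kappa>"
  shows "h\<^sub>r p + \<kappa> * hc p \<le> pressure \<kappa>"
proof -
  have fib: "col p a * ln (col p a) - (\<Sum>b\<in>P a. p (a, b) * ln (p (a, b))) \<le> col p a * ln (real (card (P a)))"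
    if a: "a \<in> S" for a
  proof -
    have "0 \<le> p (a, b)" if "b \<in> P a" for b
      using that a p by (auto intro!: Upsilon_nonneg simp: Q_def)
    then show ?thesis
      using log_sum_inequality[of "P a" "\<lambda>b. p (a, b)" "\<lambda>_. 1"] finite_P[OF a] P_nonempty[OF a]
      by (simp add: col_def)
  qed
  have "h\<^sub>r p + \<kappa> * hc p = (\<Sum>a\<in>S. - (col p a * ln (col p a)) + \<kappa> * (col p a * ln (col p a) - (\<Sum>b\<in>P a. p (a, b) * ln (p (a, b)))))"
    by (simp add: hc_def h_def h_r_col sum_Q sum.distrib sum_distrib_left[symmetric] sum_subtractf sum_negf)
  also have "\<dots> \<le> (\<Sum>a\<in>S. - (col p a * ln (col p a)) + \<kappa> * (col p a * ln (real (card (P a)))))"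
    by (intro sum_mono add_left_mono mult_left_mono fib \<kappa>)
  also have "\<dots> = (\<Sum>a\<in>S. col p a * ln (real (card (P a)) powr \<kappa>)) - (\<Sum>a\<in>S. col p a * ln (col p a))"
  proof -
    have "ln (real (card (P a)) powr \<kappa>) = \<kappa> * ln (real (card (P a)))" if "a \<in> S" for a
      using card_P_ge_1[OF that] by (simp add: ln_powr)
    then show ?thesis by (simp add: sum_subtractf[symmetric] algebra_simps cong: sum.cong)
  qed
  also have "\<dots> \<le> pressure \<kappa>"
  proof -
    have "0 < real (card (P a)) powr \<kappa>" if "a \<in> S" for a using card_P_ge_1[OF that] by simp
    then show ?thesis
      using log_sum_inequality[of S "col p" "\<lambda>a. real (card (P a)) powr \<kappa>"] finite_S S_nonempty
        col_nonneg[OF p] col_sum[OF p]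
      by (simp add: pressure_def)
  qed
  finally show ?thesis .
qed

text \<open>Equality holds for the Gibbs measure: column weights proportional to
  \<open>card (P a) powr \<kappa>\<close> and the uniform distribution inside each column. For it
  the summand in every column is the constant \<open>ln Z\<close>.\<close>

lemma pressure_attained: "\<exists>p\<in>\<Upsilon>. h\<^sub>r p + \<kappa> * hc p = pressure \<kappa>"
proof -
  define w where "w a = real (card (P a)) powr \<kappa>" for a
  define Z where "Z = sum w S"
  have Z: "Z > 0" unfolding Z_def w_def by (rule pressure_sum_pos)
  have w: "w a > 0" if "a \<in> S" for a using card_P_ge_1[OF that] by (simp add: w_def)
  define p where "p = (\<lambda>q\<in>Q. w (fst q) / Z / real (card (P (fst q))))"
  have pab: "p (a, b) = w a / Z / real (card (P a))" if "a \<in> S" "b \<in> P a" for a b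
    using that by (simp add: p_def Q_def)
  have col: "col p a = w a / Z" if a: "a \<in> S" for a
    using a card_P_ge_1[OF a] by (simp add: col_def pab cong: sum.cong)
  have sum1: "(\<Sum>a\<in>S. w a / Z) = 1"
    using Z by (simp add: sum_divide_distrib[symmetric] Z_def[symmetric])
  have "p \<in> \<Upsilon>"
  proof -
    have "(\<Sum>q\<in>Q. p q) = (\<Sum>a\<in>S. col p a)" by (simp add: sum_Q col_def)
    also have "\<dots> = 1" using sum1 by (simp add: col cong: sum.cong)
    finally show ?thesis
      using Z w by (auto simp: \<Upsilon>_def p_def Q_def less_imp_le)
  qed
  moreover have "h\<^sub>r p + \<kappa> * hc p = pressure \<kappa>"
  proof -
    have lnw: "ln (w a / Z) = \<kappa> * ln (real (card (P a))) - ln Z" if "a \<in> S" for a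
      using w[OF that] Z card_P_ge_1[OF that] by (simp add: ln_div w_def ln_powr)
    have lnp: "ln (p (a, b)) = ln (w a / Z) - ln (real (card (P a)))" if "a \<in> S" "b \<in> P a" for a b
      using w[OF that(1)] Z card_P_ge_1[OF that(1)] that by (simp add: pab ln_div ln_mult)
    have h: "h p = - (\<Sum>a\<in>S. w a / Z * (ln (w a / Z) - ln (real (card (P a)))))"
    proof -
      have "(\<Sum>b\<in>P a. p (a, b) * ln (p (a, b))) = w a / Z * (ln (w a / Z) - ln (real (card (P a))))" if a: "a \<in> S" for a
      proof -
        have "(\<Sum>b\<in>P a. p (a, b) * ln (p (a, b))) = (\<Sum>b\<in>P a. p (a, b)) * (ln (w a / Z) - ln (real (card (P a))))"
          unfolding sum_distrib_right using a by (intro sum.cong) (auto simp: lnp)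
        then show ?thesis using col[OF a] by (simp add: col_def)
      qed
      then show ?thesis by (simp add: h_def sum_Q cong: sum.cong)
    qed
    have hr: "h\<^sub>r p = - (\<Sum>a\<in>S. w a / Z * ln (w a / Z))"
      by (simp add: h_r_col col cong: sum.cong)
    have "h\<^sub>r p + \<kappa> * hc p = (\<Sum>a\<in>S. w a / Z * (\<kappa> * ln (real (card (P a))) - ln (w a / Z)))"
      unfolding hc_def h hr
      by (simp add: algebra_simps sum_subtractf sum.distrib sum_distrib_left sum_negf)
    also have "\<dots> = (\<Sum>a\<in>S. w a / Z * ln Z)"
      by (intro sum.cong refl) (simp add: lnw)
    also have "\<dots> = ln Z" using sum1 unfolding sum_distrib_right[symmetric] by simp
    finally show ?thesis by (simp add: pressure_def Z_def w_def)
  qed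
  ultimately show ?thesis by blast
qed

lemma pressure_nonneg: "0 \<le> \<kappa> \<Longrightarrow> 0 \<le> pressure \<kappa>"
  using pressure_attained[of \<kappa>] h_r_nonneg hc_nonneg by (metis add_nonneg_nonneg mult_nonneg_nonneg)

text \<open>The maximiser for \<open>\<kappa>\<close> is a competitor for \<open>\<kappa>'\<close>,
  and its conditional entropy is nonnegative.\<close>

lemma pressure_mono:
  assumes "0 \<le> \<kappa>" "\<kappa> \<le> \<kappa>'" shows "pressure \<kappa> \<le> pressure \<kappa>'"
proof -
  obtain p where p: "p \<in> \<Upsilon>" "h\<^sub>r p + \<kappa> * hc p = pressure \<kappa>" using pressure_attained by blast
  have "\<kappa> * hc p \<le> \<kappa>' * hc p" using assms hc_nonneg[OF p(1)] by (rule_tac mult_right_mono)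
  then show ?thesis using pressure_ge[OF p(1), of \<kappa>'] p(2) assms by linarith
qed

section \<open>Mixtures, concavity of the entropies, compactness of the simplex\<close>

definition mix :: "real \<Rightarrow> (nat \<times> nat \<Rightarrow> real) \<Rightarrow> (nat \<times> nat \<Rightarrow> real) \<Rightarrow> nat \<times> nat \<Rightarrow> real" where
  "mix t p p' = (\<lambda>q\<in>Q. (1 - t) * p q + t * p' q)"

lemma col_mix: "a \<in> S \<Longrightarrow> col (mix t p p') a = (1 - t) * col p a + t * col p' a"
  by (simp add: col_def mix_def Q_def sum.distrib sum_distrib_left cong: sum.cong)

lemma mix_Upsilon:
  assumes "p \<in> \<Upsilon>" "p' \<in> \<Upsilon>" "0 \<le> t" "t \<le> 1" shows "mix t p p' \<in> \<Upsilon>"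
proof -
  have "(\<Sum>q\<in>Q. mix t p p' q) = 1"
    using Upsilon_sum[OF assms(1)] Upsilon_sum[OF assms(2)]
    by (simp add: mix_def sum.distrib sum_distrib_left[symmetric] cong: sum.cong)
  moreover have "0 \<le> mix t p p' q" if "q \<in> Q" for q
    using that assms Upsilon_nonneg by (simp add: mix_def)
  ultimately show ?thesis by (auto simp: \<Upsilon>_def PiE_iff mix_def)
qed

lemma h_mix_ge:
  assumes "p \<in> \<Upsilon>" "p' \<in> \<Upsilon>" "0 \<le> t" "t \<le> 1"
  shows "h (mix t p p') \<ge> (1 - t) * h p + t * h p'"
proof -
  have "(\<Sum>q\<in>Q. mix t p p' q * ln (mix t p p' q)) \<le> (\<Sum>q\<in>Q. (1 - t) * (p q * ln (p q)) + t * (p' q * ln (p' q)))"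
    using assms by (intro sum_mono) (simp add: mix_def x_ln_x_convex Upsilon_nonneg)
  also have "\<dots> = (1 - t) * (\<Sum>q\<in>Q. p q * ln (p q)) + t * (\<Sum>q\<in>Q. p' q * ln (p' q))"
    by (simp add: sum.distrib sum_distrib_left)
  finally show ?thesis by (simp add: h_def)
qed

lemma h_r_mix_ge:
  assumes "p \<in> \<Upsilon>" "p' \<in> \<Upsilon>" "0 \<le> t" "t \<le> 1"
  shows "h\<^sub>r (mix t p p') \<ge> (1 - t) * h\<^sub>r p + t * h\<^sub>r p'"
proof -
  have "(\<Sum>a\<in>S. col (mix t p p') a * ln (col (mix t p p') a))
      \<le> (\<Sum>a\<in>S. (1 - t) * (col p a * ln (col p a)) + t * (col p' a * ln (col p' a)))"
    using assms by (intro sum_mono) (simp add: col_mix x_ln_x_convex col_nonneg)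
  also have "\<dots> = (1 - t) * (\<Sum>a\<in>S. col p a * ln (col p a)) + t * (\<Sum>a\<in>S. col p' a * ln (col p' a))"
    by (simp add: sum.distrib sum_distrib_left)
  finally show ?thesis by (simp add: h_r_col)
qed

lemma continuous_on_h: "continuous_on \<Upsilon> h"
proof -
  have "continuous_on \<Upsilon> (\<lambda>p. p q * ln (p q))" if "q \<in> Q" for q
    by (rule continuous_on_compose2[OF continuous_on_x_ln_x])
      (use that Upsilon_nonneg[where q = q] in \<open>auto intro: continuous_on_subset[OF continuous_on_product_coordinates] simp del: split_paired_All\<close>)
  then show ?thesis unfolding h_def[abs_def] by (intro continuous_on_minus continuous_on_sum)
qed

lemma continuous_on_h_r: "continuous_on \<Upsilon> h\<^sub>r"
proof -
  have "continuous_on \<Upsilon> (\<lambda>p. col p a * ln (col p a))" if "a \<in> S" for a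
    by (rule continuous_on_compose2[OF continuous_on_x_ln_x])
      (use that col_nonneg in \<open>auto simp: col_def intro!: continuous_on_sum intro: continuous_on_subset[OF continuous_on_product_coordinates]\<close>)
  then show ?thesis unfolding h_r_col[abs_def] by (intro continuous_on_minus continuous_on_sum)
qed

lemma compact_Upsilon: "compact \<Upsilon>"
proof -
  \<comment> \<open>Elements of \<open>\<Upsilon>\<close> are \<open>undefined\<close> outside
    \<open>Q\<close>. A one-point factor there turns \<open>\<Upsilon>\<close> into a closed subset
    of a product of compact sets over the whole index type.\<close>
  define B where "B = (\<lambda>q. if q \<in> Q then {0..1::real} else {undefined})"
  have "compactin (product_topology (\<lambda>i. euclidean) UNIV) (PiE UNIV B)"
    unfolding compactin_PiE by (auto simp: B_def)
  then have B: "compact (PiE UNIV B)"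
    by (simp add: euclidean_product_topology)
  have "\<Upsilon> = PiE UNIV B \<inter> {p. (\<Sum>q\<in>Q. p q) = 1}"
  proof (intro set_eqI iffI)
    fix p assume p: "p \<in> \<Upsilon>"
    have "p q = undefined" if "q \<notin> Q" for q
      using p that unfolding \<Upsilon>_def by (auto intro: PiE_arb)
    then have "p q \<in> B q" for q
      using Upsilon_nonneg[OF p, of q] Upsilon_le_1[OF p, of q] by (simp add: B_def)
    then show "p \<in> PiE UNIV B \<inter> {p. (\<Sum>q\<in>Q. p q) = 1}" using Upsilon_sum[OF p] by auto
  next
    fix p assume p: "p \<in> PiE UNIV B \<inter> {p. (\<Sum>q\<in>Q. p q) = 1}"
    have "p q \<in> B q" for q using p by auto
    then have "q \<in> Q \<Longrightarrow> 0 \<le> p q" "q \<notin> Q \<Longrightarrow> p q = undefined" for q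
      unfolding B_def by (metis atLeastAtMost_iff, metis singletonD)
    then show "p \<in> \<Upsilon>" using p by (auto simp: \<Upsilon>_def PiE_iff extensional_def)
  qed
  moreover have "closed {p::nat\<times>nat\<Rightarrow>real. (\<Sum>q\<in>Q. p q) = 1}"
    by (intro closed_Collect_eq continuous_intros) auto
  ultimately show ?thesis using B by (simp add: compact_Int_closed)
qed

lemma continuous_on_mix: "continuous_on A (\<lambda>t. mix t p p')"
proof (rule continuous_on_coordinatewise_then_product)
  fix q show "continuous_on A (\<lambda>t. mix t p p' q)"
    by (cases "q \<in> Q") (auto simp: mix_def intro!: continuous_intros)
qed

definition dirac :: "nat \<times> nat \<Rightarrow> nat \<times> nat \<Rightarrow> real" where
  "dirac q = (\<lambda>q'\<in>Q. if q' = q then 1 else 0)"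

lemma dirac_Upsilon: "q \<in> Q \<Longrightarrow> dirac q \<in> \<Upsilon>"
  using finite_Q by (auto simp: \<Upsilon>_def dirac_def sum.delta)

lemma Upsilon_nonempty: "\<Upsilon> \<noteq> {}"
  using Q_nonempty dirac_Upsilon by blast

end

section \<open>Itineraries\<close>

text \<open>A common frame for one coordinate of an orbit of \<open>T\<close> and for one coordinate
  of a coded sequence. At K-adic points both admissible digits are allowed, since \<open>T\<close>
  and the coding may choose different ones.\<close>

locale digit_orbit =
  fixes K :: nat and x :: "nat \<Rightarrow> real" and a :: "nat \<Rightarrow> nat"
  assumes K: "K \<ge> 2" and x: "\<And>i. 0 \<le> x i \<and> x i \<le> 1"
    and a: "\<And>i. 1 \<le> a i \<and> a i \<le> K"
    and step: "\<And>i. real K * x i = real (a i) - 1 + x (Suc i)"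
begin

lemma eq_1_digits: assumes "x j = 1" "j \<le> i" shows "a i = K"
proof -
  have "x i = 1"
    using assms(2)
  proof (induction i rule: dec_induct)
    case base then show ?case by (rule assms(1))
  next
    case (step i)
    have "real K = real (a i) - 1 + x (Suc i)"
      using digit_orbit.step[OF digit_orbit_axioms, of i] step.IH by simp
    moreover have "real (a i) \<le> real K" "x (Suc i) \<le> 1" using a[of i] x[of "Suc i"] by auto
    ultimately show ?case by linarith
  qed
  moreover have "x (Suc i) \<le> 1" "real (a i) \<le> real K" using x[of "Suc i"] a[of i] by auto
  ultimately have "real (a i) = real K" using step[of i] by simp
  then show ?thesis by simp
qed

lemma eq_0_digits: assumes "x j = 0" "j \<le> i" shows "a i = 1"
proof -
  have *: "a i = 1 \<and> x (Suc i) = 0" if "x i = 0" for i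
  proof -
    have "1 \<le> real (a i)" using a[of i] by simp
    moreover have "0 = real (a i) - 1 + x (Suc i)" using step[of i] that by simp
    ultimately have "real (a i) = 1 \<and> x (Suc i) = 0" using x[of "Suc i"] by linarith
    then show ?thesis by simp
  qed
  have "x i = 0"
    using assms(2)
    by (induction i rule: dec_induct) (use assms(1) * in auto)
  then show ?thesis using * by simp
qed

end

text \<open>While the digits agree, each step multiplies the difference of the two points by
  \<open>K\<close>; after \<open>L\<close> steps it is still at most 1.\<close>

lemma digit_orbit_close:
  assumes "digit_orbit K x a" "digit_orbit K x' a'" "\<And>i. i < L \<Longrightarrow> a i = a' i"
  shows "\<bar>x 0 - x' 0\<bar> \<le> 1 / real K ^ L"
proof -
  interpret A: digit_orbit K x a by fact
  interpret B: digit_orbit K x' a' by fact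
  have *: "real K ^ i * (x 0 - x' 0) = x i - x' i" if "i \<le> L" for i
    using that
  proof (induction i)
    case (Suc i)
    have "real K ^ Suc i * (x 0 - x' 0) = real K * (real K ^ i * (x 0 - x' 0))" by simp
    also have "\<dots> = real K * (x i - x' i)" using Suc by simp
    also have "\<dots> = x (Suc i) - x' (Suc i)"
      using A.step[of i] B.step[of i] assms(3)[of i] Suc.prems by (simp add: right_diff_distrib)
    finally show ?case .
  qed simp
  have "\<bar>real K ^ L * (x 0 - x' 0)\<bar> \<le> 1"
    using *[of L] A.x[of L] B.x[of L] by (simp add: abs_le_iff)
  moreover have "real K ^ L > 0" using A.K by simp
  ultimately show ?thesis by (simp add: abs_mult pos_le_divide_eq mult.commute)
qed

text \<open>The two remainders differ by a nonzero integer, and both lie in the unit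
  interval.\<close>

lemma digit_branch:
  fixes v v' :: real and a a' :: nat
  assumes "real a - 1 + v = real a' - 1 + v'" "0 \<le> v" "v \<le> 1" "0 \<le> v'" "v' \<le> 1" "a \<noteq> a'"
  shows "v = 0 \<or> v = 1"
proof -
  have "real a + 1 \<le> real a' \<or> real a' + 1 \<le> real a" using assms(6) by linarith
  then show ?thesis using assms(1-5) by linarith
qed

definition digit_value :: "nat \<Rightarrow> (nat \<Rightarrow> nat) \<Rightarrow> real" where
  "digit_value K a = (\<Sum>i. (real (a i) - 1) / real K ^ Suc i)"

text \<open>Splitting off the first term of the series gives the recursion; comparison with the
  geometric series for the digit \<open>K\<close> gives the bound 1.\<close>

lemma digit_orbit_value:
  assumes K: "K \<ge> 2" and a: "\<And>i. 1 \<le> a i \<and> a i \<le> K"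
  shows "digit_orbit K (\<lambda>i. digit_value K (\<lambda>j. a (i + j))) a"
proof
  have geo: "(\<lambda>i. (real K - 1) / real K ^ Suc i) sums 1"
  proof -
    have "(\<lambda>i. (1 / real K) ^ i) sums (1 / (1 - 1 / real K))"
      using K by (intro geometric_sums) simp
    from sums_mult[OF this, of "(real K - 1) / real K"]
    show ?thesis using K by (simp add: field_simps power_divide)
  qed
  have le: "0 \<le> (real (a j) - 1) / real K ^ Suc i \<and> (real (a j) - 1) / real K ^ Suc i \<le> (real K - 1) / real K ^ Suc i" for i j
    using a[of j] K by (auto intro!: divide_right_mono)
  have ab: "norm ((real (a j) - 1) / real K ^ Suc i) \<le> (real K - 1) / real K ^ Suc i" for i j
    using le[of j i] by (simp only: real_norm_def abs_of_nonneg simp_thms)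
  have sm: "summable (\<lambda>i. (real (a (n + i)) - 1) / real K ^ Suc i)" for n
    by (rule summable_comparison_test'[OF sums_summable[OF geo], of 0])
      (rule ab)
  fix i
  show "2 \<le> K" by fact
  show "1 \<le> a i \<and> a i \<le> K" using a .
  show "0 \<le> digit_value K (\<lambda>j. a (i + j)) \<and> digit_value K (\<lambda>j. a (i + j)) \<le> 1"
  proof
    show "0 \<le> digit_value K (\<lambda>j. a (i + j))" unfolding digit_value_def using sm[of i] le by (intro suminf_nonneg) auto
    show "digit_value K (\<lambda>j. a (i + j)) \<le> 1" unfolding digit_value_def
      using suminf_le[OF _ sm[of i] sums_summable[OF geo]] le sums_unique[OF geo] by simp
  qed
  have "digit_value K (\<lambda>j. a (i + j)) = (real (a i) - 1) / real K + (\<Sum>j. (real (a (i + Suc j)) - 1) / real K ^ Suc (Suc j))"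
    unfolding digit_value_def using suminf_split_head[OF sm[of i]] by simp
  also have "(\<Sum>j. (real (a (i + Suc j)) - 1) / real K ^ Suc (Suc j)) = (\<Sum>j. (real (a (Suc i + j)) - 1) / real K ^ Suc j / real K)"
    by (intro suminf_cong) (simp add: mult.commute)
  also have "\<dots> = digit_value K (\<lambda>j. a (Suc i + j)) / real K"
    unfolding digit_value_def by (rule suminf_divide[OF sm])
  finally have "digit_value K (\<lambda>j. a (i + j)) = (real (a i) - 1 + digit_value K (\<lambda>j. a (Suc i + j))) / real K"
    by (simp only: add_divide_distrib)
  then show "real K * digit_value K (\<lambda>j. a (i + j)) = real (a i) - 1 + digit_value K (\<lambda>j. a (Suc i + j))"
    using K by simp
qed

section \<open>Itineraries of the orbits on the carpet\<close>

context bedford_mcmullen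
begin

definition dig :: "real \<times> real \<Rightarrow> nat \<times> nat" where
  "dig z = (if exceptional z then address z
     else (nat \<lfloor>real N * fst z\<rfloor> + 1, nat \<lfloor>real M * snd z\<rfloor> + 1))"

lemma F_square:
  "F (a, b) ` ({0..1} \<times> {0..1}) =
    {(real a - 1) / real N .. real a / real N} \<times> {(real b - 1) / real M .. real b / real M}"
proof (intro subset_antisym subsetI)
  fix z assume "z \<in> F (a, b) ` ({0..1} \<times> {0..1})"
  then show "z \<in> {(real a - 1) / real N .. real a / real N} \<times> {(real b - 1) / real M .. real b / real M}"
    using N_pos M_pos by (auto simp: F_def intro!: divide_right_mono)
next
  fix z assume z: "z \<in> {(real a - 1) / real N .. real a / real N} \<times> {(real b - 1) / real M .. real b / real M}"
  define w where "w = (real N * fst z - (real a - 1), real M * snd z - (real b - 1))"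
  have "z = F (a, b) w" using N_pos M_pos by (cases z) (simp add: F_def w_def)
  moreover have "w \<in> {0..1} \<times> {0..1}"
    using z N_pos M_pos by (auto simp: w_def field_simps)
  ultimately show "z \<in> F (a, b) ` ({0..1} \<times> {0..1})" by blast
qed

lemma address:
  assumes "z \<in> carpet" shows "address z \<in> Q" "z \<in> F (address z) ` carpet"
proof -
  have "\<exists>q. q \<in> Q \<and> z \<in> F q ` carpet" using assms is_carpet_carpet by blast
  then have "address z \<in> Q \<and> z \<in> F (address z) ` carpet"
    unfolding address_def by (rule someI_ex)
  then show "address z \<in> Q" "z \<in> F (address z) ` carpet" by auto
qed

text \<open>The ordinary and the exceptional points become indistinguishable: \<open>T\<close> is
  always the inverse branch of the map with index \<open>dig z\<close>, and \<open>cell z\<close> is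
  the rectangle of that map.\<close>

lemma dig_T_cell:
  assumes z: "z \<in> carpet"
  shows dig_in_Q: "dig z \<in> Q" and F_dig_T: "F (dig z) (T z) = z"
    and cell_dig: "cell z = F (dig z) ` ({0..1} \<times> {0..1})"
proof -
  have "dig z \<in> Q \<and> F (dig z) (T z) = z \<and> cell z = F (dig z) ` ({0..1} \<times> {0..1})"
  proof (cases "exceptional z")
    case True
    obtain w where w: "z = F (address z) w" using address[OF z] by blast
    have "the_inv (F (address z)) z = w" by (subst (2) w) (rule the_inv_f_f[OF inj_F])
    then show ?thesis using True w address(1)[OF z] by (simp add: dig_def T_def cell_def)
  next
    case False
    obtain x y where xy: "z = (x, y)" by (cases z)
    have pos: "0 \<le> \<lfloor>real N * x\<rfloor>" "0 \<le> \<lfloor>real M * y\<rfloor>" using z carpet_subset xy by auto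
    have "dig z \<in> Q" using False z unfolding exceptional_def dig_def xy by auto
    moreover have "F (dig z) (T z) = z"
      using False pos N_pos M_pos by (simp add: dig_def T_def T_floor_def F_def xy frac_def)
    moreover have "cell z = F (dig z) ` ({0..1} \<times> {0..1})"
      using False pos unfolding dig_def if_not_P[OF False] F_square by (simp add: cell_def cell_floor_def xy add.commute)
    ultimately show ?thesis by blast
  qed
  then show "dig z \<in> Q" "F (dig z) (T z) = z" "cell z = F (dig z) ` ({0..1} \<times> {0..1})" by auto
qed

lemma T_pow_carpet: "y \<in> carpet \<Longrightarrow> (T ^^ i) y \<in> carpet"
  by (induction i) (auto intro: T_carpet)

definition itin :: "real \<times> real \<Rightarrow> nat \<Rightarrow> nat \<times> nat" where
  "itin y i = dig ((T ^^ i) y)"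

lemma itin_in_Q: "y \<in> carpet \<Longrightarrow> itin y i \<in> Q"
  unfolding itin_def by (intro dig_in_Q T_pow_carpet)

lemma F_coords: "F q z = w \<Longrightarrow> real N * fst w = real (fst q) - 1 + fst z \<and> real M * snd w = real (snd q) - 1 + snd z"
  using N_pos M_pos by (cases q; cases z) (auto simp: F_def)

lemma digit_orbit_itin:
  assumes y: "y \<in> carpet"
  shows "digit_orbit N (\<lambda>i. fst ((T ^^ i) y)) (\<lambda>i. fst (itin y i))"
    and "digit_orbit M (\<lambda>i. snd ((T ^^ i) y)) (\<lambda>i. snd (itin y i))"
proof -
  have 1: "(T ^^ i) y \<in> {0..1} \<times> {0..1}" for i using T_pow_carpet[OF y] carpet_subset by blast
  have 2: "F (itin y i) ((T ^^ Suc i) y) = (T ^^ i) y" for i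
    unfolding itin_def using F_dig_T[OF T_pow_carpet[OF y]] by simp
  have 3: "1 \<le> fst (itin y i)" "fst (itin y i) \<le> N" "1 \<le> snd (itin y i)" "snd (itin y i) \<le> M" for i
    using Q_bounds[of "fst (itin y i)" "snd (itin y i)"] itin_in_Q[OF y] by auto
  show "digit_orbit N (\<lambda>i. fst ((T ^^ i) y)) (\<lambda>i. fst (itin y i))"
    using N_ge_2 1 3 F_coords[OF 2] by unfold_locales (auto simp: mem_Times_iff)
  show "digit_orbit M (\<lambda>i. snd ((T ^^ i) y)) (\<lambda>i. snd (itin y i))"
    using N_ge_2 N_less_M 1 3 F_coords[OF 2] by unfold_locales (auto simp: mem_Times_iff)
qed

lemma cyl_iff:
  assumes "x \<in> carpet"
  shows "(T ^^ n) y \<in> cyl f x \<longleftrightarrow> (\<forall>k<f. (T ^^ (n + k)) y \<in> F (itin x k) ` ({0..1} \<times> {0..1}))"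
proof -
  have "(T ^^ (n + k)) y = (T ^^ k) ((T ^^ n) y)" for k by (metis add.commute comp_apply funpow_add)
  then show ?thesis unfolding cyl_def itin_def by (auto simp: cell_dig[OF T_pow_carpet[OF assms]])
qed

lemma itin_in_cyl:
  assumes "x \<in> carpet" "y \<in> carpet" "\<And>k. k < f \<Longrightarrow> itin y (n + k) = itin x k"
  shows "(T ^^ n) y \<in> cyl f x"
  unfolding cyl_iff[OF assms(1)]
proof (intro allI impI)
  fix k assume k: "k < f"
  have "F (itin y (n + k)) ((T ^^ Suc (n + k)) y) = (T ^^ (n + k)) y"
    unfolding itin_def using F_dig_T[OF T_pow_carpet[OF assms(2)]] by simp
  moreover have "(T ^^ Suc (n + k)) y \<in> {0..1} \<times> {0..1}"
    using T_pow_carpet[OF assms(2), of "Suc (n + k)"] carpet_subset by blast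
  ultimately show "(T ^^ (n + k)) y \<in> F (itin x k) ` ({0..1} \<times> {0..1})"
    using assms(3)[OF k] by (metis imageI)
qed

text \<open>A point of a rectangle whose own digit is different from that of the rectangle lies on its
  boundary, and then one of its two coordinates has a constant expansion from that place on.\<close>

lemma boundary_digits:
  assumes y: "y \<in> carpet" and t: "(T ^^ i) y \<in> F t ` ({0..1} \<times> {0..1})"
  shows "fst (itin y i) \<noteq> fst t \<Longrightarrow> \<exists>c. \<forall>j>i. fst (itin y j) = c"
    and "snd (itin y i) \<noteq> snd t \<Longrightarrow> \<exists>c. \<forall>j>i. snd (itin y j) = c"
proof -
  obtain w where w: "w \<in> {0..1} \<times> {0..1}" "F t w = (T ^^ i) y" using t by auto
  have 1: "(T ^^ Suc i) y \<in> {0..1} \<times> {0..1}"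
    using T_pow_carpet[OF y, of "Suc i"] carpet_subset by blast
  have 2: "F (itin y i) ((T ^^ Suc i) y) = (T ^^ i) y"
    unfolding itin_def using F_dig_T[OF T_pow_carpet[OF y]] by simp
  {
    assume "fst (itin y i) \<noteq> fst t"
    then have "fst ((T ^^ Suc i) y) = 0 \<or> fst ((T ^^ Suc i) y) = 1"
      using digit_branch[of "fst (itin y i)" "fst ((T ^^ Suc i) y)" "fst t" "fst w"]
        F_coords[OF w(2)] F_coords[OF 2] w(1) 1 by (auto simp: mem_Times_iff)
    then show "\<exists>c. \<forall>j>i. fst (itin y j) = c"
      using digit_orbit.eq_1_digits[OF digit_orbit_itin(1)[OF y], of "Suc i"]
        digit_orbit.eq_0_digits[OF digit_orbit_itin(1)[OF y], of "Suc i"] by (metis Suc_le_eq)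
  }
  {
    assume "snd (itin y i) \<noteq> snd t"
    then have "snd ((T ^^ Suc i) y) = 0 \<or> snd ((T ^^ Suc i) y) = 1"
      using digit_branch[of "snd (itin y i)" "snd ((T ^^ Suc i) y)" "snd t" "snd w"]
        F_coords[OF w(2)] F_coords[OF 2] w(1) 1 by (auto simp: mem_Times_iff)
    then show "\<exists>c. \<forall>j>i. snd (itin y j) = c"
      using digit_orbit.eq_1_digits[OF digit_orbit_itin(2)[OF y], of "Suc i"]
        digit_orbit.eq_0_digits[OF digit_orbit_itin(2)[OF y], of "Suc i"] by (metis Suc_le_eq)
  }
qed

section \<open>Targets expressed by digits\<close>

definition digit_target :: "(nat \<Rightarrow> nat) \<Rightarrow> (nat \<Rightarrow> nat \<Rightarrow> nat \<times> nat) \<Rightarrow> (real \<times> real) set" where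
  "digit_target f t = {y \<in> carpet. infinite {n. n \<ge> 1 \<and> (\<forall>k<f n. itin y (n + k) = t n k)}}"

text \<open>By \<open>boundary_digits\<close>, a coordinate of the itinerary either agrees with the
  target at every hit or is eventually constant. In the second case the point hits, at all late
  times, the target with that coordinate replaced by the constant. There are finitely many
  constants, so sets of measure zero remain so under the union. The modified targets need not
  consist of elements of \<open>Q\<close>.\<close>

lemma cyl_target_subset:
  assumes x: "\<And>n. n \<ge> 1 \<Longrightarrow> x n \<in> carpet"
  defines "t \<equiv> \<lambda>n. itin (x n)"
  shows "{y \<in> carpet. infinite {n. n \<ge> 1 \<and> (T ^^ n) y \<in> cyl (f n) (x n)}} \<subseteq>
    \<Union>({digit_target f t} \<union> (\<lambda>c. digit_target f (\<lambda>n k. (c, snd (t n k)))) ` S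
      \<union> (\<lambda>c. digit_target f (\<lambda>n k. (fst (t n k), c))) ` snd ` Q
      \<union> (\<lambda>q. digit_target f (\<lambda>n k. q)) ` Q)"
proof
  fix y assume "y \<in> {y \<in> carpet. infinite {n. n \<ge> 1 \<and> (T ^^ n) y \<in> cyl (f n) (x n)}}"
  then have y: "y \<in> carpet" and inf: "infinite {n. n \<ge> 1 \<and> (T ^^ n) y \<in> cyl (f n) (x n)}" by auto
  have inf': "infinite {n. n \<ge> 1 \<and> R n}"
    if "\<And>n. n \<ge> 1 \<Longrightarrow> n \<ge> j \<Longrightarrow> (T ^^ n) y \<in> cyl (f n) (x n) \<Longrightarrow> R n" for R j
  proof -
    have "infinite ({n. n \<ge> 1 \<and> (T ^^ n) y \<in> cyl (f n) (x n)} - {..<j})" using inf by simp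
    moreover have "{n. n \<ge> 1 \<and> (T ^^ n) y \<in> cyl (f n) (x n)} - {..<j} \<subseteq> {n. n \<ge> 1 \<and> R n}"
      using that by auto
    ultimately show ?thesis using finite_subset by blast
  qed
  define evx where "evx \<longleftrightarrow> (\<exists>c j. \<forall>i\<ge>j. fst (itin y i) = c)"
  define evy where "evy \<longleftrightarrow> (\<exists>c j. \<forall>i\<ge>j. snd (itin y i) = c)"
  have ex: "fst (itin y (n + k)) = fst (t n k)" if "\<not> evx" "n \<ge> 1" "(T ^^ n) y \<in> cyl (f n) (x n)" "k < f n" for n k
    using that boundary_digits(1)[OF y, of "n + k" "itin (x n) k"] cyl_iff[OF x[OF that(2)]]
    unfolding evx_def t_def by (metis less_eq_Suc_le)
  have ey: "snd (itin y (n + k)) = snd (t n k)" if "\<not> evy" "n \<ge> 1" "(T ^^ n) y \<in> cyl (f n) (x n)" "k < f n" for n k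
    using that boundary_digits(2)[OF y, of "n + k" "itin (x n) k"] cyl_iff[OF x[OF that(2)]]
    unfolding evy_def t_def by (metis less_eq_Suc_le)
  consider "\<not> evx" "\<not> evy" | "evx" "\<not> evy" | "\<not> evx" "evy" | "evx" "evy" by blast
  then show "y \<in> \<Union>({digit_target f t} \<union> (\<lambda>c. digit_target f (\<lambda>n k. (c, snd (t n k)))) ` S
      \<union> (\<lambda>c. digit_target f (\<lambda>n k. (fst (t n k), c))) ` snd ` Q
      \<union> (\<lambda>q. digit_target f (\<lambda>n k. q)) ` Q)"
  proof cases
    case 1
    have "y \<in> digit_target f t"
      unfolding digit_target_def using y 1 ex ey by (intro CollectI conjI inf'[of 0] allI impI prod_eqI) auto
    then show ?thesis by blast
  next
    case 2
    then obtain c j where c: "\<And>i. i \<ge> j \<Longrightarrow> fst (itin y i) = c" unfolding evx_def by blast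
    have "c \<in> S" using itin_in_Q[OF y, of j] c[of j] by (auto simp: Q_def)
    moreover have "y \<in> digit_target f (\<lambda>n k. (c, snd (t n k)))"
      unfolding digit_target_def using y 2 ey c by (intro CollectI conjI inf'[of j] allI impI prod_eqI) auto
    ultimately show ?thesis by blast
  next
    case 3
    then obtain c j where c: "\<And>i. i \<ge> j \<Longrightarrow> snd (itin y i) = c" unfolding evy_def by blast
    have "c \<in> snd ` Q" using itin_in_Q[OF y, of j] c[of j] by (metis image_eqI order_refl)
    moreover have "y \<in> digit_target f (\<lambda>n k. (fst (t n k), c))"
      unfolding digit_target_def using y 3 ex c by (intro CollectI conjI inf'[of j] allI impI prod_eqI) auto
    ultimately show ?thesis by blast
  next
    case 4
    then obtain c j c' j' where c: "\<And>i. i \<ge> j \<Longrightarrow> fst (itin y i) = c" "\<And>i. i \<ge> j' \<Longrightarrow> snd (itin y i) = c'"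
      unfolding evx_def evy_def by blast
    have "itin y (max j j') = (c, c')" using c by (intro prod_eqI) auto
    then have "(c, c') \<in> Q" using itin_in_Q[OF y, of "max j j'"] by simp
    moreover have "y \<in> digit_target f (\<lambda>n k. (c, c'))"
      unfolding digit_target_def using y c by (intro CollectI conjI inf'[of "max j j'"] allI impI prod_eqI) auto
    ultimately show ?thesis by blast
  qed
qed

section \<open>The coding map from digit sequences to the carpet\<close>

definition code :: "(nat \<Rightarrow> nat \<times> nat) \<Rightarrow> real \<times> real" where
  "code \<omega> = (digit_value N (\<lambda>i. fst (\<omega> i)), digit_value M (\<lambda>i. snd (\<omega> i)))"

lemma digit_orbit_code:
  assumes "\<And>i. \<omega> i \<in> Q"
  shows "digit_orbit N (\<lambda>i. fst (code (\<lambda>j. \<omega> (i + j)))) (\<lambda>i. fst (\<omega> i))"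
    and "digit_orbit M (\<lambda>i. snd (code (\<lambda>j. \<omega> (i + j)))) (\<lambda>i. snd (\<omega> i))"
proof -
  have *: "1 \<le> fst (\<omega> i)" "fst (\<omega> i) \<le> N" "1 \<le> snd (\<omega> i)" "snd (\<omega> i) \<le> M" for i
    using Q_bounds[of "fst (\<omega> i)" "snd (\<omega> i)"] assms by auto
  show "digit_orbit N (\<lambda>i. fst (code (\<lambda>j. \<omega> (i + j)))) (\<lambda>i. fst (\<omega> i))"
    using digit_orbit_value[of N "\<lambda>i. fst (\<omega> i)"] N_ge_2 * by (simp add: code_def)
  show "digit_orbit M (\<lambda>i. snd (code (\<lambda>j. \<omega> (i + j)))) (\<lambda>i. snd (\<omega> i))"
    using digit_orbit_value[of M "\<lambda>i. snd (\<omega> i)"] N_ge_2 N_less_M * by (simp add: code_def)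
qed

text \<open>Removing the first digit applies an inverse branch, and the branches contract distances
  by at least 1/2. After \<open>n\<close> steps the code is within \<open>2 * (1/2) ^ n\<close> of
  the carpet, where 2 bounds a distance in the unit square; the carpet is closed.\<close>

lemma code_carpet:
  assumes "\<And>i. \<omega> i \<in> Q" shows "code \<omega> \<in> carpet"
proof -
  obtain z0 where z0: "z0 \<in> carpet" using is_carpet_carpet by blast
  have sq: "code \<omega> \<in> {0..1} \<times> {0..1}" if "\<And>i. \<omega> i \<in> Q" for \<omega>
    using digit_orbit.x[OF digit_orbit_code(1), of \<omega> 0] digit_orbit.x[OF digit_orbit_code(2), of \<omega> 0] that
    by (auto simp: mem_Times_iff)
  have "\<exists>z\<in>carpet. dist (code \<omega>) z \<le> 2 * (1/2) ^ n" if "\<And>i. \<omega> i \<in> Q" for n \<omega>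
    using that
  proof (induction n arbitrary: \<omega>)
    case 0
    have z: "z0 \<in> {0..1} \<times> {0..1}" using z0 carpet_subset by blast
    have "dist (code \<omega>) z0 \<le> dist (fst (code \<omega>)) (fst z0) + dist (snd (code \<omega>)) (snd z0)"
      by (simp add: dist_prod_def sqrt_sum_squares_le_sum)
    moreover have "dist (fst (code \<omega>)) (fst z0) \<le> 1" "dist (snd (code \<omega>)) (snd z0) \<le> 1"
      using sq[of \<omega>] 0 z unfolding dist_real_def mem_Times_iff atLeastAtMost_iff by (auto simp: abs_le_iff)
    ultimately have "dist (code \<omega>) z0 \<le> 2" by simp
    then show ?case using z0 by auto
  next
    case (Suc n)
    define \<sigma> where "\<sigma> = (\<lambda>j. \<omega> (1 + j))"
    obtain z where z: "z \<in> carpet" "dist (code \<sigma>) z \<le> 2 * (1/2) ^ n"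
      using Suc.IH[of \<sigma>] Suc.prems by (auto simp: \<sigma>_def)
    have "code \<omega> = F (\<omega> 0) (code \<sigma>)"
      using digit_orbit.step[OF digit_orbit_code(1), of \<omega> 0] digit_orbit.step[OF digit_orbit_code(2), of \<omega> 0]
        Suc.prems N_pos M_pos
      by (intro prod_eqI) (auto simp: F_def \<sigma>_def case_prod_beta field_simps)
    then have "dist (code \<omega>) (F (\<omega> 0) z) \<le> 2 * (1/2) ^ Suc n"
      using dist_F[of "\<omega> 0" "code \<sigma>" z] z(2) by simp
    moreover have "F (\<omega> 0) z \<in> carpet" using is_carpet_carpet z(1) Suc.prems by blast
    ultimately show ?case by blast
  qed
  then have ap: "\<exists>z\<in>carpet. dist z (code \<omega>) \<le> 2 * (1/2) ^ n" for n
    using assms by (simp add: dist_commute)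
  have "code \<omega> \<in> closure carpet"
    unfolding closure_approachable
  proof (intro allI impI)
    fix e :: real assume "e > 0"
    then obtain n where "(1/2::real) ^ n < e / 2"
      using real_arch_pow_inv[of "e/2" "1/2"] by auto
    moreover obtain z where "z \<in> carpet" "dist z (code \<omega>) \<le> 2 * (1/2) ^ n" using ap[of n] by blast
    ultimately show "\<exists>y\<in>carpet. dist y (code \<omega>) < e" by (intro bexI[of _ z]) auto
  qed
  then show ?thesis using is_carpet_carpet compact_imp_closed closure_closed by blast
qed

text \<open>Were a digit of the itinerary different from that of \<open>\<omega>\<close>, the next
  point would have coordinate 0 or 1, and \<open>\<omega>\<close> would be constant in this
  coordinate from then on. As every element of \<open>Q\<close> recurs, this coordinate would be
  constant on all of \<open>Q\<close>, so that the two digits could not differ. This also covers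
  carpets contained in a line.\<close>

lemma itin_code:
  assumes \<omega>: "\<And>i. \<omega> i \<in> Q" and io: "\<And>q. q \<in> Q \<Longrightarrow> infinite {i. \<omega> i = q}"
  shows "itin (code \<omega>) i = \<omega> i"
proof -
  define y where "y = code \<omega>"
  have y: "y \<in> carpet" unfolding y_def using \<omega> by (rule code_carpet)
  have all: "g q = c" if "\<And>j. j > i \<Longrightarrow> g (\<omega> j) = c" "q \<in> Q" for g :: "nat \<times> nat \<Rightarrow> nat" and c i q
    using io[OF that(2)] that(1) unfolding infinite_nat_iff_unbounded by blast
  have X: "fst ((T ^^ i) y) = fst (code (\<lambda>j. \<omega> (i + j)))" and X': "fst (itin y i) = fst (\<omega> i)" for i
  proof -
    interpret A: digit_orbit N "\<lambda>i. fst ((T ^^ i) y)" "\<lambda>i. fst (itin y i)" using y by (rule digit_orbit_itin)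
    interpret B: digit_orbit N "\<lambda>i. fst (code (\<lambda>j. \<omega> (i + j)))" "\<lambda>i. fst (\<omega> i)" using \<omega> by (rule digit_orbit_code)
    have dg: "fst (itin y i) = fst (\<omega> i)" if "fst ((T ^^ i) y) = fst (code (\<lambda>j. \<omega> (i + j)))" for i
    proof (rule ccontr)
      assume ne: "fst (itin y i) \<noteq> fst (\<omega> i)"
      then have "fst (code (\<lambda>j. \<omega> (Suc i + j))) = 0 \<or> fst (code (\<lambda>j. \<omega> (Suc i + j))) = 1"
        using digit_branch[of "fst (\<omega> i)" "fst (code (\<lambda>j. \<omega> (Suc i + j)))" "fst (itin y i)" "fst ((T ^^ Suc i) y)"]
          A.step[of i] B.step[of i] A.x[of "Suc i"] B.x[of "Suc i"] that by simp
      then obtain c where "\<And>j. j > i \<Longrightarrow> fst (\<omega> j) = c"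
        using B.eq_0_digits[of "Suc i"] B.eq_1_digits[of "Suc i"] by (metis Suc_le_eq)
      then have "fst q = c" if "q \<in> Q" for q using all[of i fst c q] that by blast
      then show False using ne itin_in_Q[OF y] \<omega> by metis
    qed
    show "fst ((T ^^ i) y) = fst (code (\<lambda>j. \<omega> (i + j)))"
    proof (induction i)
      case 0 then show ?case by (simp add: y_def)
    next
      case (Suc i)
      then show ?case using dg[OF Suc] A.step[of i] B.step[of i] by simp
    qed
    then show "fst (itin y i) = fst (\<omega> i)" by (rule dg)
  qed
  have Y: "snd ((T ^^ i) y) = snd (code (\<lambda>j. \<omega> (i + j)))" and Y': "snd (itin y i) = snd (\<omega> i)" for i
  proof -
    interpret A: digit_orbit M "\<lambda>i. snd ((T ^^ i) y)" "\<lambda>i. snd (itin y i)" using y by (rule digit_orbit_itin)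
    interpret B: digit_orbit M "\<lambda>i. snd (code (\<lambda>j. \<omega> (i + j)))" "\<lambda>i. snd (\<omega> i)" using \<omega> by (rule digit_orbit_code)
    have dg: "snd (itin y i) = snd (\<omega> i)" if "snd ((T ^^ i) y) = snd (code (\<lambda>j. \<omega> (i + j)))" for i
    proof (rule ccontr)
      assume ne: "snd (itin y i) \<noteq> snd (\<omega> i)"
      then have "snd (code (\<lambda>j. \<omega> (Suc i + j))) = 0 \<or> snd (code (\<lambda>j. \<omega> (Suc i + j))) = 1"
        using digit_branch[of "snd (\<omega> i)" "snd (code (\<lambda>j. \<omega> (Suc i + j)))" "snd (itin y i)" "snd ((T ^^ Suc i) y)"]
          A.step[of i] B.step[of i] A.x[of "Suc i"] B.x[of "Suc i"] that by simp
      then obtain c where "\<And>j. j > i \<Longrightarrow> snd (\<omega> j) = c"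
        using B.eq_0_digits[of "Suc i"] B.eq_1_digits[of "Suc i"] by (metis Suc_le_eq)
      then have "snd q = c" if "q \<in> Q" for q using all[of i snd c q] that by blast
      then show False using ne itin_in_Q[OF y] \<omega> by metis
    qed
    show "snd ((T ^^ i) y) = snd (code (\<lambda>j. \<omega> (i + j)))"
    proof (induction i)
      case 0 then show ?case by (simp add: y_def)
    next
      case (Suc i)
      then show ?case using dg[OF Suc] A.step[of i] B.step[of i] by simp
    qed
    then show "snd (itin y i) = snd (\<omega> i)" by (rule dg)
  qed
  show ?thesis using X' Y' by (intro prod_eqI) (auto simp: y_def)
qed

end

section \<open>Minimax duality for the dimension functions\<close>

text \<open>By concavity the set \<open>C\<close> of all vectors dominated by some value of
  \<open>g\<close> is convex, and it misses the open orthant \<open>W\<close> above the point with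
  all coordinates \<open>d\<close>. A normal vector of a separating hyperplane, normalised, gives
  the weights.\<close>

lemma concave_minimax:
  fixes g :: "'a \<Rightarrow> 'v::euclidean_space"
  assumes ne: "X \<noteq> {}"
    and concave: "\<And>x y t. \<lbrakk>x \<in> X; y \<in> X; 0 \<le> t; t \<le> 1\<rbrakk> \<Longrightarrow>
      \<exists>z\<in>X. \<forall>b\<in>Basis. (1 - t) * (g x \<bullet> b) + t * (g y \<bullet> b) \<le> g z \<bullet> b"
    and le: "\<And>x. x \<in> X \<Longrightarrow> \<exists>b\<in>Basis. g x \<bullet> b \<le> d"
  obtains l :: 'v where "\<And>b. b \<in> Basis \<Longrightarrow> 0 \<le> l \<bullet> b" "l \<bullet> One = 1" "\<And>x. x \<in> X \<Longrightarrow> l \<bullet> g x \<le> d"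
proof -
  define C where "C = {v. \<exists>x\<in>X. \<forall>b\<in>Basis. v \<bullet> b \<le> g x \<bullet> b}"
  define W where "W = {v::'v. \<forall>b\<in>Basis. d < v \<bullet> b}"
  have "convex C"
  proof (rule convexI)
    fix v w :: 'v and u t :: real
    assume vw: "v \<in> C" "w \<in> C" and ut: "0 \<le> u" "0 \<le> t" "u + t = 1"
    obtain x y where x: "x \<in> X" "\<And>b. b \<in> Basis \<Longrightarrow> v \<bullet> b \<le> g x \<bullet> b"
      and y: "y \<in> X" "\<And>b. b \<in> Basis \<Longrightarrow> w \<bullet> b \<le> g y \<bullet> b" using vw by (auto simp: C_def)
    obtain z where z: "z \<in> X" "\<And>b. b \<in> Basis \<Longrightarrow> (1 - t) * (g x \<bullet> b) + t * (g y \<bullet> b) \<le> g z \<bullet> b"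
      using concave[of x y t] x(1) y(1) ut by auto
    have "(u *\<^sub>R v + t *\<^sub>R w) \<bullet> b \<le> g z \<bullet> b" if b: "b \<in> Basis" for b
    proof -
      have "u * (v \<bullet> b) + t * (w \<bullet> b) \<le> u * (g x \<bullet> b) + t * (g y \<bullet> b)"
        using ut x(2)[OF b] y(2)[OF b] by (intro add_mono mult_left_mono) auto
      moreover have "u = 1 - t" using ut by simp
      ultimately show ?thesis using z(2)[OF b] by (simp add: inner_add_left)
    qed
    then show "u *\<^sub>R v + t *\<^sub>R w \<in> C" using z(1) by (auto simp: C_def)
  qed
  moreover have "convex W"
  proof (rule convexI)
    fix v w :: 'v and u t :: real
    assume vw: "v \<in> W" "w \<in> W" and ut: "0 \<le> u" "0 \<le> t" "u + t = 1"
    have "d < u * (v \<bullet> b) + t * (w \<bullet> b)" if b: "b \<in> Basis" for b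
    proof -
      have "u * d + t * d < u * (v \<bullet> b) + t * (w \<bullet> b)"
      proof (cases "u = 0")
        case True then show ?thesis using ut vw b by (auto simp: W_def)
      next
        case False
        then show ?thesis using ut vw b by (intro add_less_le_mono mult_strict_left_mono mult_left_mono) (auto simp: W_def less_imp_le)
      qed
      then show ?thesis using ut by (metis distrib_right mult_1)
    qed
    then show "u *\<^sub>R v + t *\<^sub>R w \<in> W" by (auto simp: W_def inner_add_left)
  qed
  moreover have "C \<noteq> {}" using ne by (auto simp: C_def)
  moreover have One_W: "(d + e) *\<^sub>R One \<in> W" if "e > 0" for e using that by (simp add: W_def)
  then have "W \<noteq> {}" using zero_less_one by blast
  moreover have "C \<inter> W = {}"
  proof -
    have False if x: "x \<in> X" "\<forall>b\<in>Basis. v \<bullet> b \<le> g x \<bullet> b" "\<forall>b\<in>Basis. d < v \<bullet> b" for v x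
      using le[OF x(1)] x(2,3) by force
    then show ?thesis by (auto simp: C_def W_def)
  qed
  ultimately obtain a c where a: "a \<noteq> 0" "\<forall>x\<in>C. a \<bullet> x \<le> c" "\<forall>x\<in>W. a \<bullet> x \<ge> c"
    using separating_hyperplane_sets[of C W] by blast
  have a_nonneg: "0 \<le> a \<bullet> b" if b: "b \<in> Basis" for b
  proof (rule ccontr)
    assume "\<not> 0 \<le> a \<bullet> b"
    then have neg: "a \<bullet> b < 0" by simp
    obtain x where x: "x \<in> X" using ne by blast
    \<comment> \<open>The set \<open>C\<close> is closed under lowering coordinates. With this
      \<open>t\<close>, lowering coordinate \<open>b\<close> would raise the inner product with
      \<open>a\<close> above \<open>c\<close>.\<close>
    define t where "t = (\<bar>c - a \<bullet> g x\<bar> + 1) / - (a \<bullet> b)"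
    have t: "t \<ge> 0" unfolding t_def using neg by (intro divide_nonneg_pos) auto
    have "g x - t *\<^sub>R b \<in> C"
      using x t b by (auto simp: C_def inner_diff_left inner_Basis intro!: bexI[of _ x])
    then have "a \<bullet> g x - t * (a \<bullet> b) \<le> c" using a(2) by (auto simp: inner_diff_right)
    moreover have "t * (a \<bullet> b) = - (\<bar>c - a \<bullet> g x\<bar> + 1)" using neg by (simp add: t_def)
    ultimately show False by linarith
  qed
  have sum: "a \<bullet> One = (\<Sum>b\<in>Basis. a \<bullet> b)" by (simp add: inner_sum_right)
  have pos: "0 < a \<bullet> One"
  proof -
    obtain b where "b \<in> Basis" "a \<bullet> b \<noteq> 0" using a(1) euclidean_all_zero_iff by metis
    then have "0 < (\<Sum>b\<in>Basis. a \<bullet> b)" using a_nonneg by (intro sum_pos2[of _ b]) (auto simp: order_less_le)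
    then show ?thesis using sum by simp
  qed
  define l where "l = a /\<^sub>R (a \<bullet> One)"
  show ?thesis
  proof (rule that[of l])
    show "0 \<le> l \<bullet> b" if "b \<in> Basis" for b using a_nonneg[OF that] pos by (simp add: l_def)
    show "l \<bullet> One = 1" using pos by (simp add: l_def)
    fix x assume x: "x \<in> X"
    have "a \<bullet> g x \<le> d * (a \<bullet> One) + e" if "e > 0" for e
    proof -
      have "g x \<in> C" using x by (auto simp: C_def)
      then have "a \<bullet> g x \<le> c" using a(2) by blast
      also have "c \<le> a \<bullet> ((d + e / (a \<bullet> One)) *\<^sub>R One)" using a(3) One_W[of "e / (a \<bullet> One)"] that pos by auto
      also have "\<dots> = d * (a \<bullet> One) + e" using pos by (simp add: distrib_right)
      finally show ?thesis .
    qed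
    then have "a \<bullet> g x \<le> d * (a \<bullet> One)" by (rule field_le_epsilon)
    then show "l \<bullet> g x \<le> d" using pos by (simp add: l_def field_simps)
  qed
qed

text \<open>The Euclidean space is the sixfold product of the reals; its basis vectors pick out the
  six functions.\<close>

lemma concave_minimax6:
  fixes g1 g2 g3 g4 g5 g6 :: "'a \<Rightarrow> real"
  assumes ne: "X \<noteq> {}"
    and concave: "\<And>x y t. \<lbrakk>x \<in> X; y \<in> X; 0 \<le> t; t \<le> 1\<rbrakk> \<Longrightarrow>
      \<exists>z\<in>X. \<forall>g\<in>{g1, g2, g3, g4, g5, g6}. (1 - t) * g x + t * g y \<le> g z"
    and le: "\<And>x. x \<in> X \<Longrightarrow> \<exists>g\<in>{g1, g2, g3, g4, g5, g6}. g x \<le> d"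
  obtains l1 l2 l3 l4 l5 l6 where "0 \<le> l1" "0 \<le> l2" "0 \<le> l3" "0 \<le> l4" "0 \<le> l5" "0 \<le> l6"
    "l1 + l2 + l3 + l4 + l5 + l6 = 1"
    "\<And>x. x \<in> X \<Longrightarrow> l1 * g1 x + l2 * g2 x + l3 * g3 x + l4 * g4 x + l5 * g5 x + l6 * g6 x \<le> d"
proof -
  define g where "g x = (g1 x, g2 x, g3 x, g4 x, g5 x, g6 x)" for x
  have B: "(\<forall>b\<in>Basis. R (g x \<bullet> b) (g y \<bullet> b) (g z \<bullet> b)) \<longleftrightarrow> (\<forall>h\<in>{g1, g2, g3, g4, g5, g6}. R (h x) (h y) (h z))"
    for x y z R by (simp add: g_def Basis_prod_def ball_Un inner_Pair_0) blast
  have E: "(\<exists>b\<in>Basis. g x \<bullet> b \<le> d) \<longleftrightarrow> (\<exists>h\<in>{g1, g2, g3, g4, g5, g6}. h x \<le> d)" for x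
    by (simp add: g_def Basis_prod_def bex_Un inner_Pair_0) blast
  obtain l where l: "\<And>b. b \<in> Basis \<Longrightarrow> 0 \<le> l \<bullet> b" "l \<bullet> One = 1" "\<And>x. x \<in> X \<Longrightarrow> l \<bullet> g x \<le> d"
  proof (rule concave_minimax[of X g d])
    show "X \<noteq> {}" by fact
    show "\<exists>z\<in>X. \<forall>b\<in>Basis. (1 - t) * (g x \<bullet> b) + t * (g y \<bullet> b) \<le> g z \<bullet> b"
      if "x \<in> X" "y \<in> X" "0 \<le> t" "t \<le> 1" for x y t
      unfolding B[of "\<lambda>u v w. (1 - t) * u + t * v \<le> w"] using that by (rule concave)
    show "\<exists>b\<in>Basis. g x \<bullet> b \<le> d" if "x \<in> X" for x unfolding E using that by (rule le)
  qed blast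
  obtain l1 l2 l3 l4 l5 l6 where l_eq: "l = (l1, l2, l3, l4, l5, l6)" by (metis surj_pair)
  have "\<forall>b\<in>Basis. 0 \<le> l \<bullet> b" using l(1) by blast
  then have "0 \<le> l1" "0 \<le> l2" "0 \<le> l3" "0 \<le> l4" "0 \<le> l5" "0 \<le> l6"
    by (simp_all add: l_eq Basis_prod_def ball_Un inner_Pair_0)
  moreover have "l \<bullet> One = l1 + l2 + l3 + l4 + l5 + l6"
    by (simp add: l_eq inner_sum_right Basis_prod_def sum.union_disjoint inner_Pair_0 sum.reindex inj_on_def)
  moreover have "l \<bullet> g x = l1 * g1 x + l2 * g2 x + l3 * g3 x + l4 * g4 x + l5 * g5 x + l6 * g6 x" for x
    by (simp add: l_eq g_def)
  ultimately show ?thesis using that l(2,3) by metis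
qed

section \<open>The six functionals, their maximum and the dual weights\<close>

context bedford_mcmullen
begin

definition prefix_m :: "real \<Rightarrow> real" where
  "prefix_m \<alpha> = min 1 ((1 + \<alpha>) / \<tau>)"

lemma prefix_m: assumes "0 < \<alpha>"
  shows "0 < prefix_m \<alpha>" "prefix_m \<alpha> \<le> 1" "prefix_m \<alpha> \<le> (1 + \<alpha>) / \<tau>" "1 / \<tau> \<le> prefix_m \<alpha>"
    "prefix_m \<alpha> = 1 \<or> prefix_m \<alpha> = (1 + \<alpha>) / \<tau>"
  using assms tau_gt_1 by (auto simp: prefix_m_def min_def divide_right_mono)

text \<open>The functionals \<open>d\<^sub>1, \<dots>, d\<^sub>6\<close> multiplied by \<open>ln N\<close>, written with \<open>h\<^sub>r\<close> and \<open>h - h\<^sub>r\<close>.\<close>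

definition e1 :: "(nat \<times> nat \<Rightarrow> real) \<Rightarrow> real" where
  "e1 p = h\<^sub>r p + hc p / \<tau>"
definition u2 :: "real \<Rightarrow> (nat \<times> nat \<Rightarrow> real) \<Rightarrow> (nat \<times> nat \<Rightarrow> real) \<Rightarrow> real" where
  "u2 \<alpha> pm p1 = prefix_m \<alpha> * (h\<^sub>r pm + hc pm) + (1 - prefix_m \<alpha>) * h\<^sub>r p1"
definition u3 :: "real \<Rightarrow> (nat \<times> nat \<Rightarrow> real) \<Rightarrow> (nat \<times> nat \<Rightarrow> real) \<Rightarrow> (nat \<times> nat \<Rightarrow> real) \<Rightarrow> real" where
  "u3 \<alpha> pm p1 p2 = u2 \<alpha> pm p1 + (1 - prefix_m \<alpha>) * hc p1 + (\<tau> - 1) * h\<^sub>r p2"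
definition u4 :: "real \<Rightarrow> (nat \<times> nat \<Rightarrow> real) \<Rightarrow> (nat \<times> nat \<Rightarrow> real) \<Rightarrow> (nat \<times> nat \<Rightarrow> real)
    \<Rightarrow> (nat \<times> nat \<Rightarrow> real) \<Rightarrow> real" where
  "u4 \<alpha> pm p1 p2 pp = u3 \<alpha> pm p1 p2 + \<alpha> * (\<tau> - 1) * h\<^sub>r pp"
definition u5 :: "real \<Rightarrow> (nat \<times> nat \<Rightarrow> real) \<Rightarrow> (nat \<times> nat \<Rightarrow> real) \<Rightarrow> (nat \<times> nat \<Rightarrow> real)
    \<Rightarrow> (nat \<times> nat \<Rightarrow> real) \<Rightarrow> real" where
  "u5 \<alpha> pm p1 p2 pp = u3 \<alpha> pm p1 p2 + (\<tau> - 1) * hc p2 + (\<tau> + \<alpha>) * (\<tau> - 1) * h\<^sub>r pp"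

lemma D_eq:
  "D \<alpha> pm p1 p2 pp 0 = Min {e1 pm / ln (real N), u2 \<alpha> pm p1 / (1 + \<alpha>) / ln (real N),
    u3 \<alpha> pm p1 p2 / (\<tau> + \<alpha>) / ln (real N), u4 \<alpha> pm p1 p2 pp / (\<tau> * (1 + \<alpha>)) / ln (real N),
    u5 \<alpha> pm p1 p2 pp / (\<tau> * (\<tau> + \<alpha>)) / ln (real N), e1 pp / ln (real N)}"
proof -
  have "pdim p = e1 p / ln (real N)" for p
    using tau_gt_1 ln_N_pos by (simp add: pdim_def e1_def hc_def ln_M field_simps)
  moreover have n: "prefix_m \<alpha> * h pm + (1 - prefix_m \<alpha>) * h\<^sub>r p1 = u2 \<alpha> pm p1"
    "prefix_m \<alpha> * h pm + (1 - prefix_m \<alpha>) * h p1 + (\<tau> - 1) * h\<^sub>r p2 = u3 \<alpha> pm p1 p2"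
    "prefix_m \<alpha> * h pm + (1 - prefix_m \<alpha>) * h p1 + (\<tau> - 1) * h\<^sub>r p2 + \<alpha> * (\<tau> - 1) * h\<^sub>r pp = u4 \<alpha> pm p1 p2 pp"
    "prefix_m \<alpha> * h pm + (1 - prefix_m \<alpha>) * h p1 + (\<tau> - 1) * h p2 + (\<tau> + \<alpha>) * (\<tau> - 1) * h\<^sub>r pp = u5 \<alpha> pm p1 p2 pp"
    by (simp_all add: u2_def u3_def u4_def u5_def hc_def algebra_simps)
  ultimately show ?thesis
    unfolding D_def Let_def prefix_m_def[symmetric] mult_zero_right add_0_right n divide_divide_eq_left
    by (simp only:)
qed

lemma D_ge_iff:
  "x \<le> D \<alpha> pm p1 p2 pp 0 \<longleftrightarrow> x * ln (real N) \<le> e1 pm \<and> x * ln (real N) \<le> u2 \<alpha> pm p1 / (1 + \<alpha>) \<and>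
    x * ln (real N) \<le> u3 \<alpha> pm p1 p2 / (\<tau> + \<alpha>) \<and> x * ln (real N) \<le> u4 \<alpha> pm p1 p2 pp / (\<tau> * (1 + \<alpha>)) \<and>
    x * ln (real N) \<le> u5 \<alpha> pm p1 p2 pp / (\<tau> * (\<tau> + \<alpha>)) \<and> x * ln (real N) \<le> e1 pp"
  unfolding D_eq
  by (subst Min_ge_iff) (simp_all del: divide_divide_eq_left add: pos_le_divide_eq[OF ln_N_pos])

lemma D_le_iff:
  "D \<alpha> pm p1 p2 pp 0 \<le> x \<longleftrightarrow> e1 pm \<le> x * ln (real N) \<or> u2 \<alpha> pm p1 / (1 + \<alpha>) \<le> x * ln (real N) \<or>
    u3 \<alpha> pm p1 p2 / (\<tau> + \<alpha>) \<le> x * ln (real N) \<or> u4 \<alpha> pm p1 p2 pp / (\<tau> * (1 + \<alpha>)) \<le> x * ln (real N) \<or>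
    u5 \<alpha> pm p1 p2 pp / (\<tau> * (\<tau> + \<alpha>)) \<le> x * ln (real N) \<or> e1 pp \<le> x * ln (real N)"
  unfolding D_eq
  by (subst Min_le_iff) (simp_all del: divide_divide_eq_left add: pos_divide_le_eq[OF ln_N_pos])

lemma D_min:
  "D \<alpha> pm p1 p2 pp 0 = min (e1 pm / ln (real N)) (min (u2 \<alpha> pm p1 / (1 + \<alpha>) / ln (real N))
    (min (u3 \<alpha> pm p1 p2 / (\<tau> + \<alpha>) / ln (real N)) (min (u4 \<alpha> pm p1 p2 pp / (\<tau> * (1 + \<alpha>)) / ln (real N))
    (min (u5 \<alpha> pm p1 p2 pp / (\<tau> * (\<tau> + \<alpha>)) / ln (real N)) (e1 pp / ln (real N))))))"
  unfolding D_eq by (simp del: divide_divide_eq_left)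

lemma D_nonneg:
  assumes "0 < \<alpha>" "pm \<in> \<Upsilon>" "p1 \<in> \<Upsilon>" "p2 \<in> \<Upsilon>" "pp \<in> \<Upsilon>"
  shows "0 \<le> D \<alpha> pm p1 p2 pp 0"
  unfolding D_ge_iff u5_def u4_def u3_def u2_def e1_def
  using assms tau_gt_1 h_r_nonneg hc_nonneg prefix_m[OF assms(1)]
  by (simp add: add_nonneg_nonneg divide_nonneg_nonneg)

lemma D_max_exists:
  obtains pm p1 p2 pp where "pm \<in> \<Upsilon>" "p1 \<in> \<Upsilon>" "p2 \<in> \<Upsilon>" "pp \<in> \<Upsilon>"
    "\<And>qm q1 q2 qp. \<lbrakk>qm \<in> \<Upsilon>; q1 \<in> \<Upsilon>; q2 \<in> \<Upsilon>; qp \<in> \<Upsilon>\<rbrakk> \<Longrightarrow> D \<alpha> qm q1 q2 qp 0 \<le> D \<alpha> pm p1 p2 pp 0"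
proof -
  define X where "X = \<Upsilon> \<times> \<Upsilon> \<times> \<Upsilon> \<times> \<Upsilon>"
  have hr: "continuous_on X (\<lambda>x. h\<^sub>r (g x))" and hc: "continuous_on X (\<lambda>x. hc (g x))"
    if "continuous_on X g" "g ` X \<subseteq> \<Upsilon>" for g
    using that unfolding hc_def
    by (auto intro!: continuous_on_diff continuous_on_compose2[OF continuous_on_h] continuous_on_compose2[OF continuous_on_h_r])
  have c: "continuous_on X fst" "continuous_on X (\<lambda>x. fst (snd x))" "continuous_on X (\<lambda>x. fst (snd (snd x)))"
    "continuous_on X (\<lambda>x. snd (snd (snd x)))" by (intro continuous_intros)+
  have i: "fst ` X \<subseteq> \<Upsilon>" "(\<lambda>x. fst (snd x)) ` X \<subseteq> \<Upsilon>" "(\<lambda>x. fst (snd (snd x))) ` X \<subseteq> \<Upsilon>"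
    "(\<lambda>x. snd (snd (snd x))) ` X \<subseteq> \<Upsilon>" by (auto simp: X_def)
  note cs = hr[OF c(1) i(1)] hr[OF c(2) i(2)] hr[OF c(3) i(3)] hr[OF c(4) i(4)]
    hc[OF c(1) i(1)] hc[OF c(2) i(2)] hc[OF c(3) i(3)] hc[OF c(4) i(4)]
  have e: "continuous_on X (\<lambda>x. e1 (fst x))" "continuous_on X (\<lambda>x. e1 (snd (snd (snd x))))"
    unfolding e1_def using tau_gt_1
    by (auto intro!: continuous_on_add continuous_on_divide continuous_on_const cs)
  have u2: "continuous_on X (\<lambda>x. u2 \<alpha> (fst x) (fst (snd x)))"
    unfolding u2_def by (intro continuous_on_add continuous_on_mult continuous_on_const cs)
  have u3: "continuous_on X (\<lambda>x. u3 \<alpha> (fst x) (fst (snd x)) (fst (snd (snd x))))"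
    unfolding u3_def by (intro continuous_on_add continuous_on_mult continuous_on_const cs u2)
  have u4: "continuous_on X (\<lambda>x. u4 \<alpha> (fst x) (fst (snd x)) (fst (snd (snd x))) (snd (snd (snd x))))"
    unfolding u4_def by (intro continuous_on_add continuous_on_mult continuous_on_const cs u3)
  have u5: "continuous_on X (\<lambda>x. u5 \<alpha> (fst x) (fst (snd x)) (fst (snd (snd x))) (snd (snd (snd x))))"
    unfolding u5_def by (intro continuous_on_add continuous_on_mult continuous_on_const cs u3)
  have dv: "continuous_on X (\<lambda>x. g x / c)" if "continuous_on X g" for g and c :: real
    using continuous_on_mult[OF that continuous_on_const[of X "inverse c"]] by (simp add: divide_inverse)
  have "continuous_on X (\<lambda>x. D \<alpha> (fst x) (fst (snd x)) (fst (snd (snd x))) (snd (snd (snd x))) 0)"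
    unfolding D_min by (intro continuous_on_min dv e u2 u3 u4 u5)
  moreover have "compact X" unfolding X_def by (intro compact_Times compact_Upsilon)
  moreover have "X \<noteq> {}" using Upsilon_nonempty by (auto simp: X_def)
  ultimately obtain x where x: "x \<in> X"
    "\<forall>y\<in>X. D \<alpha> (fst y) (fst (snd y)) (fst (snd (snd y))) (snd (snd (snd y))) 0 \<le>
      D \<alpha> (fst x) (fst (snd x)) (fst (snd (snd x))) (snd (snd (snd x))) 0"
    using continuous_attains_sup by blast
  show ?thesis
  proof (rule that[of "fst x" "fst (snd x)" "fst (snd (snd x))" "snd (snd (snd x))"])
    fix qm q1 q2 qp assume "qm \<in> \<Upsilon>" "q1 \<in> \<Upsilon>" "q2 \<in> \<Upsilon>" "qp \<in> \<Upsilon>"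
    then have "(qm, q1, q2, qp) \<in> X" by (simp add: X_def)
    from x(2)[rule_format, OF this]
    show "D \<alpha> qm q1 q2 qp 0 \<le> D \<alpha> (fst x) (fst (snd x)) (fst (snd (snd x))) (snd (snd (snd x))) 0" by simp
  qed (use i x(1) in auto)
qed

text \<open>Each functional is a nonnegative combination of \<open>h\<close> and
  \<open>h\<^sub>r\<close> and hence concave. Its expression by \<open>hc\<close> hides this, so the
  concavity proofs first restore the sums \<open>h\<^sub>r p + hc p\<close>.\<close>

lemma dual_weights:
  assumes \<alpha>: "0 < \<alpha>"
    and max: "\<And>qm q1 q2 qp. \<lbrakk>qm \<in> \<Upsilon>; q1 \<in> \<Upsilon>; q2 \<in> \<Upsilon>; qp \<in> \<Upsilon>\<rbrakk> \<Longrightarrow> D \<alpha> qm q1 q2 qp 0 \<le> d"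
  obtains l1 k2 k3 k4 k5 l6 where "0 \<le> l1" "0 \<le> k2" "0 \<le> k3" "0 \<le> k4" "0 \<le> k5" "0 \<le> l6"
    "l1 + k2 * (1 + \<alpha>) + k3 * (\<tau> + \<alpha>) + k4 * (\<tau> * (1 + \<alpha>)) + k5 * (\<tau> * (\<tau> + \<alpha>)) + l6 = 1"
    "\<And>qm q1 q2 qp. \<lbrakk>qm \<in> \<Upsilon>; q1 \<in> \<Upsilon>; q2 \<in> \<Upsilon>; qp \<in> \<Upsilon>\<rbrakk> \<Longrightarrow>
      l1 * e1 qm + k2 * u2 \<alpha> qm q1 + k3 * u3 \<alpha> qm q1 q2 + k4 * u4 \<alpha> qm q1 q2 qp
      + k5 * u5 \<alpha> qm q1 q2 qp + l6 * e1 qp \<le> d * ln (real N)"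
proof -
  define X where "X = \<Upsilon> \<times> \<Upsilon> \<times> \<Upsilon> \<times> \<Upsilon>"
  define g1 g2 g3 g4 g5 g6 where
    "g1 = (\<lambda>(qm :: nat \<times> nat \<Rightarrow> real, q1 :: nat \<times> nat \<Rightarrow> real, q2 :: nat \<times> nat \<Rightarrow> real, qp :: nat \<times> nat \<Rightarrow> real). e1 qm)" and
    "g2 = (\<lambda>(qm, q1, q2 :: nat \<times> nat \<Rightarrow> real, qp :: nat \<times> nat \<Rightarrow> real). u2 \<alpha> qm q1 / (1 + \<alpha>))" and
    "g3 = (\<lambda>(qm, q1, q2, qp :: nat \<times> nat \<Rightarrow> real). u3 \<alpha> qm q1 q2 / (\<tau> + \<alpha>))" and
    "g4 = (\<lambda>(qm, q1, q2, qp). u4 \<alpha> qm q1 q2 qp / (\<tau> * (1 + \<alpha>)))" and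
    "g5 = (\<lambda>(qm, q1, q2, qp). u5 \<alpha> qm q1 q2 qp / (\<tau> * (\<tau> + \<alpha>)))" and
    "g6 = (\<lambda>(qm :: nat \<times> nat \<Rightarrow> real, q1 :: nat \<times> nat \<Rightarrow> real, q2 :: nat \<times> nat \<Rightarrow> real, qp). e1 qp)"
  note g = g1_def g2_def g3_def g4_def g5_def g6_def
  note pos = tau_gt_1 \<alpha> prefix_m[OF \<alpha>]
  obtain l1 l2 l3 l4 l5 l6 where l: "0 \<le> l1" "0 \<le> l2" "0 \<le> l3" "0 \<le> l4" "0 \<le> l5" "0 \<le> l6"
    "l1 + l2 + l3 + l4 + l5 + l6 = 1"
    "\<And>x. x \<in> X \<Longrightarrow> l1 * g1 x + l2 * g2 x + l3 * g3 x + l4 * g4 x + l5 * g5 x + l6 * g6 x \<le> d * ln (real N)"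
  proof (rule concave_minimax6[of X g1 g2 g3 g4 g5 g6 "d * ln (real N)"])
    show "X \<noteq> {}" using Upsilon_nonempty by (auto simp: X_def)
    show "\<exists>g\<in>{g1, g2, g3, g4, g5, g6}. g x \<le> d * ln (real N)" if "x \<in> X" for x
    proof -
      obtain qm q1 q2 qp where x: "x = (qm, q1, q2, qp)" by (metis surj_pair)
      then have "D \<alpha> qm q1 q2 qp 0 \<le> d" using max that by (simp add: X_def)
      then show ?thesis unfolding D_le_iff x by (simp add: g)
    qed
    show "\<exists>z\<in>X. \<forall>g\<in>{g1, g2, g3, g4, g5, g6}. (1 - t) * g x + t * g y \<le> g z"
      if xy: "x \<in> X" "y \<in> X" and t: "0 \<le> t" "t \<le> 1" for x y t
    proof -
      obtain qm q1 q2 qp where x: "x = (qm, q1, q2, qp)" by (metis surj_pair)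
      obtain rm r1 r2 rp where y: "y = (rm, r1, r2, rp)" by (metis surj_pair)
      have in\<Upsilon>: "qm \<in> \<Upsilon>" "q1 \<in> \<Upsilon>" "q2 \<in> \<Upsilon>" "qp \<in> \<Upsilon>" "rm \<in> \<Upsilon>" "r1 \<in> \<Upsilon>" "r2 \<in> \<Upsilon>" "rp \<in> \<Upsilon>"
        using xy by (auto simp: X_def x y)
      define z where "z = (mix t qm rm, mix t q1 r1, mix t q2 r2, mix t qp rp)"
      have "z \<in> X" using in\<Upsilon> t by (simp add: X_def z_def mix_Upsilon)
      have R: "(1 - t) * h\<^sub>r q + t * h\<^sub>r r \<le> h\<^sub>r (mix t q r)" if "q \<in> \<Upsilon>" "r \<in> \<Upsilon>" for q r
        using h_r_mix_ge[OF that t] .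
      have H: "(1 - t) * (h\<^sub>r q + hc q) + t * (h\<^sub>r r + hc r) \<le> h\<^sub>r (mix t q r) + hc (mix t q r)" if "q \<in> \<Upsilon>" "r \<in> \<Upsilon>" for q r
        using h_mix_ge[OF that t] by (simp add: hc_def)
      have E1: "(1 - t) * e1 q + t * e1 r \<le> e1 (mix t q r)" if "q \<in> \<Upsilon>" "r \<in> \<Upsilon>" for q r
      proof -
        define c where "c = 1 / \<tau>"
        have c: "0 \<le> c" "c \<le> 1" using pos by (auto simp: c_def)
        have e: "e1 p = (1 - c) * h\<^sub>r p + c * (h\<^sub>r p + hc p)" for p
          by (simp add: e1_def c_def algebra_simps)
        have "(1 - c) * ((1 - t) * h\<^sub>r q + t * h\<^sub>r r) + c * ((1 - t) * (h\<^sub>r q + hc q) + t * (h\<^sub>r r + hc r))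
          \<le> (1 - c) * h\<^sub>r (mix t q r) + c * (h\<^sub>r (mix t q r) + hc (mix t q r))"
          by (rule add_mono[OF mult_left_mono[OF R[OF that]] mult_left_mono[OF H[OF that]]]) (use c in auto)
        then show ?thesis unfolding e by (simp add: algebra_simps)
      qed
      have U2: "(1 - t) * u2 \<alpha> qm q1 + t * u2 \<alpha> rm r1 \<le> u2 \<alpha> (mix t qm rm) (mix t q1 r1)"
      proof -
        have "prefix_m \<alpha> * ((1 - t) * (h\<^sub>r qm + hc qm) + t * (h\<^sub>r rm + hc rm)) + (1 - prefix_m \<alpha>) * ((1 - t) * h\<^sub>r q1 + t * h\<^sub>r r1)
          \<le> u2 \<alpha> (mix t qm rm) (mix t q1 r1)"
          unfolding u2_def by (rule add_mono[OF mult_left_mono[OF H[OF in\<Upsilon>(1) in\<Upsilon>(5)]] mult_left_mono[OF R[OF in\<Upsilon>(2) in\<Upsilon>(6)]]]) (use pos in auto)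
        then show ?thesis unfolding u2_def by (simp add: algebra_simps)
      qed
      have U3: "(1 - t) * u3 \<alpha> qm q1 q2 + t * u3 \<alpha> rm r1 r2 \<le> u3 \<alpha> (mix t qm rm) (mix t q1 r1) (mix t q2 r2)"
      proof -
        have e: "u3 \<alpha> pm p1 p2 = prefix_m \<alpha> * (h\<^sub>r pm + hc pm) + (1 - prefix_m \<alpha>) * (h\<^sub>r p1 + hc p1) + (\<tau> - 1) * h\<^sub>r p2" for pm p1 p2
          by (simp add: u3_def u2_def algebra_simps)
        have "prefix_m \<alpha> * ((1 - t) * (h\<^sub>r qm + hc qm) + t * (h\<^sub>r rm + hc rm))
          + (1 - prefix_m \<alpha>) * ((1 - t) * (h\<^sub>r q1 + hc q1) + t * (h\<^sub>r r1 + hc r1))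
          + (\<tau> - 1) * ((1 - t) * h\<^sub>r q2 + t * h\<^sub>r r2)
          \<le> u3 \<alpha> (mix t qm rm) (mix t q1 r1) (mix t q2 r2)"
          unfolding e by (rule add_mono[OF add_mono[OF mult_left_mono[OF H[OF in\<Upsilon>(1) in\<Upsilon>(5)]] mult_left_mono[OF H[OF in\<Upsilon>(2) in\<Upsilon>(6)]]]
              mult_left_mono[OF R[OF in\<Upsilon>(3) in\<Upsilon>(7)]]]) (use pos in auto)
        then show ?thesis unfolding e by (simp add: algebra_simps)
      qed
      have U4: "(1 - t) * u4 \<alpha> qm q1 q2 qp + t * u4 \<alpha> rm r1 r2 rp \<le> u4 \<alpha> (mix t qm rm) (mix t q1 r1) (mix t q2 r2) (mix t qp rp)"
      proof -
        have "((1 - t) * u3 \<alpha> qm q1 q2 + t * u3 \<alpha> rm r1 r2) + \<alpha> * (\<tau> - 1) * ((1 - t) * h\<^sub>r qp + t * h\<^sub>r rp)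
          \<le> u4 \<alpha> (mix t qm rm) (mix t q1 r1) (mix t q2 r2) (mix t qp rp)"
          unfolding u4_def by (rule add_mono[OF U3 mult_left_mono[OF R[OF in\<Upsilon>(4) in\<Upsilon>(8)]]]) (use pos in auto)
        then show ?thesis unfolding u4_def by (simp add: algebra_simps)
      qed
      have U5: "(1 - t) * u5 \<alpha> qm q1 q2 qp + t * u5 \<alpha> rm r1 r2 rp \<le> u5 \<alpha> (mix t qm rm) (mix t q1 r1) (mix t q2 r2) (mix t qp rp)"
      proof -
        have e: "u5 \<alpha> pm p1 p2 pp = prefix_m \<alpha> * (h\<^sub>r pm + hc pm) + (1 - prefix_m \<alpha>) * (h\<^sub>r p1 + hc p1)
          + (\<tau> - 1) * (h\<^sub>r p2 + hc p2) + (\<tau> + \<alpha>) * (\<tau> - 1) * h\<^sub>r pp" for pm p1 p2 pp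
          by (simp add: u5_def u3_def u2_def algebra_simps)
        have "prefix_m \<alpha> * ((1 - t) * (h\<^sub>r qm + hc qm) + t * (h\<^sub>r rm + hc rm))
          + (1 - prefix_m \<alpha>) * ((1 - t) * (h\<^sub>r q1 + hc q1) + t * (h\<^sub>r r1 + hc r1))
          + (\<tau> - 1) * ((1 - t) * (h\<^sub>r q2 + hc q2) + t * (h\<^sub>r r2 + hc r2))
          + (\<tau> + \<alpha>) * (\<tau> - 1) * ((1 - t) * h\<^sub>r qp + t * h\<^sub>r rp)
          \<le> u5 \<alpha> (mix t qm rm) (mix t q1 r1) (mix t q2 r2) (mix t qp rp)"
          unfolding e by (rule add_mono[OF add_mono[OF add_mono[OF mult_left_mono[OF H[OF in\<Upsilon>(1) in\<Upsilon>(5)]] mult_left_mono[OF H[OF in\<Upsilon>(2) in\<Upsilon>(6)]]]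
              mult_left_mono[OF H[OF in\<Upsilon>(3) in\<Upsilon>(7)]]] mult_left_mono[OF R[OF in\<Upsilon>(4) in\<Upsilon>(8)]]]) (use pos in auto)
        then show ?thesis unfolding e by (simp add: algebra_simps)
      qed
      have dv: "(1 - t) * (a / c) + t * (b / c) \<le> e / c" if "(1 - t) * a + t * b \<le> e" "0 < c" for a b c e :: real
        using divide_right_mono[OF that(1), of c] that(2) by (simp add: add_divide_distrib)
      have "\<forall>g\<in>{g1, g2, g3, g4, g5, g6}. (1 - t) * g x + t * g y \<le> g z"
        using E1 in\<Upsilon> dv[OF U2] dv[OF U3] dv[OF U4] dv[OF U5] pos by (simp add: x y z_def g)
      then show ?thesis using \<open>z \<in> X\<close> by blast
    qed
  qed blast
  show ?thesis
  \<comment> \<open>The denominators of the functionals move into the weights, which explains the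
    factors in their normalisation.\<close>
  proof (rule that[of l1 "l2 / (1 + \<alpha>)" "l3 / (\<tau> + \<alpha>)" "l4 / (\<tau> * (1 + \<alpha>))" "l5 / (\<tau> * (\<tau> + \<alpha>))" l6])
    fix qm q1 q2 qp assume "qm \<in> \<Upsilon>" "q1 \<in> \<Upsilon>" "q2 \<in> \<Upsilon>" "qp \<in> \<Upsilon>"
    then have "(qm, q1, q2, qp) \<in> X" by (simp add: X_def)
    from l(8)[OF this]
    show "l1 * e1 qm + l2 / (1 + \<alpha>) * u2 \<alpha> qm q1 + l3 / (\<tau> + \<alpha>) * u3 \<alpha> qm q1 q2
      + l4 / (\<tau> * (1 + \<alpha>)) * u4 \<alpha> qm q1 q2 qp + l5 / (\<tau> * (\<tau> + \<alpha>)) * u5 \<alpha> qm q1 q2 qp + l6 * e1 qp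
      \<le> d * ln (real N)" by (simp add: g)
  qed (use l pos in auto)
qed

text \<open>Values of the entropies at an optimal quadruple, in the form in which they are used for the
  upper bound: \<open>\<kappa>m, \<kappa>1, \<kappa>2, \<kappa>p\<close> are the Gibbs exponents of the four optimal measures.\<close>

definition optimal_data :: "real \<Rightarrow> real \<Rightarrow> real \<Rightarrow> real \<Rightarrow> real \<Rightarrow> real \<Rightarrow> real \<Rightarrow> real \<Rightarrow> real \<Rightarrow> real \<Rightarrow>
    real \<Rightarrow> real \<Rightarrow> real \<Rightarrow> real \<Rightarrow> real \<Rightarrow> real \<Rightarrow> real \<Rightarrow> real \<Rightarrow> bool" where
  "optimal_data \<alpha> s0 k2 k3 k4 k5 \<phi>m \<psi>m \<phi>1 \<psi>1 \<phi>2 \<psi>2 \<phi>p \<psi>p \<kappa>m \<kappa>1 \<kappa>2 \<kappa>p \<longleftrightarrow>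
    0 \<le> k2 \<and> 0 \<le> k3 \<and> 0 \<le> k4 \<and> 0 \<le> k5 \<and> 0 < k2 + k3 + k4 + k5 \<and>
    (k2 + k3 + k4 + k5) * (prefix_m \<alpha> * (\<phi>m + \<psi>m))
      + (1 - prefix_m \<alpha>) * ((k2 + k3 + k4 + k5) * \<phi>1 + (k3 + k4 + k5) * \<psi>1)
      + (\<tau> - 1) * ((k3 + k4 + k5) * \<phi>2 + k5 * \<psi>2)
      + (k4 * (\<alpha> * (\<tau> - 1)) + k5 * ((\<tau> + \<alpha>) * (\<tau> - 1))) * \<phi>p
      = s0 * (k2 * (1 + \<alpha>) + k3 * (\<tau> + \<alpha>) + k4 * (\<tau> * (1 + \<alpha>)) + k5 * (\<tau> * (\<tau> + \<alpha>))) \<and>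
    0 \<le> \<psi>m \<and> 0 \<le> \<psi>p \<and>
    1 / \<tau> < \<kappa>m \<and> \<kappa>m \<le> 1 \<and> pressure \<kappa>m = \<phi>m + \<kappa>m * \<psi>m \<and> (\<kappa>m < 1 \<longrightarrow> s0 = \<phi>m + \<psi>m / \<tau>) \<and>
    0 \<le> \<kappa>1 \<and> \<kappa>1 \<le> 1 \<and> \<kappa>1 * (k2 + k3 + k4 + k5) = k3 + k4 + k5 \<and>
      (prefix_m \<alpha> = 1 \<or> pressure \<kappa>1 = \<phi>1 + \<kappa>1 * \<psi>1) \<and>
    0 \<le> \<kappa>2 \<and> \<kappa>2 \<le> 1 \<and> \<kappa>2 * (k3 + k4 + k5) = k5 \<and>
      (k3 + k4 + k5 = 0 \<or> pressure \<kappa>2 = \<phi>2 + \<kappa>2 * \<psi>2) \<and>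
    0 \<le> \<kappa>p \<and> \<kappa>p < 1 / \<tau> \<and> \<kappa>p * (k4 + k5) \<le> k5 \<and>
      (k4 + k5 = 0 \<or> pressure \<kappa>p = \<phi>p + \<kappa>p * \<psi>p) \<and> (0 < \<kappa>p \<longrightarrow> s0 = \<phi>p + \<psi>p / \<tau>)"

text \<open>Dividing the maximised functional by \<open>A\<close> shows that \<open>q\<close> is
  optimal in the variational principle for the exponent \<open>B / A\<close>.\<close>

lemma pressure_eqI:
  assumes q: "q \<in> \<Upsilon>" and A: "0 < A" and B: "0 \<le> B"
    and opt: "\<And>p. p \<in> \<Upsilon> \<Longrightarrow> A * h\<^sub>r p + B * hc p \<le> A * h\<^sub>r q + B * hc q"
  shows "pressure (B / A) = h\<^sub>r q + B / A * hc q"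
proof (rule antisym)
  obtain p where p: "p \<in> \<Upsilon>" "h\<^sub>r p + B / A * hc p = pressure (B / A)" using pressure_attained by blast
  have "A * (h\<^sub>r p + B / A * hc p) = A * h\<^sub>r p + B * hc p" "A * (h\<^sub>r q + B / A * hc q) = A * h\<^sub>r q + B * hc q"
    using A by (simp_all add: distrib_left)
  then have "A * (h\<^sub>r p + B / A * hc p) \<le> A * (h\<^sub>r q + B / A * hc q)" using opt[OF p(1)] by simp
  then show "pressure (B / A) \<le> h\<^sub>r q + B / A * hc q" using A p(2) by simp
  show "h\<^sub>r q + B / A * hc q \<le> pressure (B / A)" using q A B by (intro pressure_ge) auto
qed

text \<open>When three of the four optimal measures are kept fixed, the fourth maximises a
  combination of \<open>h\<^sub>r\<close> and \<open>hc\<close> and is therefore optimal for the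
  pressure at an exponent read off from the dual weights. The first alternative collects the cases
  in which the dual weights show that no measure has \<open>pdim\<close> above \<open>d\<close>;
  there the exponents cannot be separated strictly from \<open>1 / \<tau>\<close>.\<close>

lemma optimal_data_exists:
  assumes \<alpha>: "0 < \<alpha>"
    and in\<Upsilon>: "pm \<in> \<Upsilon>" "p1 \<in> \<Upsilon>" "p2 \<in> \<Upsilon>" "pp \<in> \<Upsilon>"
    and d: "D \<alpha> pm p1 p2 pp 0 = d"
    and max: "\<And>qm q1 q2 qp. \<lbrakk>qm \<in> \<Upsilon>; q1 \<in> \<Upsilon>; q2 \<in> \<Upsilon>; qp \<in> \<Upsilon>\<rbrakk> \<Longrightarrow> D \<alpha> qm q1 q2 qp 0 \<le> d"
  defines "s0 \<equiv> d * ln (real N)"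
  shows "(\<forall>p\<in>\<Upsilon>. h\<^sub>r p + hc p / \<tau> \<le> s0) \<or>
    (\<exists>k2 k3 k4 k5 \<phi>m \<psi>m \<phi>1 \<psi>1 \<phi>2 \<psi>2 \<phi>p \<psi>p \<kappa>m \<kappa>1 \<kappa>2 \<kappa>p.
      optimal_data \<alpha> s0 k2 k3 k4 k5 \<phi>m \<psi>m \<phi>1 \<psi>1 \<phi>2 \<psi>2 \<phi>p \<psi>p \<kappa>m \<kappa>1 \<kappa>2 \<kappa>p)"
proof -
  obtain l1 k2 k3 k4 k5 l6 where k: "0 \<le> l1" "0 \<le> k2" "0 \<le> k3" "0 \<le> k4" "0 \<le> k5" "0 \<le> l6"
    and k_sum: "l1 + k2 * (1 + \<alpha>) + k3 * (\<tau> + \<alpha>) + k4 * (\<tau> * (1 + \<alpha>)) + k5 * (\<tau> * (\<tau> + \<alpha>)) + l6 = 1"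
    and dual: "\<And>qm q1 q2 qp. \<lbrakk>qm \<in> \<Upsilon>; q1 \<in> \<Upsilon>; q2 \<in> \<Upsilon>; qp \<in> \<Upsilon>\<rbrakk> \<Longrightarrow>
      l1 * e1 qm + k2 * u2 \<alpha> qm q1 + k3 * u3 \<alpha> qm q1 q2 + k4 * u4 \<alpha> qm q1 q2 qp
      + k5 * u5 \<alpha> qm q1 q2 qp + l6 * e1 qp \<le> s0"
    by (rule dual_weights[OF \<alpha> max, folded s0_def]) blast+
  define m where "m = prefix_m \<alpha>"
  note pos = tau_gt_1 \<alpha> prefix_m[OF \<alpha>, folded m_def]
  have \<tau>0: "\<tau> > 0" using pos by simp
  have ge: "s0 \<le> e1 pm" "s0 * (1 + \<alpha>) \<le> u2 \<alpha> pm p1" "s0 * (\<tau> + \<alpha>) \<le> u3 \<alpha> pm p1 p2"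
    "s0 * (\<tau> * (1 + \<alpha>)) \<le> u4 \<alpha> pm p1 p2 pp" "s0 * (\<tau> * (\<tau> + \<alpha>)) \<le> u5 \<alpha> pm p1 p2 pp" "s0 \<le> e1 pp"
    using D_ge_iff[of d \<alpha> pm p1 p2 pp] d pos unfolding s0_def[symmetric]
    by (auto simp: pos_le_divide_eq)
  define U where "U = l1 * e1 pm + k2 * u2 \<alpha> pm p1 + k3 * u3 \<alpha> pm p1 p2 + k4 * u4 \<alpha> pm p1 p2 pp
      + k5 * u5 \<alpha> pm p1 p2 pp + l6 * e1 pp"
  have U_le: "U \<le> s0" unfolding U_def by (rule dual[OF in\<Upsilon>])
  have parts: "l1 * s0 \<le> l1 * e1 pm" "k2 * (s0 * (1 + \<alpha>)) \<le> k2 * u2 \<alpha> pm p1"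
    "k3 * (s0 * (\<tau> + \<alpha>)) \<le> k3 * u3 \<alpha> pm p1 p2" "k4 * (s0 * (\<tau> * (1 + \<alpha>))) \<le> k4 * u4 \<alpha> pm p1 p2 pp"
    "k5 * (s0 * (\<tau> * (\<tau> + \<alpha>))) \<le> k5 * u5 \<alpha> pm p1 p2 pp" "l6 * s0 \<le> l6 * e1 pp"
    using ge k by (auto intro: mult_left_mono)
  have tot: "l1 * s0 + k2 * (s0 * (1 + \<alpha>)) + k3 * (s0 * (\<tau> + \<alpha>)) + k4 * (s0 * (\<tau> * (1 + \<alpha>)))
      + k5 * (s0 * (\<tau> * (\<tau> + \<alpha>))) + l6 * s0 = s0"
  proof -
    have "s0 * (l1 + k2 * (1 + \<alpha>) + k3 * (\<tau> + \<alpha>) + k4 * (\<tau> * (1 + \<alpha>)) + k5 * (\<tau> * (\<tau> + \<alpha>)) + l6) = s0"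
      unfolding k_sum by simp
    then show ?thesis by (simp only: distrib_left mult.left_commute mult.assoc mult.commute)
  qed
  \<comment> \<open>Complementary slackness: the weighted sum is squeezed between \<open>s0\<close>
    from both sides, so every functional of positive weight attains its minimum value.\<close>
  have tight: "l1 * e1 pm = l1 * s0" "k2 * u2 \<alpha> pm p1 = k2 * (s0 * (1 + \<alpha>))"
    "k3 * u3 \<alpha> pm p1 p2 = k3 * (s0 * (\<tau> + \<alpha>))" "k4 * u4 \<alpha> pm p1 p2 pp = k4 * (s0 * (\<tau> * (1 + \<alpha>)))"
    "k5 * u5 \<alpha> pm p1 p2 pp = k5 * (s0 * (\<tau> * (\<tau> + \<alpha>)))" "l6 * e1 pp = l6 * s0"
    using parts tot U_le unfolding U_def by linarith+
  have U_eq: "U = s0" unfolding U_def tight using tot by simp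
  define G where "G = k2 + k3 + k4 + k5"
  define G3 where "G3 = k3 + k4 + k5"
  have G: "0 \<le> G" "0 \<le> G3" "G3 \<le> G" using k by (auto simp: G_def G3_def)
  have optm: "(l1 + G * m) * h\<^sub>r p + (l1 / \<tau> + G * m) * hc p \<le> (l1 + G * m) * h\<^sub>r pm + (l1 / \<tau> + G * m) * hc pm"
    if "p \<in> \<Upsilon>" for p
    using dual[OF that in\<Upsilon>(2-4)] U_eq
    unfolding U_def u2_def u3_def u4_def u5_def e1_def G_def m_def[symmetric]
    by (simp add: algebra_simps)
  have opt1: "((1 - m) * G) * h\<^sub>r p + ((1 - m) * G3) * hc p \<le> ((1 - m) * G) * h\<^sub>r p1 + ((1 - m) * G3) * hc p1"
    if "p \<in> \<Upsilon>" for p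
    using dual[OF in\<Upsilon>(1) that in\<Upsilon>(3,4)] U_eq
    unfolding U_def u2_def u3_def u4_def u5_def G_def G3_def m_def[symmetric]
    by (simp add: algebra_simps)
  have opt2: "((\<tau> - 1) * G3) * h\<^sub>r p + ((\<tau> - 1) * k5) * hc p \<le> ((\<tau> - 1) * G3) * h\<^sub>r p2 + ((\<tau> - 1) * k5) * hc p2"
    if "p \<in> \<Upsilon>" for p
    using dual[OF in\<Upsilon>(1,2) that in\<Upsilon>(4)] U_eq
    unfolding U_def u3_def u4_def u5_def G3_def
    by (simp add: algebra_simps)
  define A where "A = l6 + (k4 * (\<alpha> * (\<tau> - 1)) + k5 * ((\<tau> + \<alpha>) * (\<tau> - 1)))"
  have optp: "A * h\<^sub>r p + (l6 / \<tau>) * hc p \<le> A * h\<^sub>r pp + (l6 / \<tau>) * hc pp"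
    if "p \<in> \<Upsilon>" for p
    using dual[OF in\<Upsilon>(1-3) that] U_eq
    unfolding U_def u4_def u5_def e1_def A_def
    by (simp add: algebra_simps)
  \<comment> \<open>The first two cases lead to the whole carpet. In the third, \<open>0 < G\<close>
    gives \<open>1 / \<tau> < \<kappa>m\<close>, and, if there is any weight on the fourth or fifth
    functional, the exponent of \<open>pp\<close> is below \<open>1 / \<tau>\<close>.\<close>
  consider "G = 0" | "k4 + k5 = 0" "0 < l6" | "0 < G" "k4 + k5 = 0 \<longrightarrow> l6 = 0"
    using k G by linarith
  then show ?thesis
  proof cases
    case 1
    then have k0: "k2 = 0" "k3 = 0" "k4 = 0" "k5 = 0" using k by (auto simp: G_def)
    have "e1 p \<le> s0" if "p \<in> \<Upsilon>" for p
    proof -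
      have "(l1 + l6) * e1 p \<le> s0" using dual[OF that that that that] k0 by (simp add: distrib_right)
      moreover have "l1 + l6 = 1" using k_sum k0 by simp
      ultimately show ?thesis by simp
    qed
    then show ?thesis by (simp add: e1_def)
  next
    case 2
    then have k0: "k4 = 0" "k5 = 0" using k by auto
    have "e1 p \<le> s0" if "p \<in> \<Upsilon>" for p
    proof -
      have "l6 * e1 p \<le> l6 * e1 pp" using optp[OF that] k0 by (simp add: A_def e1_def algebra_simps)
      then have "l6 * e1 p \<le> l6 * s0" using tight(6) by simp
      then show ?thesis using 2(2) by simp
    qed
    then show ?thesis by (simp add: e1_def)
  next
    case 3
    have Gm: "0 < G * m" using 3(1) pos by simp
    define \<kappa>m where "\<kappa>m = (l1 / \<tau> + G * m) / (l1 + G * m)"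
    have den: "0 < l1 + G * m" using Gm k by simp
    have l1\<tau>: "l1 / \<tau> \<le> l1" using k(1) pos by (simp add: pos_divide_le_eq \<tau>0 mult_le_cancel_left1)
    have m1: "1 / \<tau> < \<kappa>m"
    proof -
      have "G * m / \<tau> < G * m" using mult_strict_left_mono[OF tau_gt_1 Gm] \<tau>0 by (simp add: pos_divide_less_eq)
      then have "(l1 + G * m) * (1 / \<tau>) < l1 / \<tau> + G * m" by (simp add: add_divide_distrib)
      then show ?thesis unfolding \<kappa>m_def using den by (simp only: pos_less_divide_eq mult.commute)
    qed
    have m2: "\<kappa>m \<le> 1" unfolding \<kappa>m_def using den l1\<tau> by simp
    have m3: "pressure \<kappa>m = h\<^sub>r pm + \<kappa>m * hc pm"
      unfolding \<kappa>m_def using optm den k(1) Gm \<tau>0 by (intro pressure_eqI in\<Upsilon>) auto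
    have m4: "s0 = h\<^sub>r pm + hc pm / \<tau>" if "\<kappa>m < 1"
    proof -
      have "l1 \<noteq> 0" using that den by (auto simp: \<kappa>m_def)
      then have "e1 pm = s0" using tight(1) by simp
      then show ?thesis by (simp add: e1_def)
    qed
    define \<kappa>1 where "\<kappa>1 = G3 / G"
    have a1: "0 \<le> \<kappa>1" "\<kappa>1 \<le> 1" "\<kappa>1 * G = G3" using 3(1) G by (auto simp: \<kappa>1_def)
    have a2: "m = 1 \<or> pressure \<kappa>1 = h\<^sub>r p1 + \<kappa>1 * hc p1"
    proof (cases "m = 1")
      case False
      then have "0 < 1 - m" using pos by simp
      then have "pressure (((1 - m) * G3) / ((1 - m) * G)) = h\<^sub>r p1 + ((1 - m) * G3) / ((1 - m) * G) * hc p1"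
        using opt1 3(1) G by (intro pressure_eqI in\<Upsilon>) auto
      then show ?thesis using \<open>0 < 1 - m\<close> by (simp add: \<kappa>1_def)
    qed simp
    define \<kappa>2 where "\<kappa>2 = k5 / G3"
    have b1: "0 \<le> \<kappa>2" "\<kappa>2 \<le> 1" "\<kappa>2 * G3 = k5"
      using k G by (auto simp: \<kappa>2_def G3_def divide_le_eq_1)
    have b2: "pressure \<kappa>2 = h\<^sub>r p2 + \<kappa>2 * hc p2" if "G3 \<noteq> 0"
    proof -
      have "0 < G3" using that G by simp
      then have "pressure (((\<tau> - 1) * k5) / ((\<tau> - 1) * G3)) = h\<^sub>r p2 + ((\<tau> - 1) * k5) / ((\<tau> - 1) * G3) * hc p2"
        using opt2 k pos by (intro pressure_eqI in\<Upsilon>) auto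
      then show ?thesis using pos by (simp add: \<kappa>2_def)
    qed
    have "\<exists>\<kappa>p. 0 \<le> \<kappa>p \<and> \<kappa>p < 1 / \<tau> \<and> \<kappa>p * (k4 + k5) \<le> k5 \<and>
      (k4 + k5 = 0 \<or> pressure \<kappa>p = h\<^sub>r pp + \<kappa>p * hc pp) \<and> (0 < \<kappa>p \<longrightarrow> s0 = h\<^sub>r pp + hc pp / \<tau>)"
    proof (cases "k4 + k5 = 0")
      case True
      then show ?thesis using k \<tau>0 by (intro exI[of _ 0]) auto
    next
      case False
      then have k45: "0 < k4 + k5" using k by simp
      have "0 < k4 * (\<alpha> * (\<tau> - 1)) + k5 * ((\<tau> + \<alpha>) * (\<tau> - 1))"
      proof (cases "k4 = 0")
        case True then show ?thesis using k45 pos by simp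
      next
        case False then show ?thesis using k pos by (intro add_pos_nonneg) auto
      qed
      then have A: "l6 < A" "0 < A" using k by (auto simp: A_def)
      define \<kappa>0 where "\<kappa>0 = l6 / \<tau> / A"
      have c1: "0 \<le> \<kappa>0" using k A \<tau>0 by (simp add: \<kappa>0_def)
      have c2: "\<kappa>0 < 1 / \<tau>" using A \<tau>0 by (simp add: \<kappa>0_def divide_less_eq less_divide_eq)
      have c3: "pressure \<kappa>0 = h\<^sub>r pp + \<kappa>0 * hc pp"
        unfolding \<kappa>0_def using optp A k \<tau>0 by (intro pressure_eqI in\<Upsilon>) auto
      have c4: "s0 = h\<^sub>r pp + hc pp / \<tau>" if "0 < \<kappa>0"
      proof -
        have "l6 \<noteq> 0" using that by (auto simp: \<kappa>0_def)
        then have "e1 pp = s0" using tight(6) by simp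
        then show ?thesis by (simp add: e1_def)
      qed
      show ?thesis
      proof (cases "\<kappa>0 * (k4 + k5) \<le> k5")
        case True
        then show ?thesis using c1 c2 c3 c4 by blast
      next
        \<comment> \<open>The exponent \<open>\<kappa>0\<close> is too large for the later
          redistribution of weights. Then \<open>d\<^sub>4\<close> and \<open>d\<^sub>6\<close> are
          both minimal, which gives \<open>hc pp \<le> hc p2\<close>, while the variational
          principle at the exponents \<open>\<kappa>2 < \<kappa>0\<close> gives the reverse
          inequality. So \<open>pp\<close> is optimal for \<open>\<kappa>2\<close> as well, and
          \<open>\<kappa>2\<close> takes the place of \<open>\<kappa>0\<close>.\<close>
        case False
        have \<kappa>0pos: "0 < \<kappa>0"
        proof (rule ccontr)
          assume "\<not> 0 < \<kappa>0"
          then have "\<kappa>0 = 0" using c1 by simp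
          then show False using False k by simp
        qed
        have "\<kappa>0 < 1" using c2 pos by (smt (verit) divide_le_eq_1)
        have "k4 \<noteq> 0"
        proof
          assume "k4 = 0"
          then have "\<kappa>0 * k5 \<le> 1 * k5" using \<open>\<kappa>0 < 1\<close> k by (intro mult_right_mono) auto
          then show False using False \<open>k4 = 0\<close> by simp
        qed
        then have u4: "u4 \<alpha> pm p1 p2 pp = s0 * (\<tau> * (1 + \<alpha>))" using tight(4) by simp
        have "u5 \<alpha> pm p1 p2 pp - u4 \<alpha> pm p1 p2 pp = (\<tau> - 1) * hc p2 + \<tau> * (\<tau> - 1) * h\<^sub>r pp"
          by (simp add: u5_def u4_def algebra_simps)
        moreover have "u5 \<alpha> pm p1 p2 pp - u4 \<alpha> pm p1 p2 pp \<ge> s0 * (\<tau> * (\<tau> - 1))"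
          using ge(5) u4 by (simp add: algebra_simps)
        moreover have "s0 * (\<tau> * (\<tau> - 1)) = \<tau> * (\<tau> - 1) * h\<^sub>r pp + (\<tau> - 1) * hc pp"
        proof -
          have "s0 * \<tau> = hc pp + \<tau> * h\<^sub>r pp" using c4[OF \<kappa>0pos] \<tau>0 by (simp add: field_simps)
          then have "(s0 * \<tau>) * (\<tau> - 1) = (hc pp + \<tau> * h\<^sub>r pp) * (\<tau> - 1)" by simp
          then show ?thesis by (simp add: algebra_simps)
        qed
        ultimately have "(\<tau> - 1) * hc pp \<le> (\<tau> - 1) * hc p2" by linarith
        then have \<psi>: "hc pp \<le> hc p2" using pos by simp
        have G3: "0 < G3" using k45 k by (simp add: G3_def)
        have "\<kappa>2 * (k4 + k5) \<le> k5"
          using b1 k mult_left_mono[of "k4 + k5" G3 \<kappa>2] by (simp add: G3_def)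
        then have \<kappa>20: "\<kappa>2 < \<kappa>0"
          using False k45 by (meson le_less_trans mult_less_cancel_right_pos not_le)
        have P2: "h\<^sub>r pp + \<kappa>2 * hc pp \<le> h\<^sub>r p2 + \<kappa>2 * hc p2"
          using b2 G3 pressure_ge[OF in\<Upsilon>(4), of \<kappa>2] b1 by simp
        have P0: "h\<^sub>r p2 + \<kappa>0 * hc p2 \<le> h\<^sub>r pp + \<kappa>0 * hc pp"
          using c3 pressure_ge[OF in\<Upsilon>(3), of \<kappa>0] c1 by simp
        have "(\<kappa>0 - \<kappa>2) * hc p2 \<le> (\<kappa>0 - \<kappa>2) * hc pp"
          using P2 P0 by (simp add: left_diff_distrib)
        then have "hc p2 \<le> hc pp" using \<kappa>20 by simp
        then have \<psi>eq: "hc p2 = hc pp" using \<psi> by simp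
        then have "h\<^sub>r p2 = h\<^sub>r pp" using P2 P0 by simp
        then have "pressure \<kappa>2 = h\<^sub>r pp + \<kappa>2 * hc pp" using b2 G3 \<psi>eq by simp
        then show ?thesis
          using b1 \<kappa>20 c2 \<open>\<kappa>2 * (k4 + k5) \<le> k5\<close> c4[OF \<kappa>0pos] by (intro exI[of _ \<kappa>2]) auto
      qed
    qed
    then obtain \<kappa>p where p: "0 \<le> \<kappa>p" "\<kappa>p < 1 / \<tau>" "\<kappa>p * (k4 + k5) \<le> k5"
      "k4 + k5 = 0 \<or> pressure \<kappa>p = h\<^sub>r pp + \<kappa>p * hc pp" "0 < \<kappa>p \<longrightarrow> s0 = h\<^sub>r pp + hc pp / \<tau>" by blast
    have eq: "G * (m * (h\<^sub>r pm + hc pm)) + (1 - m) * (G * h\<^sub>r p1 + G3 * hc p1) + (\<tau> - 1) * (G3 * h\<^sub>r p2 + k5 * hc p2)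
      + (k4 * (\<alpha> * (\<tau> - 1)) + k5 * ((\<tau> + \<alpha>) * (\<tau> - 1))) * h\<^sub>r pp
      = s0 * (k2 * (1 + \<alpha>) + k3 * (\<tau> + \<alpha>) + k4 * (\<tau> * (1 + \<alpha>)) + k5 * (\<tau> * (\<tau> + \<alpha>)))"
      (is "?L = ?R")
    proof -
      have "?L = k2 * u2 \<alpha> pm p1 + k3 * u3 \<alpha> pm p1 p2 + k4 * u4 \<alpha> pm p1 p2 pp + k5 * u5 \<alpha> pm p1 p2 pp"
        unfolding u2_def u3_def u4_def u5_def m_def[symmetric] G_def G3_def by (simp add: algebra_simps)
      also have "\<dots> = ?R" unfolding tight by (simp add: algebra_simps)
      finally show ?thesis .
    qed
    have "optimal_data \<alpha> s0 k2 k3 k4 k5 (h\<^sub>r pm) (hc pm) (h\<^sub>r p1) (hc p1) (h\<^sub>r p2) (hc p2) (h\<^sub>r pp) (hc pp) \<kappa>m \<kappa>1 \<kappa>2 \<kappa>p"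
      unfolding optimal_data_def m_def[symmetric] G_def[symmetric] G3_def[symmetric]
      using k 3(1) eq m1 m2 m3 m4 a1 a2 b1 b2 p hc_nonneg[OF in\<Upsilon>(1)] hc_nonneg[OF in\<Upsilon>(4)] by blast
    then show ?thesis by blast
  qed
qed

section \<open>Coverings by approximate squares\<close>

text \<open>The number of row digits that goes with \<open>L\<close> column digits. Because of the
  ceiling the height of an approximate square is at most its width; it is smaller by a factor of at
  most \<open>M\<close>.\<close>

definition lev :: "nat \<Rightarrow> nat" where
  "lev L = nat \<lceil>real L / \<tau>\<rceil>"

lemma lev_le: "lev L \<le> L"
proof -
  have "real L / \<tau> \<le> real L" using tau_gt_1 by (simp add: pos_divide_le_eq mult_le_cancel_left1)
  then have "\<lceil>real L / \<tau>\<rceil> \<le> \<lceil>real L\<rceil>" by (rule ceiling_mono)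
  then show ?thesis by (simp only: lev_def nat_le_iff ceiling_of_nat)
qed

lemma N_pow_le_M_pow_lev: "real N ^ L \<le> real M ^ lev L"
proof -
  have "real L / \<tau> \<le> real (lev L)" unfolding lev_def by linarith
  then have "real L \<le> real (lev L) * \<tau>" using tau_gt_1 by (simp add: pos_divide_le_eq)
  then have "real L * ln (real N) \<le> real (lev L) * \<tau> * ln (real N)"
    using ln_N_pos by (intro mult_right_mono) auto
  then have "ln (real N ^ L) \<le> ln (real M ^ lev L)"
    using N_pos M_pos by (simp add: ln_realpow ln_M mult.assoc)
  then show ?thesis using N_pos M_pos by (subst (asm) ln_le_cancel_iff) auto
qed

definition u :: "nat \<Rightarrow> real" where
  "u a = ln (real (card (P a)))"

lemma u_nonneg: "a \<in> S \<Longrightarrow> 0 \<le> u a"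
  using card_P_ge_1[of a] by (simp add: u_def)

lemma u_le: assumes "a \<in> S" shows "u a \<le> ln (real M)"
proof -
  have "card (P a) \<le> M" using card_mono[OF _ P_subset[OF assms]] by simp
  then show ?thesis using card_P_ge_1[OF assms] by (simp add: u_def)
qed

text \<open>With respect to the product measure that has, outside the prescribed positions \<open>I\<close>, the
  Gibbs weights \<open>card (P a) powr \<kappa> i\<close> on columns and uniform weights inside the columns, the
  approximate square of level \<open>L\<close> around \<open>y\<close> has measure \<open>exp (- cost \<kappa> I L y)\<close>.\<close>

definition cost :: "(nat \<Rightarrow> real) \<Rightarrow> nat set \<Rightarrow> nat \<Rightarrow> real \<times> real \<Rightarrow> real" where
  "cost \<kappa> I L y =
     (\<Sum>i<L. if i \<in> I then 0 else pressure (\<kappa> i) - \<kappa> i * u (fst (itin y i)))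
     + (\<Sum>i<lev L. if i \<in> I then 0 else u (fst (itin y i)))"

lemma dist_itin_le:
  assumes y: "y \<in> carpet" "z \<in> carpet"
    and x: "\<And>i. i < L \<Longrightarrow> fst (itin y i) = fst (itin z i)"
    and s: "\<And>i. i < lev L \<Longrightarrow> snd (itin y i) = snd (itin z i)"
  shows "dist y z \<le> 2 / real N ^ L"
proof -
  have "\<bar>fst y - fst z\<bar> \<le> 1 / real N ^ L"
    using digit_orbit_close[OF digit_orbit_itin(1)[OF y(1)] digit_orbit_itin(1)[OF y(2)], of L] x by simp
  moreover have "\<bar>snd y - snd z\<bar> \<le> 1 / real M ^ lev L"
    using digit_orbit_close[OF digit_orbit_itin(2)[OF y(1)] digit_orbit_itin(2)[OF y(2)], of "lev L"] s by simp
  moreover have "1 / real M ^ lev L \<le> 1 / real N ^ L"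
    using N_pow_le_M_pow_lev N_pos M_pos by (intro divide_left_mono) auto
  moreover have "dist y z \<le> \<bar>fst y - fst z\<bar> + \<bar>snd y - snd z\<bar>"
    by (simp add: dist_prod_def dist_real_def sqrt_sum_squares_le_sum_abs[of "fst y - fst z" "snd y - snd z", simplified])
  ultimately show ?thesis by simp
qed

lemma fst_itin_in_S: "y \<in> carpet \<Longrightarrow> fst (itin y i) \<in> S"
  using itin_in_Q[of y i] by (auto simp: Q_def)

definition gibbs :: "real \<Rightarrow> nat \<Rightarrow> real" where
  "gibbs \<kappa> a = exp (\<kappa> * u a - pressure \<kappa>)"

lemma gibbs_sum: "(\<Sum>a\<in>S. gibbs \<kappa> a) = 1"
proof -
  have "gibbs \<kappa> a = real (card (P a)) powr \<kappa> / (\<Sum>a\<in>S. real (card (P a)) powr \<kappa>)" if "a \<in> S" for a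
    using card_P_ge_1[OF that] pressure_sum_pos[of \<kappa>]
    by (simp add: gibbs_def u_def pressure_def exp_diff powr_def)
  then show ?thesis
    using pressure_sum_pos[of \<kappa>] by (simp add: sum_divide_distrib[symmetric])
qed

text \<open>A square that contains a point of cost at most \<open>c\<close> has mass at least
  \<open>exp (- c)\<close>, and the total mass is 1, so there are at most \<open>exp c\<close> such
  squares. The masses are finite products of weights, and the total is computed by expanding a
  product of sums.\<close>

lemma cheap_squares_cover:
  fixes c :: real and \<kappa> :: "nat \<Rightarrow> real" and I :: "nat set" and L :: nat and t :: "nat \<Rightarrow> nat \<times> nat"
  defines "A \<equiv> {y \<in> carpet. (\<forall>i\<in>I. itin y i = t i) \<and> cost \<kappa> I L y \<le> c}"
  shows "\<exists>\<U>. finite \<U> \<and> real (card \<U>) \<le> exp c \<and> A \<subseteq> \<Union>\<U> \<and>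
    (\<forall>U\<in>\<U>. bounded U \<and> diameter U \<le> 2 / real N ^ L)"
proof -
  \<comment> \<open>Beyond \<open>lev L\<close> only the column is recorded; the second component 0
    is a placeholder. At a prescribed position the alphabet \<open>B i\<close> has a single letter,
    of weight 1.\<close>
  define tr where "tr i q = (if i < lev L then q else (fst q, 0))" for i and q :: "nat \<times> nat"
  define B where "B i = (if i \<in> I then {tr i (t i)} else if i < lev L then Q else S \<times> {0})" for i
  define wt where "wt i q = (if i \<in> I then 1 else if i < lev L then gibbs (\<kappa> i) (fst q) * exp (- u (fst q))
    else gibbs (\<kappa> i) (fst q))" for i and q :: "nat \<times> nat"
  define key where "key y = (\<lambda>i\<in>{..<L}. tr i (itin y i))" for y
  define w where "w g = (\<Prod>i<L. wt i (g i))" for g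
  have finB: "finite (B i)" for i using finite_Q finite_S by (simp add: B_def)
  have sumB: "(\<Sum>q\<in>B i. wt i q) = 1" for i
  proof -
    have "(\<Sum>q\<in>Q. gibbs \<kappa> (fst q) * exp (- u (fst q))) = 1" for \<kappa>
    proof -
      have "(\<Sum>b\<in>P a. gibbs \<kappa> a * exp (- u a)) = gibbs \<kappa> a" if "a \<in> S" for a
        using card_P_ge_1[OF that] by (simp add: u_def exp_minus)
      then have "(\<Sum>a\<in>S. \<Sum>b\<in>P a. gibbs \<kappa> a * exp (- u a)) = (\<Sum>a\<in>S. gibbs \<kappa> a)"
        by (rule sum.cong[OF refl])
      then show ?thesis unfolding sum_Q fst_conv gibbs_sum .
    qed
    moreover have "(\<Sum>q\<in>S \<times> {0::nat}. gibbs \<kappa> (fst q)) = 1" for \<kappa>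
    proof -
      have "S \<times> {0} = (\<lambda>a. (a, 0::nat)) ` S" by auto
      then show ?thesis using gibbs_sum[of \<kappa>] by (simp add: sum.reindex inj_on_def)
    qed
    ultimately show ?thesis by (simp add: B_def wt_def)
  qed
  have wpos: "0 \<le> w g" for g unfolding w_def by (intro prod_nonneg) (auto simp: wt_def gibbs_def)
  have key: "key y \<in> PiE {..<L} B" if "y \<in> A" for y
    using that itin_in_Q[of y] fst_itin_in_S[of y] unfolding key_def
    by (intro restrict_PiE_iff[THEN iffD2]) (auto simp: B_def tr_def A_def)
  have w_key: "exp (- c) \<le> w (key y)" if y: "y \<in> A" for y
  proof -
    define e where "e i = (if i \<in> I then 0 else \<kappa> i * u (fst (itin y i)) - pressure (\<kappa> i))
      - (if i < lev L then (if i \<in> I then 0 else u (fst (itin y i))) else 0)" for i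
    have "w (key y) = (\<Prod>i<L. exp (e i))"
      unfolding w_def by (intro prod.cong refl) (auto simp: wt_def key_def tr_def e_def gibbs_def exp_add[symmetric] exp_diff[symmetric])
    also have "\<dots> = exp (\<Sum>i<L. e i)" by (simp add: exp_sum)
    also have "(\<Sum>i<L. e i) = - cost \<kappa> I L y"
    proof -
      have "(\<Sum>i<L. if i < lev L then (if i \<in> I then 0 else u (fst (itin y i))) else 0)
        = (\<Sum>i<lev L. if i \<in> I then 0 else u (fst (itin y i)))"
        using lev_le[of L] by (intro sum.mono_neutral_cong_right) auto
      moreover have "(\<Sum>i<L. if i \<in> I then 0 else \<kappa> i * u (fst (itin y i)) - pressure (\<kappa> i))
        = - (\<Sum>i<L. if i \<in> I then 0 else pressure (\<kappa> i) - \<kappa> i * u (fst (itin y i)))"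
        unfolding sum_negf[symmetric] by (intro sum.cong) auto
      ultimately show ?thesis by (simp add: e_def cost_def sum_subtractf)
    qed
    finally show ?thesis using y by (simp add: A_def)
  qed
  define \<U> where "\<U> = (\<lambda>g. {y \<in> A. key y = g}) ` (key ` A)"
  have fin: "finite (key ` A)"
    using key finB by (intro finite_subset[OF _ finite_PiE[of "{..<L}" B]]) auto
  have "real (card (key ` A)) * exp (- c) = (\<Sum>g\<in>key ` A. exp (- c))" by simp
  also have "\<dots> \<le> (\<Sum>g\<in>key ` A. w g)" using w_key by (intro sum_mono) auto
  also have "\<dots> \<le> (\<Sum>g\<in>PiE {..<L} B. w g)"
    using key wpos finB by (intro sum_mono2) (auto intro: finite_PiE)
  also have "\<dots> = (\<Prod>i<L. \<Sum>q\<in>B i. wt i q)"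
    unfolding w_def using finB by (intro prod_sum_PiE[symmetric]) auto
  also have "\<dots> = 1" by (simp add: sumB)
  finally have "real (card (key ` A)) \<le> exp c" by (simp add: exp_minus field_simps)
  moreover have "card \<U> \<le> card (key ` A)" unfolding \<U>_def using fin by (rule card_image_le)
  ultimately have "real (card \<U>) \<le> exp c" by simp
  moreover have "bounded U \<and> diameter U \<le> 2 / real N ^ L" if U: "U \<in> \<U>" for U
  proof -
    have d: "dist y z \<le> 2 / real N ^ L" if yz: "y \<in> U" "z \<in> U" for y z
    proof (rule dist_itin_le)
      have yzA: "y \<in> A" "z \<in> A" and k: "key y = key z" using U yz by (auto simp: \<U>_def)
      then show "y \<in> carpet" "z \<in> carpet" by (auto simp: A_def)
      have tr_eq: "tr i (itin y i) = tr i (itin z i)" if "i < L" for i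
        using fun_cong[OF k, of i] that by (simp add: key_def)
      show "fst (itin y i) = fst (itin z i)" if "i < L" for i
        using tr_eq[OF that] by (auto simp: tr_def split: if_splits)
      show "snd (itin y i) = snd (itin z i)" if "i < lev L" for i
        using tr_eq[of i] that lev_le[of L] by (auto simp: tr_def)
    qed
    have "U \<subseteq> carpet" using U by (auto simp: \<U>_def A_def)
    moreover have "bounded carpet" using is_carpet_carpet compact_imp_bounded by blast
    ultimately have "bounded U" using bounded_subset by blast
    moreover have "diameter U \<le> 2 / real N ^ L"
      by (rule diameter_le) (use N_pos in simp, rule d[unfolded dist_norm])
    ultimately show ?thesis by blast
  qed
  moreover have "A \<subseteq> \<Union>\<U>" by (auto simp: \<U>_def)
  moreover have "finite \<U>" using fin by (simp add: \<U>_def)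
  ultimately show ?thesis by blast
qed

text \<open>A square of level \<open>L\<close> has diameter at most \<open>2 / real N ^ L\<close>,
  and at most \<open>real N powr (\<sigma> * L)\<close> squares are needed. For
  \<open>s > \<sigma>\<close> the mass decays geometrically in \<open>L\<close>, and the levels grow
  at least linearly in \<open>n\<close>.\<close>

lemma limsup_cheap_squares_zero:
  fixes J :: nat and g :: "nat \<Rightarrow> nat \<Rightarrow> nat" and c \<sigma> s :: real
  assumes s: "0 \<le> \<sigma>" "\<sigma> < s" and c: "0 < c" and J: "0 < J"
    and g: "\<And>n j. j < J \<Longrightarrow> c * real n \<le> real (g n j)"
    and A: "\<And>y. y \<in> A \<Longrightarrow> y \<in> carpet \<and> infinite {n. (\<forall>i\<in>I n. itin y i = t n i) \<and>
      (\<exists>j<J. cost (\<kappa> n) (I n) (g n j) y \<le> \<sigma> * real (g n j) * ln (real N))}"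
  shows "hausdorff_measure s A = 0"
proof -
  \<comment> \<open>The pair of a time \<open>n\<close> and a scale index \<open>j\<close> is coded
    as \<open>k = n * J + j\<close>, which turns the \<open>J\<close> scales into one sequence of
    families.\<close>
  define L where "L k = g (k div J) (k mod J)" for k
  define Y where "Y k = {y \<in> carpet. (\<forall>i\<in>I (k div J). itin y i = t (k div J) i) \<and>
    cost (\<kappa> (k div J)) (I (k div J)) (L k) y \<le> \<sigma> * real (L k) * ln (real N)}" for k
  have "\<forall>k. \<exists>\<U>. finite \<U> \<and> real (card \<U>) \<le> exp (\<sigma> * real (L k) * ln (real N)) \<and> Y k \<subseteq> \<Union>\<U> \<and>
    (\<forall>U\<in>\<U>. bounded U \<and> diameter U \<le> 2 / real N ^ L k)"
    unfolding Y_def by (intro allI cheap_squares_cover)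
  then obtain \<C> where \<C>: "\<And>k. finite (\<C> k)" "\<And>k. real (card (\<C> k)) \<le> exp (\<sigma> * real (L k) * ln (real N))"
    "\<And>k. Y k \<subseteq> \<Union>(\<C> k)" "\<And>k U. U \<in> \<C> k \<Longrightarrow> bounded U \<and> diameter U \<le> 2 / real N ^ L k" by metis
  have Lk: "c * (real k / real J - 1) \<le> real (L k)" for k
  proof -
    have "real k / real J - 1 \<le> real (k div J)"
    proof -
      have "k = J * (k div J) + k mod J" by simp
      moreover have "k mod J < J" using J by simp
      ultimately have "k \<le> J * (k div J) + J" by linarith
      then have "real k \<le> real J * real (k div J) + real J" by (metis of_nat_add of_nat_le_iff of_nat_mult)
      then show ?thesis using J by (simp add: field_simps)
    qed
    then have "c * (real k / real J - 1) \<le> c * real (k div J)" using c by (intro mult_left_mono) auto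
    also have "\<dots> \<le> real (L k)" unfolding L_def using J by (intro g) simp
    finally show ?thesis .
  qed
  have pw: "1 / real N ^ n = exp (- real n * ln (real N))" for n
    using N_pos by (simp add: exp_minus exp_of_nat_mult inverse_eq_divide)
  \<comment> \<open>The ratio of the geometric series in \<open>k\<close>: per step of
    \<open>k\<close> the level grows on average by at least \<open>c / J\<close>.\<close>
  define q where "q b = exp (- (b * c * ln (real N) / real J))" for b
  have bound: "exp (- (b * real (L k) * ln (real N))) \<le> exp (b * c * ln (real N)) * q b ^ k" if "0 < b" for b k
  proof -
    have "b * ln (real N) * (c * (real k / real J - 1)) \<le> b * ln (real N) * real (L k)"
      using that ln_N_pos by (intro mult_left_mono Lk) auto
    then have "- (b * real (L k) * ln (real N)) \<le> b * c * ln (real N) + real k * (- (b * c * ln (real N) / real J))"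
      by (simp add: algebra_simps)
    then have "exp (- (b * real (L k) * ln (real N))) \<le> exp (b * c * ln (real N) + real k * (- (b * c * ln (real N) / real J)))"
      by simp
    then show ?thesis unfolding q_def exp_add exp_of_nat_mult .
  qed
  have q: "0 \<le> q b" "q b < 1" if "0 < b" for b using that c J ln_N_pos by (auto simp: q_def)
  show ?thesis
  proof (rule hausdorff_measure_limsup_zero[where \<C> = \<C> and r = "\<lambda>k. 2 / real N ^ L k"
        and a = "\<lambda>k. 2 powr s * (exp ((s - \<sigma>) * c * ln (real N)) * q (s - \<sigma>) ^ k)"])
    show "0 < s" using s by simp
    show "finite (\<C> k)" for k by fact
    show "bounded U \<and> diameter U \<le> 2 / real N ^ L k" if "U \<in> \<C> k" for k U using \<C>(4)[OF that] .
    show "(\<lambda>k. 2 / real N ^ L k) \<longlonglongrightarrow> 0"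
    proof (rule tendsto_sandwich[of "\<lambda>_. 0" _ _ "\<lambda>k. 2 * (exp (1 * c * ln (real N)) * q 1 ^ k)"])
      show "\<forall>\<^sub>F k in sequentially. 2 / real N ^ L k \<le> 2 * (exp (1 * c * ln (real N)) * q 1 ^ k)"
      proof (rule always_eventually, rule allI)
        fix k
        have "2 / real N ^ L k = 2 * exp (- (1 * real (L k) * ln (real N)))" using pw[of "L k"] by simp
        also have "\<dots> \<le> 2 * (exp (1 * c * ln (real N)) * q 1 ^ k)" using bound[of 1 k] by (intro mult_left_mono) auto
        finally show "2 / real N ^ L k \<le> 2 * (exp (1 * c * ln (real N)) * q 1 ^ k)" .
      qed
      show "(\<lambda>k. 2 * (exp (1 * c * ln (real N)) * q 1 ^ k)) \<longlonglongrightarrow> 0"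
        using q[of 1] by (intro tendsto_mult_right_zero LIMSEQ_realpow_zero) auto
    qed auto
    show "real (card (\<C> k)) * (2 / real N ^ L k) powr s \<le>
      2 powr s * (exp ((s - \<sigma>) * c * ln (real N)) * q (s - \<sigma>) ^ k)" for k
    proof -
      have "(2 / real N ^ L k) powr s = 2 powr s * (1 / real N ^ L k) powr s"
        using N_pos by (simp add: powr_mult[symmetric])
      also have "(1 / real N ^ L k) powr s = exp (- (s * real (L k) * ln (real N)))"
        unfolding pw by (simp add: powr_def mult.assoc)
      finally have "real (card (\<C> k)) * (2 / real N ^ L k) powr s \<le>
        exp (\<sigma> * real (L k) * ln (real N)) * (2 powr s * exp (- (s * real (L k) * ln (real N))))"
        using \<C>(2)[of k] by (simp add: mult_right_mono)
      also have "\<dots> = 2 powr s * exp (- ((s - \<sigma>) * real (L k) * ln (real N)))"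
        by (simp add: exp_add[symmetric] algebra_simps)
      also have "\<dots> \<le> 2 powr s * (exp ((s - \<sigma>) * c * ln (real N)) * q (s - \<sigma>) ^ k)"
        using bound[of "s - \<sigma>" k] s by (intro mult_left_mono) auto
      finally show ?thesis .
    qed
    show "summable (\<lambda>k. 2 powr s * (exp ((s - \<sigma>) * c * ln (real N)) * q (s - \<sigma>) ^ k))"
      using q[of "s - \<sigma>"] s by (intro summable_mult summable_geometric) auto
    fix y assume y: "y \<in> A"
    show "infinite {k. y \<in> \<Union>(\<C> k)}"
      unfolding infinite_nat_iff_unbounded_le
    proof
      fix n0
      obtain n where n: "n0 \<le> n" "\<forall>i\<in>I n. itin y i = t n i"
        "\<exists>j<J. cost (\<kappa> n) (I n) (g n j) y \<le> \<sigma> * real (g n j) * ln (real N)"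
        using A[OF y] unfolding infinite_nat_iff_unbounded_le by blast
      then obtain j where j: "j < J" "cost (\<kappa> n) (I n) (g n j) y \<le> \<sigma> * real (g n j) * ln (real N)" by blast
      have dm: "(n * J + j) div J = n" "(n * J + j) mod J = j" using j(1) by auto
      then have "L (n * J + j) = g n j" by (simp add: L_def)
      then have "y \<in> Y (n * J + j)" using A[OF y] n(2) j(2) dm by (simp add: Y_def)
      then have "y \<in> \<Union>(\<C> (n * J + j))" using \<C>(3) by blast
      moreover have "n0 \<le> n * J + j" using n(1) J by (metis le_add1 le_trans mult.commute mult_le_mono1 nat_mult_1 Suc_leI One_nat_def)
      ultimately show "\<exists>n\<ge>n0. n \<in> {k. y \<in> \<Union>(\<C> k)}" by blast
    qed
  qed
qed

end

section \<open>The scales at which the covering is efficient\<close>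

text \<open>Iteration gives \<open>\<kappa> ^ J * D 0 \<le> C / \<tau> ^ J\<close>, and
  \<open>\<kappa> * \<tau> > 1\<close> makes the resulting bound on \<open>D 0\<close> small. The
  threshold \<open>J0\<close> does not depend on \<open>D\<close>, so the scales can be fixed before
  the point.\<close>

lemma chain_down:
  fixes \<kappa> \<tau> C \<rho> :: real
  assumes \<tau>: "1 < \<tau>" and \<kappa>: "1 / \<tau> < \<kappa>" and \<rho>: "0 < \<rho>"
  obtains J0 where "\<And>J D. J0 \<le> J \<Longrightarrow> (\<And>j. j < J \<Longrightarrow> \<kappa> * D j \<le> D (Suc j)) \<Longrightarrow> D J \<le> C / \<tau> ^ J \<Longrightarrow> D 0 \<le> \<rho>"
proof -
  have \<kappa>0: "0 < \<kappa>" using \<kappa> \<tau> by (smt (verit) divide_pos_pos)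
  define r where "r = 1 / (\<kappa> * \<tau>)"
  have r: "0 \<le> r" "r < 1"
    using \<kappa> \<tau> \<kappa>0 by (auto simp: r_def divide_less_eq less_divide_eq mult.commute)
  have "(\<lambda>J. C * r ^ J) \<longlonglongrightarrow> 0"
    using r by (intro tendsto_mult_right_zero LIMSEQ_realpow_zero) auto
  then have "\<forall>\<^sub>F J in sequentially. C * r ^ J < \<rho>" by (rule order_tendstoD(2)[OF _ \<rho>])
  then obtain J0 where J0: "\<And>J. J0 \<le> J \<Longrightarrow> C * r ^ J < \<rho>" unfolding eventually_sequentially by blast
  show ?thesis
  proof (rule that[of J0])
    fix J and D :: "nat \<Rightarrow> real"
    assume J: "J0 \<le> J" and step: "\<And>j. j < J \<Longrightarrow> \<kappa> * D j \<le> D (Suc j)" and last: "D J \<le> C / \<tau> ^ J"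
    have "\<kappa> ^ j * D 0 \<le> D j" if "j \<le> J" for j
      using that
    proof (induction j)
      case (Suc j)
      have "\<kappa> ^ Suc j * D 0 = \<kappa> * (\<kappa> ^ j * D 0)" by simp
      also have "\<dots> \<le> \<kappa> * D j" using Suc \<kappa>0 by (intro mult_left_mono) auto
      also have "\<dots> \<le> D (Suc j)" using Suc by (intro step) auto
      finally show ?case .
    qed simp
    then have "\<kappa> ^ J * D 0 \<le> C / \<tau> ^ J" using last by fastforce
    then have "D 0 \<le> C / \<tau> ^ J / \<kappa> ^ J" using \<kappa>0 by (simp only: pos_le_divide_eq zero_less_power mult.commute)
    also have "\<dots> = C * r ^ J" by (simp add: r_def power_divide power_mult_distrib mult.commute)
    finally show "D 0 \<le> \<rho>" using J0[OF J] by simp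
  qed
qed

text \<open>Iteration bounds \<open>D 0\<close> by \<open>\<kappa> ^ J * D J\<close> plus a partial
  geometric series with factor \<open>X\<close>; the first term vanishes in the limit because
  \<open>\<kappa> * \<tau> < 1\<close>. The lower bound on \<open>X\<close> is for negative
  \<open>X\<close>, where the partial series exceeds the full one. Again \<open>J0\<close> is
  uniform in \<open>D\<close> and \<open>X\<close>.\<close>

lemma chain_up:
  fixes \<kappa> \<tau> C \<rho> :: real
  assumes \<tau>: "1 < \<tau>" and \<kappa>: "0 \<le> \<kappa>" "\<kappa> < 1 / \<tau>" and \<rho>: "0 < \<rho>"
  obtains J0 where "\<And>J D X. J0 \<le> J \<Longrightarrow> (\<And>j. j < J \<Longrightarrow> D j \<le> \<kappa> * D (Suc j) + X) \<Longrightarrow>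
    D J \<le> C * \<tau> ^ J \<Longrightarrow> - X \<le> C \<Longrightarrow> D 0 \<le> X / (1 - \<kappa>) + \<rho>"
proof -
  have \<kappa>\<tau>: "\<kappa> * \<tau> < 1" using \<kappa> \<tau> by (simp add: pos_less_divide_eq)
  have "1 / \<tau> < 1" using \<tau> by simp
  then have \<kappa>1: "\<kappa> < 1" using \<kappa> by linarith
  have "(\<lambda>J. C * (\<kappa> * \<tau>) ^ J + C / (1 - \<kappa>) * \<kappa> ^ J) \<longlonglongrightarrow> 0 + 0"
    using \<kappa> \<tau> \<kappa>\<tau> \<kappa>1 by (intro tendsto_add tendsto_mult_right_zero LIMSEQ_realpow_zero) auto
  then have "(\<lambda>J. C * (\<kappa> * \<tau>) ^ J + C / (1 - \<kappa>) * \<kappa> ^ J) \<longlonglongrightarrow> 0" by simp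
  then have "\<forall>\<^sub>F J in sequentially. C * (\<kappa> * \<tau>) ^ J + C / (1 - \<kappa>) * \<kappa> ^ J < \<rho>"
    by (rule order_tendstoD(2)[OF _ \<rho>])
  then obtain J0 where J0: "\<And>J. J0 \<le> J \<Longrightarrow> C * (\<kappa> * \<tau>) ^ J + C / (1 - \<kappa>) * \<kappa> ^ J < \<rho>" unfolding eventually_sequentially by blast
  show ?thesis
  proof (rule that[of J0])
    fix J X and D :: "nat \<Rightarrow> real"
    assume J: "J0 \<le> J" and step: "\<And>j. j < J \<Longrightarrow> D j \<le> \<kappa> * D (Suc j) + X"
      and last: "D J \<le> C * \<tau> ^ J" and X: "- X \<le> C"
    have "D 0 \<le> \<kappa> ^ j * D j + X * (1 - \<kappa> ^ j) / (1 - \<kappa>)" if "j \<le> J" for j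
      using that
    proof (induction j)
      case (Suc j)
      have "D 0 \<le> \<kappa> ^ j * D j + X * (1 - \<kappa> ^ j) / (1 - \<kappa>)" using Suc by simp
      also have "\<dots> \<le> \<kappa> ^ j * (\<kappa> * D (Suc j) + X) + X * (1 - \<kappa> ^ j) / (1 - \<kappa>)"
        using Suc \<kappa> by (intro add_right_mono mult_left_mono step) auto
      also have "\<dots> = \<kappa> ^ Suc j * D (Suc j) + X * (1 - \<kappa> ^ Suc j) / (1 - \<kappa>)"
        using \<kappa>1 by (simp add: field_simps)
      finally show ?case .
    qed simp
    then have "D 0 \<le> \<kappa> ^ J * D J + X * (1 - \<kappa> ^ J) / (1 - \<kappa>)" by blast
    also have "\<dots> \<le> \<kappa> ^ J * (C * \<tau> ^ J) + X * (1 - \<kappa> ^ J) / (1 - \<kappa>)"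
      using \<kappa> last by (intro add_right_mono mult_left_mono) auto
    also have "\<dots> = C * (\<kappa> * \<tau>) ^ J + X / (1 - \<kappa>) + (- X) / (1 - \<kappa>) * \<kappa> ^ J"
      by (simp add: power_mult_distrib algebra_simps diff_divide_distrib)
    also have "(- X) / (1 - \<kappa>) * \<kappa> ^ J \<le> C / (1 - \<kappa>) * \<kappa> ^ J"
      using X \<kappa> \<kappa>1 by (intro mult_right_mono divide_right_mono) auto
    finally show "D 0 \<le> X / (1 - \<kappa>) + \<rho>" using J0[OF J] by linarith
  qed
qed

text \<open>The elimination of the unknown column sums. \<open>S1\<close> cancels since
  \<open>\<kappa>1 * G = G3\<close>, and \<open>S2\<close> since \<open>\<kappa>2 * G3 = k5\<close>.
  The bounds at the last two scales contain the chain quantity \<open>Y\<close>; the weight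
  \<open>k5'\<close> is chosen so that its total coefficient becomes
  \<open>(1 - \<kappa>) * k5\<close>, and \<open>(1 - \<kappa>) * Y\<close> is known again. Only
  \<open>S0\<close> survives, with the nonnegative factor \<open>1 - \<kappa>m\<close>, and is
  bounded by the chain below the target.\<close>

lemma combine_scales:
  fixes k2 k3 k4 k5 k5' :: real
  assumes k: "0 \<le> k2" "0 \<le> k3" "0 \<le> k4" "0 \<le> k5'" and G3: "G3 = k3 + k4 + k5" and G: "G = k2 + G3" "0 \<le> G"
    and k5': "k5' = (1 - \<kappa>) * k5 - \<kappa> * k4"
    and E: "G * (m * (\<phi>m + \<psi>m)) + m' * (G * \<phi>1 + G3 * \<psi>1) + t1 * (G3 * \<phi>2 + k5 * \<psi>2)
      + (k4 * (L4 - R0) + k5 * (L5 - R0)) * \<phi>p = s0 * (k2 * L2 + k3 * L3 + k4 * L4 + k5 * L5)"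
    and Pm: "Pm = \<phi>m + \<kappa>m * \<psi>m" and P1: "m' * P1 = m' * (\<phi>1 + \<kappa>1 * \<psi>1)" "\<kappa>1 * G = G3"
    and P2: "G3 * P2 = G3 * (\<phi>2 + \<kappa>2 * \<psi>2)" "\<kappa>2 * G3 = k5"
    and Pp: "k4 * Pp = k4 * (\<phi>p + \<kappa> * \<psi>p)" "k5 * Pp = k5 * (\<phi>p + \<kappa> * \<psi>p)" "\<kappa> * (\<psi>p * R0 + \<phi>p * L5) = \<kappa> * (L5 * s0)"
    and F2: "F2 = Pm * m + (1 - \<kappa>m) * S0 + m' * P1 - \<kappa>1 * S1"
    and F3: "F3 = F2 + S1 + t1 * P2 - \<kappa>2 * S2" and X: "X = F3 + S2"
    and Y: "(1 - \<kappa>) * Y = X - Pp * R0"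
    and b2: "t2 \<le> F2 + e" and b3: "t3 \<le> F3 + e"
    and b4: "t4 \<le> F3 + Pp * (L4 - R0) - \<kappa> * \<psi>p * L4 + \<kappa> * Y + e"
    and b5: "t5 \<le> X + Pp * (L5 - R0) - \<kappa> * \<psi>p * L5 + \<kappa> * Y + e"
    and S0: "(1 - \<kappa>m) * S0 \<le> (1 - \<kappa>m) * (m * \<psi>m) + e"
  shows "k2 * t2 + k3 * t3 + k4 * t4 + k5' * t5 \<le>
    s0 * (k2 * L2 + k3 * L3 + k4 * L4 + k5' * L5) + (k2 + k3 + k4 + k5' + G) * e"
proof -
  have Y': "X + \<kappa> * Y = Y + Pp * R0" using Y by (simp add: algebra_simps)
  \<comment> \<open>This identity determines \<open>k5'\<close>.\<close>
  have kY: "k4 * (\<kappa> * Y) + k5' * Y = k5 * (F3 + S2 - Pp * R0)"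
  proof -
    have "k4 * (\<kappa> * Y) + k5' * Y = k5 * ((1 - \<kappa>) * Y)" unfolding k5' by (simp add: algebra_simps)
    then show ?thesis unfolding Y X by simp
  qed
  have k5P: "k5' * Pp = k5' * (\<phi>p + \<kappa> * \<psi>p)"
  proof -
    have "k5' * Pp = (1 - \<kappa>) * (k5 * Pp) - \<kappa> * (k4 * Pp)" unfolding k5' by (simp add: algebra_simps)
    then show ?thesis unfolding Pp unfolding k5' by (simp add: algebra_simps)
  qed
  have b5': "t5 \<le> Y + Pp * L5 - \<kappa> * \<psi>p * L5 + e" using b5 Y' by (simp add: algebra_simps)
  have "k2 * t2 + k3 * t3 + k4 * t4 + k5' * t5 \<le> k2 * (F2 + e) + k3 * (F3 + e)
    + k4 * (F3 + Pp * (L4 - R0) - \<kappa> * \<psi>p * L4 + \<kappa> * Y + e) + k5' * (Y + Pp * L5 - \<kappa> * \<psi>p * L5 + e)"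
    by (rule add_mono[OF add_mono[OF add_mono[OF mult_left_mono[OF b2 k(1)] mult_left_mono[OF b3 k(2)]]
          mult_left_mono[OF b4 k(3)]] mult_left_mono[OF b5' k(4)]])
  also have "\<dots> = (k2 * F2 + (k3 + k4) * F3 + (k4 * (\<kappa> * Y) + k5' * Y)) + (k4 * Pp) * (L4 - R0) - k4 * (\<kappa> * \<psi>p * L4)
    + (k5' * Pp) * L5 - k5' * (\<kappa> * \<psi>p * L5) + (k2 + k3 + k4 + k5') * e"
    by (simp add: algebra_simps)
  also have "\<dots> = (k2 * F2 + G3 * F3 + k5 * S2) - (k5 * Pp) * R0 + (k4 * Pp) * (L4 - R0) - k4 * (\<kappa> * \<psi>p * L4)
    + (k5' * Pp) * L5 - k5' * (\<kappa> * \<psi>p * L5) + (k2 + k3 + k4 + k5') * e"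
    unfolding kY G3 by (simp add: algebra_simps)
  also have "\<dots> = (k2 * F2 + G3 * F3 + k5 * S2) - k5 * (\<phi>p + \<kappa> * \<psi>p) * R0 + k4 * (\<phi>p * (L4 - R0) - \<kappa> * \<psi>p * R0)
    + k5' * \<phi>p * L5 + (k2 + k3 + k4 + k5') * e"
    unfolding k5P Pp by (simp add: algebra_simps)
  also have "k2 * F2 + G3 * F3 + k5 * S2 = G * (Pm * m) + G * ((1 - \<kappa>m) * S0) + G * (m' * P1) + t1 * (G3 * P2)"
  proof -
    have "k2 * F2 + G3 * F3 + k5 * S2 = G * F2 + G3 * S1 + t1 * (G3 * P2) - (\<kappa>2 * G3) * S2 + k5 * S2"
      unfolding F3 G by (simp add: algebra_simps)
    also have "\<dots> = G * F2 + (\<kappa>1 * G) * S1 + t1 * (G3 * P2)" unfolding P1(2) P2(2) by simp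
    finally show ?thesis unfolding F2 by (simp add: algebra_simps)
  qed
  also have "\<dots> \<le> G * (Pm * m) + G * ((1 - \<kappa>m) * (m * \<psi>m) + e) + G * (m' * P1) + t1 * (G3 * P2)"
    using S0 G(2) by (intro add_right_mono add_left_mono mult_left_mono) auto
  also have "\<dots> = (G * (m * (\<phi>m + \<psi>m)) + m' * (G * \<phi>1 + G3 * \<psi>1) + t1 * (G3 * \<phi>2 + k5 * \<psi>2)) + G * e"
  proof -
    have "G * (m' * P1) = m' * (G * \<phi>1 + (\<kappa>1 * G) * \<psi>1)" unfolding P1(1) by (simp add: algebra_simps)
    moreover have "t1 * (G3 * P2) = t1 * (G3 * \<phi>2 + (\<kappa>2 * G3) * \<psi>2)" unfolding P2(1) by (simp add: algebra_simps)
    ultimately show ?thesis unfolding P1(2) P2(2) Pm by (simp add: algebra_simps)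
  qed
  also have "G * (m * (\<phi>m + \<psi>m)) + m' * (G * \<phi>1 + G3 * \<psi>1) + t1 * (G3 * \<phi>2 + k5 * \<psi>2)
    = s0 * (k2 * L2 + k3 * L3 + k4 * L4 + k5 * L5) - (k4 * (L4 - R0) + k5 * (L5 - R0)) * \<phi>p"
    using E by linarith
  finally have "k2 * t2 + k3 * t3 + k4 * t4 + k5' * t5 \<le>
    s0 * (k2 * L2 + k3 * L3 + k4 * L4 + k5 * L5) - (k4 * (L4 - R0) + k5 * (L5 - R0)) * \<phi>p + G * e
    - k5 * (\<phi>p + \<kappa> * \<psi>p) * R0 + k4 * (\<phi>p * (L4 - R0) - \<kappa> * \<psi>p * R0)
    + k5' * \<phi>p * L5 + (k2 + k3 + k4 + k5') * e" by simp
  also have "\<dots> = s0 * (k2 * L2 + k3 * L3 + k4 * L4 + k5 * L5) - (k4 + k5) * (\<kappa> * (\<psi>p * R0 + \<phi>p * L5)) + (k2 + k3 + k4 + k5' + G) * e"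
    unfolding k5' by (simp add: algebra_simps)
  also have "\<dots> = s0 * (k2 * L2 + k3 * L3 + k4 * L4 + k5' * L5) + (k2 + k3 + k4 + k5' + G) * e"
    unfolding Pp(3) k5' by (simp add: algebra_simps)
  finally show ?thesis .
qed

context bedford_mcmullen
begin

text \<open>Limit objects, after division by \<open>n\<close>: \<open>free_count \<alpha> t\<close> is the proportion of positions below
  \<open>t n\<close> outside the target, and \<open>w t\<close> stands for the sum of the logarithmic column sizes over the
  free positions below \<open>t n\<close>.\<close>

definition free_count :: "real \<Rightarrow> real \<Rightarrow> real" where
  "free_count \<alpha> t = (if t \<le> 1 then t else if t \<le> 1 + \<alpha> then 1 else t - \<alpha>)"

definition profile_cost :: "real \<Rightarrow> real \<Rightarrow> real \<Rightarrow> real \<Rightarrow> real \<Rightarrow> (real \<Rightarrow> real) \<Rightarrow> real \<Rightarrow> real" where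
  "profile_cost \<alpha> \<kappa>m \<kappa>1 \<kappa>2 \<kappa>p w c =
     (let m = prefix_m \<alpha>; R = \<tau> + \<alpha>; f = free_count \<alpha> in
      pressure \<kappa>m * f (min c m) - \<kappa>m * w (min c m)
      + (pressure \<kappa>1 * (f (min c 1) - f (min c m)) - \<kappa>1 * (w (min c 1) - w (min c m)))
      + (pressure \<kappa>2 * (f (min c R) - f (min c 1)) - \<kappa>2 * (w (min c R) - w (min c 1)))
      + (pressure \<kappa>p * (f c - f (min c R)) - \<kappa>p * (w c - w (min c R))) + w (c / \<tau>))"

text \<open>The geometric families exist because the cost at \<open>c\<close> relates
  \<open>w c\<close> to \<open>w (c / \<tau>)\<close>: consecutive members give a recursion for the
  deviation of \<open>w\<close> from its Gibbs mean.\<close>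

definition scales :: "real \<Rightarrow> nat \<Rightarrow> real set" where
  "scales \<alpha> J = {1 + \<alpha>, \<tau> + \<alpha>} \<union> (\<lambda>j. prefix_m \<alpha> / \<tau> ^ j) ` {..J}
     \<union> (\<lambda>j. \<tau> * (1 + \<alpha>) * \<tau> ^ j) ` {..J} \<union> (\<lambda>j. \<tau> * (\<tau> + \<alpha>) * \<tau> ^ j) ` {..J}"

lemma scalesI:
  assumes "j \<le> J"
  shows "prefix_m \<alpha> / \<tau> ^ j \<in> scales \<alpha> J" "\<tau> * (1 + \<alpha>) * \<tau> ^ j \<in> scales \<alpha> J"
    "\<tau> * (\<tau> + \<alpha>) * \<tau> ^ j \<in> scales \<alpha> J"
  using assms unfolding scales_def by blast+

text \<open>By contradiction: if all scales are expensive, \<open>chain_down\<close> bounds the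
  column sum below the target from above, \<open>chain_up\<close> bounds the column sum beyond it
  from below, and the weighted sum of the inequalities at the four main scales contradicts the
  duality identity. \<open>J\<close> and \<open>\<delta>\<close> are obtained before
  \<open>w\<close>; the number \<open>B\<close> is a trivial slope of \<open>w\<close>.\<close>

lemma cheap_scale_exists:
  assumes \<alpha>: "0 < \<alpha>" and \<epsilon>: "0 < \<epsilon>" and B: "0 \<le> B"
    and opt: "optimal_data \<alpha> s0 k2 k3 k4 k5 \<phi>m \<psi>m \<phi>1 \<psi>1 \<phi>2 \<psi>2 \<phi>p \<psi>p \<kappa>m \<kappa>1 \<kappa>2 \<kappa>p"
  obtains J \<delta> where "0 < \<delta>"
    "\<And>w. \<lbrakk>\<And>t. 0 \<le> t \<Longrightarrow> 0 \<le> w t \<and> w t \<le> B * t + \<delta>; \<And>s t. 0 \<le> s \<Longrightarrow> s \<le> t \<Longrightarrow> w s \<le> w t; w (1 + \<alpha>) \<le> w 1 + \<delta>\<rbrakk>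
      \<Longrightarrow> \<exists>c\<in>scales \<alpha> J. profile_cost \<alpha> \<kappa>m \<kappa>1 \<kappa>2 \<kappa>p w c + \<delta> < (s0 + \<epsilon>) * c"
proof -
  define m where "m = prefix_m \<alpha>"
  define R0 where "R0 = \<tau> + \<alpha>"
  define L4 where "L4 = \<tau> * (1 + \<alpha>)"
  define L5 where "L5 = \<tau> * (\<tau> + \<alpha>)"
  define G3 where "G3 = k3 + k4 + k5"
  define G where "G = k2 + G3"
  define k5' where "k5' = (1 - \<kappa>p) * k5 - \<kappa>p * k4"
  define Pm where "Pm = pressure \<kappa>m"
  define P1 where "P1 = pressure \<kappa>1"
  define P2 where "P2 = pressure \<kappa>2"
  define Pp where "Pp = pressure \<kappa>p"
  note pos = tau_gt_1 \<alpha> prefix_m[OF \<alpha>, folded m_def]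
  have \<tau>0: "0 < \<tau>" using pos by simp
  have G_alt: "k2 + k3 + k4 + k5 = G" by (simp add: G_def G3_def)
  have k: "0 \<le> k2" "0 \<le> k3" "0 \<le> k4" "0 \<le> k5" "0 < G"
    and E: "G * (m * (\<phi>m + \<psi>m)) + (1 - m) * (G * \<phi>1 + G3 * \<psi>1) + (\<tau> - 1) * (G3 * \<phi>2 + k5 * \<psi>2)
      + (k4 * (\<alpha> * (\<tau> - 1)) + k5 * ((\<tau> + \<alpha>) * (\<tau> - 1))) * \<phi>p
      = s0 * (k2 * (1 + \<alpha>) + k3 * (\<tau> + \<alpha>) + k4 * L4 + k5 * L5)"
    and \<psi>: "0 \<le> \<psi>m" "0 \<le> \<psi>p"
    and \<kappa>m: "1 / \<tau> < \<kappa>m" "\<kappa>m \<le> 1" "Pm = \<phi>m + \<kappa>m * \<psi>m" "\<kappa>m < 1 \<Longrightarrow> s0 = \<phi>m + \<psi>m / \<tau>"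
    and \<kappa>1: "0 \<le> \<kappa>1" "\<kappa>1 \<le> 1" "\<kappa>1 * G = G3" "m = 1 \<or> P1 = \<phi>1 + \<kappa>1 * \<psi>1"
    and \<kappa>2: "0 \<le> \<kappa>2" "\<kappa>2 \<le> 1" "\<kappa>2 * G3 = k5" "G3 = 0 \<or> P2 = \<phi>2 + \<kappa>2 * \<psi>2"
    and \<kappa>p: "0 \<le> \<kappa>p" "\<kappa>p < 1 / \<tau>" "\<kappa>p * (k4 + k5) \<le> k5" "k4 + k5 = 0 \<or> Pp = \<phi>p + \<kappa>p * \<psi>p"
      "0 < \<kappa>p \<Longrightarrow> s0 = \<phi>p + \<psi>p / \<tau>"
    using opt unfolding optimal_data_def G_alt m_def[symmetric] G3_def[symmetric] L4_def[symmetric] L5_def[symmetric]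
      Pm_def P1_def P2_def Pp_def by blast+
  have "0 < 1 / \<tau>" using \<tau>0 by simp
  then have \<kappa>m0: "0 < \<kappa>m" using \<kappa>m(1) by (rule less_trans)
  have \<kappa>p1: "\<kappa>p < 1" using \<kappa>p(2) pos by (smt (verit) divide_le_eq_1)
  have k5': "0 \<le> k5'" using \<kappa>p(3) by (simp add: k5'_def algebra_simps)
  have Ppos: "0 \<le> Pm" "0 \<le> P1" "0 \<le> P2" "0 \<le> Pp"
    unfolding Pm_def P1_def P2_def Pp_def using \<kappa>m(1) \<kappa>1 \<kappa>2 \<kappa>p \<tau>0
    by (auto intro!: pressure_nonneg intro: less_imp_le order_less_trans[of 0 "1/\<tau>"])
  have Lpos: "1 < R0" "1 < L4" "1 < L5" "R0 < L4" "R0 < L5"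
  proof -
    show "1 < R0" using pos by (simp add: R0_def)
    have "1 * (1 + \<alpha>) < \<tau> * (1 + \<alpha>)" using pos by (intro mult_strict_right_mono) auto
    then have "1 + \<alpha> < L4" unfolding L4_def mult_1 .
    then show "1 < L4" using \<alpha> by linarith
    have "1 * (\<tau> + \<alpha>) < \<tau> * (\<tau> + \<alpha>)" using pos by (intro mult_strict_right_mono) auto
    then show "R0 < L5" by (simp add: L5_def R0_def)
    then show "1 < L5" using \<open>1 < R0\<close> by simp
    have "1 * \<alpha> < \<tau> * \<alpha>" using pos by (intro mult_strict_right_mono) auto
    then show "R0 < L4" by (simp add: L4_def R0_def algebra_simps)
  qed
  have L4R: "L4 - R0 = \<alpha> * (\<tau> - 1)" "L5 - R0 = (\<tau> + \<alpha>) * (\<tau> - 1)"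
    by (simp_all add: L4_def L5_def R0_def algebra_simps)
  \<comment> \<open>The total weight of the main scales. The assumed excess of
    \<open>\<epsilon>\<close> per unit of scale adds up to \<open>\<epsilon> * \<Lambda>\<close>, so
    positivity is essential. If only \<open>k5\<close> is positive, \<open>k5'\<close> is still
    positive because \<open>\<kappa>p < 1\<close>.\<close>
  define \<Lambda> where "\<Lambda> = k2 * (1 + \<alpha>) + k3 * (\<tau> + \<alpha>) + k4 * L4 + k5' * L5"
  have \<Lambda>: "0 < \<Lambda>"
  proof -
    have nn: "0 \<le> k2 * (1 + \<alpha>)" "0 \<le> k3 * (\<tau> + \<alpha>)" "0 \<le> k4 * L4" "0 \<le> k5' * L5"
      using k k5' pos Lpos by simp_all
    consider "0 < k2" | "0 < k3" | "0 < k4" | "k4 = 0" "0 < k5"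
      using k unfolding G_def G3_def by linarith
    then show ?thesis
    proof cases
      case 1 then have "0 < k2 * (1 + \<alpha>)" using pos by simp
      then show ?thesis using nn unfolding \<Lambda>_def by linarith
    next
      case 2 then have "0 < k3 * (\<tau> + \<alpha>)" using pos by simp
      then show ?thesis using nn unfolding \<Lambda>_def by linarith
    next
      case 3 then have "0 < k4 * L4" using Lpos by simp
      then show ?thesis using nn unfolding \<Lambda>_def by linarith
    next
      case 4 then have "0 < k5' * L5" using Lpos \<kappa>p1 by (simp add: k5'_def)
      then show ?thesis using nn unfolding \<Lambda>_def by linarith
    qed
  qed
  define W where "W = k2 + k3 + k4 + k5' + G"
  have W: "0 \<le> W" using k k5' by (simp add: W_def)
  \<comment> \<open>The error per inequality, so small that all errors together stay below the gain
    \<open>\<epsilon> * \<Lambda>\<close>.\<close>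
  define e where "e = \<epsilon> * \<Lambda> / (W + 1)"
  have e: "0 < e" using \<epsilon> \<Lambda> W by (simp add: e_def)
  have We: "W * e < \<epsilon> * \<Lambda>"
  proof -
    have "W * e < (W + 1) * e" using e by simp
    also have "\<dots> = \<epsilon> * \<Lambda>" using W by (simp add: e_def)
    finally show ?thesis .
  qed
  define C where "C = \<psi>p * L4 + \<psi>p * L5 + Pp * R0"
  have nn: "0 \<le> \<psi>p * L4" "0 \<le> \<psi>p * L5" "0 \<le> Pp * R0" using \<psi> Lpos Ppos by auto
  obtain J1 where J1: "\<And>J D. J1 \<le> J \<Longrightarrow> (\<And>j. j < J \<Longrightarrow> \<kappa>m * D j \<le> D (Suc j)) \<Longrightarrow> D J \<le> (B * m + 1) / \<tau> ^ J \<Longrightarrow> D 0 \<le> e / 2"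
    using chain_down[OF tau_gt_1 \<kappa>m(1), of "e/2" "B * m + 1"] e by auto
  obtain J2 where J2: "\<And>J D X. J2 \<le> J \<Longrightarrow> (\<And>j. j < J \<Longrightarrow> D j \<le> \<kappa>p * D (Suc j) + X) \<Longrightarrow>
    D J \<le> C * \<tau> ^ J \<Longrightarrow> - X \<le> C \<Longrightarrow> D 0 \<le> X / (1 - \<kappa>p) + e / 2"
    using chain_up[OF tau_gt_1 \<kappa>p(1,2), of "e/2" C] e by auto
  define J where "J = max J1 J2"
  have \<tau>J: "1 \<le> \<tau> ^ j" for j using pos by simp
  \<comment> \<open>The four bounds serve, in order, the inequalities at the main scales, the
    trivial bound at the lower end of the descending chain, and the absorption of
    \<open>\<delta>\<close> into \<open>\<epsilon> * c\<close> on the descending and on the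
    ascending chains.\<close>
  define \<delta> where "\<delta> = min (min (e / 4) (1 / \<tau> ^ J)) (min (\<epsilon> * m / \<tau> ^ J) \<epsilon>)"
  have \<delta>: "0 < \<delta>" "\<delta> \<le> e / 4" "\<delta> \<le> 1 / \<tau> ^ J" "\<delta> \<le> \<epsilon> * m / \<tau> ^ J" "\<delta> \<le> \<epsilon>"
  proof -
    show "0 < \<delta>" using e \<epsilon> pos by (simp add: \<delta>_def)
    show "\<delta> \<le> e / 4" "\<delta> \<le> 1 / \<tau> ^ J" "\<delta> \<le> \<epsilon> * m / \<tau> ^ J" "\<delta> \<le> \<epsilon>"
      unfolding \<delta>_def by (meson min.cobounded1 min.cobounded2 order_trans)+
  qed
  show ?thesis
  proof (rule that[of \<delta> J])
    show "0 < \<delta>" by fact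
    fix w :: "real \<Rightarrow> real"
    assume w: "\<And>t. 0 \<le> t \<Longrightarrow> 0 \<le> w t \<and> w t \<le> B * t + \<delta>" and mono: "\<And>s t. 0 \<le> s \<Longrightarrow> s \<le> t \<Longrightarrow> w s \<le> w t"
      and w1: "w (1 + \<alpha>) \<le> w 1 + \<delta>"
    show "\<exists>c\<in>scales \<alpha> J. profile_cost \<alpha> \<kappa>m \<kappa>1 \<kappa>2 \<kappa>p w c + \<delta> < (s0 + \<epsilon>) * c"
    proof (rule ccontr)
      assume "\<not> ?thesis"
      then have bad: "(s0 + \<epsilon>) * c \<le> profile_cost \<alpha> \<kappa>m \<kappa>1 \<kappa>2 \<kappa>p w c + \<delta>" if "c \<in> scales \<alpha> J" for c
        using that by force
      have w1': "w t \<le> w 1 + \<delta>" if "0 \<le> t" "t \<le> 1 + \<alpha>" for t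
        using mono[OF that] w1 by linarith
      define S0 where "S0 = w m"
      define S1 where "S1 = w 1 - w m"
      define S2 where "S2 = w R0 - w 1"
      have S: "0 \<le> S0" "0 \<le> S1" "0 \<le> S2"
        using w[of m] mono[of m 1] mono[of 1 R0] pos Lpos by (auto simp: S0_def S1_def S2_def)
      define F2 where "F2 = Pm * m + (1 - \<kappa>m) * S0 + (1 - m) * P1 - \<kappa>1 * S1"
      define F3 where "F3 = F2 + S1 + (\<tau> - 1) * P2 - \<kappa>2 * S2"
      define X where "X = F3 + S2"
      have fc: "free_count \<alpha> m = m" "free_count \<alpha> 1 = 1" "free_count \<alpha> (1 + \<alpha>) = 1" "free_count \<alpha> R0 = \<tau>"
        using pos by (auto simp: free_count_def R0_def)
      have b2: "(s0 + \<epsilon>) * (1 + \<alpha>) \<le> F2 + e"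
      proof -
        have mn: "min (1 + \<alpha>) m = m" "min (1 + \<alpha>) 1 = 1" "min (1 + \<alpha>) R0 = 1 + \<alpha>"
          using pos by (auto simp: R0_def)
        \<comment> \<open>If \<open>m = 1\<close>, the point \<open>(1 + \<alpha>) / \<tau>\<close>
          lies inside the target, where \<open>w\<close> hardly grows; otherwise it is
          \<open>m\<close> itself.\<close>
        have "w ((1 + \<alpha>) / \<tau>) \<le> S0 + \<delta>"
        proof (cases "m = 1")
          case True
          have "(1 + \<alpha>) / \<tau> \<le> 1 + \<alpha>" using pos by (simp add: pos_divide_le_eq mult_le_cancel_left1)
          then show ?thesis using w1'[of "(1 + \<alpha>) / \<tau>"] True pos by (simp add: S0_def)
        next
          case False
          then show ?thesis using pos \<delta> by (auto simp: S0_def)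
        qed
        moreover have "0 \<le> \<kappa>2 * (w (1 + \<alpha>) - w 1)" using \<kappa>2 mono[of 1 "1 + \<alpha>"] pos by simp
        moreover have "profile_cost \<alpha> \<kappa>m \<kappa>1 \<kappa>2 \<kappa>p w (1 + \<alpha>) = Pm * m - \<kappa>m * S0 + (P1 * (1 - m) - \<kappa>1 * S1)
          - \<kappa>2 * (w (1 + \<alpha>) - w 1) + w ((1 + \<alpha>) / \<tau>)"
          unfolding profile_cost_def Let_def m_def[symmetric] R0_def[symmetric] mn fc
          by (simp add: S0_def S1_def Pm_def P1_def)
        moreover have "Pm * m - \<kappa>m * S0 + (P1 * (1 - m) - \<kappa>1 * S1) + S0 = F2"
          by (simp add: F2_def algebra_simps)
        ultimately show ?thesis using bad[of "1 + \<alpha>"] \<delta> e by (simp add: scales_def)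
      qed
      have b3: "(s0 + \<epsilon>) * R0 \<le> F3 + e"
      proof -
        have mn: "min R0 m = m" "min R0 1 = 1" "min R0 R0 = R0" using pos Lpos by auto
        have "R0 / \<tau> \<le> 1 + \<alpha>" using pos mult_right_mono[of 1 \<tau> \<alpha>] by (simp add: R0_def pos_divide_le_eq algebra_simps)
        moreover have "0 \<le> R0 / \<tau>" using Lpos \<tau>0 by simp
        ultimately have "w (R0 / \<tau>) \<le> S0 + S1 + \<delta>" using w1'[of "R0 / \<tau>"] by (simp add: S0_def S1_def)
        moreover have "profile_cost \<alpha> \<kappa>m \<kappa>1 \<kappa>2 \<kappa>p w R0 = Pm * m - \<kappa>m * S0 + (P1 * (1 - m) - \<kappa>1 * S1)
          + (P2 * (\<tau> - 1) - \<kappa>2 * S2) + w (R0 / \<tau>)"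
          unfolding profile_cost_def Let_def m_def[symmetric] R0_def[symmetric] mn fc
          by (simp add: S0_def S1_def S2_def Pm_def P1_def P2_def)
        moreover have "Pm * m - \<kappa>m * S0 + (P1 * (1 - m) - \<kappa>1 * S1) + (P2 * (\<tau> - 1) - \<kappa>2 * S2) + (S0 + S1) = F3"
          by (simp add: F2_def F3_def algebra_simps)
        ultimately show ?thesis using bad[of R0] \<delta> e by (simp add: scales_def R0_def)
      qed
      have pc: "profile_cost \<alpha> \<kappa>m \<kappa>1 \<kappa>2 \<kappa>p w c = X - w R0 + Pp * (c - R0) - \<kappa>p * (w c - w R0) + w (c / \<tau>)"
        if c: "R0 \<le> c" "1 + \<alpha> < c" for c
      proof -
        have mn: "min c m = m" "min c 1 = 1" "min c R0 = R0" using pos Lpos c by auto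
        have fcc: "free_count \<alpha> c = c - \<alpha>" using c pos by (simp add: free_count_def)
        have "profile_cost \<alpha> \<kappa>m \<kappa>1 \<kappa>2 \<kappa>p w c = Pm * m - \<kappa>m * S0 + (P1 * (1 - m) - \<kappa>1 * S1)
          + (P2 * (\<tau> - 1) - \<kappa>2 * S2) + (Pp * (c - \<alpha> - \<tau>) - \<kappa>p * (w c - w R0)) + w (c / \<tau>)"
          unfolding profile_cost_def Let_def m_def[symmetric] R0_def[symmetric] mn fc fcc
          by (simp add: S0_def S1_def S2_def Pm_def P1_def P2_def Pp_def)
        moreover have "Pm * m - \<kappa>m * S0 + (P1 * (1 - m) - \<kappa>1 * S1) + (P2 * (\<tau> - 1) - \<kappa>2 * S2) = X - w R0"
          by (simp add: X_def F2_def F3_def S0_def S1_def S2_def algebra_simps)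
        ultimately show ?thesis by (simp add: R0_def algebra_simps)
      qed
      define X1 where "X1 = X - Pp * R0"
      define Y where "Y = X1 / (1 - \<kappa>p)"
      have Y: "(1 - \<kappa>p) * Y = X - Pp * R0" using \<kappa>p1 by (simp add: Y_def X1_def)
      have X0: "0 \<le> X"
      proof -
        have "X = Pm * m + (1 - m) * P1 + (\<tau> - 1) * P2 + (1 - \<kappa>m) * S0 + (1 - \<kappa>1) * S1 + (1 - \<kappa>2) * S2"
          by (simp add: X_def F2_def F3_def algebra_simps)
        also have "\<dots> \<ge> 0" using Ppos S pos \<kappa>m \<kappa>1 \<kappa>2 by (intro add_nonneg_nonneg mult_nonneg_nonneg) auto
        finally show ?thesis .
      qed
      have chain: "\<psi>p * L - (w L - w R0) \<le> Y + e / 2"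
        if L: "L = L4 \<or> L = L5" and \<kappa>pos: "0 < \<kappa>p" and k45: "k4 + k5 \<noteq> 0" for L
      proof -
        have PpE: "Pp = \<phi>p + \<kappa>p * \<psi>p" using \<kappa>p(4) k45 by blast
        have s0E: "s0 = \<phi>p + \<psi>p / \<tau>" using \<kappa>p(5) \<kappa>pos by blast
        have L0: "1 < L" "R0 < L" "1 + \<alpha> < \<tau> * L" using L Lpos pos by (auto simp: R0_def mult.commute intro: less_trans[of _ "L4"] less_trans[of _ "L5"] mult_strict_mono[of 1 \<tau>, simplified])
        \<comment> \<open>The deficit of the column sum beyond \<open>R0\<close> with respect to the
          linear growth of slope \<open>\<psi>p\<close>. Being expensive at scale
          \<open>L * \<tau> ^ Suc j\<close> is exactly the recursion of \<open>chain_up\<close>,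
          because \<open>s0 = \<phi>p + \<psi>p / \<tau>\<close> cancels the linear terms.\<close>
        define D where "D j = \<psi>p * (L * \<tau> ^ j) - (w (L * \<tau> ^ j) - w R0)" for j
        have "D 0 \<le> X1 / (1 - \<kappa>p) + e / 2"
        proof (rule J2[of J])
          show "J2 \<le> J" by (simp add: J_def)
          have Lj: "L * 1 \<le> L * \<tau> ^ j" for j using L0 \<tau>J[of j] by (intro mult_left_mono) auto
          show "D j \<le> \<kappa>p * D (Suc j) + X1" if j: "j < J" for j
          proof -
            define c where "c = L * \<tau> ^ Suc j"
            have c\<tau>: "c / \<tau> = L * \<tau> ^ j" using \<tau>0 by (simp add: c_def)
            have cR: "R0 \<le> c" "1 \<le> c" using Lj[of "Suc j"] L0 unfolding c_def mult_1_right by linarith+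
            have "1 + \<alpha> < c"
            proof -
              have "\<tau> * L \<le> c" using Lj[of j] \<tau>0 by (simp add: c_def)
              then show ?thesis using L0 by simp
            qed
            have "c \<in> scales \<alpha> J"
              using L scalesI(2,3)[of "Suc j" J \<alpha>] j unfolding c_def L4_def L5_def by (metis Suc_leI)
            then have "(s0 + \<epsilon>) * c \<le> X - w R0 + Pp * (c - R0) - \<kappa>p * (w c - w R0) + w (c / \<tau>) + \<delta>"
              using bad pc[OF cR(1) \<open>1 + \<alpha> < c\<close>] by metis
            moreover have "\<delta> \<le> \<epsilon> * c" using \<delta>(5) \<epsilon> mult_left_mono[OF cR(2), of \<epsilon>] by linarith
            moreover have "\<psi>p * (L * \<tau> ^ j) = \<psi>p / \<tau> * c" unfolding c\<tau>[symmetric] by simp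
            ultimately show ?thesis
              unfolding D_def c\<tau>[symmetric] c_def[symmetric] X1_def PpE s0E
              by (simp add: algebra_simps)
          qed
          have "D J \<le> \<psi>p * (L * \<tau> ^ J)"
            using mono[of R0 "L * \<tau> ^ J"] Lj[of J] L0 Lpos by (simp add: D_def)
          also have "\<dots> = (\<psi>p * L) * \<tau> ^ J" by simp
          also have "\<dots> \<le> C * \<tau> ^ J"
            using L nn \<tau>J[of J] by (intro mult_right_mono) (auto simp: C_def)
          finally show "D J \<le> C * \<tau> ^ J" .
          show "- X1 \<le> C" using X0 nn by (simp add: X1_def C_def)
        qed
        then show ?thesis by (simp add: D_def Y_def)
      qed
      have chain': "- \<kappa>p * (w L - w R0) \<le> - \<kappa>p * \<psi>p * L + \<kappa>p * Y + e / 2"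
        if L: "L = L4 \<or> L = L5" and k45: "k4 + k5 \<noteq> 0" for L
      proof (cases "\<kappa>p = 0")
        case True then show ?thesis using e by simp
      next
        case False
        then have "0 < \<kappa>p" using \<kappa>p by simp
        then have "\<kappa>p * (\<psi>p * L - (w L - w R0)) \<le> \<kappa>p * (Y + e / 2)"
          using chain[OF L _ k45] by (intro mult_left_mono) auto
        moreover have "\<kappa>p * (e / 2) \<le> e / 2" using \<kappa>p1 e by (simp add: mult_le_cancel_right1)
        ultimately show ?thesis by (simp add: algebra_simps)
      qed
      have b4: "(s0 + \<epsilon>) * L4 \<le> F3 + Pp * (L4 - R0) - \<kappa>p * \<psi>p * L4 + \<kappa>p * Y + e" if "k4 + k5 \<noteq> 0"
      proof -
        have "L4 \<in> scales \<alpha> J" using scalesI(2)[of 0 J \<alpha>] by (simp add: L4_def)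
        moreover have "1 + \<alpha> < L4" using pos by (simp add: L4_def)
        moreover have "w (L4 / \<tau>) \<le> w 1 + \<delta>" using w1 \<tau>0 by (simp add: L4_def)
        moreover have "X - w R0 + w 1 = F3" by (simp add: X_def S2_def)
        ultimately show ?thesis using bad[of L4] pc[of L4] Lpos chain'[of L4] that \<delta> e by simp
      qed
      have b5: "(s0 + \<epsilon>) * L5 \<le> X + Pp * (L5 - R0) - \<kappa>p * \<psi>p * L5 + \<kappa>p * Y + e" if "k4 + k5 \<noteq> 0"
      proof -
        have "L5 \<in> scales \<alpha> J" using scalesI(3)[of 0 J \<alpha>] by (simp add: L5_def)
        moreover have "1 + \<alpha> < L5" using pos Lpos by (simp add: R0_def)
        moreover have "w (L5 / \<tau>) = w R0" using \<tau>0 by (simp add: L5_def R0_def)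
        ultimately show ?thesis using bad[of L5] pc[of L5] Lpos chain'[of L5] that \<delta> e by simp
      qed
      have S0b: "(1 - \<kappa>m) * S0 \<le> (1 - \<kappa>m) * (m * \<psi>m) + e"
      proof (cases "\<kappa>m = 1")
        case True then show ?thesis using e by simp
      next
        case False
        then have "\<kappa>m < 1" using \<kappa>m by simp
        then have s0E: "s0 = \<phi>m + \<psi>m / \<tau>" using \<kappa>m by blast
        \<comment> \<open>The excess of the column sum over the linear growth of slope
          \<open>\<psi>m\<close>; here \<open>s0 = \<phi>m + \<psi>m / \<tau>\<close> cancels the
          linear terms.\<close>
        define D where "D j = w (m / \<tau> ^ j) - \<psi>m * (m / \<tau> ^ j)" for j
        have "D 0 \<le> e / 2"
        proof (rule J1[of J])
          show "J1 \<le> J" by (simp add: J_def)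
          show "\<kappa>m * D j \<le> D (Suc j)" if j: "j < J" for j
          proof -
            define c where "c = m / \<tau> ^ j"
            have c\<tau>: "m / \<tau> ^ Suc j = c / \<tau>" by (simp add: c_def mult.commute)
            have c0: "0 < c" using pos by (simp add: c_def)
            have cm: "c \<le> m" using pos \<tau>J[of j] by (simp add: c_def pos_divide_le_eq mult_le_cancel_left1)
            have mn: "min c m = c" "min c 1 = c" "min c R0 = c" using cm pos Lpos by auto
            have "free_count \<alpha> c = c" using cm pos by (simp add: free_count_def)
            then have "profile_cost \<alpha> \<kappa>m \<kappa>1 \<kappa>2 \<kappa>p w c = Pm * c - \<kappa>m * w c + w (c / \<tau>)"
              unfolding profile_cost_def Let_def m_def[symmetric] R0_def[symmetric] mn by (simp add: Pm_def)
            moreover have "c \<in> scales \<alpha> J" using scalesI(1)[of j J \<alpha>] j by (simp add: c_def m_def)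
            ultimately have "(s0 + \<epsilon>) * c \<le> Pm * c - \<kappa>m * w c + w (c / \<tau>) + \<delta>" using bad by metis
            moreover have "\<delta> \<le> \<epsilon> * c"
            proof -
              have "m / \<tau> ^ J \<le> c" unfolding c_def using j pos by (intro divide_left_mono power_increasing) auto
              then have "\<epsilon> * (m / \<tau> ^ J) \<le> \<epsilon> * c" using \<epsilon> by (intro mult_left_mono) auto
              then show ?thesis using \<delta>(4) by simp
            qed
            ultimately show ?thesis
              unfolding D_def c\<tau> c_def[symmetric] \<kappa>m(3) s0E by (simp add: algebra_simps)
          qed
          have "w (m / \<tau> ^ J) \<le> B * (m / \<tau> ^ J) + 1 / \<tau> ^ J"
            using w[of "m / \<tau> ^ J"] pos \<delta>(3) by simp
          moreover have "0 \<le> \<psi>m * (m / \<tau> ^ J)" using \<psi> pos by simp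
          ultimately show "D J \<le> (B * m + 1) / \<tau> ^ J" by (simp add: D_def add_divide_distrib)
        qed
        then have "S0 \<le> m * \<psi>m + e / 2" by (simp add: D_def S0_def mult.commute)
        then have "(1 - \<kappa>m) * S0 \<le> (1 - \<kappa>m) * (m * \<psi>m + e / 2)" using \<kappa>m by (intro mult_left_mono) auto
        moreover have "(1 - \<kappa>m) * (e / 2) \<le> 1 * e"
          using \<kappa>m(2) \<kappa>m0 e by (intro mult_mono) auto
        ultimately show ?thesis by (simp add: distrib_left)
      qed
      have R: "\<tau> + \<alpha> = R0" by (simp add: R0_def)
      \<comment> \<open>If \<open>k4 + k5 = 0\<close>, no Gibbs relation for \<open>pp\<close> is
        available and the bounds may fail. The values are then replaced by the right-hand sides;
        they enter with weight zero.\<close>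
      define t4 where "t4 = (if k4 + k5 = 0 then F3 + Pp * (L4 - R0) - \<kappa>p * \<psi>p * L4 + \<kappa>p * Y + e else (s0 + \<epsilon>) * L4)"
      define t5 where "t5 = (if k4 + k5 = 0 then X + Pp * (L5 - R0) - \<kappa>p * \<psi>p * L5 + \<kappa>p * Y + e else (s0 + \<epsilon>) * L5)"
      have "k2 * ((s0 + \<epsilon>) * (1 + \<alpha>)) + k3 * ((s0 + \<epsilon>) * R0) + k4 * t4 + k5' * t5
        \<le> s0 * (k2 * (1 + \<alpha>) + k3 * R0 + k4 * L4 + k5' * L5) + (k2 + k3 + k4 + k5' + G) * e"
      proof (rule combine_scales[OF k(1-3) k5' G3_def G_def less_imp_le[OF k(5)] k5'_def _ \<kappa>m(3) _ \<kappa>1(3) _ \<kappa>2(3) _ _ _ F2_def F3_def X_def Y b2 b3 _ _ S0b])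
        show "G * (m * (\<phi>m + \<psi>m)) + (1 - m) * (G * \<phi>1 + G3 * \<psi>1) + (\<tau> - 1) * (G3 * \<phi>2 + k5 * \<psi>2)
          + (k4 * (L4 - R0) + k5 * (L5 - R0)) * \<phi>p = s0 * (k2 * (1 + \<alpha>) + k3 * R0 + k4 * L4 + k5 * L5)"
          using E unfolding L4R R .
        show "(1 - m) * P1 = (1 - m) * (\<phi>1 + \<kappa>1 * \<psi>1)" using \<kappa>1(4) by auto
        show "G3 * P2 = G3 * (\<phi>2 + \<kappa>2 * \<psi>2)" using \<kappa>2(4) by auto
        have "k4 = 0 \<and> k5 = 0 \<or> Pp = \<phi>p + \<kappa>p * \<psi>p" using \<kappa>p(4) k by auto
        then show "k4 * Pp = k4 * (\<phi>p + \<kappa>p * \<psi>p)" "k5 * Pp = k5 * (\<phi>p + \<kappa>p * \<psi>p)" by auto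
        show "\<kappa>p * (\<psi>p * R0 + \<phi>p * L5) = \<kappa>p * (L5 * s0)"
        proof (cases "\<kappa>p = 0")
          case False
          then have "s0 = \<phi>p + \<psi>p / \<tau>" using \<kappa>p by simp
          then have "L5 * s0 = \<psi>p * R0 + \<phi>p * L5"
          proof -
            have \<tau>s0: "\<tau> * s0 = \<psi>p + \<tau> * \<phi>p"
              using \<tau>0 by (simp add: \<open>s0 = \<phi>p + \<psi>p / \<tau>\<close> distrib_left)
            have "L5 * s0 = R0 * (\<tau> * s0)" by (simp add: L5_def R0_def)
            then show ?thesis unfolding \<tau>s0 by (simp add: L5_def R0_def algebra_simps)
          qed
          then show ?thesis by simp
        qed simp
        show "t4 \<le> F3 + Pp * (L4 - R0) - \<kappa>p * \<psi>p * L4 + \<kappa>p * Y + e" using b4 by (simp add: t4_def)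
        show "t5 \<le> X + Pp * (L5 - R0) - \<kappa>p * \<psi>p * L5 + \<kappa>p * Y + e" using b5 by (simp add: t5_def)
      qed
      moreover have "k4 * t4 = k4 * ((s0 + \<epsilon>) * L4)" "k5' * t5 = k5' * ((s0 + \<epsilon>) * L5)"
      proof -
        have "k4 = 0 \<and> k5' = 0" if "k4 + k5 = 0"
        proof -
          have "k4 = 0" "k5 = 0" using that k by linarith+
          then show ?thesis by (simp add: k5'_def)
        qed
        then show "k4 * t4 = k4 * ((s0 + \<epsilon>) * L4)" "k5' * t5 = k5' * ((s0 + \<epsilon>) * L5)"
          by (auto simp: t4_def t5_def)
      qed
      ultimately have "(s0 + \<epsilon>) * \<Lambda> \<le> s0 * \<Lambda> + W * e"
        unfolding \<Lambda>_def W_def R[symmetric] by (simp add: algebra_simps)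
      then show False using We by (simp add: distrib_right)
    qed
  qed
qed

end

section \<open>Sums over the naturals below a real bound\<close>

definition csum :: "(nat \<Rightarrow> real) \<Rightarrow> real \<Rightarrow> real" where
  "csum v r = (\<Sum>i<nat \<lceil>r\<rceil>. v i)"

lemma csum_of_nat [simp]: "csum v (real L) = (\<Sum>i<L. v i)"
  by (simp add: csum_def)

lemma csum_mono:
  assumes "\<And>i. 0 \<le> v i" "r \<le> s" shows "csum v r \<le> csum v s"
  unfolding csum_def using assms(1) nat_mono[OF ceiling_mono[OF assms(2)]]
  by (intro sum_mono2) auto

lemma csum_nonneg: "(\<And>i. 0 \<le> v i) \<Longrightarrow> 0 \<le> csum v r"
  unfolding csum_def by (simp add: sum_nonneg)

lemma csum_diff:
  assumes "r \<le> s" shows "csum v s - csum v r = (\<Sum>i\<in>{nat \<lceil>r\<rceil>..<nat \<lceil>s\<rceil>}. v i)"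
proof -
  have "nat \<lceil>r\<rceil> \<le> nat \<lceil>s\<rceil>" by (rule nat_mono[OF ceiling_mono[OF assms]])
  then show ?thesis unfolding csum_def lessThan_atLeast0
    using sum.atLeastLessThan_concat[of 0 "nat \<lceil>r\<rceil>" "nat \<lceil>s\<rceil>" v] by simp
qed

lemma csum_diff_le:
  assumes v: "\<And>i. v i \<le> B" and B: "0 \<le> B" and rs: "0 \<le> r" "r \<le> s"
  shows "csum v s - csum v r \<le> B * (s - r + 1)"
proof -
  have "csum v s - csum v r \<le> (\<Sum>i\<in>{nat \<lceil>r\<rceil>..<nat \<lceil>s\<rceil>}. B)"
    unfolding csum_diff[OF rs(2)] using v by (rule sum_mono)
  also have "\<dots> = B * real (nat \<lceil>s\<rceil> - nat \<lceil>r\<rceil>)" by simp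
  also have "real (nat \<lceil>s\<rceil> - nat \<lceil>r\<rceil>) \<le> s - r + 1" using rs by linarith
  finally show ?thesis using B by (simp add: mult_left_mono)
qed

lemma csum_abs_diff_le:
  assumes v: "\<And>i. 0 \<le> v i" "\<And>i. v i \<le> B" and rs: "0 \<le> r" "0 \<le> s" "\<bar>r - s\<bar> \<le> 1"
  shows "\<bar>csum v r - csum v s\<bar> \<le> 2 * B"
proof -
  have B: "0 \<le> B" using v(1)[of 0] v(2)[of 0] by linarith
  have *: "\<bar>csum v r - csum v s\<bar> \<le> 2 * B" if "0 \<le> r" "r \<le> s" "s - r \<le> 1" for r s
  proof -
    have "csum v s - csum v r \<le> B * (s - r + 1)" using csum_diff_le[OF v(2) B that(1,2)] .
    also have "\<dots> \<le> B * 2" using B that by (intro mult_left_mono) auto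
    finally show ?thesis using csum_mono[OF v(1) that(2)] by simp
  qed
  show ?thesis using *[of r s] *[of s r] rs by (cases "r \<le> s") auto
qed

definition step3 :: "real \<Rightarrow> real \<Rightarrow> real \<Rightarrow> 'a \<Rightarrow> 'a \<Rightarrow> 'a \<Rightarrow> 'a \<Rightarrow> nat \<Rightarrow> 'a" where
  "step3 a1 a2 a3 x1 x2 x3 x4 i =
     (if real i < a1 then x1 else if real i < a2 then x2 else if real i < a3 then x3 else x4)"

lemma csum_min_Suc: "csum v (min (real (Suc L)) a) = csum v (min (real L) a) + (if real L < a then v L else 0)"
proof (cases "real L < a")
  case True
  have "\<lceil>min (real (Suc L)) a\<rceil> = int (Suc L)" using True by (auto simp: ceiling_eq_iff min_def)
  then have "nat \<lceil>min (real (Suc L)) a\<rceil> = Suc L" by simp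
  moreover have "min (real L) a = real L" using True by simp
  ultimately show ?thesis using True by (simp add: csum_def del: of_nat_Suc)
next
  case False
  then show ?thesis by (simp add: min_def)
qed

lemma sum_step3:
  assumes "a1 \<le> a2" "a2 \<le> a3"
  shows "(\<Sum>i<L. step3 a1 a2 a3 x1 x2 x3 x4 i * v i) =
    x1 * csum v (min (real L) a1) + x2 * (csum v (min (real L) a2) - csum v (min (real L) a1))
    + x3 * (csum v (min (real L) a3) - csum v (min (real L) a2)) + x4 * (csum v (real L) - csum v (min (real L) a3))"
proof (induction L)
  case 0
  then show ?case by (simp add: csum_def min_def)
next
  case (Suc L)
  have S: "csum v (real (Suc L)) = csum v (real L) + v L" unfolding csum_of_nat by simp
  have "(\<Sum>i<Suc L. step3 a1 a2 a3 x1 x2 x3 x4 i * v i) =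
    (\<Sum>i<L. step3 a1 a2 a3 x1 x2 x3 x4 i * v i) + step3 a1 a2 a3 x1 x2 x3 x4 L * v L" by simp
  then show ?case unfolding Suc.IH csum_min_Suc S using assms
    by (auto simp: step3_def algebra_simps)
qed

text \<open>With an integral bound and \<open>f\<close> in place of \<open>\<alpha> * n\<close> the
  formula is exact. Rounding \<open>r\<close> up and replacing \<open>f\<close> cause the
  error.\<close>

lemma target_count:
  fixes n f :: nat and \<alpha> r :: real
  defines "cn \<equiv> (\<lambda>i. if i \<in> {n..<n+f} then 0 else 1 :: real)"
  assumes "0 \<le> r" "0 < n"
  shows "\<bar>csum cn r - (min r n + max 0 (r - n - \<alpha> * n))\<bar> \<le> \<bar>real f - \<alpha> * n\<bar> + 2"
proof -
  have c: "(\<Sum>i<K. cn i) = min (real K) n + max 0 (real K - n - f)" for K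
  proof (induction K)
    case (Suc K)
    then show ?case by (auto simp: cn_def)
  qed simp
  have "r \<le> real (nat \<lceil>r\<rceil>)" "real (nat \<lceil>r\<rceil>) \<le> r + 1" using assms by linarith+
  then show ?thesis unfolding csum_def c by linarith
qed

context bedford_mcmullen
begin

lemma sum_lev: "(\<Sum>i<lev L. v i) = csum v (real L / \<tau>)"
  by (simp add: csum_def lev_def)

text \<open>The classical covering of the carpet: the exponent \<open>1 / \<tau>\<close> makes the
  column sums telescope over the levels \<open>n\<close>, \<open>lev n\<close>,
  \<open>lev (lev n)\<close> and so on. If all these levels were expensive, the rescaled column sums
  would grow by a fixed multiple of \<open>n\<close> at each step, although they are at most
  \<open>2 * ln M * n\<close>.\<close>

lemma whole_carpet_zero:
  assumes s0: "\<And>p. p \<in> \<Upsilon> \<Longrightarrow> h\<^sub>r p + hc p / \<tau> \<le> d * ln (real N)" and d: "0 \<le> d" "d < s"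
  shows "hausdorff_measure s carpet = 0"
proof -
  define \<sigma> where "\<sigma> = (d + s) / 2"
  have \<sigma>: "d < \<sigma>" "\<sigma> < s" "0 \<le> \<sigma>" using d by (auto simp: \<sigma>_def)
  define \<epsilon> where "\<epsilon> = (\<sigma> - d) * ln (real N)"
  have \<epsilon>: "0 < \<epsilon>" using \<sigma> ln_N_pos by (simp add: \<epsilon>_def)
  have \<tau>0: "0 < \<tau>" using tau_gt_1 by simp
  obtain p where "p \<in> \<Upsilon>" "h\<^sub>r p + 1 / \<tau> * hc p = pressure (1 / \<tau>)" using pressure_attained by blast
  then have P: "pressure (1 / \<tau>) \<le> d * ln (real N)" using s0[of p] by simp
  define g where "g n j = (lev ^^ j) n" for n j
  have gS: "g n (Suc j) = lev (g n j)" for n j by (simp add: g_def)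
  have lev_ge: "real L / \<tau> \<le> real (lev L)" for L unfolding lev_def by linarith
  have lev_le': "real (lev L) \<le> real L / \<tau> + 1" for L 
  proof -
    have "0 \<le> real L / \<tau>" using \<tau>0 by simp
    then show ?thesis unfolding lev_def by linarith
  qed
  have g_ge: "real n \<le> real (g n j) * \<tau> ^ j" for n j
  proof (induction j)
    case 0 then show ?case by (simp add: g_def)
  next
    case (Suc j)
    have "real (g n j) \<le> real (g n (Suc j)) * \<tau>"
      using lev_ge[of "g n j"] \<tau>0 unfolding gS by (simp add: pos_divide_le_eq)
    then have "real (g n j) * \<tau> ^ j \<le> real (g n (Suc j)) * \<tau> * \<tau> ^ j" using \<tau>0 by (intro mult_right_mono) auto
    then show ?case using Suc by (simp add: mult.assoc)
  qed
  \<comment> \<open>The sum of the geometric series with ratio \<open>1 / \<tau>\<close>: the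
    accumulated effect of the ceilings in the iterates of \<open>lev\<close>.\<close>
  define K where "K = \<tau> / (\<tau> - 1)"
  have K: "0 < K" "K / \<tau> + 1 = K" using tau_gt_1 by (auto simp: K_def field_simps)
  have g_le: "real (g n j) \<le> real n / \<tau> ^ j + K" for n j
  proof (induction j)
    case 0 then show ?case using K by (simp add: g_def)
  next
    case (Suc j)
    have "real (g n (Suc j)) \<le> real (g n j) / \<tau> + 1" unfolding gS by (rule lev_le')
    also have "\<dots> \<le> (real n / \<tau> ^ j + K) / \<tau> + 1" using Suc \<tau>0 by (intro add_right_mono divide_right_mono) auto
    also have "\<dots> = real n / \<tau> ^ Suc j + (K / \<tau> + 1)" by (simp add: add_divide_distrib mult.commute)
    finally show ?case using K by simp
  qed
  have "0 < \<epsilon> * \<tau>" using \<epsilon> \<tau>0 by simp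
  \<comment> \<open>With this many levels the forced growth exceeds the trivial bound on the column
    sum.\<close>
  then obtain J :: nat where J: "2 * ln (real M) < real J * (\<epsilon> * \<tau>)"
    using reals_Archimedean3[of "\<epsilon> * \<tau>"] by blast
  have lnM: "0 \<le> ln (real M)" using M_pos N_ge_2 N_less_M by simp
  show ?thesis
  proof (rule limsup_cheap_squares_zero[where \<sigma> = \<sigma> and c = "1 / \<tau> ^ J" and J = "Suc J" and g = g and \<kappa> = "\<lambda>_ _. 1 / \<tau>"
        and I = "\<lambda>_. {}" and t = "\<lambda>_ _. undefined"])
    show "0 \<le> \<sigma>" "\<sigma> < s" "0 < 1 / \<tau> ^ J" "0 < Suc J" using \<sigma> \<tau>0 by auto
    show "1 / \<tau> ^ J * real n \<le> real (g n j)" if "j < Suc J" for n j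
    proof -
      have "real (g n j) * \<tau> ^ j \<le> real (g n j) * \<tau> ^ J"
        using that tau_gt_1 by (intro mult_left_mono power_increasing) auto
      then have "real n \<le> real (g n j) * \<tau> ^ J" using g_ge[of n j] by simp
      then show ?thesis using \<tau>0 by (simp add: pos_divide_le_eq)
    qed
    fix y assume y: "y \<in> carpet"
    define v where "v i = u (fst (itin y i))" for i
    have v: "0 \<le> v i" "v i \<le> ln (real M)" for i
      using u_nonneg u_le fst_itin_in_S[OF y] by (auto simp: v_def)
    obtain n1 where n1: "K * \<tau> ^ J < real n1" using reals_Archimedean2 by blast
    have ex: "\<exists>j<Suc J. cost (\<lambda>_. 1 / \<tau>) {} (g n j) y \<le> \<sigma> * real (g n j) * ln (real N)" if n: "n1 \<le> n" for n
    proof (rule ccontr)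
      assume "\<not> ?thesis"
      then have bad: "\<sigma> * real (g n j) * ln (real N) < cost (\<lambda>_. 1 / \<tau>) {} (g n j) y" if "j < Suc J" for j
        using that by force
      have cost: "cost (\<lambda>_. 1 / \<tau>) {} L y = pressure (1 / \<tau>) * real L - (\<Sum>i<L. v i) / \<tau> + (\<Sum>i<lev L. v i)" for L
        by (simp add: cost_def v_def sum_subtractf sum_divide_distrib)
      \<comment> \<open>Multiplication by \<open>\<tau> ^ j\<close> makes consecutive levels
        comparable: an expensive level \<open>j\<close> gives
        \<open>V (Suc j) \<ge> V j + \<epsilon> * \<tau> * n\<close>.\<close>
      define V where "V j = (\<Sum>i<g n j. v i) * \<tau> ^ j" for j
      have "real j * (\<epsilon> * \<tau> * real n) \<le> V j" if "j \<le> Suc J" for j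
        using that
      proof (induction j)
        case 0 then show ?case using v by (simp add: V_def sum_nonneg)
      next
        case (Suc j)
        have "\<sigma> * real (g n j) * ln (real N) < pressure (1 / \<tau>) * real (g n j) - (\<Sum>i<g n j. v i) / \<tau> + (\<Sum>i<g n (Suc j). v i)"
          using bad[of j] Suc.prems unfolding cost gS by simp
        moreover have "pressure (1 / \<tau>) * real (g n j) \<le> d * ln (real N) * real (g n j)"
          using P by (intro mult_right_mono) auto
        ultimately have "(\<Sum>i<g n j. v i) / \<tau> + \<epsilon> * real (g n j) \<le> (\<Sum>i<g n (Suc j). v i)"
          by (simp add: \<epsilon>_def algebra_simps)
        then have "((\<Sum>i<g n j. v i) / \<tau> + \<epsilon> * real (g n j)) * \<tau> ^ Suc j \<le> V (Suc j)"
          unfolding V_def using \<tau>0 by (intro mult_right_mono) auto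
        moreover have "((\<Sum>i<g n j. v i) / \<tau> + \<epsilon> * real (g n j)) * \<tau> ^ Suc j = V j + \<epsilon> * \<tau> * (real (g n j) * \<tau> ^ j)"
          using \<tau>0 by (simp add: V_def field_simps)
        moreover have "\<epsilon> * \<tau> * real n \<le> \<epsilon> * \<tau> * (real (g n j) * \<tau> ^ j)"
          using g_ge[of n j] \<epsilon> \<tau>0 by (intro mult_left_mono) auto
        ultimately show ?case using Suc by (simp add: algebra_simps)
      qed
      from this[of J] have "real J * (\<epsilon> * \<tau> * real n) \<le> V J" by simp
      also have "V J \<le> ln (real M) * real (g n J) * \<tau> ^ J"
        unfolding V_def using sum_bounded_above[of "{..<g n J}" v "ln (real M)"] v \<tau>0
        by (intro mult_right_mono) (auto simp: mult.commute)
      also have "\<dots> \<le> ln (real M) * ((real n / \<tau> ^ J + K) * \<tau> ^ J)"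
        unfolding mult.assoc using lnM g_le[of n J] \<tau>0 by (intro mult_left_mono mult_right_mono) auto
      also have "(real n / \<tau> ^ J + K) * \<tau> ^ J = real n + K * \<tau> ^ J" using \<tau>0 by (simp add: distrib_right)
      also have "ln (real M) * (real n + K * \<tau> ^ J) \<le> ln (real M) * (2 * real n)"
        using n n1 lnM by (intro mult_left_mono) auto
      also have "\<dots> < real J * (\<epsilon> * \<tau>) * real n"
      proof -
        have "0 < real n" using n n1 K \<tau>0 by (smt (verit) mult_pos_pos of_nat_mono zero_less_power)
        then have "2 * ln (real M) * real n < real J * (\<epsilon> * \<tau>) * real n" using J by (intro mult_strict_right_mono)
        then show ?thesis by simp
      qed
      finally show False by simp
    qed
    have "{n1..} \<subseteq> {n. (\<forall>i\<in>{}. itin y i = undefined) \<and> (\<exists>j<Suc J. cost (\<lambda>_. 1 / \<tau>) {} (g n j) y \<le> \<sigma> * real (g n j) * ln (real N))}"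
      using ex by auto
    then show "y \<in> carpet \<and> infinite {n. (\<forall>i\<in>{}. itin y i = undefined) \<and> (\<exists>j<Suc J. cost (\<lambda>_. 1 / \<tau>) {} (g n j) y \<le> \<sigma> * real (g n j) * ln (real N))}"
      using y infinite_Ici[of n1] infinite_super by blast
  qed
qed

section \<open>The upper bound\<close>

lemma free_count_alt: "0 \<le> \<alpha> \<Longrightarrow> free_count \<alpha> t = min t 1 + max 0 (t - 1 - \<alpha>)"
  by (auto simp: free_count_def)

text \<open>The cost consists of counts of free positions and of column sums, cut at the four
  breakpoints. Passing to the rescaled profile changes every count by a multiple of the deviation of
  \<open>f\<close> from \<open>\<alpha> * n\<close> and every column sum by a multiple of
  \<open>ln (real M)\<close>.\<close>

lemma cost_le_profile_cost:
  fixes n f :: nat and \<alpha> c :: real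
  assumes y: "y \<in> carpet" and n: "0 < n" and \<alpha>: "0 < \<alpha>" and c: "0 < c"
    and \<kappa>: "0 \<le> \<kappa>m" "\<kappa>m \<le> 1" "0 \<le> \<kappa>1" "\<kappa>1 \<le> 1" "0 \<le> \<kappa>2" "\<kappa>2 \<le> 1" "0 \<le> \<kappa>p" "\<kappa>p \<le> 1"
  defines "v \<equiv> \<lambda>i. if i \<in> {n..<n+f} then 0 else u (fst (itin y i))"
    and "\<kappa> \<equiv> step3 (prefix_m \<alpha> * n) n ((\<tau> + \<alpha>) * n) \<kappa>m \<kappa>1 \<kappa>2 \<kappa>p"
  shows "cost \<kappa> {n..<n+f} (nat \<lceil>c * n\<rceil>) y \<le>
    n * profile_cost \<alpha> \<kappa>m \<kappa>1 \<kappa>2 \<kappa>p (\<lambda>t. csum v (t * n) / n) c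
    + (14 * pressure 1 * (\<bar>real f - \<alpha> * n\<bar> + 3) + 16 * ln (real M))"
proof -
  define L where "L = nat \<lceil>c * n\<rceil>"
  define cn where "cn = (\<lambda>i. if i \<in> {n..<n+f} then 0 else 1 :: real)"
  define E where "E = \<bar>real f - \<alpha> * n\<bar> + 3"
  define B where "B = ln (real M)"
  have v: "0 \<le> v i" "v i \<le> B" for i
    using u_nonneg u_le fst_itin_in_S[OF y] M_pos N_ge_2 N_less_M by (auto simp: v_def B_def)
  have \<tau>0: "0 < \<tau>" using tau_gt_1 by simp
  have L: "\<bar>real L - c * n\<bar> \<le> 1" "0 \<le> c * n"
    using c n unfolding L_def by (auto simp: abs_le_iff) linarith+
  have mn: "\<bar>min (real L) (a * n) - min c a * n\<bar> \<le> 1" "0 \<le> min (real L) (a * n)" "0 \<le> min c a * n" if "0 \<le> a" for a :: real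
  proof -
    have "min c a * n = min (c * n) (a * n)" using n by (simp add: min_def)
    then show "\<bar>min (real L) (a * n) - min c a * n\<bar> \<le> 1" using L by linarith
    show "0 \<le> min (real L) (a * n)" "0 \<le> min c a * n" using that c by auto
  qed
  have fc: "n * free_count \<alpha> (r / n) = min r n + max 0 (r - n - \<alpha> * n)" for r :: real
  proof -
    have "n * min (r / n) 1 = min r n" using n by (simp add: min_mult_distrib_left)
    moreover have "n * max 0 (r / n - 1 - \<alpha>) = max 0 (r - n - \<alpha> * n)"
      using n by (simp add: max_mult_distrib_left algebra_simps)
    ultimately show ?thesis using \<alpha> by (simp add: free_count_alt distrib_left)
  qed
  define \<Phi> where "\<Phi> r = min r n + max 0 (r - n - \<alpha> * n)" for r :: real
  have \<Phi>: "\<bar>csum cn r - \<Phi> s\<bar> \<le> 2 * E" if "0 \<le> r" "\<bar>r - s\<bar> \<le> 1" for r s :: real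
  proof -
    have "0 \<le> \<alpha> * n" using \<alpha> by simp
    then have "\<bar>\<Phi> r - \<Phi> s\<bar> \<le> \<bar>r - s\<bar>" unfolding \<Phi>_def by (auto simp: min_def max_def abs_if)
    moreover have "\<bar>csum cn r - \<Phi> r\<bar> \<le> \<bar>real f - \<alpha> * n\<bar> + 2"
      unfolding cn_def \<Phi>_def by (rule target_count) (use that n in auto)
    moreover have "\<bar>csum cn r - \<Phi> s\<bar> \<le> \<bar>csum cn r - \<Phi> r\<bar> + \<bar>\<Phi> r - \<Phi> s\<bar>" by linarith
    moreover have "0 \<le> \<bar>real f - \<alpha> * n\<bar>" by simp
    ultimately have "\<bar>csum cn r - \<Phi> s\<bar> \<le> \<bar>real f - \<alpha> * n\<bar> + 3" using that(2) by (smt (verit))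
    then show ?thesis unfolding E_def using \<open>0 \<le> \<bar>real f - \<alpha> * n\<bar>\<close> by (simp only: mult_2)
  qed
  have cw: "\<bar>csum v (min (real L) (a * n)) - csum v (min c a * n)\<bar> \<le> 2 * B" if "0 \<le> a" for a :: real
    by (rule csum_abs_diff_le[OF v]) (fact mn[OF that])+
  have cc: "\<bar>csum cn (min (real L) (a * n)) - n * free_count \<alpha> (min c a)\<bar> \<le> 2 * E" if a: "0 \<le> a" for a :: real
  proof -
    have "n * free_count \<alpha> (min c a) = \<Phi> (min c a * n)"
      using fc[of "min c a * n"] n by (simp add: \<Phi>_def)
    then show ?thesis using \<Phi>[OF mn(2)[OF a] mn(1)[OF a]] by simp
  qed
  have cost: "cost \<kappa> {n..<n+f} L y = (\<Sum>i<L. step3 (prefix_m \<alpha> * n) n ((\<tau> + \<alpha>) * n) (pressure \<kappa>m) (pressure \<kappa>1) (pressure \<kappa>2) (pressure \<kappa>p) i * cn i)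
    - (\<Sum>i<L. step3 (prefix_m \<alpha> * n) n ((\<tau> + \<alpha>) * n) \<kappa>m \<kappa>1 \<kappa>2 \<kappa>p i * v i) + csum v (real L / \<tau>)"
    unfolding cost_def sum_subtractf[symmetric] sum_lev[symmetric]
    by (intro arg_cong2[where f="(+)"] sum.cong refl) (auto simp: v_def cn_def \<kappa>_def step3_def)
  have ord: "prefix_m \<alpha> * n \<le> real n" "real n \<le> (\<tau> + \<alpha>) * n"
    using prefix_m[OF \<alpha>] tau_gt_1 \<alpha> n by (auto simp: mult_le_cancel_right1)
  define m where "m = prefix_m \<alpha>"
  define R where "R = \<tau> + \<alpha>"
  have a0: "0 \<le> m" "0 \<le> (1::real)" "0 \<le> R" using prefix_m[OF \<alpha>] tau_gt_1 \<alpha> by (auto simp: m_def R_def)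
  have s1: "csum cn (real L) = csum cn (min (real L) (c * n + 1))" "csum v (real L) = csum v (min (real L) (c * n + 1))"
    using L by (auto simp: min_def)
  have ccL: "\<bar>csum cn (real L) - n * free_count \<alpha> c\<bar> \<le> 2 * E"
  proof -
    have "n * free_count \<alpha> c = \<Phi> (c * n)" using fc[of "c * n"] n by (simp add: \<Phi>_def)
    then show ?thesis using \<Phi>[of "real L" "c * n"] L(1) by simp
  qed
  have cwL: "\<bar>csum v (real L) - csum v (c * n)\<bar> \<le> 2 * B"
    by (rule csum_abs_diff_le[OF v]) (use L in auto)
  have cwl: "csum v (real L / \<tau>) \<le> csum v (c / \<tau> * n) + 2 * B"
  proof -
    have "real L / \<tau> - c / \<tau> * n = (real L - c * n) / \<tau>" by (simp add: diff_divide_distrib)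
    then have "\<bar>real L / \<tau> - c / \<tau> * n\<bar> \<le> 1" using L(1) tau_gt_1 by (simp add: abs_divide divide_le_eq)
    moreover have "0 \<le> real L / \<tau>" "0 \<le> c / \<tau> * n" using \<tau>0 c by auto
    ultimately have "\<bar>csum v (real L / \<tau>) - csum v (c / \<tau> * n)\<bar> \<le> 2 * B"
      by (intro csum_abs_diff_le[OF v]) auto
    then show ?thesis by linarith
  qed
  have P: "0 \<le> pressure x \<and> pressure x \<le> pressure 1" if "0 \<le> x" "x \<le> 1" for x
    using that pressure_nonneg pressure_mono by auto
  have tmc: "p * (x - x') \<le> p * (z - z') + pressure 1 * (2 * e)"
    if "0 \<le> p" "p \<le> pressure 1" "\<bar>x - z\<bar> \<le> e" "\<bar>x' - z'\<bar> \<le> e" for p x x' z z' e :: real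
  proof -
    have "p * (x - x') \<le> p * (z - z' + 2 * e)" using that by (intro mult_left_mono) auto
    also have "\<dots> = p * (z - z') + p * (2 * e)" by (simp add: distrib_left)
    also have "p * (2 * e) \<le> pressure 1 * (2 * e)" using that by (intro mult_right_mono) auto
    finally show ?thesis by simp
  qed
  have tmw: "k * (z - z') \<le> k * (x - x') + 2 * e"
    if "0 \<le> k" "k \<le> 1" "\<bar>x - z\<bar> \<le> e" "\<bar>x' - z'\<bar> \<le> e" for k x x' z z' e :: real
  proof -
    have "k * (z - z') \<le> k * (x - x' + 2 * e)" using that by (intro mult_left_mono) auto
    also have "\<dots> = k * (x - x') + k * (2 * e)" by (simp add: distrib_left)
    also have "k * (2 * e) \<le> 1 * (2 * e)" using that by (intro mult_right_mono) auto
    finally show ?thesis by simp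
  qed
  define f' where "f' t = n * free_count \<alpha> t" for t :: real
  define w where "w t = csum v (t * n)" for t :: real
  have wn: "n * (csum v (t * n) / n) = w t" for t :: real using n by (simp add: w_def)
  have z0: "csum cn 0 = 0" "csum v 0 = 0" by (auto simp: csum_def)
  have Em: "0 \<le> E" by (simp add: E_def)
  have B0: "0 \<le> B" using v(1)[of 0] v(2)[of 0] by linarith
  have T1: "pressure \<kappa>m * csum cn (min (real L) (m * n)) \<le> pressure \<kappa>m * f' (min c m) + pressure 1 * (2 * E)"
  proof -
    have "pressure \<kappa>m * csum cn (min (real L) (m * n)) \<le> pressure \<kappa>m * (f' (min c m) + 2 * E)"
      using cc[OF a0(1)] P[OF \<kappa>(1,2)] unfolding f'_def by (intro mult_left_mono) auto
    also have "\<dots> = pressure \<kappa>m * f' (min c m) + pressure \<kappa>m * (2 * E)" by (simp add: distrib_left)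
    also have "pressure \<kappa>m * (2 * E) \<le> pressure 1 * (2 * E)" using P[OF \<kappa>(1,2)] Em by (intro mult_right_mono) auto
    finally show ?thesis by simp
  qed
  have T2: "\<kappa>m * w (min c m) \<le> \<kappa>m * csum v (min (real L) (m * n)) + 2 * B"
  proof -
    have "\<kappa>m * w (min c m) \<le> \<kappa>m * (csum v (min (real L) (m * n)) + 2 * B)"
      using cw[OF a0(1)] \<kappa>(1) by (intro mult_left_mono) (auto simp: w_def)
    moreover have "\<kappa>m * (2 * B) \<le> 1 * (2 * B)" using \<kappa>(2) B0 by (intro mult_right_mono) auto
    ultimately show ?thesis by (simp add: distrib_left)
  qed
  have cc1: "\<bar>csum cn (min (real L) n) - f' (min c 1)\<bar> \<le> 2 * E" using cc[OF a0(2)] by (simp add: f'_def)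
  have cw1: "\<bar>csum v (min (real L) n) - w (min c 1)\<bar> \<le> 2 * B" using cw[OF a0(2)] by (simp add: w_def)
  note ccs = cc[OF a0(1), folded f'_def] cc1 cc[OF a0(3), folded f'_def] ccL[folded f'_def]
  note cws = cw[OF a0(1), folded w_def] cw1 cw[OF a0(3), folded w_def] cwL[folded w_def]
  have pc: "n * profile_cost \<alpha> \<kappa>m \<kappa>1 \<kappa>2 \<kappa>p (\<lambda>t. csum v (t * n) / n) c =
      pressure \<kappa>m * f' (min c m) - \<kappa>m * w (min c m)
      + (pressure \<kappa>1 * (f' (min c 1) - f' (min c m)) - \<kappa>1 * (w (min c 1) - w (min c m)))
      + (pressure \<kappa>2 * (f' (min c R) - f' (min c 1)) - \<kappa>2 * (w (min c R) - w (min c 1)))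
      + (pressure \<kappa>p * (f' c - f' (min c R)) - \<kappa>p * (w c - w (min c R))) + w (c / \<tau>)"
    unfolding profile_cost_def Let_def m_def[symmetric] R_def[symmetric] f'_def wn[symmetric]
    by (simp only: distrib_left right_diff_distrib mult.left_commute[of "real n"])
  \<comment> \<open>The first window contains one count and one sum, each of the other three a
    difference of two; the last \<open>2 * B\<close> comes from the row part. This yields the
    constants 14 and 16.\<close>
  have "cost \<kappa> {n..<n+f} L y \<le> n * profile_cost \<alpha> \<kappa>m \<kappa>1 \<kappa>2 \<kappa>p (\<lambda>t. csum v (t * n) / n) c
    + (pressure 1 * (2 * E) + 3 * (pressure 1 * (2 * (2 * E))) + 2 * B + 3 * (2 * (2 * B)) + 2 * B)"
    unfolding cost sum_step3[OF ord] pc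
    using T1 T2 tmc[OF P[THEN conjunct1, OF \<kappa>(3,4)] P[THEN conjunct2, OF \<kappa>(3,4)] ccs(2,1)]
      tmc[OF P[THEN conjunct1, OF \<kappa>(5,6)] P[THEN conjunct2, OF \<kappa>(5,6)] ccs(3,2)]
      tmc[OF P[THEN conjunct1, OF \<kappa>(7,8)] P[THEN conjunct2, OF \<kappa>(7,8)] ccs(4,3)]
      tmw[OF \<kappa>(3,4) cws(2,1)] tmw[OF \<kappa>(5,6) cws(3,2)] tmw[OF \<kappa>(7,8) cws(4,3)]
      cwl[folded w_def]
    unfolding m_def[symmetric] R_def[symmetric] by linarith
  also have "\<dots> = n * profile_cost \<alpha> \<kappa>m \<kappa>1 \<kappa>2 \<kappa>p (\<lambda>t. csum v (t * n) / n) c + (14 * pressure 1 * E + 16 * B)"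
    by simp
  finally show ?thesis unfolding L_def E_def B_def by simp
qed

text \<open>These are the hypotheses of \<open>cheap_scale_exists\<close> for the rescaled column
  sum. The last one holds because prescribed positions contribute nothing, up to the difference
  between \<open>f\<close> and \<open>\<alpha> * n\<close>.\<close>

lemma target_profile:
  fixes n f :: nat and \<alpha> \<delta> :: real
  assumes y: "y \<in> carpet" and n: "0 < n" and \<alpha>: "0 < \<alpha>"
  defines "v \<equiv> \<lambda>i. if i \<in> {n..<n+f} then 0 else u (fst (itin y i))"
  defines "w \<equiv> \<lambda>t::real. csum v (t * n) / n"
  assumes small: "ln (real M) * (\<bar>real f - \<alpha> * n\<bar> + 1) \<le> \<delta> * n"
  shows "\<And>t. 0 \<le> t \<Longrightarrow> 0 \<le> w t \<and> w t \<le> ln (real M) * t + \<delta>"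
    and "\<And>s t. 0 \<le> s \<Longrightarrow> s \<le> t \<Longrightarrow> w s \<le> w t"
    and "w (1 + \<alpha>) \<le> w 1 + \<delta>"
proof -
  define B where "B = ln (real M)"
  have v: "0 \<le> v i" "v i \<le> B" for i
    using u_nonneg u_le fst_itin_in_S[OF y] M_pos N_ge_2 N_less_M by (auto simp: v_def B_def)
  have B0: "0 \<le> B" using v(1)[of 0] v(2)[of 0] by linarith
  have z0: "csum v 0 = 0" by (simp add: csum_def)
  have B\<delta>: "B \<le> \<delta> * n"
  proof -
    have "B * 1 \<le> B * (\<bar>real f - \<alpha> * n\<bar> + 1)" using B0 by (intro mult_left_mono) auto
    then show ?thesis using small by (simp add: B_def)
  qed
  show "0 \<le> w t \<and> w t \<le> ln (real M) * t + \<delta>" if t: "0 \<le> t" for t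
  proof
    show "0 \<le> w t" unfolding w_def using csum_nonneg[of v] v by simp
    have "csum v (t * n) \<le> B * (t * n + 1)"
      using csum_diff_le[of v B 0 "t * n", OF v(2) B0] t z0 by simp
    also have "\<dots> \<le> (B * t + \<delta>) * n" using B\<delta> by (simp add: algebra_simps)
    finally show "w t \<le> ln (real M) * t + \<delta>" using n by (simp add: w_def B_def pos_divide_le_eq)
  qed
  show "w s \<le> w t" if "0 \<le> s" "s \<le> t" for s t
    unfolding w_def using that v by (intro divide_right_mono csum_mono mult_right_mono) auto
  have eq: "csum v (real (n + f)) = csum v (real n)"
  proof -
    have "csum v (real (n + f)) - csum v (real n) = (\<Sum>i\<in>{n..<n+f}. v i)"
      using csum_diff[of "real n" "real (n + f)" v] by (simp only: ceiling_of_nat nat_int of_nat_le_iff le_add1)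
    also have "\<dots> = 0" by (intro sum.neutral) (auto simp: v_def)
    finally show ?thesis by simp
  qed
  have "csum v ((1 + \<alpha>) * n) \<le> csum v (real n) + \<delta> * n"
  proof (cases "(1 + \<alpha>) * n \<le> real (n + f)")
    case True
    then have "csum v ((1 + \<alpha>) * n) \<le> csum v (real n)"
      using csum_mono[of v _ "real (n + f)", OF v(1) True] eq by simp
    then show ?thesis using B\<delta> B0 by linarith
  next
    case False
    then have "csum v ((1 + \<alpha>) * n) - csum v (real (n + f)) \<le> B * ((1 + \<alpha>) * n - real (n + f) + 1)"
      by (intro csum_diff_le[OF v(2) B0]) auto
    also have "\<dots> \<le> B * (\<bar>real f - \<alpha> * n\<bar> + 1)"
      using B0 by (intro mult_left_mono) (auto simp: distrib_right)
    also have "\<dots> \<le> \<delta> * n" using small by (simp add: B_def)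
    finally show ?thesis using eq by simp
  qed
  then have "csum v ((1 + \<alpha>) * n) / n \<le> (csum v (real n) + \<delta> * n) / n" using n by (intro divide_right_mono) auto
  then show "w (1 + \<alpha>) \<le> w 1 + \<delta>" using n by (simp add: w_def add_divide_distrib)
qed

text \<open>At each late hit one of the finitely many scales is cheap, and the cheap squares at all
  hits form a limsup cover. Only the lengths of the prescribed blocks matter, so \<open>t\<close> is
  arbitrary.\<close>

lemma digit_target_zero:
  fixes f :: "nat \<Rightarrow> nat" and \<alpha> d s :: real
  assumes f: "(\<lambda>n. real (f n) / real n) \<longlonglongrightarrow> \<alpha>" and \<alpha>: "0 < \<alpha>"
    and in\<Upsilon>: "pm \<in> \<Upsilon>" "p1 \<in> \<Upsilon>" "p2 \<in> \<Upsilon>" "pp \<in> \<Upsilon>"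
    and d: "D \<alpha> pm p1 p2 pp 0 = d"
    and max: "\<And>qm q1 q2 qp. \<lbrakk>qm \<in> \<Upsilon>; q1 \<in> \<Upsilon>; q2 \<in> \<Upsilon>; qp \<in> \<Upsilon>\<rbrakk> \<Longrightarrow> D \<alpha> qm q1 q2 qp 0 \<le> d"
    and s: "d < s"
  shows "hausdorff_measure s (digit_target f t) = 0"
proof -
  have d0: "0 \<le> d" using D_nonneg[OF \<alpha> in\<Upsilon>] d by simp
  define \<sigma> where "\<sigma> = (d + s) / 2"
  have \<sigma>: "d < \<sigma>" "\<sigma> < s" "0 \<le> \<sigma>" using d0 s by (auto simp: \<sigma>_def)
  \<comment> \<open>Then \<open>d * ln (real N) + \<epsilon> = \<sigma> * ln (real N)\<close>, which
    leaves the gap between \<open>\<sigma>\<close> and \<open>s\<close> for the convergence of the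
    series.\<close>
  define \<epsilon> where "\<epsilon> = (\<sigma> - d) * ln (real N)"
  have \<epsilon>: "0 < \<epsilon>" using \<sigma> ln_N_pos by (simp add: \<epsilon>_def)
  have B0: "0 \<le> ln (real M)" using M_pos N_ge_2 N_less_M by simp
  from optimal_data_exists[OF \<alpha> in\<Upsilon> d max]
  consider "\<forall>p\<in>\<Upsilon>. h\<^sub>r p + hc p / \<tau> \<le> d * ln (real N)"
    | k2 k3 k4 k5 \<phi>m \<psi>m \<phi>1 \<psi>1 \<phi>2 \<psi>2 \<phi>p \<psi>p \<kappa>m \<kappa>1 \<kappa>2 \<kappa>p where
      "optimal_data \<alpha> (d * ln (real N)) k2 k3 k4 k5 \<phi>m \<psi>m \<phi>1 \<psi>1 \<phi>2 \<psi>2 \<phi>p \<psi>p \<kappa>m \<kappa>1 \<kappa>2 \<kappa>p"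
    by blast
  then show ?thesis
  proof cases
    case 1
    then have "hausdorff_measure s carpet = 0" using d0 s by (intro whole_carpet_zero) auto
    moreover have "hausdorff_measure s (digit_target f t) \<le> hausdorff_measure s carpet"
      by (intro hausdorff_measure_mono) (auto simp: digit_target_def)
    ultimately show ?thesis by simp
  next
    case opt: 2
    obtain J \<delta> where \<delta>: "0 < \<delta>"
      "\<And>w. \<lbrakk>\<And>t. 0 \<le> t \<Longrightarrow> 0 \<le> w t \<and> w t \<le> ln (real M) * t + \<delta>; \<And>s t. 0 \<le> s \<Longrightarrow> s \<le> t \<Longrightarrow> w s \<le> w t; w (1 + \<alpha>) \<le> w 1 + \<delta>\<rbrakk>
      \<Longrightarrow> \<exists>c\<in>scales \<alpha> J. profile_cost \<alpha> \<kappa>m \<kappa>1 \<kappa>2 \<kappa>p w c + \<delta> < (d * ln (real N) + \<epsilon>) * c"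
      using cheap_scale_exists[OF \<alpha> \<epsilon> B0 opt] by metis
    have \<kappa>: "0 \<le> \<kappa>m" "\<kappa>m \<le> 1" "0 \<le> \<kappa>1" "\<kappa>1 \<le> 1" "0 \<le> \<kappa>2" "\<kappa>2 \<le> 1" "0 \<le> \<kappa>p" "\<kappa>p \<le> 1"
    proof -
      have "0 < 1 / \<tau>" "1 / \<tau> < 1" using tau_gt_1 by auto
      moreover have "1 / \<tau> < \<kappa>m \<and> \<kappa>m \<le> 1 \<and> 0 \<le> \<kappa>1 \<and> \<kappa>1 \<le> 1 \<and> 0 \<le> \<kappa>2 \<and> \<kappa>2 \<le> 1 \<and> 0 \<le> \<kappa>p \<and> \<kappa>p < 1 / \<tau>"
        using opt unfolding optimal_data_def by blast
      ultimately show "0 \<le> \<kappa>m" "\<kappa>m \<le> 1" "0 \<le> \<kappa>1" "\<kappa>1 \<le> 1" "0 \<le> \<kappa>2" "\<kappa>2 \<le> 1" "0 \<le> \<kappa>p" "\<kappa>p \<le> 1" by linarith+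
    qed
    have fin: "finite (scales \<alpha> J)" by (simp add: scales_def)
    obtain K e where e: "scales \<alpha> J = e ` {i. i < (K::nat)}"
      using finite_imp_nat_seg_image_inj_on[OF fin] by blast
    have spos: "0 < c" if "c \<in> scales \<alpha> J" for c
      using that prefix_m[OF \<alpha>] tau_gt_1 \<alpha> by (auto simp: scales_def)
    have sne: "scales \<alpha> J \<noteq> {}" by (simp add: scales_def)
    then have K: "0 < K" using e by auto
    define c0 where "c0 = Min (scales \<alpha> J)"
    have c0: "0 < c0" "\<And>c. c \<in> scales \<alpha> J \<Longrightarrow> c0 \<le> c" using fin sne spos by (auto simp: c0_def)
    define \<theta> where "\<theta> n = \<bar>real (f n) - \<alpha> * n\<bar>" for n :: nat
    have lim: "(\<lambda>n. (a * (\<theta> n + b) + b') / real n) \<longlonglongrightarrow> 0" for a b b' :: real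
    proof -
      have "(\<lambda>n. \<bar>real (f n) / real n - \<alpha>\<bar>) \<longlonglongrightarrow> \<bar>\<alpha> - \<alpha>\<bar>"
        by (intro tendsto_rabs tendsto_diff f tendsto_const)
      then have "(\<lambda>n. a * \<bar>real (f n) / real n - \<alpha>\<bar> + (a * b + b') * (1 / real n)) \<longlonglongrightarrow> a * \<bar>\<alpha> - \<alpha>\<bar> + (a * b + b') * 0"
        by (intro tendsto_add tendsto_mult tendsto_const lim_1_over_n) auto
      then have "(\<lambda>n. a * \<bar>real (f n) / real n - \<alpha>\<bar> + (a * b + b') * (1 / real n)) \<longlonglongrightarrow> 0" by simp
      then show ?thesis
      proof (rule Lim_transform_eventually)
        show "\<forall>\<^sub>F n in sequentially. a * \<bar>real (f n) / real n - \<alpha>\<bar> + (a * b + b') * (1 / real n) = (a * (\<theta> n + b) + b') / real n"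
          using eventually_gt_at_top[of "0::nat"]
        proof eventually_elim
          case (elim n)
          have "\<theta> n = \<bar>real (f n) / real n - \<alpha>\<bar> * real n"
          proof -
            have "real (f n) - \<alpha> * n = (real (f n) / real n - \<alpha>) * real n" using elim by (simp add: left_diff_distrib)
            then show ?thesis by (simp add: \<theta>_def abs_mult)
          qed
          then show ?case using elim by (simp add: field_simps)
        qed
      qed
    qed
    have ev: "\<forall>\<^sub>F n in sequentially. a * (\<theta> n + b) + b' \<le> \<delta> * n" for a b b' :: real
      using order_tendstoD(2)[OF lim[of a b b'] \<delta>(1)] eventually_gt_at_top[of "0::nat"]
    proof eventually_elim
      case (elim n)
      then show ?case by (simp add: pos_divide_less_eq)
    qed
    \<comment> \<open>The two error bounds are those of \<open>target_profile\<close> and of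
      \<open>cost_le_profile_cost\<close>; both are negligible with respect to \<open>n\<close>
      since \<open>f n / n\<close> tends to \<open>\<alpha>\<close>.\<close>
    have "\<forall>\<^sub>F n in sequentially. 0 < n \<and> ln (real M) * (\<theta> n + 1) + 0 \<le> \<delta> * n \<and>
      (14 * pressure 1) * (\<theta> n + 3) + 16 * ln (real M) \<le> \<delta> * n"
      by (intro eventually_conj ev eventually_gt_at_top)
    then obtain n1 where n1: "\<And>n. n1 \<le> n \<Longrightarrow> 0 < n \<and> ln (real M) * (\<theta> n + 1) \<le> \<delta> * n \<and>
      14 * pressure 1 * (\<theta> n + 3) + 16 * ln (real M) \<le> \<delta> * n"
      unfolding eventually_sequentially by auto
    define g where "g n j = nat \<lceil>e j * real n\<rceil>" for n j
    define \<kappa> where "\<kappa> n = step3 (prefix_m \<alpha> * real n) (real n) ((\<tau> + \<alpha>) * real n) \<kappa>m \<kappa>1 \<kappa>2 \<kappa>p" for n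
    have cheap: "\<exists>j<K. cost (\<kappa> n) {n..<n + f n} (g n j) y \<le> \<sigma> * real (g n j) * ln (real N)"
      if y: "y \<in> carpet" and n: "n1 \<le> n" for y n
    proof -
      define v where "v = (\<lambda>i. if i \<in> {n..<n+f n} then 0 else u (fst (itin y i)))"
      define w where "w = (\<lambda>t::real. csum v (t * n) / n)"
      have n0: "0 < n" using n1[OF n] by blast
      have small: "ln (real M) * (\<bar>real (f n) - \<alpha> * n\<bar> + 1) \<le> \<delta> * n" using n1[OF n] by (simp add: \<theta>_def)
      note tp = target_profile[OF y n0 \<alpha> small, folded v_def]
      have "\<exists>c\<in>scales \<alpha> J. profile_cost \<alpha> \<kappa>m \<kappa>1 \<kappa>2 \<kappa>p w c + \<delta> < (d * ln (real N) + \<epsilon>) * c"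
      proof (rule \<delta>(2))
        show "0 \<le> w t \<and> w t \<le> ln (real M) * t + \<delta>" if "0 \<le> t" for t unfolding w_def using that by (rule tp(1))
        show "w s \<le> w t" if "0 \<le> s" "s \<le> t" for s t unfolding w_def using that by (rule tp(2))
        show "w (1 + \<alpha>) \<le> w 1 + \<delta>" unfolding w_def by (rule tp(3))
      qed
      then obtain c where c: "c \<in> scales \<alpha> J" "profile_cost \<alpha> \<kappa>m \<kappa>1 \<kappa>2 \<kappa>p w c + \<delta> < (d * ln (real N) + \<epsilon>) * c"
        by blast
      obtain j where j: "j < K" "c = e j" using c(1) e by blast
      have "cost (\<kappa> n) {n..<n + f n} (g n j) y \<le> n * profile_cost \<alpha> \<kappa>m \<kappa>1 \<kappa>2 \<kappa>p w c
        + (14 * pressure 1 * (\<bar>real (f n) - \<alpha> * n\<bar> + 3) + 16 * ln (real M))"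
        using cost_le_profile_cost[OF y n0 \<alpha> spos[OF c(1)] \<kappa>, of "f n"]
        unfolding g_def \<kappa>_def w_def v_def j(2) .
      also have "\<dots> \<le> n * profile_cost \<alpha> \<kappa>m \<kappa>1 \<kappa>2 \<kappa>p w c + \<delta> * n"
        using n1[OF n] by (simp add: \<theta>_def)
      also have "\<dots> = n * (profile_cost \<alpha> \<kappa>m \<kappa>1 \<kappa>2 \<kappa>p w c + \<delta>)" by (simp add: distrib_left)
      also have "\<dots> \<le> n * ((d * ln (real N) + \<epsilon>) * c)" using c(2) by (intro mult_left_mono) auto
      also have "\<dots> = \<sigma> * ln (real N) * (e j * n)" by (simp add: \<epsilon>_def j(2) algebra_simps)
      also have "\<dots> \<le> \<sigma> * ln (real N) * real (g n j)"
        unfolding g_def using \<sigma> ln_N_pos by (intro mult_left_mono real_nat_ceiling_ge) auto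
      finally show ?thesis using j(1) by (auto simp: mult_ac)
    qed
    show ?thesis
    proof (rule limsup_cheap_squares_zero[where \<sigma> = \<sigma> and c = c0 and J = K and g = g and \<kappa> = \<kappa>
          and I = "\<lambda>n. {n..<n + f n}" and t = "\<lambda>n i. t n (i - n)"])
      show "0 \<le> \<sigma>" "\<sigma> < s" "0 < c0" "0 < K" using \<sigma> c0 K by auto
      show "c0 * real n \<le> real (g n j)" if "j < K" for n j
      proof -
        have "c0 * real n \<le> e j * real n" using c0(2)[of "e j"] e that by (intro mult_right_mono) auto
        also have "\<dots> \<le> real (g n j)" unfolding g_def by linarith
        finally show ?thesis .
      qed
      fix y assume y: "y \<in> digit_target f t"
      then have yc: "y \<in> carpet" and inf: "infinite {n. n \<ge> 1 \<and> (\<forall>k<f n. itin y (n + k) = t n k)}"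
        by (auto simp: digit_target_def)
      have "infinite ({n. n \<ge> 1 \<and> (\<forall>k<f n. itin y (n + k) = t n k)} - {..<n1})" using inf by simp
      moreover have "{n. n \<ge> 1 \<and> (\<forall>k<f n. itin y (n + k) = t n k)} - {..<n1} \<subseteq>
        {n. (\<forall>i\<in>{n..<n + f n}. itin y i = t n (i - n)) \<and> (\<exists>j<K. cost (\<kappa> n) {n..<n + f n} (g n j) y \<le> \<sigma> * real (g n j) * ln (real N))}"
      proof
        fix n assume "n \<in> {n. n \<ge> 1 \<and> (\<forall>k<f n. itin y (n + k) = t n k)} - {..<n1}"
        then have h: "\<And>k. k < f n \<Longrightarrow> itin y (n + k) = t n k" and n: "n1 \<le> n" by auto
        have "itin y i = t n (i - n)" if "i \<in> {n..<n + f n}" for i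
          using h[of "i - n"] that by auto
        then show "n \<in> {n. (\<forall>i\<in>{n..<n + f n}. itin y i = t n (i - n)) \<and> (\<exists>j<K. cost (\<kappa> n) {n..<n + f n} (g n j) y \<le> \<sigma> * real (g n j) * ln (real N))}"
          using cheap[OF yc n] by blast
      qed
      ultimately have "infinite {n. (\<forall>i\<in>{n..<n + f n}. itin y i = t n (i - n)) \<and> (\<exists>j<K. cost (\<kappa> n) {n..<n + f n} (g n j) y \<le> \<sigma> * real (g n j) * ln (real N))}"
        using infinite_super by blast
      with yc show "y \<in> carpet \<and> infinite {n. (\<forall>i\<in>{n..<n + f n}. itin y i = t n (i - n)) \<and> (\<exists>j<K. cost (\<kappa> n) {n..<n + f n} (g n j) y \<le> \<sigma> * real (g n j) * ln (real N))}" ..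
    qed
  qed
qed

end

section \<open>Product measures on the carpet\<close>

text \<open>With \<open>y = - x\<close>, this follows from the lower Taylor bound for
  \<open>exp y\<close>, since \<open>(1 - y + y^2 / 2) * (1 + y + y^2 / 2) = 1 + y ^ 4 / 4\<close>
  is at least 1.\<close>

lemma exp_le_quadratic:
  fixes x :: real assumes "x \<le> 0" shows "exp x \<le> 1 + x + x\<^sup>2 / 2"
proof -
  define y where "y = - x"
  have y: "0 \<le> y" using assms by (simp add: y_def)
  have "1 + y + y\<^sup>2 / 2 \<le> exp y" using exp_lower_Taylor_quadratic[OF y] .
  moreover have "0 < 1 + y + y\<^sup>2 / 2" using y by (simp add: add_pos_nonneg)
  ultimately have "exp x \<le> 1 / (1 + y + y\<^sup>2 / 2)"
    using frac_le[of 1 1 "1 + y + y\<^sup>2 / 2" "exp y"] by (simp add: y_def exp_minus inverse_eq_divide)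
  also have "\<dots> \<le> 1 - y + y\<^sup>2 / 2"
  proof -
    have "(1 - y + y\<^sup>2 / 2) * (1 + y + y\<^sup>2 / 2) = 1 + y ^ 4 / 4"
      by (simp add: power2_eq_square power4_eq_xxxx field_simps)
    also have "\<dots> \<ge> 1" by simp
    finally show ?thesis using \<open>0 < 1 + y + y\<^sup>2 / 2\<close> by (simp add: pos_divide_le_eq)
  qed
  finally show ?thesis by (simp add: y_def)
qed

text \<open>A moment bound for the logarithm of the mass, with linear term equal to the entropy. The
  quadratic error is uniform over all weight vectors because \<open>w * (ln w)^2 / 2\<close> never
  exceeds 1 on the unit interval; no lower bound on positive weights enters.\<close>

lemma powr_sum_le:
  fixes w :: "'a \<Rightarrow> real"
  assumes w: "\<And>q. q \<in> B \<Longrightarrow> 0 \<le> w q \<and> w q \<le> 1" "(\<Sum>q\<in>B. w q) = 1" and \<beta>: "0 \<le> \<beta>"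
  shows "(\<Sum>q\<in>B. w q powr (1 + \<beta>)) \<le> exp (\<beta> * (\<Sum>q\<in>B. w q * ln (w q)) + \<beta>\<^sup>2 * real (card B))"
proof -
  have *: "w q powr (1 + \<beta>) \<le> w q + \<beta> * (w q * ln (w q)) + \<beta>\<^sup>2" if q: "q \<in> B" for q
  proof (cases "w q = 0")
    case True then show ?thesis by simp
  next
    case False
    then have pos: "0 < w q" "ln (w q) \<le> 0" using w(1)[OF q] by auto
    have "w q powr (1 + \<beta>) = w q * exp (\<beta> * ln (w q))" using pos by (simp add: powr_def exp_add distrib_right)
    also have "\<dots> \<le> w q * (1 + \<beta> * ln (w q) + (\<beta> * ln (w q))\<^sup>2 / 2)"
      using pos \<beta> by (intro mult_left_mono exp_le_quadratic) (auto intro: mult_nonneg_nonpos)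
    also have "\<dots> = w q + \<beta> * (w q * ln (w q)) + \<beta>\<^sup>2 * (w q * (ln (w q))\<^sup>2 / 2)"
      by (simp add: algebra_simps power_mult_distrib)
    also have "w q * (ln (w q))\<^sup>2 / 2 \<le> 1"
    proof -
      have "1 + (- ln (w q)) + (- ln (w q))\<^sup>2 / 2 \<le> exp (- ln (w q))"
        using pos by (intro exp_lower_Taylor_quadratic) simp
      also have "exp (- ln (w q)) = 1 / w q" using pos by (simp add: exp_minus inverse_eq_divide)
      finally have "(ln (w q))\<^sup>2 / 2 \<le> 1 / w q" using pos(2) unfolding power2_minus by linarith
      then have "w q * ((ln (w q))\<^sup>2 / 2) \<le> w q * (1 / w q)" using pos by (intro mult_left_mono) auto
      then show ?thesis using pos by simp
    qed
    then have "\<beta>\<^sup>2 * (w q * (ln (w q))\<^sup>2 / 2) \<le> \<beta>\<^sup>2"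
      using mult_left_mono[of "w q * (ln (w q))\<^sup>2 / 2" 1 "\<beta>\<^sup>2"] by simp
    finally show ?thesis by simp
  qed
  have "(\<Sum>q\<in>B. w q powr (1 + \<beta>)) \<le> (\<Sum>q\<in>B. w q + \<beta> * (w q * ln (w q)) + \<beta>\<^sup>2)"
    by (rule sum_mono) (rule *)
  also have "\<dots> = 1 + (\<beta> * (\<Sum>q\<in>B. w q * ln (w q)) + \<beta>\<^sup>2 * real (card B))"
    by (simp add: sum.distrib w(2) sum_distrib_left mult.commute)
  also have "\<dots> \<le> exp (\<beta> * (\<Sum>q\<in>B. w q * ln (w q)) + \<beta>\<^sup>2 * real (card B))" by (rule exp_ge_add_one_self)
  finally show ?thesis .
qed

text \<open>The index of the K-adic interval with the given first \<open>L\<close> digits. Being an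
  integer, it turns closeness of points into closeness of digit blocks across the boundaries of
  intervals.\<close>

primrec prefix_code :: "nat \<Rightarrow> (nat \<Rightarrow> nat) \<Rightarrow> nat \<Rightarrow> int" where
  "prefix_code K a 0 = 0"
| "prefix_code K a (Suc L) = int K * prefix_code K a L + (int (a L) - 1)"

lemma prefix_code_cong: "(\<And>i. i < L \<Longrightarrow> a i = a' i) \<Longrightarrow> prefix_code K a L = prefix_code K a' L"
  by (induction L) auto

lemma prefix_code_inj:
  assumes "\<And>i. i < L \<Longrightarrow> 1 \<le> a i \<and> a i \<le> K" "\<And>i. i < L \<Longrightarrow> 1 \<le> a' i \<and> a' i \<le> K"
    "prefix_code K a L = prefix_code K a' L" "i < L"
  shows "a i = a' i"
  using assms
proof (induction L)
  case (Suc L)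
  have r: "1 \<le> a L" "a L \<le> K" "1 \<le> a' L" "a' L \<le> K" using Suc.prems(1)[of L] Suc.prems(2)[of L] by auto
  have eq: "int K * prefix_code K a L + (int (a L) - 1) = int K * prefix_code K a' L + (int (a' L) - 1)"
    using Suc.prems(3) by simp
  have m: "int (a L) - 1 = (int K * prefix_code K a L + (int (a L) - 1)) mod int K"
    "int (a' L) - 1 = (int K * prefix_code K a' L + (int (a' L) - 1)) mod int K"
    using r by (simp_all add: mod_pos_pos_trivial)
  have "int (a L) - 1 = int (a' L) - 1" using m eq by metis
  then have last: "a L = a' L" by simp
  then have "prefix_code K a L = prefix_code K a' L" using eq r by simp
  then show ?case using Suc.IH Suc.prems last by (metis less_Suc_eq)
qed simp

lemma (in digit_orbit) prefix_code: "real K ^ L * x 0 = of_int (prefix_code K a L) + x L"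
proof (induction L)
  case (Suc L)
  have "real K ^ Suc L * x 0 = real K * (real K ^ L * x 0)" by simp
  also have "\<dots> = real K * of_int (prefix_code K a L) + real K * x L" unfolding Suc by (simp add: distrib_left)
  finally show ?case using step[of L] by simp
qed simp

context bedford_mcmullen
begin

lemma M_pow_lev_le: "real M ^ lev L \<le> real M * real N ^ L"
proof -
  have "0 \<le> real L / \<tau>" using tau_gt_1 by simp
  then have "real (lev L) \<le> real L / \<tau> + 1" unfolding lev_def by linarith
  then have "real (lev L) * \<tau> \<le> real L + \<tau>" using tau_gt_1 by (simp add: field_simps)
  then have "real (lev L) * \<tau> * ln (real N) \<le> (real L + \<tau>) * ln (real N)"
    using ln_N_pos by (intro mult_right_mono) auto
  then have "ln (real M ^ lev L) \<le> ln (real M * real N ^ L)"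
    using N_pos M_pos by (simp add: ln_realpow ln_mult ln_M algebra_simps)
  then show ?thesis using N_pos M_pos by (subst (asm) ln_le_cancel_iff) auto
qed

definition box_key :: "nat \<Rightarrow> (nat \<Rightarrow> nat \<times> nat) \<Rightarrow> nat \<Rightarrow> nat \<times> nat" where
  "box_key L \<omega> = (\<lambda>i\<in>{..<L}. if i < lev L then \<omega> i else (fst (\<omega> i), 0))"

text \<open>Two points at distance at most \<open>1 / real N ^ L\<close> have column indices that
  differ by at most 2, and row indices that differ by at most \<open>M + 1\<close> because the rows
  may be \<open>M\<close> times finer than this distance. This leaves 5 and \<open>2 * M + 3\<close>
  possible values.\<close>

lemma card_box_keys:
  assumes \<Omega>: "\<And>\<omega> i. \<omega> \<in> \<Omega> \<Longrightarrow> \<omega> i \<in> Q"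
    and close: "\<And>\<omega> \<omega>'. \<omega> \<in> \<Omega> \<Longrightarrow> \<omega>' \<in> \<Omega> \<Longrightarrow> dist (code \<omega>) (code \<omega>') \<le> 1 / real N ^ L"
  shows "finite (box_key L ` \<Omega>) \<and> card (box_key L ` \<Omega>) \<le> 5 * (2 * M + 3)"
proof (cases "\<Omega> = {}")
  case False
  then obtain \<omega>0 where \<omega>0: "\<omega>0 \<in> \<Omega>" by blast
  define X where "X \<omega> = prefix_code N (\<lambda>i. fst (\<omega> i)) L" for \<omega> :: "nat \<Rightarrow> nat \<times> nat"
  define Y where "Y \<omega> = prefix_code M (\<lambda>i. snd (\<omega> i)) (lev L)" for \<omega> :: "nat \<Rightarrow> nat \<times> nat"
  have XY: "X \<omega> \<in> {X \<omega>0 - 2..X \<omega>0 + 2} \<and> Y \<omega> \<in> {Y \<omega>0 - (int M + 1)..Y \<omega>0 + (int M + 1)}" if \<omega>: "\<omega> \<in> \<Omega>" for \<omega>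
  proof -
    have Nx: "real N ^ L * fst (code \<omega>) - of_int (X \<omega>) \<in> {0..1}" if "\<omega> \<in> \<Omega>" for \<omega>
      using digit_orbit.prefix_code[OF digit_orbit_code(1), of \<omega> L] digit_orbit.x[OF digit_orbit_code(1), of \<omega> L] \<Omega>[OF that]
      by (simp add: X_def)
    have My: "real M ^ lev L * snd (code \<omega>) - of_int (Y \<omega>) \<in> {0..1}" if "\<omega> \<in> \<Omega>" for \<omega>
      using digit_orbit.prefix_code[OF digit_orbit_code(2), of \<omega> "lev L"] digit_orbit.x[OF digit_orbit_code(2), of \<omega> "lev L"] \<Omega>[OF that]
      by (simp add: Y_def)
    have d: "\<bar>fst (code \<omega>) - fst (code \<omega>0)\<bar> \<le> 1 / real N ^ L" "\<bar>snd (code \<omega>) - snd (code \<omega>0)\<bar> \<le> 1 / real N ^ L"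
      using close[OF \<omega> \<omega>0] dist_fst_le[of "code \<omega>" "code \<omega>0"] dist_snd_le[of "code \<omega>" "code \<omega>0"]
      by (auto simp: dist_real_def)
    have "\<bar>real N ^ L * fst (code \<omega>) - real N ^ L * fst (code \<omega>0)\<bar> \<le> 1"
    proof -
      have "\<bar>real N ^ L * fst (code \<omega>) - real N ^ L * fst (code \<omega>0)\<bar> = real N ^ L * \<bar>fst (code \<omega>) - fst (code \<omega>0)\<bar>"
        by (simp add: right_diff_distrib[symmetric] abs_mult)
      also have "\<dots> \<le> real N ^ L * (1 / real N ^ L)" using d by (intro mult_left_mono) auto
      finally show ?thesis using N_pos by simp
    qed
    then have "\<bar>of_int (X \<omega>) - of_int (X \<omega>0) :: real\<bar> \<le> 2" using Nx[OF \<omega>] Nx[OF \<omega>0] by (auto simp: abs_le_iff)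
    moreover have "\<bar>real M ^ lev L * snd (code \<omega>) - real M ^ lev L * snd (code \<omega>0)\<bar> \<le> real M"
    proof -
      have "\<bar>real M ^ lev L * snd (code \<omega>) - real M ^ lev L * snd (code \<omega>0)\<bar> = real M ^ lev L * \<bar>snd (code \<omega>) - snd (code \<omega>0)\<bar>"
        by (simp add: right_diff_distrib[symmetric] abs_mult)
      also have "\<dots> \<le> (real M * real N ^ L) * (1 / real N ^ L)" using d M_pow_lev_le[of L] by (intro mult_mono) auto
      finally show ?thesis using N_pos by simp
    qed
    then have "\<bar>of_int (Y \<omega>) - of_int (Y \<omega>0) :: real\<bar> \<le> real M + 1" using My[OF \<omega>] My[OF \<omega>0] by (auto simp: abs_le_iff)
    ultimately show ?thesis by (simp add: abs_le_iff)
  qed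
  define R where "R = {X \<omega>0 - 2..X \<omega>0 + 2} \<times> {Y \<omega>0 - (int M + 1)..Y \<omega>0 + (int M + 1)}"
  have R: "finite R" "card R = 5 * (2 * M + 3)" by (auto simp: R_def card_cartesian_product nat_add_distrib)
  define \<phi> where "\<phi> g = (prefix_code N (\<lambda>i. fst (g i)) L, prefix_code M (\<lambda>i. snd (g i)) (lev L))" for g :: "nat \<Rightarrow> nat \<times> nat"
  have \<phi>key: "\<phi> (box_key L \<omega>) = (X \<omega>, Y \<omega>)" for \<omega>
    unfolding \<phi>_def X_def Y_def using lev_le[of L]
    by (intro arg_cong2[where f = Pair] prefix_code_cong) (auto simp: box_key_def)
  have "inj_on \<phi> (box_key L ` \<Omega>)"
  proof (rule inj_onI)
    fix g g' assume "g \<in> box_key L ` \<Omega>" "g' \<in> box_key L ` \<Omega>" and eq: "\<phi> g = \<phi> g'"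
    then obtain \<omega> \<omega>' where \<omega>: "\<omega> \<in> \<Omega>" "g = box_key L \<omega>" "\<omega>' \<in> \<Omega>" "g' = box_key L \<omega>'" by blast
    have b: "1 \<le> fst (\<omega> i) \<and> fst (\<omega> i) \<le> N" "1 \<le> snd (\<omega> i) \<and> snd (\<omega> i) \<le> M"  if "\<omega> \<in> \<Omega>" for \<omega> i
      using Q_bounds[of "fst (\<omega> i)" "snd (\<omega> i)"] \<Omega>[OF that, of i] by auto
    have "X \<omega> = X \<omega>'" "Y \<omega> = Y \<omega>'" using eq by (auto simp: \<omega> \<phi>key)
    then have f: "i < L \<Longrightarrow> fst (\<omega> i) = fst (\<omega>' i)" and s: "i < lev L \<Longrightarrow> snd (\<omega> i) = snd (\<omega>' i)" for i
      using prefix_code_inj[of L "\<lambda>i. fst (\<omega> i)" N "\<lambda>i. fst (\<omega>' i)" i] prefix_code_inj[of "lev L" "\<lambda>i. snd (\<omega> i)" M "\<lambda>i. snd (\<omega>' i)" i]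
        b[OF \<omega>(1)] b[OF \<omega>(3)] by (auto simp: X_def Y_def)
    show "g = g'" unfolding \<omega> box_key_def using f s lev_le[of L] by (intro restrict_ext) (auto intro: prod_eqI)
  qed
  moreover have "\<phi> ` box_key L ` \<Omega> \<subseteq> R" using XY by (auto simp: \<phi>key R_def)
  ultimately show ?thesis using R by (metis card_inj_on_le inj_on_finite)
qed simp

definition digit_pmf :: "(nat \<times> nat \<Rightarrow> real) \<Rightarrow> (nat \<times> nat) pmf" where
  "digit_pmf p = embed_pmf (\<lambda>q. if q \<in> Q then p q else 0)"

lemma pmf_digit_pmf:
  assumes p: "p \<in> \<Upsilon>" shows "pmf (digit_pmf p) q = (if q \<in> Q then p q else 0)"
  unfolding digit_pmf_def
proof (rule pmf_embed_pmf)
  show "0 \<le> (if q \<in> Q then p q else 0)" for q using Upsilon_nonneg[OF p] by simp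
  have "(\<integral>\<^sup>+ q. ennreal (if q \<in> Q then p q else 0) \<partial>count_space UNIV) = (\<Sum>q\<in>Q. ennreal (if q \<in> Q then p q else 0))"
    by (intro nn_integral_count_space') (auto simp: finite_Q)
  also have "\<dots> = ennreal (\<Sum>q\<in>Q. p q)"
    using Upsilon_nonneg[OF p] by (subst sum_ennreal[symmetric]) (auto intro!: sum.cong)
  finally show "(\<integral>\<^sup>+ q. ennreal (if q \<in> Q then p q else 0) \<partial>count_space UNIV) = 1"
    using Upsilon_sum[OF p] by simp
qed

lemma measure_digit_pmf:
  assumes p: "p \<in> \<Upsilon>" shows "measure (measure_pmf (digit_pmf p)) A = (\<Sum>q\<in>A \<inter> Q. p q)"
proof -
  have "set_pmf (digit_pmf p) \<subseteq> Q" by (auto simp: set_pmf_eq pmf_digit_pmf[OF p] split: if_splits)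
  then have "measure (measure_pmf (digit_pmf p)) A = measure (measure_pmf (digit_pmf p)) (A \<inter> Q)"
    by (intro measure_eq_AE) (auto simp: AE_measure_pmf_iff)
  also have "\<dots> = (\<Sum>q\<in>A \<inter> Q. p q)"
    using finite_Q by (subst measure_measure_pmf_finite) (auto simp: pmf_digit_pmf[OF p])
  finally show ?thesis .
qed

text \<open>The sums in \<open>U\<close> are the expected negative logarithms of the masses of the
  approximate squares. Exponential moments show that squares heavier than
  \<open>real N powr (- s * L)\<close> carry exponentially little mass, so a set \<open>G\<close> of
  positive measure avoids all of them from some level on. There the mass distribution principle
  applies. The condition in \<open>A\<close> that every digit has positive probability is what later
  makes prescribed digits certain.\<close>

lemma lower_mass:
  fixes p :: "nat \<Rightarrow> nat \<times> nat \<Rightarrow> real" and s \<eta> :: real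
  assumes p: "\<And>i. p i \<in> \<Upsilon>" and s: "0 < s" and \<eta>: "0 < \<eta>"
    and U: "\<And>L. L0 \<le> L \<Longrightarrow> (s * ln (real N) + \<eta>) * real L \<le> (\<Sum>i<L. h\<^sub>r (p i)) + (\<Sum>i<lev L. hc (p i))"
    and A: "\<And>\<omega>. (\<And>i. \<omega> i \<in> Q \<and> 0 < p i (\<omega> i)) \<Longrightarrow> code \<omega> \<in> A"
  shows "hausdorff_measure s A \<noteq> 0"
proof -
  define \<mu> where "\<mu> = PiM UNIV (\<lambda>i::nat. measure_pmf (digit_pmf (p i)))"
  interpret product_prob_space "\<lambda>i::nat. measure_pmf (digit_pmf (p i))" UNIV
    by (intro product_prob_spaceI prob_space_measure_pmf)
  have space: "space \<mu> = UNIV" by (simp add: \<mu>_def space_PiM)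
  have box: "{\<omega>. \<forall>i<L. \<omega> i \<in> X i} \<in> sets \<mu>"
    "emeasure \<mu> {\<omega>. \<forall>i<L. \<omega> i \<in> X i} = ennreal (\<Prod>i<L. \<Sum>q\<in>X i \<inter> Q. p i q)" for L :: nat and X
  proof -
    have eq: "{\<omega>. \<forall>i<L. \<omega> i \<in> X i} = prod_emb UNIV (\<lambda>i::nat. measure_pmf (digit_pmf (p i))) {..<L} (PiE {..<L} X)"
      by (intro set_eqI) (simp add: prod_emb_def restrict_PiE_iff Pi_iff Ball_def)
    show "{\<omega>. \<forall>i<L. \<omega> i \<in> X i} \<in> sets \<mu>"
      unfolding eq \<mu>_def by (intro sets_PiM_I) auto
    have "emeasure \<mu> {\<omega>. \<forall>i<L. \<omega> i \<in> X i} = (\<Prod>i<L. emeasure (measure_pmf (digit_pmf (p i))) (X i))"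
      unfolding eq \<mu>_def by (intro emeasure_PiM_emb) auto
    also have "\<dots> = (\<Prod>i<L. ennreal (\<Sum>q\<in>X i \<inter> Q. p i q))"
      by (simp add: measure_pmf.emeasure_eq_measure measure_digit_pmf[OF p])
    also have "\<dots> = ennreal (\<Prod>i<L. \<Sum>q\<in>X i \<inter> Q. p i q)"
      using Upsilon_nonneg[OF p] by (intro prod_ennreal sum_nonneg) auto
    finally show "emeasure \<mu> {\<omega>. \<forall>i<L. \<omega> i \<in> X i} = ennreal (\<Prod>i<L. \<Sum>q\<in>X i \<inter> Q. p i q)" .
  qed
  define tr where "tr L i q = (if i < lev L then q else (fst q, 0))" for L i and q :: "nat \<times> nat"
  define B where "B L i = (if i < lev L then Q else S \<times> {0})" for L i
  define wt where "wt L i q = (if i < lev L then p i q else col (p i) (fst q))" for L i and q :: "nat \<times> nat"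
  define w where "w L g = (\<Prod>i<L. wt L i (g i))" for L and g :: "nat \<Rightarrow> nat \<times> nat"
  define Box where "Box L g = {\<omega>. \<forall>i<L. \<omega> i \<in> {q. tr L i q = g i}}" for L and g :: "nat \<Rightarrow> nat \<times> nat"
  have finB: "finite (B L i)" for L i using finite_Q finite_S by (simp add: B_def)
  have key: "box_key L \<omega> \<in> PiE {..<L} (B L)" if "\<And>i. \<omega> i \<in> Q" for L \<omega>
  proof -
    have "fst (\<omega> i) \<in> S" for i using that[of i] by (auto simp: Q_def)
    then show ?thesis using that by (auto simp: box_key_def B_def)
  qed
  have in_Box: "\<omega> \<in> Box L (box_key L \<omega>)" for L \<omega>
    by (auto simp: Box_def box_key_def tr_def)
  have Box_sets: "Box L g \<in> sets \<mu>" for L g unfolding Box_def by (rule box)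
  have Box_mass: "emeasure \<mu> (Box L g) = ennreal (w L g)" if g: "g \<in> PiE {..<L} (B L)" for L g
  proof -
    have "(\<Sum>q\<in>{q. tr L i q = g i} \<inter> Q. p i q) = wt L i (g i)" if i: "i < L" for i
    proof (cases "i < lev L")
      case True
      then have "g i \<in> Q" using PiE_mem[OF g, of i] i by (simp add: B_def)
      then have "{q. tr L i q = g i} \<inter> Q = {g i}" using True by (auto simp: tr_def)
      then show ?thesis using True by (simp add: wt_def)
    next
      case False
      define a where "a = fst (g i)"
      have a: "a \<in> S" "g i = (a, 0)" using PiE_mem[OF g, of i] i False by (auto simp: B_def a_def)
      have "{q. tr L i q = g i} \<inter> Q = (\<lambda>b. (a, b)) ` P a" using a False by (auto simp: tr_def Q_def)
      then show ?thesis using False a by (simp add: wt_def col_def sum.reindex inj_on_def)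
    qed
    then show ?thesis unfolding Box_def box(2) w_def by (intro arg_cong[where f = ennreal] prod.cong) auto
  qed
  have wt: "0 \<le> wt L i q \<and> wt L i q \<le> 1" if "q \<in> B L i" for L i q
    using that Upsilon_nonneg[OF p] Upsilon_le_1[OF p] col_nonneg[OF p] col_le_1[OF p]
    by (auto simp: wt_def B_def split: if_splits)
  have w0: "0 \<le> w L g" if "g \<in> PiE {..<L} (B L)" for L g
    unfolding w_def using that wt by (intro prod_nonneg) (auto simp: PiE_iff)
  have S0: "(\<Sum>q\<in>S \<times> {0::nat}. k (fst q)) = (\<Sum>a\<in>S. k a)" for k :: "nat \<Rightarrow> real"
  proof -
    have "S \<times> {0::nat} = (\<lambda>a. (a, 0)) ` S" by auto
    then show ?thesis by (simp add: sum.reindex inj_on_def)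
  qed
  have wt_sum: "(\<Sum>q\<in>B L i. wt L i q) = 1" for L i
    using Upsilon_sum[OF p] col_sum[OF p] S0[of "col (p i)"] by (simp add: wt_def B_def)
  have wt_ent: "(\<Sum>q\<in>B L i. wt L i q * ln (wt L i q)) = - (h\<^sub>r (p i) + (if i < lev L then hc (p i) else 0))" for L i
    using S0[of "\<lambda>a. col (p i) a * ln (col (p i) a)"] by (simp add: wt_def B_def hc_def h_def h_r_col)
  have cardB: "card (B L i) \<le> card Q" for L i
  proof -
    have "S = fst ` Q" using P_nonempty by (force simp: Q_def image_def)
    then have "card S \<le> card Q" using finite_Q card_image_le by metis
    then show ?thesis by (simp add: B_def card_cartesian_product)
  qed
  define K where "K = real (card Q)"
  have K: "1 \<le> K" using finite_Q Q_nonempty by (simp add: K_def Suc_le_eq card_gt_0_iff)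
  \<comment> \<open>The exponent of the moment bound is
    \<open>- \<beta> * \<eta> + \<beta>\<^sup>2 * K\<close> per digit. This \<open>\<beta>\<close>
    makes the quadratic term half of the linear one, which leaves the decay rate
    \<open>c\<close>.\<close>
  define \<beta> where "\<beta> = \<eta> / (2 * K)"
  have \<beta>: "0 < \<beta>" "\<beta> * K = \<eta> / 2" using \<eta> K by (auto simp: \<beta>_def)
  define \<sigma> where "\<sigma> = s * ln (real N)"
  define Bad where "Bad L = {g \<in> PiE {..<L} (B L). exp (- \<sigma> * real L) < w L g}" for L
  have finPi: "finite (PiE {..<L} (B L))" for L by (rule finite_PiE) (simp_all add: finB)
  have finBad: "finite (Bad L)" for L
    by (rule finite_subset[OF _ finPi[of L]]) (auto simp: Bad_def)
  define c where "c = \<beta> * \<eta> / 2"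
  have c: "0 < c" using \<beta> \<eta> by (simp add: c_def)
  have bad: "emeasure \<mu> (\<Union>g\<in>Bad L. Box L g) \<le> ennreal (exp (- c * real L))" if L: "L0 \<le> L" for L
  proof -
    \<comment> \<open>Markov's inequality for the power \<open>\<beta>\<close> of the mass: on
      \<open>Bad L\<close> the inserted factor is at least 1.\<close>
    have "(\<Sum>g\<in>Bad L. w L g) \<le> (\<Sum>g\<in>Bad L. w L g powr (1 + \<beta>) * exp (\<beta> * \<sigma> * real L))"
    proof (rule sum_mono)
      fix g assume g: "g \<in> Bad L"
      then have wp: "0 < w L g" unfolding Bad_def by (auto intro: less_trans[OF exp_gt_zero])
      have "1 \<le> w L g powr \<beta> * exp (\<beta> * \<sigma> * real L)"
      proof -
        have "exp (- \<sigma> * real L) powr \<beta> \<le> w L g powr \<beta>"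
          using g \<beta> by (intro powr_mono2) (auto simp: Bad_def)
        moreover have "exp (- \<sigma> * real L) powr \<beta> = exp (- (\<beta> * \<sigma> * real L))" by (simp add: powr_def)
        ultimately have "exp (- (\<beta> * \<sigma> * real L)) * exp (\<beta> * \<sigma> * real L) \<le> w L g powr \<beta> * exp (\<beta> * \<sigma> * real L)"
          by (intro mult_right_mono) auto
        then show ?thesis by (simp add: exp_add[symmetric])
      qed
      then have "w L g * 1 \<le> w L g * (w L g powr \<beta> * exp (\<beta> * \<sigma> * real L))"
        using wp by (intro mult_left_mono) auto
      then show "w L g \<le> w L g powr (1 + \<beta>) * exp (\<beta> * \<sigma> * real L)"
        using wp by (simp add: powr_add)
    qed
    also have "\<dots> = (\<Sum>g\<in>Bad L. w L g powr (1 + \<beta>)) * exp (\<beta> * \<sigma> * real L)"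
      by (simp add: sum_distrib_right)
    also have "(\<Sum>g\<in>Bad L. w L g powr (1 + \<beta>)) \<le> (\<Sum>g\<in>PiE {..<L} (B L). w L g powr (1 + \<beta>))"
      using finPi by (intro sum_mono2) (auto simp: Bad_def)
    also have "\<dots> = (\<Sum>g\<in>PiE {..<L} (B L). \<Prod>i<L. wt L i (g i) powr (1 + \<beta>))"
      unfolding w_def by (intro sum.cong refl prod_powr_distrib)
    also have "\<dots> = (\<Prod>i<L. \<Sum>q\<in>B L i. wt L i q powr (1 + \<beta>))"
      using finB by (intro prod_sum_PiE[symmetric]) auto
    also have "\<dots> \<le> (\<Prod>i<L. exp (- \<beta> * (h\<^sub>r (p i) + (if i < lev L then hc (p i) else 0)) + \<beta>\<^sup>2 * K))"
    proof (intro prod_mono conjI)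
      fix i
      show "0 \<le> (\<Sum>q\<in>B L i. wt L i q powr (1 + \<beta>))" by (intro sum_nonneg) auto
      have "(\<Sum>q\<in>B L i. wt L i q powr (1 + \<beta>)) \<le> exp (\<beta> * (\<Sum>q\<in>B L i. wt L i q * ln (wt L i q)) + \<beta>\<^sup>2 * real (card (B L i)))"
        using wt wt_sum \<beta> by (intro powr_sum_le) auto
      also have "\<dots> \<le> exp (- \<beta> * (h\<^sub>r (p i) + (if i < lev L then hc (p i) else 0)) + \<beta>\<^sup>2 * K)"
      proof -
        have "\<beta>\<^sup>2 * real (card (B L i)) \<le> \<beta>\<^sup>2 * K" using cardB[of L i] by (intro mult_left_mono) (auto simp: K_def)
        then show ?thesis unfolding wt_ent exp_le_cancel_iff mult_minus_right mult_minus_left by linarith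
      qed
      finally show "(\<Sum>q\<in>B L i. wt L i q powr (1 + \<beta>)) \<le> exp (- \<beta> * (h\<^sub>r (p i) + (if i < lev L then hc (p i) else 0)) + \<beta>\<^sup>2 * K)" .
    qed
    also have "\<dots> = exp (\<Sum>i<L. - \<beta> * (h\<^sub>r (p i) + (if i < lev L then hc (p i) else 0)) + \<beta>\<^sup>2 * K)"
      by (simp add: exp_sum)
    also have "(\<Sum>i<L. - \<beta> * (h\<^sub>r (p i) + (if i < lev L then hc (p i) else 0)) + \<beta>\<^sup>2 * K)
      = - \<beta> * ((\<Sum>i<L. h\<^sub>r (p i)) + (\<Sum>i<lev L. hc (p i))) + \<beta>\<^sup>2 * K * real L"
    proof -
      have "(\<Sum>i<L. if i < lev L then hc (p i) else 0) = (\<Sum>i<lev L. hc (p i))"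
        using lev_le[of L] by (intro sum.mono_neutral_cong_right) auto
      then show ?thesis by (simp add: sum.distrib sum_distrib_left[symmetric] sum_subtractf sum_negf distrib_left)
    qed
    finally have "(\<Sum>g\<in>Bad L. w L g) \<le>
      exp (- \<beta> * ((\<Sum>i<L. h\<^sub>r (p i)) + (\<Sum>i<lev L. hc (p i))) + \<beta>\<^sup>2 * K * real L) * exp (\<beta> * \<sigma> * real L)"
      by simp
    also have "\<dots> \<le> exp (- c * real L)"
    proof -
      have "\<beta> * ((\<sigma> + \<eta>) * real L) \<le> \<beta> * ((\<Sum>i<L. h\<^sub>r (p i)) + (\<Sum>i<lev L. hc (p i)))"
        using U[OF L] \<beta> by (intro mult_left_mono) (auto simp: \<sigma>_def)
      moreover have "\<beta>\<^sup>2 * K * real L = c * real L"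
      proof -
        have "\<beta>\<^sup>2 * K = \<beta> * (\<beta> * K)" by (simp add: power2_eq_square)
        then show ?thesis unfolding \<beta>(2) by (simp add: c_def)
      qed
      moreover have "\<beta> * \<eta> * real L = 2 * (c * real L)" by (simp add: c_def)
      ultimately have "- \<beta> * ((\<Sum>i<L. h\<^sub>r (p i)) + (\<Sum>i<lev L. hc (p i))) + \<beta>\<^sup>2 * K * real L + \<beta> * \<sigma> * real L \<le> - c * real L"
      proof -
        have "\<beta> * ((\<sigma> + \<eta>) * real L) = \<beta> * \<sigma> * real L + \<beta> * \<eta> * real L" by (simp add: algebra_simps)
        then show ?thesis using \<open>\<beta> * ((\<sigma> + \<eta>) * real L) \<le> _\<close> \<open>\<beta>\<^sup>2 * K * real L = c * real L\<close> \<open>\<beta> * \<eta> * real L = 2 * (c * real L)\<close>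
          unfolding minus_mult_left[symmetric] by linarith
      qed
      then show ?thesis by (simp add: exp_add[symmetric])
    qed
    finally have sum: "(\<Sum>g\<in>Bad L. w L g) \<le> exp (- c * real L)" .
    have "emeasure \<mu> (\<Union>g\<in>Bad L. Box L g) \<le> (\<Sum>g\<in>Bad L. emeasure \<mu> (Box L g))"
      using finBad Box_sets by (intro emeasure_subadditive_finite) auto
    also have "\<dots> = (\<Sum>g\<in>Bad L. ennreal (w L g))"
      by (intro sum.cong refl Box_mass) (auto simp: Bad_def)
    also have "\<dots> = ennreal (\<Sum>g\<in>Bad L. w L g)" using w0 by (intro sum_ennreal) (auto simp: Bad_def)
    also have "\<dots> \<le> ennreal (exp (- c * real L))" using sum by (rule ennreal_leI)
    finally show ?thesis .
  qed
  \<comment> \<open>The null set of sequences in which some digit lies outside \<open>Q\<close> or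
    has probability zero. Each condition is written as a box, so that the measure formula
    applies.\<close>
  define N0 where "N0 = (\<Union>i. {\<omega>. \<forall>j<Suc i. \<omega> j \<in> (if j = i then - {q \<in> Q. 0 < p i q} else UNIV)})"
  have N0: "N0 \<in> sets \<mu>" "emeasure \<mu> N0 = 0"
  proof -
    have bx: "range (\<lambda>i. {\<omega>. \<forall>j<Suc i. \<omega> j \<in> (if j = i then - {q \<in> Q. 0 < p i q} else UNIV)}) \<subseteq> sets \<mu>"
      by (intro image_subsetI box)
    then show "N0 \<in> sets \<mu>" unfolding N0_def by (rule sets.countable_UN)
    have "emeasure \<mu> {\<omega>. \<forall>j<Suc i. \<omega> j \<in> (if j = i then - {q \<in> Q. 0 < p i q} else UNIV)} = 0" for i
    proof -
      have "(\<Sum>q\<in>- {q \<in> Q. 0 < p i q} \<inter> Q. p i q) = 0"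
        using Upsilon_nonneg[OF p, of _ i] by (intro sum.neutral) (auto intro: antisym)
      then show ?thesis unfolding box(2) by simp
    qed
    then show "emeasure \<mu> N0 = 0" unfolding N0_def using bx by (rule emeasure_UN_eq_0)
  qed
  define r where "r = exp (- c)"
  have r: "0 < r" "r < 1" using c by (auto simp: r_def)
  have "(\<lambda>L. r ^ L / (1 - r)) \<longlonglongrightarrow> 0 / (1 - r)"
    using r by (intro tendsto_divide LIMSEQ_realpow_zero tendsto_const) auto
  then have "\<forall>\<^sub>F L in sequentially. r ^ L / (1 - r) < 1"
    by (intro order_tendstoD(2)) auto
  \<comment> \<open>Far enough out the geometric tail is below 1, so the exceptional set does not
    have full measure.\<close>
  then obtain L2 where L2: "\<And>L. L2 \<le> L \<Longrightarrow> r ^ L / (1 - r) < 1" unfolding eventually_sequentially by blast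
  define L1 where "L1 = max L0 L2"
  define Z where "Z = N0 \<union> (\<Union>L. \<Union>g\<in>Bad (L + L1). Box (L + L1) g)"
  have Z_sets: "Z \<in> sets \<mu>" unfolding Z_def using N0 Box_sets finBad by (intro sets.Un sets.countable_UN sets.finite_UN) auto
  have "emeasure \<mu> Z < 1"
  proof -
    have "emeasure \<mu> Z \<le> emeasure \<mu> N0 + emeasure \<mu> (\<Union>L. \<Union>g\<in>Bad (L + L1). Box (L + L1) g)"
      unfolding Z_def using N0 Box_sets finBad by (intro emeasure_subadditive sets.countable_UN sets.finite_UN) auto
    also have "\<dots> \<le> (\<Sum>L. emeasure \<mu> (\<Union>g\<in>Bad (L + L1). Box (L + L1) g))"
      unfolding N0(2) add_0 using Box_sets finBad
      by (intro emeasure_subadditive_countably) (auto intro!: sets.finite_UN)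
    also have "\<dots> \<le> (\<Sum>L. ennreal (r ^ (L + L1)))"
    proof (intro suminf_le)
      fix L
      have "exp (- c * real (L + L1)) = r ^ (L + L1)" by (simp add: r_def exp_of_nat_mult[symmetric] mult.commute)
      then show "emeasure \<mu> (\<Union>g\<in>Bad (L + L1). Box (L + L1) g) \<le> ennreal (r ^ (L + L1))"
        using bad[of "L + L1"] by (simp add: L1_def)
    qed auto
    also have "\<dots> = ennreal (\<Sum>L. r ^ (L + L1))"
      using r by (intro suminf_ennreal2) (auto simp: power_add intro!: summable_mult2 summable_geometric)
    also have "(\<Sum>L. r ^ (L + L1)) = r ^ L1 / (1 - r)"
      using r by (simp add: power_add suminf_mult2[symmetric] suminf_geometric summable_geometric)
    also have "ennreal (r ^ L1 / (1 - r)) < 1" using L2[of L1] r by (simp add: L1_def ennreal_lessI)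
    finally show ?thesis .
  qed
  define G where "G = space \<mu> - Z"
  have G_sets: "G \<in> sets \<mu>" unfolding G_def using Z_sets by auto
  have P_space: "prob_space \<mu>" unfolding \<mu>_def by (rule prob_space_PiM) (rule prob_space_measure_pmf)
  have G_pos: "0 < emeasure \<mu> G"
  proof (rule ccontr)
    assume "\<not> 0 < emeasure \<mu> G"
    then have "emeasure \<mu> G = 0" by simp
    moreover have "emeasure \<mu> (space \<mu>) \<le> emeasure \<mu> G + emeasure \<mu> Z"
    proof -
      have "emeasure \<mu> (space \<mu>) \<le> emeasure \<mu> (G \<union> Z)"
        unfolding G_def using Z_sets by (intro emeasure_mono) auto
      also have "\<dots> \<le> emeasure \<mu> G + emeasure \<mu> Z" using G_sets Z_sets by (rule emeasure_subadditive)
      finally show ?thesis .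
    qed
    ultimately show False using \<open>emeasure \<mu> Z < 1\<close> prob_space.emeasure_space_1[OF P_space] by simp
  qed
  have GQ: "\<omega> i \<in> Q \<and> 0 < p i (\<omega> i)" if "\<omega> \<in> G" for \<omega> i
  proof (rule ccontr)
    assume "\<not> ?thesis"
    then have "\<forall>j<Suc i. \<omega> j \<in> (if j = i then - {q \<in> Q. 0 < p i q} else UNIV)" by simp
    then have "\<omega> \<in> N0" unfolding N0_def by blast
    then show False using that by (simp add: G_def Z_def)
  qed
  have Gw: "w L (box_key L \<omega>) \<le> exp (- \<sigma> * real L)" if \<omega>: "\<omega> \<in> G" and L: "L1 \<le> L" for \<omega> L
  proof (rule ccontr)
    assume "\<not> ?thesis"
    then have "box_key L \<omega> \<in> Bad (L - L1 + L1)" using key GQ[OF \<omega>] L by (auto simp: Bad_def)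
    then have "\<omega> \<in> (\<Union>g\<in>Bad (L - L1 + L1). Box (L - L1 + L1) g)" using in_Box[of \<omega> L] L by auto
    then show False using \<omega> by (auto simp: G_def Z_def)
  qed
  define C0 where "C0 = real (5 * (2 * M + 3))"
  \<comment> \<open>A small set meets boundedly many squares, and each square that contains the code
    of a point of \<open>G\<close> is light.\<close>
  have cov: "\<exists>E\<in>sets \<mu>. G \<inter> code -` V \<subseteq> E \<and> emeasure \<mu> E \<le> ennreal (C0 * exp (- \<sigma> * real L))"
    if V: "bounded V" "diameter V \<le> 1 / real N ^ L" and L: "L1 \<le> L" for V L
  proof -
    define \<Omega> where "\<Omega> = G \<inter> code -` V"
    have ck: "finite (box_key L ` \<Omega>) \<and> card (box_key L ` \<Omega>) \<le> 5 * (2 * M + 3)"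
    proof (rule card_box_keys)
      show "\<omega> i \<in> Q" if "\<omega> \<in> \<Omega>" for \<omega> i using GQ that by (simp add: \<Omega>_def)
      show "dist (code \<omega>) (code \<omega>') \<le> 1 / real N ^ L" if "\<omega> \<in> \<Omega>" "\<omega>' \<in> \<Omega>" for \<omega> \<omega>'
        using diameter_bounded_bound[OF V(1), of "code \<omega>" "code \<omega>'"] that V(2) by (simp add: \<Omega>_def)
    qed
    define E where "E = (\<Union>g\<in>box_key L ` \<Omega>. Box L g)"
    have "E \<in> sets \<mu>" unfolding E_def using ck Box_sets by (intro sets.finite_UN) auto
    moreover have "G \<inter> code -` V \<subseteq> E" unfolding E_def \<Omega>_def[symmetric] using in_Box by blast
    moreover have "emeasure \<mu> E \<le> ennreal (C0 * exp (- \<sigma> * real L))"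
    proof -
      have "emeasure \<mu> E \<le> (\<Sum>g\<in>box_key L ` \<Omega>. emeasure \<mu> (Box L g))"
        unfolding E_def using ck Box_sets by (intro emeasure_subadditive_finite) auto
      also have "\<dots> \<le> (\<Sum>g\<in>box_key L ` \<Omega>. ennreal (exp (- \<sigma> * real L)))"
      proof (rule sum_mono)
        fix g assume "g \<in> box_key L ` \<Omega>"
        then obtain \<omega> where \<omega>: "\<omega> \<in> G" "g = box_key L \<omega>" by (auto simp: \<Omega>_def)
        have "emeasure \<mu> (Box L g) = ennreal (w L g)" unfolding \<omega>(2) using GQ[OF \<omega>(1)] by (intro Box_mass key) auto
        then show "emeasure \<mu> (Box L g) \<le> ennreal (exp (- \<sigma> * real L))"
          using Gw[OF \<omega>(1) L] \<omega>(2) by (simp add: ennreal_leI)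
      qed
      also have "\<dots> = ennreal (real (card (box_key L ` \<Omega>)) * exp (- \<sigma> * real L))"
        by (simp add: ennreal_mult ennreal_of_nat_eq_real_of_nat)
      also have "\<dots> \<le> ennreal (C0 * exp (- \<sigma> * real L))"
      proof -
        have "real (card (box_key L ` \<Omega>)) \<le> C0" unfolding C0_def of_nat_le_iff using ck by blast
        then show ?thesis by (intro ennreal_leI mult_right_mono) auto
      qed
      finally show ?thesis .
    qed
    ultimately show ?thesis by blast
  qed
  have expN: "exp (- \<sigma> * real L) = (1 / real N ^ L) powr s" for L
    using N_pos by (simp add: powr_def ln_div ln_realpow \<sigma>_def)
  have N1: "1 < real N" using N_ge_2 by simp
  have N_lim: "(\<lambda>L. 1 / real N ^ L) \<longlonglongrightarrow> 0"
    using LIMSEQ_inverse_realpow_zero[OF N1] by (simp add: inverse_eq_divide)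
  show ?thesis
  proof (rule mass_distribution_principle[where \<pi> = code and \<mu> = \<mu> and G = G and C = "C0 * real N powr s" and \<delta> = "1 / real N ^ L1"])
    show "0 < s" "G \<in> sets \<mu>" "0 < emeasure \<mu> G" by (fact s G_sets G_pos)+
    show "0 \<le> C0 * real N powr s" by (simp add: C0_def)
    show "0 < 1 / real N ^ L1" using N_pos by simp
    show "code ` G \<subseteq> A" using A GQ by blast
    fix V :: "(real \<times> real) set"
    assume V: "bounded V" "V \<noteq> {}" "diameter V \<le> 1 / real N ^ L1"
    show "\<exists>E\<in>sets \<mu>. G \<inter> code -` V \<subseteq> E \<and> emeasure \<mu> E \<le> ennreal (C0 * real N powr s * diameter V powr s)"
    proof (cases "diameter V = 0")
      case True
      \<comment> \<open>For diameter zero the estimate holds at every level, and the intersection of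
        the covering events is a null set.\<close>
      have "\<forall>L. \<exists>E\<in>sets \<mu>. G \<inter> code -` V \<subseteq> E \<and> emeasure \<mu> E \<le> ennreal (C0 * exp (- \<sigma> * real (L + L1)))"
        using True N_pos by (intro allI cov[OF V(1)]) auto
      then obtain E where E: "\<And>L. E L \<in> sets \<mu>" "\<And>L. G \<inter> code -` V \<subseteq> E L"
        "\<And>L. emeasure \<mu> (E L) \<le> ennreal (C0 * exp (- \<sigma> * real (L + L1)))" by metis
      have "emeasure \<mu> (\<Inter>L. E L) \<le> ennreal (C0 * exp (- \<sigma> * real (L + L1)))" for L
        using emeasure_mono[of "\<Inter>L. E L" "E L" \<mu>] E(1,3) by (meson INT_lower UNIV_I order_trans)
      moreover have "(\<lambda>L. ennreal (C0 * exp (- \<sigma> * real (L + L1)))) \<longlonglongrightarrow> ennreal (C0 * 0)"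
      proof (intro tendsto_ennrealI tendsto_mult tendsto_const)
        have "0 < \<sigma>" using s ln_N_pos by (simp add: \<sigma>_def)
        then have "(\<lambda>L. exp (- \<sigma>) ^ (L + L1)) \<longlonglongrightarrow> 0"
          by (intro LIMSEQ_ignore_initial_segment LIMSEQ_realpow_zero) auto
        moreover have "exp (- \<sigma> * real (L + L1)) = exp (- \<sigma>) ^ (L + L1)" for L
          by (simp only: exp_of_nat_mult[symmetric] mult.commute)
        ultimately show "(\<lambda>L. exp (- \<sigma> * real (L + L1))) \<longlonglongrightarrow> 0" by simp
      qed
      ultimately have "emeasure \<mu> (\<Inter>L. E L) \<le> ennreal (C0 * 0)"
        by (intro LIMSEQ_le_const) auto
      moreover have "(\<Inter>L. E L) \<in> sets \<mu>" using E(1) by (intro sets.countable_INT) auto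
      ultimately show ?thesis using E(2) by (intro bexI[of _ "\<Inter>L. E L"]) auto
    next
      case False
      then have dpos: "0 < diameter V" using diameter_ge_0[OF V(1)] by simp
      obtain k where k: "1 / real N ^ Suc k < diameter V"
      proof -
        obtain j where "1 / real N ^ j < diameter V"
          using order_tendstoD(2)[OF N_lim dpos] unfolding eventually_sequentially by blast
        moreover have "1 / real N ^ Suc j \<le> 1 / real N ^ j" using N1 by (intro divide_left_mono power_increasing) auto
        ultimately have "1 / real N ^ Suc j < diameter V" by linarith
        then show ?thesis by (rule that)
      qed
      \<comment> \<open>The level with
        \<open>1 / real N ^ Suc L < diameter V \<le> 1 / real N ^ L\<close>; the lost factor is the
        \<open>real N powr s\<close> in the constant.\<close>
      define L where "L = (LEAST k. 1 / real N ^ Suc k < diameter V)"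
      have L: "1 / real N ^ Suc L < diameter V" unfolding L_def by (rule LeastI[of _ k]) (rule k)
      have "L1 \<le> L"
      proof (rule ccontr)
        assume "\<not> L1 \<le> L"
        then have "1 / real N ^ L1 \<le> 1 / real N ^ Suc L" using N1 by (intro divide_left_mono power_increasing) auto
        then show False using L V(3) by simp
      qed
      moreover have "diameter V \<le> 1 / real N ^ L"
      proof (cases L)
        case 0
        have "1 / real N ^ L1 \<le> 1 / real N ^ 0" using N1 by (intro divide_left_mono power_increasing) auto
        then show ?thesis using V(3) 0 by simp
      next
        case (Suc j)
        then have "\<not> 1 / real N ^ Suc j < diameter V"
          unfolding L_def by (intro not_less_Least) simp
        then show ?thesis using Suc by simp
      qed
      ultimately obtain E where E: "E \<in> sets \<mu>" "G \<inter> code -` V \<subseteq> E" "emeasure \<mu> E \<le> ennreal (C0 * exp (- \<sigma> * real L))"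
        using cov[OF V(1)] by blast
      have "exp (- \<sigma> * real L) \<le> real N powr s * diameter V powr s"
      proof -
        have "exp (- \<sigma> * real L) = (real N * (1 / real N ^ Suc L)) powr s" unfolding expN using N_pos by simp
        also have "\<dots> = real N powr s * (1 / real N ^ Suc L) powr s" by (rule powr_mult)
        also have "\<dots> \<le> real N powr s * diameter V powr s"
          using L s by (intro mult_left_mono powr_mono2) auto
        finally show ?thesis .
      qed
      then have "C0 * exp (- \<sigma> * real L) \<le> C0 * real N powr s * diameter V powr s"
        unfolding mult.assoc by (intro mult_left_mono) (auto simp: C0_def)
      then have "emeasure \<mu> E \<le> ennreal (C0 * real N powr s * diameter V powr s)"
        using E(3) ennreal_leI order_trans by blast
      then show ?thesis using E by blast
    qed
  qed
qed

end

section \<open>The measure for the lower bound\<close>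

text \<open>The difference of two affine functions is monotone, so on an interval its minimum is at
  one of the ends.\<close>

lemma affine_ge:
  fixes A B a b c s :: real
  assumes "s * a \<le> A + B * a" "s * b \<le> A + B * b" "a \<le> c" "c \<le> b"
  shows "s * c \<le> A + B * c"
proof (cases "B \<ge> s")
  case True
  have "(B - s) * a \<le> (B - s) * c" using True assms by (intro mult_left_mono) auto
  then show ?thesis using assms(1) by (simp add: algebra_simps)
next
  case False
  have "(s - B) * c \<le> (s - B) * b" using False assms by (intro mult_left_mono) auto
  then show ?thesis using assms(2) by (simp add: algebra_simps)
qed

context bedford_mcmullen
begin

text \<open>The measure of an approximate square of level \<open>r\<close> is about \<open>exp (- (X r + Y (r / \<tau>)))\<close>. Between
  two consecutive critical scales the lower bound is the minimum of affine functions, so that it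
  is enough to have the estimate at the critical scales, where it is one of the conditions
  \<open>d\<^sub>1, \<dots>, d\<^sub>6\<close>.\<close>

lemma stage_bound:
  fixes X Y :: "real \<Rightarrow> real" and n E K s0 \<epsilon> \<alpha> :: real and q :: "nat \<Rightarrow> nat \<times> nat \<Rightarrow> real"
  defines "m \<equiv> prefix_m \<alpha>" and "R \<equiv> \<tau> + \<alpha>"
  assumes \<alpha>: "0 < \<alpha>" and n: "0 < n" and in\<Upsilon>: "pm \<in> \<Upsilon>" "p1 \<in> \<Upsilon>" "p2 \<in> \<Upsilon>" "pp \<in> \<Upsilon>"
    and s0: "0 \<le> s0" "s0 \<le> e1 pm" "s0 * (1 + \<alpha>) \<le> u2 \<alpha> pm p1" "s0 * (\<tau> + \<alpha>) \<le> u3 \<alpha> pm p1 p2"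
      "s0 * (\<tau> * (1 + \<alpha>)) \<le> u4 \<alpha> pm p1 p2 pp" "s0 * (\<tau> * (\<tau> + \<alpha>)) \<le> u5 \<alpha> pm p1 p2 pp"
    and E: "0 \<le> E" "9 * E \<le> \<epsilon> * m * n" "2 * E \<le> \<epsilon> * (\<tau> - 1) * n" and \<epsilon>: "0 < \<epsilon>"
    and K: "\<tau> * R \<le> m * K"
    and mono: "\<And>r r'. 0 \<le> r \<Longrightarrow> r \<le> r' \<Longrightarrow> X r \<le> X r' \<and> Y r \<le> Y r'"
    and w1: "\<And>r. 0 \<le> r \<Longrightarrow> r \<le> m * n \<Longrightarrow> h\<^sub>r pm * r - E \<le> X r \<and> hc pm * r - E \<le> Y r"
    and w2: "\<And>r. m * n \<le> r \<Longrightarrow> r \<le> n \<Longrightarrow> X (m * n) + h\<^sub>r p1 * (r - m * n) - E \<le> X r \<and> Y (m * n) + hc p1 * (r - m * n) - E \<le> Y r"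
    and w3: "\<And>r. n \<le> r \<Longrightarrow> r \<le> R * n \<Longrightarrow> X n + h\<^sub>r p2 * (r - (1 + \<alpha>) * n) - E \<le> X r \<and> Y n + hc p2 * (r - (1 + \<alpha>) * n) - E \<le> Y r"
    and w4: "\<And>r j. R * \<tau> ^ j * n \<le> r \<Longrightarrow> r \<le> R * \<tau> ^ Suc j * n \<Longrightarrow> r \<le> m * K * n \<Longrightarrow>
      X (R * \<tau> ^ j * n) + h\<^sub>r (q j) * (r - R * \<tau> ^ j * n) - E \<le> X r \<and> Y (R * \<tau> ^ j * n) + hc (q j) * (r - R * \<tau> ^ j * n) - E \<le> Y r"
    and q0: "q 0 = pp" and slope: "\<And>j. s0 - \<epsilon> \<le> h\<^sub>r (q (Suc j)) + hc (q j) / \<tau>"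
    and r: "m * n \<le> r" "r \<le> m * K * n"
  shows "(s0 - 2 * \<epsilon>) * r \<le> X r + Y (r / \<tau>)"
proof -
  note pos = tau_gt_1 \<alpha> prefix_m[OF \<alpha>, folded m_def]
  have \<tau>0: "0 < \<tau>" using pos by simp
  have nonneg: "0 \<le> h\<^sub>r pm" "0 \<le> h\<^sub>r p1" "0 \<le> h\<^sub>r p2" "0 \<le> h\<^sub>r pp" "0 \<le> hc pm" "0 \<le> hc p1" "0 \<le> hc p2" "0 \<le> hc pp"
    using h_r_nonneg hc_nonneg in\<Upsilon> by auto
  define L4 where "L4 = \<tau> * (1 + \<alpha>)"
  define L5 where "L5 = \<tau> * R"
  define U where "U r = X r + Y (r / \<tau>)" for r
  have R1: "1 + \<alpha> \<le> R" "1 \<le> R" using pos by (auto simp: R_def)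
  have RL: "R \<le> L4" "L4 \<le> L5" "1 \<le> L5" "R \<le> L5"
  proof -
    have "1 * \<alpha> \<le> \<tau> * \<alpha>" using pos by (intro mult_right_mono) auto
    then show "R \<le> L4" by (simp add: R_def L4_def distrib_left)
    show "L4 \<le> L5" unfolding L4_def L5_def using R1 \<tau>0 by (intro mult_left_mono) auto
    then show "R \<le> L5" using \<open>R \<le> L4\<close> by simp
    then show "1 \<le> L5" using R1 by simp
  qed
  have R\<tau>: "1 \<le> R / \<tau>" "R / \<tau> \<le> 1 + \<alpha>"
  proof -
    show "1 \<le> R / \<tau>" using pos by (simp add: R_def pos_le_divide_eq)
    have "R \<le> (1 + \<alpha>) * \<tau>" using RL(1) by (simp add: L4_def mult.commute)
    then show "R / \<tau> \<le> 1 + \<alpha>" using \<tau>0 by (simp add: pos_divide_le_eq)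
  qed
  have m\<tau>: "m \<le> (1 + \<alpha>) / \<tau>" using pos by blast
  have Xm: "(h\<^sub>r pm * m) * n - E \<le> X (m * n)" and Ym: "(hc pm * m) * n - E \<le> Y (m * n)"
    using w1[of "m * n"] pos n by (auto simp: mult.assoc)
  have Xn: "(h\<^sub>r pm * m + h\<^sub>r p1 * (1 - m)) * n - 2 * E \<le> X n" and Yn: "(hc pm * m + hc p1 * (1 - m)) * n - 2 * E \<le> Y n"
    using w2[of n] Xm Ym pos n by (auto simp: algebra_simps)
  have XR: "(h\<^sub>r pm * m + h\<^sub>r p1 * (1 - m) + h\<^sub>r p2 * (\<tau> - 1)) * n - 3 * E \<le> X (R * n)"
  proof -
    have "R * n - (1 + \<alpha>) * n = (\<tau> - 1) * n" by (simp add: R_def algebra_simps)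
    then have "X n + h\<^sub>r p2 * ((\<tau> - 1) * n) - E \<le> X (R * n)" using w3[of "R * n"] n R1 by simp
    then show ?thesis using Xn by (simp add: algebra_simps)
  qed
  \<comment> \<open>The regimes are separated where the position \<open>c\<close> or the row
    position \<open>c / \<tau>\<close> enters another window. The loss \<open>7 * E\<close> is that
    of the last one: three windows plus one for the columns, two plus one for the rows.\<close>
  have small: "s0 * c * n - 7 * E \<le> U (c * n)" if c: "m \<le> c" "c \<le> L5" for c
  proof -
    have c0: "0 \<le> c" using c pos by simp
    have c\<tau>: "c * n / \<tau> = c / \<tau> * n" by simp
    consider "c \<le> 1" | "1 \<le> c" "c \<le> 1 + \<alpha>" | "1 + \<alpha> \<le> c" "c \<le> R" | "R \<le> c" "c \<le> L4" | "L4 \<le> c"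
      by linarith
    then show ?thesis
    proof cases
      case 1
      have "c / \<tau> \<le> m" using 1 pos by (meson divide_right_mono \<tau>0 less_imp_le order_trans)
      then have "c / \<tau> * n \<le> m * n" using n by (intro mult_right_mono) auto
      then have "hc pm * (c / \<tau> * n) - E \<le> Y (c / \<tau> * n)" using w1[of "c / \<tau> * n"] c0 \<tau>0 n by simp
      moreover have "X (m * n) + h\<^sub>r p1 * (c * n - m * n) - E \<le> X (c * n)"
        using w2[of "c * n"] c 1 n by (simp add: mult_right_mono)
      moreover have "s0 * c \<le> (h\<^sub>r pm * m - h\<^sub>r p1 * m) + (h\<^sub>r p1 + hc pm / \<tau>) * c"
      proof (rule affine_ge[of _ m _ _ "1 + \<alpha>"])
        have "s0 * m \<le> e1 pm * m" using s0 pos by (intro mult_right_mono) auto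
        then show "s0 * m \<le> (h\<^sub>r pm * m - h\<^sub>r p1 * m) + (h\<^sub>r p1 + hc pm / \<tau>) * m"
          by (simp add: e1_def algebra_simps)
        have "hc pm * m \<le> hc pm * ((1 + \<alpha>) / \<tau>)" using m\<tau> nonneg by (intro mult_left_mono) auto
        moreover have "0 \<le> h\<^sub>r p1 * \<alpha>" using nonneg \<alpha> by simp
        ultimately show "s0 * (1 + \<alpha>) \<le> (h\<^sub>r pm * m - h\<^sub>r p1 * m) + (h\<^sub>r p1 + hc pm / \<tau>) * (1 + \<alpha>)"
          using s0(3) unfolding u2_def m_def[symmetric] by (simp add: algebra_simps)
      qed (use c 1 \<alpha> in auto)
      then have "(s0 * c) * n \<le> ((h\<^sub>r pm * m - h\<^sub>r p1 * m) + (h\<^sub>r p1 + hc pm / \<tau>) * c) * n"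
        using n by (intro mult_right_mono) auto
      ultimately show ?thesis using Xm E(1) unfolding U_def c\<tau> by (simp add: algebra_simps)
    next
      case 2
      have "n \<le> c * n" using 2 n by simp
      then have Xc: "X n \<le> X (c * n)" using mono[of n "c * n"] n by simp
      show ?thesis
      proof (cases "c / \<tau> \<le> m")
        case True
        then have "c / \<tau> * n \<le> m * n" using n by (intro mult_right_mono) auto
        then have "hc pm * (c / \<tau> * n) - E \<le> Y (c / \<tau> * n)" using w1[of "c / \<tau> * n"] c0 \<tau>0 n by simp
        moreover have "s0 * c \<le> (h\<^sub>r pm * m + h\<^sub>r p1 * (1 - m)) + (hc pm / \<tau>) * c"
        proof (rule affine_ge[of _ m _ _ "1 + \<alpha>"])
          have "s0 * m \<le> e1 pm * m" using s0 pos by (intro mult_right_mono) auto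
          moreover have "0 \<le> h\<^sub>r p1 * (1 - m)" using nonneg pos by simp
          ultimately show "s0 * m \<le> (h\<^sub>r pm * m + h\<^sub>r p1 * (1 - m)) + (hc pm / \<tau>) * m"
            by (simp add: e1_def algebra_simps)
          have "hc pm * m \<le> hc pm * ((1 + \<alpha>) / \<tau>)" using m\<tau> nonneg by (intro mult_left_mono) auto
          then show "s0 * (1 + \<alpha>) \<le> (h\<^sub>r pm * m + h\<^sub>r p1 * (1 - m)) + (hc pm / \<tau>) * (1 + \<alpha>)"
            using s0(3) unfolding u2_def m_def[symmetric] by (simp add: algebra_simps)
        qed (use c 2 in auto)
        then have "(s0 * c) * n \<le> ((h\<^sub>r pm * m + h\<^sub>r p1 * (1 - m)) + (hc pm / \<tau>) * c) * n"
          using n by (intro mult_right_mono) auto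
        ultimately show ?thesis using Xn Xc E(1) unfolding U_def c\<tau> by (simp add: algebra_simps)
      next
        case False
        then have "m * n \<le> c / \<tau> * n" using n by (intro mult_right_mono) auto
        then have "Y (m * n) \<le> Y (c / \<tau> * n)" using mono[of "m * n" "c / \<tau> * n"] pos n by simp
        moreover have "(s0 * c) * n \<le> u2 \<alpha> pm p1 * n"
        proof (rule mult_right_mono)
          have "s0 * c \<le> s0 * (1 + \<alpha>)" using 2 s0(1) by (intro mult_left_mono) auto
          then show "s0 * c \<le> u2 \<alpha> pm p1" using s0(3) by simp
        qed (use n in simp)
        ultimately show ?thesis using Xn Xc Ym E(1) unfolding U_def c\<tau> u2_def m_def[symmetric] by (simp add: algebra_simps)
      qed
    next
      case 3
      have "n \<le> c * n" "c * n \<le> R * n" using 3 n \<alpha> by auto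
      then have Xc: "X n + h\<^sub>r p2 * (c * n - (1 + \<alpha>) * n) - E \<le> X (c * n)" using w3[of "c * n"] by simp
      have mc: "m \<le> c / \<tau>"
      proof -
        have "(1 + \<alpha>) / \<tau> \<le> c / \<tau>" using 3 \<tau>0 by (intro divide_right_mono) auto
        then show ?thesis using m\<tau> by simp
      qed
      show ?thesis
      proof (cases "c / \<tau> \<le> 1")
        case True
        have "m * n \<le> c / \<tau> * n" using mc n by (intro mult_right_mono) auto
        then have "Y (m * n) + hc p1 * (c / \<tau> * n - m * n) - E \<le> Y (c / \<tau> * n)"
          using w2[of "c / \<tau> * n"] mult_right_mono[OF True, of n] n by simp
        moreover have "s0 * c \<le> (u2 \<alpha> pm p1 - h\<^sub>r p2 * (1 + \<alpha>) - hc p1 * m) + (h\<^sub>r p2 + hc p1 / \<tau>) * c"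
        proof (rule affine_ge[of _ "1 + \<alpha>" _ _ R])
          have "hc p1 * m \<le> hc p1 * ((1 + \<alpha>) / \<tau>)" using m\<tau> nonneg by (intro mult_left_mono) auto
          then show "s0 * (1 + \<alpha>) \<le> (u2 \<alpha> pm p1 - h\<^sub>r p2 * (1 + \<alpha>) - hc p1 * m) + (h\<^sub>r p2 + hc p1 / \<tau>) * (1 + \<alpha>)"
            using s0(3) by (simp add: algebra_simps)
          have "hc p1 * 1 \<le> hc p1 * (R / \<tau>)" using R\<tau> nonneg by (intro mult_left_mono) auto
          moreover have "h\<^sub>r p2 * R = h\<^sub>r p2 * (1 + \<alpha>) + (\<tau> - 1) * h\<^sub>r p2" by (simp add: R_def algebra_simps)
          ultimately show "s0 * R \<le> (u2 \<alpha> pm p1 - h\<^sub>r p2 * (1 + \<alpha>) - hc p1 * m) + (h\<^sub>r p2 + hc p1 / \<tau>) * R"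
            using s0(4)[folded R_def] unfolding u3_def m_def[symmetric] by (simp add: algebra_simps)
        qed (use 3 in auto)
        then have "(s0 * c) * n \<le> ((u2 \<alpha> pm p1 - h\<^sub>r p2 * (1 + \<alpha>) - hc p1 * m) + (h\<^sub>r p2 + hc p1 / \<tau>) * c) * n"
          using n by (intro mult_right_mono) auto
        ultimately show ?thesis using Xn Xc Ym E(1) unfolding U_def c\<tau> u2_def m_def[symmetric] by (simp add: algebra_simps)
      next
        case False
        then have "n \<le> c / \<tau> * n" using mult_right_mono[of 1 "c / \<tau>" n] n by simp
        then have "Y n \<le> Y (c / \<tau> * n)" using mono[of n "c / \<tau> * n"] n by simp
        moreover have "s0 * c \<le> (u2 \<alpha> pm p1 + (1 - m) * hc p1 - h\<^sub>r p2 * (1 + \<alpha>)) + h\<^sub>r p2 * c"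
        proof (rule affine_ge[of _ "1 + \<alpha>" _ _ R])
          have "0 \<le> (1 - m) * hc p1" using nonneg pos by simp
          then show "s0 * (1 + \<alpha>) \<le> (u2 \<alpha> pm p1 + (1 - m) * hc p1 - h\<^sub>r p2 * (1 + \<alpha>)) + h\<^sub>r p2 * (1 + \<alpha>)"
            using s0(3) by simp
          have "h\<^sub>r p2 * R = h\<^sub>r p2 * (1 + \<alpha>) + (\<tau> - 1) * h\<^sub>r p2" by (simp add: R_def algebra_simps)
          then show "s0 * R \<le> (u2 \<alpha> pm p1 + (1 - m) * hc p1 - h\<^sub>r p2 * (1 + \<alpha>)) + h\<^sub>r p2 * R"
            using s0(4)[folded R_def] unfolding u3_def m_def[symmetric] by simp
        qed (use 3 in auto)
        then have "(s0 * c) * n \<le> ((u2 \<alpha> pm p1 + (1 - m) * hc p1 - h\<^sub>r p2 * (1 + \<alpha>)) + h\<^sub>r p2 * c) * n"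
          using n by (intro mult_right_mono) auto
        ultimately show ?thesis using Xn Xc Yn E(1) unfolding U_def c\<tau> u2_def m_def[symmetric] by (simp add: algebra_simps)
      qed
    next
      case 4
      have "c * n \<le> R * \<tau> * n" using 4 RL n by (simp add: L5_def mult.commute)
      moreover have "R * \<tau> * n \<le> m * K * n" using K n by (simp add: mult.commute)
      ultimately have Xc: "X (R * n) + h\<^sub>r pp * (c * n - R * n) - E \<le> X (c * n)"
        using w4[of 0 "c * n"] 4 n q0 by (simp add: mult_right_mono)
      have "1 \<le> c / \<tau>" using 4 R\<tau> \<tau>0 by (meson divide_right_mono less_imp_le order_trans)
      then have "n \<le> c / \<tau> * n" using mult_right_mono[of 1 "c / \<tau>" n] n by simp
      then have "Y n \<le> Y (c / \<tau> * n)" using mono[of n "c / \<tau> * n"] n by simp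
      moreover have "s0 * c \<le> (u3 \<alpha> pm p1 p2 - h\<^sub>r pp * R) + h\<^sub>r pp * c"
      proof (rule affine_ge[of _ R _ _ L4])
        show "s0 * R \<le> (u3 \<alpha> pm p1 p2 - h\<^sub>r pp * R) + h\<^sub>r pp * R" using s0(4) by (simp add: R_def)
        have "h\<^sub>r pp * L4 = h\<^sub>r pp * R + \<alpha> * (\<tau> - 1) * h\<^sub>r pp" by (simp add: R_def L4_def algebra_simps)
        then show "s0 * L4 \<le> (u3 \<alpha> pm p1 p2 - h\<^sub>r pp * R) + h\<^sub>r pp * L4"
          using s0(5)[folded L4_def] unfolding u4_def by simp
      qed (use 4 in auto)
      then have "(s0 * c) * n \<le> ((u3 \<alpha> pm p1 p2 - h\<^sub>r pp * R) + h\<^sub>r pp * c) * n"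
        using n by (intro mult_right_mono) auto
      ultimately show ?thesis using XR Xc Yn E(1) unfolding U_def c\<tau> u3_def u2_def m_def[symmetric] by (simp add: algebra_simps)
    next
      case 5
      have "c * n \<le> R * \<tau> * n" using c n by (simp add: L5_def mult.commute)
      moreover have "R * \<tau> * n \<le> m * K * n" using K n by (simp add: mult.commute)
      moreover have "R * n \<le> c * n" using 5 RL n by simp
      ultimately have Xc: "X (R * n) + h\<^sub>r pp * (c * n - R * n) - E \<le> X (c * n)"
        using w4[of 0 "c * n"] q0 by simp
      have "1 + \<alpha> \<le> c / \<tau>" using 5 \<tau>0 by (simp add: L4_def pos_le_divide_eq mult.commute)
      moreover have "c / \<tau> \<le> R" using c \<tau>0 by (simp add: L5_def pos_divide_le_eq mult.commute)
      ultimately have "1 * n \<le> c / \<tau> * n" "c / \<tau> * n \<le> R * n" using n \<alpha> by (intro mult_right_mono; simp)+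
      then have "Y n + hc p2 * (c / \<tau> * n - (1 + \<alpha>) * n) - E \<le> Y (c / \<tau> * n)" using w3[of "c / \<tau> * n"] unfolding mult_1 by blast
      moreover have "s0 * c \<le> (u3 \<alpha> pm p1 p2 - h\<^sub>r pp * R - hc p2 * (1 + \<alpha>)) + (h\<^sub>r pp + hc p2 / \<tau>) * c"
      proof (rule affine_ge[of _ L4 _ _ L5])
        have "h\<^sub>r pp * L4 = h\<^sub>r pp * R + \<alpha> * (\<tau> - 1) * h\<^sub>r pp" by (simp add: R_def L4_def algebra_simps)
        moreover have "hc p2 / \<tau> * L4 = hc p2 * (1 + \<alpha>)" using \<tau>0 by (simp add: L4_def)
        ultimately show "s0 * L4 \<le> (u3 \<alpha> pm p1 p2 - h\<^sub>r pp * R - hc p2 * (1 + \<alpha>)) + (h\<^sub>r pp + hc p2 / \<tau>) * L4"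
          using s0(5)[folded L4_def] unfolding u4_def distrib_right by simp
        have "h\<^sub>r pp * L5 = h\<^sub>r pp * R + (\<tau> + \<alpha>) * (\<tau> - 1) * h\<^sub>r pp" by (simp add: R_def L5_def algebra_simps)
        moreover have "hc p2 / \<tau> * L5 = hc p2 * (1 + \<alpha>) + (\<tau> - 1) * hc p2" using \<tau>0 by (simp add: L5_def R_def algebra_simps)
        ultimately show "s0 * L5 \<le> (u3 \<alpha> pm p1 p2 - h\<^sub>r pp * R - hc p2 * (1 + \<alpha>)) + (h\<^sub>r pp + hc p2 / \<tau>) * L5"
          using s0(6)[folded R_def, folded L5_def] unfolding u5_def distrib_right by simp
      qed (use c 5 in auto)
      then have "(s0 * c) * n \<le> ((u3 \<alpha> pm p1 p2 - h\<^sub>r pp * R - hc p2 * (1 + \<alpha>)) + (h\<^sub>r pp + hc p2 / \<tau>) * c) * n"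
        using n by (intro mult_right_mono) auto
      ultimately show ?thesis using XR Xc Yn E(1) unfolding U_def c\<tau> u3_def u2_def m_def[symmetric] by (simp add: algebra_simps)
    qed
  qed
  \<comment> \<open>Between \<open>a j\<close> and \<open>a (Suc j)\<close> the columns are in
    window \<open>Suc j\<close> of the interpolation, while the rows, at \<open>r / \<tau>\<close>,
    are still in window \<open>j\<close>. This lag is the reason for the form of
    \<open>slope\<close>.\<close>
  define a where "a j = L5 * \<tau> ^ j * n" for j
  have a_Suc: "a (Suc j) = \<tau> * a j" for j by (simp add: a_def)
  have a_ge: "n \<le> a j" for j
  proof -
    have "1 * 1 \<le> L5 * \<tau> ^ j" using RL pos by (intro mult_mono) auto
    then show ?thesis using n by (simp add: a_def)
  qed
  have inc: "U (a j) + (s0 - \<epsilon>) * (r - a j) - 2 * E \<le> U r" if r: "a j \<le> r" "r \<le> a (Suc j)" "r \<le> m * K * n" for j r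
  proof -
    have aj: "a j = R * \<tau> ^ Suc j * n" "a (Suc j) = R * \<tau> ^ Suc (Suc j) * n" "a j / \<tau> = R * \<tau> ^ j * n"
      using \<tau>0 by (auto simp: a_def L5_def)
    have r0: "0 \<le> r" using r(1) a_ge[of j] n by linarith
    have 1: "X (a j) + h\<^sub>r (q (Suc j)) * (r - a j) - E \<le> X r" using w4[of "Suc j" r] r unfolding aj(1,2) by blast
    have "R * \<tau> ^ j * n \<le> r / \<tau>" unfolding aj(3)[symmetric] using r(1) \<tau>0 by (intro divide_right_mono) auto
    moreover have "r / \<tau> \<le> R * \<tau> ^ Suc j * n" unfolding aj(1)[symmetric] using r(2) \<tau>0 by (simp add: a_Suc pos_divide_le_eq mult.commute)
    moreover have "r / \<tau> \<le> m * K * n"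
    proof -
      have "r * 1 \<le> r * \<tau>" using r0 pos by (intro mult_left_mono) auto
      then have "r / \<tau> \<le> r" using \<tau>0 by (simp add: pos_divide_le_eq)
      then show ?thesis using r(3) by simp
    qed
    ultimately have 2: "Y (a j / \<tau>) + hc (q j) * (r / \<tau> - a j / \<tau>) - E \<le> Y (r / \<tau>)" using w4[of j "r / \<tau>"] unfolding aj(3) by blast
    have "(s0 - \<epsilon>) * (r - a j) \<le> (h\<^sub>r (q (Suc j)) + hc (q j) / \<tau>) * (r - a j)"
      using slope r by (intro mult_right_mono) auto
    also have "\<dots> = h\<^sub>r (q (Suc j)) * (r - a j) + hc (q j) * (r / \<tau> - a j / \<tau>)"
      by (simp add: distrib_right diff_divide_distrib right_diff_distrib)
    finally show ?thesis using 1 2 unfolding U_def by linarith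
  qed
  \<comment> \<open>Each window loses \<open>2 * E\<close> but has length at least
    \<open>(\<tau> - 1) * n\<close>, so the second \<open>\<epsilon>\<close> pays for it. The
    surplus \<open>2 * E\<close> in the claim is kept for the last, incomplete window.\<close>
  have big: "(s0 - 2 * \<epsilon>) * a j + 2 * E \<le> U (a j)" if "a j \<le> m * K * n" for j
    using that
  proof (induction j)
    case 0
    have "s0 * L5 * n - 7 * E \<le> U (L5 * n)" using RL pos by (intro small) auto
    moreover have "9 * E \<le> 2 * (\<epsilon> * L5 * n)"
    proof -
      have "m * (\<epsilon> * n) \<le> (2 * L5) * (\<epsilon> * n)" using RL pos \<epsilon> n by (intro mult_right_mono) auto
      then show ?thesis using E(2) by (simp add: mult_ac)
    qed
    ultimately show ?case by (simp add: a_def algebra_simps)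
  next
    case (Suc j)
    have le: "a j \<le> a (Suc j)" using a_ge[of j] n pos by (simp add: a_Suc mult_le_cancel_right1)
    have IH: "(s0 - 2 * \<epsilon>) * a j + 2 * E \<le> U (a j)" using Suc le by simp
    have "U (a j) + (s0 - \<epsilon>) * (a (Suc j) - a j) - 2 * E \<le> U (a (Suc j))" using le Suc.prems by (intro inc) auto
    moreover have "2 * E \<le> \<epsilon> * (a (Suc j) - a j)"
    proof -
      have "(\<epsilon> * (\<tau> - 1)) * n \<le> (\<epsilon> * (\<tau> - 1)) * a j" using a_ge[of j] \<epsilon> pos by (intro mult_left_mono) auto
      then show ?thesis using E(3) by (simp add: a_Suc algebra_simps)
    qed
    ultimately show ?case using IH by (simp add: algebra_simps)
  qed
  show ?thesis
  proof (cases "r \<le> L5 * n")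
    case True
    have c: "m \<le> r / n" "r / n \<le> L5" using r True n by (auto simp: pos_le_divide_eq pos_divide_le_eq)
    have "s0 * r - 7 * E \<le> U r" using small[OF c] n by simp
    moreover have "9 * E \<le> 2 * (\<epsilon> * r)"
    proof -
      have "0 < m * n" using pos n by simp
      then have "m * n \<le> 2 * r" using r(1) by linarith
      then have "\<epsilon> * (m * n) \<le> \<epsilon> * (2 * r)" using \<epsilon> by (intro mult_left_mono) auto
      then show ?thesis using E(2) by (simp add: mult_ac)
    qed
    ultimately show ?thesis using E(1) by (simp add: U_def algebra_simps)
  next
    case False
    have "\<exists>j. r < a j"
    proof -
      obtain j where "r / (L5 * n) < \<tau> ^ j" using real_arch_pow[OF tau_gt_1] by blast
      then have "r < \<tau> ^ j * (L5 * n)" using RL n by (simp add: pos_divide_less_eq)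
      then show ?thesis by (auto simp: a_def mult_ac)
    qed
    define k where "k = (LEAST j. r < a j)"
    have k: "r < a k" unfolding k_def using \<open>\<exists>j. r < a j\<close> by (rule LeastI_ex)
    have "k \<noteq> 0"
    proof
      assume "k = 0" then show False using k False by (simp add: a_def)
    qed
    then obtain j where j: "k = Suc j" by (cases k) auto
    have aj: "a j \<le> r"
    proof (rule ccontr)
      assume "\<not> a j \<le> r"
      then have "k \<le> j" unfolding k_def by (intro Least_le) simp
      then show False using j by simp
    qed
    have "U (a j) + (s0 - \<epsilon>) * (r - a j) - 2 * E \<le> U r" using aj k j r by (intro inc) auto
    moreover have "(s0 - 2 * \<epsilon>) * a j + 2 * E \<le> U (a j)" using aj r by (intro big) auto
    moreover have "0 \<le> \<epsilon> * (r - a j)" using \<epsilon> aj by simp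
    ultimately show ?thesis unfolding U_def[symmetric] by (simp add: algebra_simps)
  qed
qed

end

text \<open>The integers in a half-open interval number more than its length minus one.\<close>

lemma csum_window:
  assumes c: "0 \<le> c" and ab: "0 \<le> a" "a \<le> b" and v: "\<And>i. a \<le> real i \<Longrightarrow> real i < b \<Longrightarrow> v i = c"
  shows "csum v a + c * (b - a - 1) \<le> csum v b"
proof -
  have "csum v b - csum v a = (\<Sum>i\<in>{nat \<lceil>a\<rceil>..<nat \<lceil>b\<rceil>}. v i)" by (rule csum_diff) fact
  also have "\<dots> = (\<Sum>i\<in>{nat \<lceil>a\<rceil>..<nat \<lceil>b\<rceil>}. c)"
  proof (rule sum.cong)
    fix i assume "i \<in> {nat \<lceil>a\<rceil>..<nat \<lceil>b\<rceil>}"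
    then have "a \<le> real i" "real i < b" by (auto simp: nat_le_iff ceiling_le_iff zless_nat_eq_int_zless less_ceiling_iff)
    then show "v i = c" by (rule v)
  qed simp
  also have "\<dots> = c * real (nat \<lceil>b\<rceil> - nat \<lceil>a\<rceil>)" by simp
  also have "\<dots> \<ge> c * (b - a - 1)"
  proof (rule mult_left_mono[OF _ c])
    show "b - a - 1 \<le> real (nat \<lceil>b\<rceil> - nat \<lceil>a\<rceil>)" using ab by linarith
  qed
  finally show ?thesis by linarith
qed

context bedford_mcmullen
begin

lemma mix_0: "p \<in> \<Upsilon> \<Longrightarrow> mix 0 p p' = p"
  unfolding \<Upsilon>_def by (auto simp: mix_def fun_eq_iff PiE_iff extensional_def restrict_def)

lemma mix_1: "p' \<in> \<Upsilon> \<Longrightarrow> mix 1 p p' = p'"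
  unfolding \<Upsilon>_def by (auto simp: mix_def fun_eq_iff PiE_iff extensional_def restrict_def)

lemma e1_mix_ge:
  assumes "p \<in> \<Upsilon>" "p' \<in> \<Upsilon>" "0 \<le> t" "t \<le> 1" "s \<le> e1 p" "s \<le> e1 p'"
  shows "s \<le> e1 (mix t p p')"
proof -
  define c where "c = 1 / \<tau>"
  have c: "0 \<le> c" "c \<le> 1" using tau_gt_1 by (auto simp: c_def)
  have e: "e1 p = (1 - c) * h\<^sub>r p + c * h p" for p
    by (simp add: e1_def hc_def c_def algebra_simps diff_divide_distrib)
  have "(1 - t) * s + t * s \<le> (1 - t) * e1 p + t * e1 p'" using assms by (intro add_mono mult_left_mono) auto
  also have "\<dots> = (1 - c) * ((1 - t) * h\<^sub>r p + t * h\<^sub>r p') + c * ((1 - t) * h p + t * h p')"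
    unfolding e by (simp add: algebra_simps)
  also have "\<dots> \<le> e1 (mix t p p')"
    unfolding e by (rule add_mono[OF mult_left_mono[OF h_r_mix_ge[OF assms(1-4)]] mult_left_mono[OF h_mix_ge[OF assms(1-4)]]])
      (use c in auto)
  finally show ?thesis by (simp add: algebra_simps)
qed

text \<open>By concavity \<open>e1\<close> stays above \<open>s0\<close> on the segment from
  \<open>pp\<close> to \<open>pm\<close>. The required expression differs from
  \<open>e1 (q (Suc j))\<close> only by the change of \<open>hc\<close> in one step, and uniform
  continuity makes this small for short steps.\<close>

lemma slow_interpolation:
  assumes in\<Upsilon>: "pp \<in> \<Upsilon>" "pm \<in> \<Upsilon>" and s0: "s0 \<le> e1 pp" "s0 \<le> e1 pm" and \<epsilon>: "0 < \<epsilon>"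
  obtains q :: "nat \<Rightarrow> nat \<times> nat \<Rightarrow> real" and J :: nat where "\<And>j. q j \<in> \<Upsilon>" "q 0 = pp" "\<And>j. J \<le> j \<Longrightarrow> q j = pm"
    "\<And>j. s0 - \<epsilon> \<le> h\<^sub>r (q (Suc j)) + hc (q j) / \<tau>"
proof -
  have sub: "(\<lambda>t. mix t pp pm) ` {0..1} \<subseteq> \<Upsilon>" using in\<Upsilon> by (auto intro!: mix_Upsilon)
  have "continuous_on {0..1} (\<lambda>t. hc (mix t pp pm))"
    unfolding hc_def
    by (intro continuous_on_diff continuous_on_compose2[OF continuous_on_h continuous_on_mix sub]
        continuous_on_compose2[OF continuous_on_h_r continuous_on_mix sub])
  then have "uniformly_continuous_on {0..1} (\<lambda>t. hc (mix t pp pm))"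
    by (rule compact_uniformly_continuous) simp
  then obtain \<delta> where \<delta>: "0 < \<delta>" "\<And>t t'. t \<in> {0..1} \<Longrightarrow> t' \<in> {0..1} \<Longrightarrow> dist t' t < \<delta> \<Longrightarrow> dist (hc (mix t' pp pm)) (hc (mix t pp pm)) < \<epsilon>"
    unfolding uniformly_continuous_on_def using \<epsilon> by metis
  obtain J :: nat where J: "1 / \<delta> < real J" using reals_Archimedean2 by blast
  have J0: "0 < real J" using J \<delta>(1) by (smt (verit) divide_pos_pos)
  define t where "t j = min 1 (real j / real J)" for j
  have t: "0 \<le> t j" "t j \<le> 1" for j by (auto simp: t_def)
  have td: "dist (t j) (t (Suc j)) < \<delta>" for j
  proof -
    have "\<bar>t j - t (Suc j)\<bar> \<le> \<bar>real j / real J - real (Suc j) / real J\<bar>" unfolding t_def by (auto simp: min_def)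
    also have "\<dots> = 1 / real J" using J0 by (simp add: diff_divide_distrib[symmetric])
    also have "\<dots> < \<delta>" using J \<delta>(1) J0 by (simp add: divide_less_eq mult.commute)
    finally show ?thesis by (simp add: dist_real_def)
  qed
  define q where "q j = mix (t j) pp pm" for j
  have q: "q j \<in> \<Upsilon>" for j unfolding q_def using in\<Upsilon> t by (intro mix_Upsilon)
  have sl: "s0 - \<epsilon> \<le> h\<^sub>r (q (Suc j)) + hc (q j) / \<tau>" for j
  proof -
    have "s0 \<le> e1 (q (Suc j))" unfolding q_def using in\<Upsilon> t s0 by (intro e1_mix_ge)
    moreover have "dist (hc (q j)) (hc (q (Suc j))) < \<epsilon>"
      unfolding q_def using t td by (intro \<delta>(2)) auto
    then have "hc (q (Suc j)) - \<epsilon> \<le> hc (q j)" by (simp add: dist_real_def)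
    then have "(hc (q (Suc j)) - \<epsilon>) / \<tau> \<le> hc (q j) / \<tau>" using tau_gt_1 by (intro divide_right_mono) auto
    moreover have "\<epsilon> / \<tau> \<le> \<epsilon>" using \<epsilon> tau_gt_1 by (simp add: pos_divide_le_eq)
    ultimately show ?thesis by (simp add: e1_def diff_divide_distrib)
  qed
  show ?thesis
  proof (rule that[of q J])
    show "q 0 = pp" using mix_0[OF in\<Upsilon>(1)] by (simp add: q_def t_def)
    show "q j = pm" if "J \<le> j" for j
    proof -
      have "t j = 1" using that J0 by (simp add: t_def pos_le_divide_eq)
      then show ?thesis using mix_1[OF in\<Upsilon>(2)] by (simp add: q_def)
    qed
  qed (fact q sl)+
qed

text \<open>The digit laws are arranged in stages, one for each target time \<open>n = ns k\<close>,
  covering the positions from \<open>m * n\<close> up to \<open>m * ns (Suc k)\<close>. The ratio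
  \<open>K\<close> of consecutive times is so large that, seen from the next stage, all positions
  before the return to \<open>pm\<close> are a negligible proportion; thus every stage starts as if
  \<open>pm\<close> had been used from the beginning, and \<open>stage_bound\<close> applies to
  each.\<close>

lemma profile_exists:
  fixes f :: "nat \<Rightarrow> nat" and t :: "nat \<Rightarrow> nat \<Rightarrow> nat \<times> nat"
  assumes \<alpha>: "0 < \<alpha>" and f: "(\<lambda>n. real (f n) / real n) \<longlonglongrightarrow> \<alpha>"
    and t: "\<And>n k. 1 \<le> n \<Longrightarrow> k < f n \<Longrightarrow> t n k \<in> Q"
    and in\<Upsilon>: "pm \<in> \<Upsilon>" "p1 \<in> \<Upsilon>" "p2 \<in> \<Upsilon>" "pp \<in> \<Upsilon>" and \<epsilon>: "0 < \<epsilon>"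
    and s0: "0 \<le> s0" "s0 \<le> e1 pm" "s0 * (1 + \<alpha>) \<le> u2 \<alpha> pm p1" "s0 * (\<tau> + \<alpha>) \<le> u3 \<alpha> pm p1 p2"
      "s0 * (\<tau> * (1 + \<alpha>)) \<le> u4 \<alpha> pm p1 p2 pp" "s0 * (\<tau> * (\<tau> + \<alpha>)) \<le> u5 \<alpha> pm p1 p2 pp" "s0 \<le> e1 pp"
  obtains p :: "nat \<Rightarrow> nat \<times> nat \<Rightarrow> real" and ns :: "nat \<Rightarrow> nat" and L0 :: nat where "\<And>i. p i \<in> \<Upsilon>"
    "\<And>L. L0 \<le> L \<Longrightarrow> (s0 - 2 * \<epsilon>) * real L \<le> (\<Sum>i<L. h\<^sub>r (p i)) + (\<Sum>i<lev L. hc (p i))"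
    "strict_mono ns" "\<And>k. 1 \<le> ns k" "\<And>k j. j < f (ns k) \<Longrightarrow> p (ns k + j) = dirac (t (ns k) j)"
proof -
  define m where "m = prefix_m \<alpha>"
  define R where "R = \<tau> + \<alpha>"
  note pos = tau_gt_1 \<alpha> prefix_m[OF \<alpha>, folded m_def]
  have \<tau>0: "0 < \<tau>" using pos by simp
  have R1: "1 < R" using pos by (simp add: R_def)
  obtain q J where q: "\<And>j. q j \<in> \<Upsilon>" "q 0 = pp" "\<And>j. J \<le> j \<Longrightarrow> q j = pm"
    "\<And>j. s0 - \<epsilon> \<le> h\<^sub>r (q (Suc j)) + hc (q j) / \<tau>"
    using slow_interpolation[OF in\<Upsilon>(4,1) s0(7,2) \<epsilon>] by blast
  define C where "C = pressure 1"
  have C: "0 \<le> h\<^sub>r x" "h\<^sub>r x \<le> C" "0 \<le> hc x" "hc x \<le> C" if "x \<in> \<Upsilon>" for x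
    using pressure_ge[OF that, of 1] h_r_nonneg[OF that] hc_nonneg[OF that] by (auto simp: C_def)
  have C0: "0 \<le> C" using C[OF in\<Upsilon>(1)] by linarith
  \<comment> \<open>The error of stage \<open>k\<close> is \<open>c9 * ns k\<close>; the 9 matches
    the requirement \<open>9 * E \<le> \<epsilon> * m * n\<close> of
    \<open>stage_bound\<close>.\<close>
  define c9 where "c9 = \<epsilon> * min m (\<tau> - 1) / 9"
  have c9: "0 < c9" "9 * c9 \<le> \<epsilon> * m" "9 * c9 \<le> \<epsilon> * (\<tau> - 1)" using \<epsilon> pos by (auto simp: c9_def)
  define c4 where "c4 = 4 * (C + 1)"
  have c4: "0 < c4" using C0 by (simp add: c4_def)
  \<comment> \<open>The proportion of positions that may be spoiled by the past, by the deviation of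
    \<open>f\<close> from \<open>\<alpha> * n\<close> and by rounding. Each of them costs at most
    the entropy bound \<open>C\<close>.\<close>
  define \<theta> where "\<theta> = c9 / c4"
  have \<theta>: "0 < \<theta>" "C * (3 * \<theta>) \<le> c9"
  proof -
    show "0 < \<theta>" using c9 c4 by (simp add: \<theta>_def)
    have "C * (3 * \<theta>) \<le> (C + 1) * (4 * \<theta>)" using C0 \<open>0 < \<theta>\<close> by (intro mult_mono) auto
    also have "\<dots> = c4 * \<theta>" by (simp add: c4_def)
    also have "\<dots> = c9" using c4 by (simp add: \<theta>_def)
    finally show "C * (3 * \<theta>) \<le> c9" .
  qed
  \<comment> \<open>The bound by \<open>\<tau> - 1\<close> makes the target end before
    \<open>R * n\<close>, where the interpolation starts.\<close>
  define \<eta> where "\<eta> = min \<theta> (\<tau> - 1)"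
  have \<eta>: "0 < \<eta>" "\<eta> \<le> \<theta>" "\<eta> \<le> \<tau> - 1" using \<theta> pos by (auto simp: \<eta>_def)
  \<comment> \<open>The three summands ensure that the interpolation fills only the proportion
    \<open>\<theta>\<close> of the next time, that the last critical scale lies within the stage,
    and that the interpolation is finished when the next stage begins.\<close>
  obtain K :: nat where K: "R * \<tau> ^ J / \<theta> + \<tau> * R / m + R * \<tau> ^ J / m + 2 < real K" using reals_Archimedean2 by blast
  have Kparts: "0 \<le> R * \<tau> ^ J / \<theta>" "0 \<le> \<tau> * R / m" "0 \<le> R * \<tau> ^ J / m" using R1 pos \<theta> by simp_all
  have "R * \<tau> ^ J / \<theta> \<le> real K" "\<tau> * R / m \<le> real K" "R * \<tau> ^ J / m \<le> real K" and K2: "2 < real K"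
    using K Kparts by linarith+
  then have K1: "R * \<tau> ^ J \<le> \<theta> * K" "\<tau> * R \<le> m * K" "R * \<tau> ^ J \<le> m * K"
    using \<theta> pos by (simp_all add: pos_divide_le_eq mult.commute)
  have K0: "0 < real K" using K2 by simp
  have mK: "1 < m * K"
  proof -
    have "1 * 1 < \<tau> * R" using pos R1 by (intro mult_strict_mono) auto
    then show ?thesis using K1(2) by simp
  qed
  obtain n0 :: nat where n0: "1 \<le> n0" "2 \<le> \<theta> * n0" "\<And>n. n0 \<le> n \<Longrightarrow> \<bar>real (f n) - \<alpha> * n\<bar> \<le> \<eta> * n"
  proof -
    have "\<forall>\<^sub>F n in sequentially. \<bar>real (f n) / n - \<alpha>\<bar> < \<eta>"
      using tendstoD[OF f \<eta>(1)] by (simp add: dist_real_def)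
    then obtain n1 where n1: "\<And>n. n1 \<le> n \<Longrightarrow> \<bar>real (f n) / n - \<alpha>\<bar> < \<eta>" unfolding eventually_sequentially by blast
    obtain n2 :: nat where n2: "2 / \<theta> < real n2" using reals_Archimedean2 by blast
    define n0 where "n0 = max 1 (max n1 n2)"
    show ?thesis
    proof (rule that[of n0])
      show "1 \<le> n0" by (simp add: n0_def)
      have "2 / \<theta> \<le> real n0" using n2 by (simp add: n0_def)
      then show "2 \<le> \<theta> * n0" using \<theta> by (simp add: pos_divide_le_eq mult.commute)
      fix n assume n: "n0 \<le> n"
      then have pn: "0 < real n" by (simp add: n0_def)
      have "real (f n) - \<alpha> * n = (real (f n) / n - \<alpha>) * n" using pn by (simp add: left_diff_distrib)
      then have "\<bar>real (f n) - \<alpha> * n\<bar> = \<bar>real (f n) / n - \<alpha>\<bar> * n" using pn by (simp add: abs_mult)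
      also have "\<dots> \<le> \<eta> * n" using n1[of n] n by (intro mult_right_mono) (auto simp: n0_def)
      finally show "\<bar>real (f n) - \<alpha> * n\<bar> \<le> \<eta> * n" .
    qed
  qed
  define ns where "ns k = n0 * K ^ k" for k
  have ns_Suc: "real (ns (Suc k)) = K * real (ns k)" for k by (simp add: ns_def)
  have ns_ge: "n0 \<le> ns k" for k using K0 by (simp add: ns_def)
  have ns_pos: "0 < real (ns k)" for k using ns_ge[of k] n0(1) by simp
  have ns_strict: "strict_mono ns"
  proof (rule strict_monoI_Suc)
    fix k
    have "1 * real (ns k) < K * real (ns k)" using K2 ns_pos by (intro mult_strict_right_mono) auto
    then have "real (ns k) < real (ns (Suc k))" unfolding ns_Suc by simp
    then show "ns k < ns (Suc k)" by simp
  qed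
  have fn: "real (ns k + f (ns k)) \<le> (1 + \<alpha>) * ns k + \<eta> * ns k" "real (ns k + f (ns k)) \<le> R * ns k" for k
  proof -
    show a: "real (ns k + f (ns k)) \<le> (1 + \<alpha>) * ns k + \<eta> * ns k"
      using n0(3)[OF ns_ge[of k]] by (simp add: algebra_simps abs_le_iff)
    have "\<eta> * ns k \<le> (\<tau> - 1) * ns k" using \<eta> by (intro mult_right_mono) auto
    then show "real (ns k + f (ns k)) \<le> R * ns k" using a by (simp add: R_def algebra_simps)
  qed
  \<comment> \<open>The stage of position \<open>i\<close>. In the definition of \<open>p\<close>,
    the logarithm to base \<open>\<tau>\<close> gives the index \<open>j\<close> of the
    interpolation window from \<open>R * \<tau> ^ j * n\<close> to
    \<open>R * \<tau> ^ Suc j * n\<close>.\<close>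
  define st where "st i = (LEAST k. real i < m * ns (Suc k))" for i :: nat
  define p where "p i = (if real i < m * ns 0 then pm else
    if i < ns (st i) then p1 else if i < ns (st i) + f (ns (st i)) then dirac (t (ns (st i)) (i - ns (st i)))
    else if real i < R * ns (st i) then p2 else q (nat \<lfloor>log \<tau> (i / (R * ns (st i)))\<rfloor>))" for i :: nat
  have mono_m: "m * ns j \<le> m * ns k" if "j \<le> k" for j k
    using that pos strict_mono_mono[OF ns_strict] by (intro mult_left_mono) (auto simp: mono_def)
  have stage: "st i = k \<and> \<not> real i < m * ns 0" if "m * ns k \<le> real i" "real i < m * ns (Suc k)" for i k
  proof
    show "st i = k" unfolding st_def
    proof (rule Least_equality)
      fix j assume j: "real i < m * ns (Suc j)"
      show "k \<le> j"
      proof (rule ccontr)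
        assume "\<not> k \<le> j"
        then have "m * ns (Suc j) \<le> m * ns k" by (intro mono_m) simp
        then show False using that j by linarith
      qed
    qed fact
    show "\<not> real i < m * ns 0" using mono_m[of 0 k] that by linarith
  qed
  have mS: "m * ns (Suc k) = m * K * ns k" for k unfolding ns_Suc by simp
  have mn_le: "m * ns k \<le> ns k" for k using pos by (simp add: mult_left_le_one_le)
  have P1: "p i = p1" if "m * ns k \<le> real i" "real i < ns k" for i k
  proof -
    have "1 * real (ns k) \<le> m * K * ns k" using mK ns_pos[of k] by (intro mult_right_mono) auto
    then have "real i < m * ns (Suc k)" using that unfolding mS by linarith
    then have "st i = k \<and> \<not> real i < m * ns 0" using that by (intro stage)
    then show ?thesis using that(2) by (simp add: p_def)
  qed
  have RK: "R * ns k \<le> m * ns (Suc k)" for k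
  proof -
    have "1 * R \<le> \<tau> * R" using R1 pos by (intro mult_right_mono) auto
    then have "R * ns k \<le> m * K * ns k" using K1(2) by (intro mult_right_mono) auto
    then show ?thesis unfolding mS .
  qed
  have PT: "p (ns k + j) = dirac (t (ns k) j)" if "j < f (ns k)" for k j
  proof -
    have "real (ns k + j) < m * ns (Suc k)" using fn(2)[of k] RK[of k] that by simp
    moreover have "m * ns k \<le> real (ns k + j)" using mn_le[of k] by simp
    ultimately have "st (ns k + j) = k \<and> \<not> real (ns k + j) < m * ns 0" by (intro stage)
    then show ?thesis using that by (simp add: p_def)
  qed
  have P2: "p i = p2" if "real (ns k + f (ns k)) \<le> real i" "real i < R * ns k" for i k
  proof -
    have "m * ns k \<le> real i" "real i < m * ns (Suc k)" using that RK[of k] mn_le[of k] by linarith+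
    then have "st i = k \<and> \<not> real i < m * ns 0" by (rule stage)
    then show ?thesis using that by (simp add: p_def)
  qed
  have P4: "p i = q (nat \<lfloor>log \<tau> (i / (R * ns k))\<rfloor>)" if "R * ns k \<le> real i" "real i < m * ns (Suc k)" for i k
  proof -
    have "1 * real (ns k) \<le> R * ns k" using R1 by (intro mult_right_mono) auto
    then have "m * ns k \<le> real i" using that mn_le[of k] by linarith
    then have "st i = k \<and> \<not> real i < m * ns 0" using that(2) by (rule stage)
    then show ?thesis using that fn(2)[of k] by (simp add: p_def)
  qed
  have P4j: "p i = q j" if "R * \<tau> ^ j * ns k \<le> real i" "real i < R * \<tau> ^ Suc j * ns k" "real i < m * ns (Suc k)" for i j k
  proof -
    have Rn: "0 < R * ns k" using R1 ns_pos by simp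
    have "R * ns k * 1 \<le> R * ns k * \<tau> ^ j" using Rn pos by (intro mult_left_mono) auto
    then have "R * ns k \<le> real i" using that(1) by (simp add: mult_ac)
    moreover have "\<lfloor>log \<tau> (i / (R * ns k))\<rfloor> = int j"
    proof (rule floor_unique)
      have a: "\<tau> ^ j \<le> i / (R * ns k)" using that(1) Rn by (simp add: pos_le_divide_eq mult_ac)
      have b: "i / (R * ns k) < \<tau> ^ Suc j" using that(2) Rn by (simp add: pos_divide_less_eq mult_ac)
      have ip: "0 < i / (R * ns k)" using a \<tau>0 by (meson less_le_trans zero_less_power)
      show "of_int (int j) \<le> log \<tau> (i / (R * ns k))"
        using a ip pos by (simp add: le_log_iff powr_realpow \<tau>0)
      show "log \<tau> (i / (R * ns k)) < of_int (int j) + 1"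
      proof -
        have "i / (R * ns k) < \<tau> powr (real (Suc j))" using b by (simp only: powr_realpow[OF \<tau>0])
        then have "log \<tau> (i / (R * ns k)) < real (Suc j)" using ip pos by (simp only: log_less_iff)
        then show ?thesis by simp
      qed
    qed
    ultimately show ?thesis using P4[of k i] that(3) by simp
  qed
  have P0: "p i = pm" if i: "R * \<tau> ^ J * ns k / K \<le> real i" "real i < m * ns k" for i k
  proof (cases k)
    case 0
    then show ?thesis using i by (simp add: p_def)
  next
    case (Suc k')
    have e: "R * \<tau> ^ J * ns k / K = R * \<tau> ^ J * ns k'" using K0 unfolding Suc ns_Suc by simp
    have Rn: "0 < R * ns k'" using R1 ns_pos by simp
    have "R * ns k' * 1 \<le> R * ns k' * \<tau> ^ J" using Rn pos by (intro mult_left_mono) auto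
    then have "R * ns k' \<le> real i" using i(1) unfolding e by (simp add: mult_ac)
    then have pq: "p i = q (nat \<lfloor>log \<tau> (i / (R * ns k'))\<rfloor>)" using i(2) Suc by (intro P4) auto
    have a: "\<tau> ^ J \<le> i / (R * ns k')" using i(1) Rn unfolding e by (simp add: pos_le_divide_eq mult_ac)
    have ip: "0 < i / (R * ns k')" using a \<tau>0 by (meson less_le_trans zero_less_power)
    have "real J \<le> log \<tau> (i / (R * ns k'))" using a ip pos by (simp add: le_log_iff powr_realpow \<tau>0)
    then have "J \<le> nat \<lfloor>log \<tau> (i / (R * ns k'))\<rfloor>" by linarith
    then show ?thesis using pq q(3) by simp
  qed
  have p\<Upsilon>: "p i \<in> \<Upsilon>" for i
  proof -
    have "dirac (t (ns (st i)) (i - ns (st i))) \<in> \<Upsilon>" if "\<not> i < ns (st i)" "i < ns (st i) + f (ns (st i))"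
      using that ns_ge[of "st i"] n0(1) by (intro dirac_Upsilon t) auto
    then show ?thesis using in\<Upsilon> q(1) by (auto simp: p_def)
  qed
  define X where "X = csum (\<lambda>i. h\<^sub>r (p i))"
  define Y where "Y = csum (\<lambda>i. hc (p i))"
  \<comment> \<open>Proved for a general bounded nonnegative \<open>H\<close>, because both
    \<open>h\<^sub>r\<close> and \<open>hc\<close> are needed.\<close>
  have windows: "(0 \<le> r \<longrightarrow> r \<le> m * ns k \<longrightarrow> H pm * r - c9 * ns k \<le> csum (\<lambda>i. H (p i)) r)
    \<and> (m * ns k \<le> r \<longrightarrow> r \<le> ns k \<longrightarrow> csum (\<lambda>i. H (p i)) (m * ns k) + H p1 * (r - m * ns k) - c9 * ns k \<le> csum (\<lambda>i. H (p i)) r)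
    \<and> (ns k \<le> r \<longrightarrow> r \<le> R * ns k \<longrightarrow> csum (\<lambda>i. H (p i)) (ns k) + H p2 * (r - (1 + \<alpha>) * ns k) - c9 * ns k \<le> csum (\<lambda>i. H (p i)) r)
    \<and> (\<forall>j. R * \<tau> ^ j * ns k \<le> r \<longrightarrow> r \<le> R * \<tau> ^ Suc j * ns k \<longrightarrow> r \<le> m * K * ns k \<longrightarrow>
       csum (\<lambda>i. H (p i)) (R * \<tau> ^ j * ns k) + H (q j) * (r - R * \<tau> ^ j * ns k) - c9 * ns k \<le> csum (\<lambda>i. H (p i)) r)"
    if H: "\<And>x. x \<in> \<Upsilon> \<Longrightarrow> 0 \<le> H x \<and> H x \<le> C" for H :: "(nat \<times> nat \<Rightarrow> real) \<Rightarrow> real" and k and r :: real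
  proof -
    define n where "n = real (ns k)"
    have n: "0 < n" "2 \<le> \<theta> * n"
    proof -
      show "0 < n" using ns_pos by (simp add: n_def)
      have "\<theta> * n0 \<le> \<theta> * n" using ns_ge[of k] \<theta> by (intro mult_left_mono) (auto simp: n_def)
      then show "2 \<le> \<theta> * n" using n0(2) by simp
    qed
    have E: "C * (\<theta> * n + \<theta> * n + 2) \<le> c9 * n"
    proof -
      have "C * (\<theta> * n + \<theta> * n + 2) \<le> C * (3 * \<theta> * n)" using n(2) C0 by (intro mult_left_mono) auto
      also have "\<dots> \<le> c9 * n" using mult_right_mono[OF \<theta>(2), of n] n by simp
      finally show ?thesis .
    qed
    have EC: "C * e \<le> c9 * n" if "e \<le> \<theta> * n + \<theta> * n + 2" for e
      using E mult_left_mono[OF that C0] by simp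
    have HE: "H x * e \<le> c9 * n" if "x \<in> \<Upsilon>" "e \<le> \<theta> * n + \<theta> * n + 2" for x e
    proof (cases "0 \<le> e")
      case True
      have "H x * e \<le> C * e" using H[OF that(1)] True by (intro mult_right_mono) auto
      then show ?thesis using EC[OF that(2)] by simp
    next
      case False
      then have "H x * e \<le> 0" using H[OF that(1)] by (intro mult_nonneg_nonpos) auto
      then show ?thesis using c9 n by (smt (verit) mult_pos_pos)
    qed
    have \<theta>n: "0 \<le> \<theta> * n" using \<theta> n by simp
    define V where "V = csum (\<lambda>i. H (p i))"
    have Vmono: "V r \<le> V r'" if "r \<le> r'" for r r' unfolding V_def using H p\<Upsilon> that by (intro csum_mono) auto
    have V0: "0 \<le> V r" for r unfolding V_def using H p\<Upsilon> by (intro csum_nonneg) auto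
    have W: "V a + H x * (b - a - 1) \<le> V b" if "x \<in> \<Upsilon>" "0 \<le> a" "a \<le> b" "\<And>i. a \<le> real i \<Longrightarrow> real i < b \<Longrightarrow> p i = x" for a b x
      unfolding V_def using that H by (intro csum_window) auto
    have 1: "H pm * r - c9 * n \<le> V r" if r: "0 \<le> r" "r \<le> m * n"
    proof -
      \<comment> \<open>For \<open>k > 0\<close> this is the end of the interpolation in the
        previous stage; from there on the law is \<open>pm\<close>, and the positions before it are
        lost.\<close>
      define A where "A = R * \<tau> ^ J * n / K"
      have A: "A \<le> \<theta> * n" "0 \<le> A"
        using K1(1) K0 n R1 \<tau>0 by (auto simp: A_def pos_divide_le_eq mult_ac intro: mult_right_mono)
      show ?thesis
      proof (cases "r \<le> A")
        case True
        then have "H pm * r \<le> c9 * n" using A \<theta>n by (intro HE in\<Upsilon>) auto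
        then show ?thesis using V0[of r] by simp
      next
        case False
        then have "V A + H pm * (r - A - 1) \<le> V r"
          using A r in\<Upsilon> P0[of k] by (intro W) (auto simp: A_def n_def)
        moreover have "H pm * (A + 1) \<le> c9 * n" using A \<theta>n by (intro HE in\<Upsilon>) auto
        ultimately show ?thesis using V0[of A] by (simp add: algebra_simps)
      qed
    qed
    have 2: "V (m * n) + H p1 * (r - m * n) - c9 * n \<le> V r" if r: "m * n \<le> r" "r \<le> n"
    proof -
      have "V (m * n) + H p1 * (r - m * n - 1) \<le> V r"
        using r in\<Upsilon> P1[of k] pos n by (intro W) (auto simp: n_def)
      moreover have "H p1 * 1 \<le> c9 * n" using \<theta>n by (intro HE in\<Upsilon>) auto
      ultimately show ?thesis by (simp add: algebra_simps)
    qed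
    have 3: "V n + H p2 * (r - (1 + \<alpha>) * n) - c9 * n \<le> V r" if r: "n \<le> r" "r \<le> R * n"
    proof -
      \<comment> \<open>The true end of the target differs from \<open>(1 + \<alpha>) * n\<close> by
        a small proportion of \<open>n\<close>. Before it only monotonicity is used, after it the
        law is \<open>p2\<close>.\<close>
      define b where "b = real (ns k + f (ns k))"
      have b: "b \<le> (1 + \<alpha>) * n + \<theta> * n" "n \<le> b"
      proof -
        have "\<eta> * n \<le> \<theta> * n" using \<eta> n by (intro mult_right_mono) auto
        then show "b \<le> (1 + \<alpha>) * n + \<theta> * n" using fn(1)[of k] by (simp add: b_def n_def)
      qed (simp add: b_def n_def)
      show ?thesis
      proof (cases "r \<le> b")
        case True
        then have "H p2 * (r - (1 + \<alpha>) * n) \<le> c9 * n" using b \<theta>n by (intro HE in\<Upsilon>) auto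
        then show ?thesis using Vmono[OF r(1)] by simp
      next
        case False
        then have "V b + H p2 * (r - b - 1) \<le> V r"
          using r in\<Upsilon> P2[of k] b n by (intro W) (auto simp: b_def n_def)
        moreover have "H p2 * (b - (1 + \<alpha>) * n + 1) \<le> c9 * n" using b \<theta>n by (intro HE in\<Upsilon>) auto
        ultimately show ?thesis using Vmono[OF b(2)] by (simp add: algebra_simps)
      qed
    qed
    have 4: "V (R * \<tau> ^ j * n) + H (q j) * (r - R * \<tau> ^ j * n) - c9 * n \<le> V r"
      if r: "R * \<tau> ^ j * n \<le> r" "r \<le> R * \<tau> ^ Suc j * n" "r \<le> m * K * n" for j
    proof -
      have "V (R * \<tau> ^ j * n) + H (q j) * (r - R * \<tau> ^ j * n - 1) \<le> V r"
      proof (rule W[OF q(1)])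
        show "0 \<le> R * \<tau> ^ j * n" using R1 \<tau>0 n by simp
        show "p i = q j" if "R * \<tau> ^ j * n \<le> real i" "real i < r" for i
          using that r by (intro P4j[of j k]) (auto simp: n_def mS)
      qed fact
      moreover have "H (q j) * 1 \<le> c9 * n" using \<theta>n by (intro HE q) auto
      ultimately show ?thesis by (simp add: algebra_simps)
    qed
    show ?thesis unfolding n_def[symmetric] V_def[symmetric] using 1 2 3 4 by blast
  qed
  have HX: "0 \<le> h\<^sub>r x \<and> h\<^sub>r x \<le> C" and HY: "0 \<le> hc x \<and> hc x \<le> C" if "x \<in> \<Upsilon>" for x using C[OF that] by auto
  show ?thesis
  proof (rule that[of p "nat \<lceil>m * ns 0\<rceil>" ns])
    show "p i \<in> \<Upsilon>" for i by (rule p\<Upsilon>)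
    show "strict_mono ns" by (rule ns_strict)
    show "1 \<le> ns k" for k using ns_ge[of k] n0(1) by simp
    show "p (ns k + j) = dirac (t (ns k) j)" if "j < f (ns k)" for k j using that by (rule PT)
    fix L assume L: "nat \<lceil>m * ns 0\<rceil> \<le> L"
    then have L0: "m * ns 0 \<le> real L" by linarith
    obtain k where k: "m * ns k \<le> real L" "real L \<le> m * K * ns k"
    proof -
      have "\<exists>k. real L < m * ns (Suc k)"
      proof -
        obtain k :: nat where "real L / m < real k" using reals_Archimedean2 by blast
        then have "real L < m * k" using pos by (simp add: pos_divide_less_eq mult.commute)
        also have "\<dots> \<le> m * ns (Suc k)"
          using pos strict_mono_imp_increasing[OF ns_strict, of "Suc k"] by (intro mult_left_mono) auto
        finally show ?thesis by blast
      qed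
      then have lt: "real L < m * ns (Suc (st L))" unfolding st_def by (rule LeastI_ex)
      have "m * ns (st L) \<le> real L"
      proof (cases "st L")
        case 0 then show ?thesis using L0 by simp
      next
        case (Suc j)
        have "\<not> real L < m * ns (Suc j)"
        proof
          assume "real L < m * ns (Suc j)"
          then have "st L \<le> j" unfolding st_def by (rule Least_le)
          then show False using Suc by simp
        qed
        then show ?thesis using Suc by simp
      qed
      then show ?thesis using that lt unfolding mS by fastforce
    qed
    have "(s0 - 2 * \<epsilon>) * real L \<le> X (real L) + Y (real L / \<tau>)"
    proof (rule stage_bound[where \<alpha> = \<alpha> and n = "real (ns k)" and E = "c9 * ns k" and K = K and q = q, OF \<alpha> ns_pos in\<Upsilon> s0(1-6) _ _ _ \<epsilon>, folded m_def R_def])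
      show "0 \<le> c9 * ns k" using c9 by simp
      show "9 * (c9 * ns k) \<le> \<epsilon> * m * ns k" using mult_right_mono[OF c9(2), of "ns k"] by simp
      have "2 * (c9 * ns k) \<le> 9 * (c9 * ns k)" using c9 by simp
      also have "\<dots> \<le> \<epsilon> * (\<tau> - 1) * ns k" using mult_right_mono[OF c9(3), of "ns k"] by simp
      finally show "2 * (c9 * ns k) \<le> \<epsilon> * (\<tau> - 1) * ns k" .
      show "\<tau> * R \<le> m * K" by (rule K1)
      show "X r \<le> X r' \<and> Y r \<le> Y r'" if "0 \<le> r" "r \<le> r'" for r r'
        unfolding X_def Y_def using C p\<Upsilon> that by (intro conjI csum_mono) auto
      show "h\<^sub>r pm * r - c9 * ns k \<le> X r \<and> hc pm * r - c9 * ns k \<le> Y r" if "0 \<le> r" "r \<le> m * ns k" for r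
        using windows[of h\<^sub>r r k, OF HX] windows[of hc r k, OF HY] that unfolding X_def Y_def by blast
      show "X (m * ns k) + h\<^sub>r p1 * (r - m * ns k) - c9 * ns k \<le> X r \<and> Y (m * ns k) + hc p1 * (r - m * ns k) - c9 * ns k \<le> Y r"
        if "m * ns k \<le> r" "r \<le> ns k" for r :: real
        using windows[of h\<^sub>r r k, OF HX] windows[of hc r k, OF HY] that unfolding X_def Y_def by blast
      show "X (ns k) + h\<^sub>r p2 * (r - (1 + \<alpha>) * ns k) - c9 * ns k \<le> X r \<and> Y (ns k) + hc p2 * (r - (1 + \<alpha>) * ns k) - c9 * ns k \<le> Y r"
        if "ns k \<le> r" "r \<le> R * ns k" for r :: real
        using windows[of h\<^sub>r r k, OF HX] windows[of hc r k, OF HY] that unfolding X_def Y_def by blast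
      show "X (R * \<tau> ^ j * ns k) + h\<^sub>r (q j) * (r - R * \<tau> ^ j * ns k) - c9 * ns k \<le> X r \<and>
        Y (R * \<tau> ^ j * ns k) + hc (q j) * (r - R * \<tau> ^ j * ns k) - c9 * ns k \<le> Y r"
        if "R * \<tau> ^ j * ns k \<le> r" "r \<le> R * \<tau> ^ Suc j * ns k" "r \<le> m * K * ns k" for r j
        using windows[of h\<^sub>r r k, OF HX] windows[of hc r k, OF HY] that unfolding X_def Y_def by blast
      show "q 0 = pp" "s0 - \<epsilon> \<le> h\<^sub>r (q (Suc j)) + hc (q j) / \<tau>" for j by (fact q)+
      show "m * ns k \<le> real L" "real L \<le> m * K * ns k" by (fact k)+
    qed
    then show "(s0 - 2 * \<epsilon>) * real L \<le> (\<Sum>i<L. h\<^sub>r (p i)) + (\<Sum>i<lev L. hc (p i))"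
      unfolding X_def Y_def sum_lev by simp
  qed
qed

section \<open>The dimension of the target set\<close>

text \<open>The targets are prolonged by an enumeration of all digits. This costs nothing in the limit
  and makes every digit occur infinitely often, so that the coding map is injective on the
  support of the measure.\<close>

lemma cyl_target_nonzero:
  fixes f :: "nat \<Rightarrow> nat" and x :: "nat \<Rightarrow> real \<times> real" and \<alpha> s :: real
  assumes \<alpha>: "0 < \<alpha>" and f: "(\<lambda>n. real (f n) / real n) \<longlonglongrightarrow> \<alpha>"
    and x: "\<And>n. n \<ge> 1 \<Longrightarrow> x n \<in> carpet"
    and in\<Upsilon>: "pm \<in> \<Upsilon>" "p1 \<in> \<Upsilon>" "p2 \<in> \<Upsilon>" "pp \<in> \<Upsilon>"
    and s: "0 < s" "s < D \<alpha> pm p1 p2 pp 0"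
  shows "hausdorff_measure s {y \<in> carpet. infinite {n. n \<ge> 1 \<and> (T ^^ n) y \<in> cyl (f n) (x n)}} \<noteq> 0"
proof -
  define d where "d = D \<alpha> pm p1 p2 pp 0"
  define s0 where "s0 = d * ln (real N)"
  have d0: "0 < d" using s by (simp add: d_def)
  have pos: "0 < 1 + \<alpha>" "0 < \<tau> + \<alpha>" "0 < \<tau> * (1 + \<alpha>)" "0 < \<tau> * (\<tau> + \<alpha>)" using \<alpha> tau_gt_1 by auto
  have ge: "0 \<le> s0" "s0 \<le> e1 pm" "s0 * (1 + \<alpha>) \<le> u2 \<alpha> pm p1" "s0 * (\<tau> + \<alpha>) \<le> u3 \<alpha> pm p1 p2"
    "s0 * (\<tau> * (1 + \<alpha>)) \<le> u4 \<alpha> pm p1 p2 pp" "s0 * (\<tau> * (\<tau> + \<alpha>)) \<le> u5 \<alpha> pm p1 p2 pp" "s0 \<le> e1 pp"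
    using D_ge_iff[of d \<alpha> pm p1 p2 pp] pos d0 ln_N_pos
    unfolding d_def[symmetric] s0_def[symmetric] by (auto simp: s0_def[symmetric] pos_le_divide_eq) (simp add: s0_def)
  \<comment> \<open>A third of the gap: two parts are lost in the profile, and the third is the
    margin \<open>\<eta>\<close> of \<open>lower_mass\<close>.\<close>
  define \<epsilon> where "\<epsilon> = (d - s) * ln (real N) / 3"
  have \<epsilon>: "0 < \<epsilon>" using s ln_N_pos by (simp add: \<epsilon>_def d_def)
  obtain e where e: "e ` {..<card Q} = Q"
    using ex_bij_betw_nat_finite[OF finite_Q] by (auto simp: bij_betw_def atLeast0LessThan)
  define f' where "f' n = f n + card Q" for n
  define t where "t n k = (if k < f n then itin (x n) k else e (k - f n))" for n k
  have f': "(\<lambda>n. real (f' n) / real n) \<longlonglongrightarrow> \<alpha>"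
  proof -
    have "(\<lambda>n. real (f n) / real n + real (card Q) * (1 / real n)) \<longlonglongrightarrow> \<alpha> + real (card Q) * 0"
      by (intro tendsto_add f tendsto_mult tendsto_const lim_1_over_n)
    then show ?thesis by (simp add: f'_def add_divide_distrib)
  qed
  have tQ: "t n k \<in> Q" if n: "1 \<le> n" and k: "k < f' n" for n k
  proof (cases "k < f n")
    case True
    then show ?thesis using itin_in_Q[OF x[OF n]] by (simp add: t_def)
  next
    case False
    then have "k - f n \<in> {..<card Q}" using k by (auto simp: f'_def)
    then have "e (k - f n) \<in> Q" using e by blast
    then show ?thesis using False by (simp add: t_def)
  qed
  obtain p :: "nat \<Rightarrow> nat \<times> nat \<Rightarrow> real" and ns :: "nat \<Rightarrow> nat" and L0 :: nat where p: "\<And>i. p i \<in> \<Upsilon>"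
    "\<And>L. L0 \<le> L \<Longrightarrow> (s0 - 2 * \<epsilon>) * real L \<le> (\<Sum>i<L. h\<^sub>r (p i)) + (\<Sum>i<lev L. hc (p i))"
    and ns: "strict_mono ns" "\<And>k. 1 \<le> ns k" and pt: "\<And>k j. j < f' (ns k) \<Longrightarrow> p (ns k + j) = dirac (t (ns k) j)"
    using profile_exists[where t = t and f = f', OF \<alpha> f' _ in\<Upsilon> \<epsilon> ge] tQ by metis
  show ?thesis
  proof (rule lower_mass[where p = p and s = s and \<eta> = \<epsilon> and ?L0.0 = L0])
    show "p i \<in> \<Upsilon>" for i by fact
    show "0 < s" "0 < \<epsilon>" by fact+
    have eq: "s0 - 2 * \<epsilon> = s * ln (real N) + \<epsilon>" by (simp add: s0_def \<epsilon>_def field_simps)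
    show "(s * ln (real N) + \<epsilon>) * real L \<le> (\<Sum>i<L. h\<^sub>r (p i)) + (\<Sum>i<lev L. hc (p i))" if "L0 \<le> L" for L
      using p(2)[OF that] unfolding eq .
    fix \<omega> assume "\<And>i. \<omega> i \<in> Q \<and> 0 < p i (\<omega> i)"
    then have \<omega>Q: "\<omega> i \<in> Q" and \<omega>p: "0 < p i (\<omega> i)" for i by auto
    have \<omega>t: "\<omega> (ns k + j) = t (ns k) j" if "j < f' (ns k)" for k j
      \<comment> \<open>At a prescribed position the law is a point mass, so positive probability
        determines the digit.\<close>
      using \<omega>p[of "ns k + j"] \<omega>Q[of "ns k + j"] unfolding pt[OF that] dirac_def by (auto split: if_splits)
    have ns_ge: "k \<le> ns k" for k using strict_mono_imp_increasing[OF ns(1)] .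
    have io: "infinite {i. \<omega> i = q}" if q: "q \<in> Q" for q
      unfolding infinite_nat_iff_unbounded_le
    proof
      fix k
      have "q \<in> e ` {..<card Q}" unfolding e by (rule q)
      then obtain j where j: "j < card Q" "e j = q" by auto
      have "\<omega> (ns k + (f (ns k) + j)) = q"
        using \<omega>t[of "f (ns k) + j" k] j by (simp add: f'_def t_def)
      moreover have "k \<le> ns k + (f (ns k) + j)" using ns_ge[of k] by simp
      ultimately show "\<exists>n\<ge>k. n \<in> {i. \<omega> i = q}" by blast
    qed
    define y where "y = code \<omega>"
    have y: "y \<in> carpet" unfolding y_def using \<omega>Q by (rule code_carpet)
    have it: "itin y i = \<omega> i" for i unfolding y_def by (rule itin_code[OF \<omega>Q io])
    have hit: "(T ^^ ns k) y \<in> cyl (f (ns k)) (x (ns k))" for k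
    proof (rule itin_in_cyl[OF x[OF ns(2)] y])
      fix j assume j: "j < f (ns k)"
      then show "itin y (ns k + j) = itin (x (ns k)) j" unfolding it using \<omega>t[of j k] by (simp add: f'_def t_def)
    qed
    have "range ns \<subseteq> {n. n \<ge> 1 \<and> (T ^^ n) y \<in> cyl (f n) (x n)}" using ns(2) hit by auto
    moreover have "infinite (range ns)" using ns(1) by (simp add: finite_image_iff strict_mono_imp_inj_on)
    ultimately have "infinite {n. n \<ge> 1 \<and> (T ^^ n) y \<in> cyl (f n) (x n)}" using infinite_super by blast
    then show "code \<omega> \<in> {y \<in> carpet. infinite {n. n \<ge> 1 \<and> (T ^^ n) y \<in> cyl (f n) (x n)}}"
      using y unfolding y_def by blast
  qed
qed

lemma hausdorff_dim_cyl_target: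
  fixes f :: "nat \<Rightarrow> nat" and x :: "nat \<Rightarrow> real \<times> real" and \<alpha> :: real
  assumes \<alpha>: "0 < \<alpha>" and f: "(\<lambda>n. real (f n) / real n) \<longlonglongrightarrow> \<alpha>"
    and x: "\<And>n. n \<ge> 1 \<Longrightarrow> x n \<in> carpet"
    and in\<Upsilon>: "pm \<in> \<Upsilon>" "p1 \<in> \<Upsilon>" "p2 \<in> \<Upsilon>" "pp \<in> \<Upsilon>"
    and max: "\<And>qm q1 q2 qp. \<lbrakk>qm \<in> \<Upsilon>; q1 \<in> \<Upsilon>; q2 \<in> \<Upsilon>; qp \<in> \<Upsilon>\<rbrakk> \<Longrightarrow> D \<alpha> qm q1 q2 qp 0 \<le> D \<alpha> pm p1 p2 pp 0"
  shows "hausdorff_dim {y \<in> carpet. infinite {n. n \<ge> 1 \<and> (T ^^ n) y \<in> cyl (f n) (x n)}} = ereal (D \<alpha> pm p1 p2 pp 0)"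
proof (rule hausdorff_dim_eqI)
  let ?E = "{y \<in> carpet. infinite {n. n \<ge> 1 \<and> (T ^^ n) y \<in> cyl (f n) (x n)}}"
  show "0 \<le> D \<alpha> pm p1 p2 pp 0" using \<alpha> in\<Upsilon> by (rule D_nonneg)
  show nz: "hausdorff_measure s ?E \<noteq> 0" if "0 < s" "s < D \<alpha> pm p1 p2 pp 0" for s
    using \<alpha> f x in\<Upsilon> that by (rule cyl_target_nonzero)
  show "?E \<noteq> {}" if "0 < D \<alpha> pm p1 p2 pp 0"
  proof
    assume E: "?E = {}"
    have "hausdorff_measure (D \<alpha> pm p1 p2 pp 0 / 2) (\<Union>({} :: (real \<times> real) set set)) = 0" by (rule hausdorff_measure_Union_zero) auto
    moreover have "hausdorff_measure (D \<alpha> pm p1 p2 pp 0 / 2) ?E \<noteq> 0" using that by (intro nz) auto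
    ultimately show False unfolding E by simp
  qed
  show "hausdorff_measure s ?E = 0" if s: "D \<alpha> pm p1 p2 pp 0 < s" for s
  proof -
    define t where "t = (\<lambda>n. itin (x n))"
    \<comment> \<open>Finitely many digit targets, all with the same lengths \<open>f\<close>; the
      bound for a single one does not depend on its digits.\<close>
    define \<A> where "\<A> = {digit_target f t} \<union> (\<lambda>c. digit_target f (\<lambda>n k. (c, snd (t n k)))) ` S
      \<union> (\<lambda>c. digit_target f (\<lambda>n k. (fst (t n k), c))) ` snd ` Q \<union> (\<lambda>q. digit_target f (\<lambda>n k. q)) ` Q"
    have "hausdorff_measure s (\<Union>\<A>) = 0"
    proof (rule hausdorff_measure_Union_zero)
      show "finite \<A>" unfolding \<A>_def using finite_S finite_Q by auto
      have "hausdorff_measure s (digit_target f t') = 0" for t'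
        using f \<alpha> in\<Upsilon> refl max s by (rule digit_target_zero)
      then show "hausdorff_measure s A = 0" if "A \<in> \<A>" for A using that unfolding \<A>_def by blast
    qed
    moreover have "?E \<subseteq> \<Union>\<A>" unfolding \<A>_def t_def using x by (rule cyl_target_subset)
    ultimately show ?thesis using hausdorff_measure_mono[of ?E "\<Union>\<A>" s] by simp
  qed
qed

end

theorem theorem1p1:
  fixes N M :: nat and S :: "nat set" and P :: "nat \<Rightarrow> nat set"
    and x :: "nat \<Rightarrow> real \<times> real" and f :: "nat \<Rightarrow> nat" and \<alpha> :: real
  defines "\<Lambda> \<equiv> bedford_mcmullen.carpet N M S P"
    and "T \<equiv> bedford_mcmullen.T N M S P"
    and "cyl \<equiv> bedford_mcmullen.cyl N M S P"
    and "\<Upsilon> \<equiv> bedford_mcmullen.\<Upsilon> S P"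
    and "D \<equiv> bedford_mcmullen.D N M S P"
  assumes "bedford_mcmullen N M S P"
    and "\<And>n. n \<ge> 1 \<Longrightarrow> x n \<in> \<Lambda>"
    and "(\<lambda>n. real (f n) / real n) \<longlonglongrightarrow> \<alpha>" and "\<alpha> > 0"
  shows "\<exists>d. hausdorff_dim {y \<in> \<Lambda>. infinite {n. n \<ge> 1 \<and> (T ^^ n) y \<in> cyl (f n) (x n)}} = ereal d
    \<and> (\<exists>pm\<in>\<Upsilon>. \<exists>p1\<in>\<Upsilon>. \<exists>p2\<in>\<Upsilon>. \<exists>pp\<in>\<Upsilon>. D \<alpha> pm p1 p2 pp 0 = d)
    \<and> (\<forall>pm\<in>\<Upsilon>. \<forall>p1\<in>\<Upsilon>. \<forall>p2\<in>\<Upsilon>. \<forall>pp\<in>\<Upsilon>. D \<alpha> pm p1 p2 pp 0 \<le> d)"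
proof -
  interpret B: bedford_mcmullen N M S P by fact
  obtain pm p1 p2 pp where in\<Upsilon>: "pm \<in> B.\<Upsilon>" "p1 \<in> B.\<Upsilon>" "p2 \<in> B.\<Upsilon>" "pp \<in> B.\<Upsilon>"
    and max: "\<And>qm q1 q2 qp. \<lbrakk>qm \<in> B.\<Upsilon>; q1 \<in> B.\<Upsilon>; q2 \<in> B.\<Upsilon>; qp \<in> B.\<Upsilon>\<rbrakk> \<Longrightarrow> B.D \<alpha> qm q1 q2 qp 0 \<le> B.D \<alpha> pm p1 p2 pp 0"
    by (rule B.D_max_exists[where \<alpha> = \<alpha>]) blast
  have "hausdorff_dim {y \<in> B.carpet. infinite {n. n \<ge> 1 \<and> (B.T ^^ n) y \<in> B.cyl (f n) (x n)}} = ereal (B.D \<alpha> pm p1 p2 pp 0)"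
    using assms(9,8,7)[unfolded \<Lambda>_def] in\<Upsilon> max by (rule B.hausdorff_dim_cyl_target)
  then show ?thesis
    unfolding \<Lambda>_def T_def cyl_def \<Upsilon>_def D_def using in\<Upsilon> max by blast
qed

end
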